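(* Suppose that for every $n\ge 1$ there are measurable functions $h_n^-,h_n^+:E_n\to(0,\infty)$ such that for all $(x,y)\in E_{n-1}\times E_n$ $$h_n^-(y)\le H_n(x,y)\le h_n^+(y),\qquad \frac{h_n^+}{h_n^-}\in \mathbb L_4(\eta_n),\qquad h_n^+\in\mathbb L_1(\lambda_n).$$ Then, for every $n\ge 0$, the sequences of random fields on $\mathcal B(E_{[0,n]})$ $$W_n^{\Gamma,N}:=\sqrt N\,(\Gamma_n^N-\Gamma_n),\qquad W_n^{\mathbb Q,N}:=\sqrt N\,(\mathbb Q_n^N-\mathbb Q_n)$$ converge in law (in the sense of finite-dimensional distributions), as $N\to\infty$, respectively to the centered Gaussian fields $W_n^\Gamma$ and $W_n^{\mathbb Q}$ defined for any $F_n\in\mathcal B(E_{[0,n]})$ by $$W_n^\Gamma(F_n)=\sum_{p=0}^n\gamma_p(1)\,V_p\big(D_{p,n}(F_n)\big),$$ $$W_n^{\mathbb Q}(F_n)=\sum_{p=0}^n V_p\big(G_{p,n}\,P_{p,n}(F_n-\mathbb Q_n(F_n))\big).$$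
   Context: General notation. $\mathcal B(E)$: bounded measurable real functions on $E$ with sup norm $\|\cdot\|$; $\mathcal P(E)$: probability measures; $\mu(f)=\int f\,d\mu$; for a kernel $M$, $M(f)(x)=\int M(x,dy)f(y)$ and $(\mu M)(f)=\mu(M(f))$. Feynman-Kac model. $(E_n)_{n\ge0}$ are measurable spaces, $E_{[p,n]}=E_p\times\cdots\times E_n$. $(X_n)_{n\ge 0}$ is a Markov chain with $X_n\in E_n$, initial law $\eta_0$ and Markov transitions $M_n(x_{n-1},dx_n)$ from $E_{n-1}$ into $E_n$. $G_n:E_n\to(0,1]$ are measurable. It is assumed that $M_n(x,dy)=H_n(x,y)\lambda_n(dy)$ for some ($\sigma$-finite) measure $\lambda_n$ on $E_n$ and some measurable $H_n>0$. Define $\Gamma_n(F_n)=\mathbb E\big(F_n(X_0,\dots,X_n)\prod_{0\le p<n}G_p(X_p)\big)$, $\mathbb Q_n=\Gamma_n/\Gamma_n(1)$ (on $E_{[0,n]}$); $\gamma_n(f)=\mathbb E\big(f(X_n)\prod_{0\le p<n}G_p(X_p)\big)$, $\eta_n=\gamma_n/\gamma_n(1)$ (on $E_n$). $Q_n(x,dy)=G_{n-1}(x)M_n(x,dy)$, $Q_{p,n}=Q_{p+1}\cdots Q_n$, $Q_{n,n}=Id$. $\Psi_{G}(\eta)(dx)=G(x)\eta(dx)/\eta(G)$ and $\Phi_{n+1}(\eta)=\Psi_{G_n}(\eta)M_{n+1}$, so that $\eta_{n+1}=\Phi_{n+1}(\eta_n)$. Backward transitions. For $\eta\in\mathcal P(E_n)$,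 $M_{n+1,\eta}(x,dy)=\dfrac{G_n(y)H_{n+1}(y,x)\,\eta(dy)}{\eta(G_nH_{n+1}(\cdot,x))}$, a Markov transition from $E_{n+1}$ into $E_n$. $\mathcal M_n(x_n,d(x_0,\dots,x_{n-1}))=\prod_{q=1}^nM_{q,\eta_{q-1}}(x_q,dx_{q-1})$. $\mathcal Q_{p,n}(x_p,d(x_{p+1},\dots,x_n))=\prod_{p\le q<n}Q_{q+1}(x_q,dx_{q+1})$. For $0\le p\le n$, $$D_{p,n}(F_n)(x_p)=\int\mathcal M_p(x_p,d(x_0,\dots,x_{p-1}))\,\mathcal Q_{p,n}(x_p,d(x_{p+1},\dots,x_n))\,F_n(x_0,\dots,x_n)$$ (no $\mathcal M$ factor if $p=0$, no $\mathcal Q$ factor if $p=n$), $G_{p,n}=Q_{p,n}(1)/\eta_pQ_{p,n}(1)$, $P_{p,n}(F_n)=D_{p,n}(F_n)/D_{p,n}(1)$. Particle model. Fix constants $\epsilon_n\ge0$ with $\epsilon_nG_n\le1$, and let $K_{n+1,\eta}(x,dy)=\epsilon_nG_n(x)M_{n+1}(x,dy)+(1-\epsilon_nG_n(x))\,\Phi_{n+1}(\eta)(dy)$, so $\eta K_{n+1,\eta}=\Phi_{n+1}(\eta)$. The $N$-particle system $\xi_n=(\xi_n^1,\dots,\xi_n^N)\in E_n^N$ is the Markov chain with $\xi_0^i$ i.i.d. of law $\eta_0$ and, given $\xi_0,\dots,\xi_n$, the $\xi_{n+1}^i$ independent with $\xi_{n+1}^i\sim K_{n+1,\eta_n^N}(\xi_n^i,\cdot)$,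 where $\eta_n^N=\frac1N\sum_{j}\delta_{\xi_n^j}$. Set $\mathcal M_n^N(x_n,d(x_0,\dots,x_{n-1}))=\prod_{q=1}^nM_{q,\eta^N_{q-1}}(x_q,dx_{q-1})$, $\mathbb Q_n^N(d(x_0,\dots,x_n))=\eta_n^N(dx_n)\mathcal M_n^N(x_n,d(x_0,\dots,x_{n-1}))$, $\gamma_n^N(1)=\prod_{0\le p<n}\eta_p^N(G_p)$, $\Gamma_n^N=\gamma_n^N(1)\,\mathbb Q_n^N$. Limit fields. $(V_n)_{n\ge0}$ is a sequence of independent centered Gaussian random fields, $V_n$ being (linearly) indexed by $\mathcal B(E_n)$, with $\mathbb E(V_n(f)^2)=\int\eta_{n-1}(dx)K_{n,\eta_{n-1}}(x,dy)\,\big(f(y)-K_{n,\eta_{n-1}}(f)(x)\big)^2$ for $n\ge1$ and $\mathbb E(V_0(f)^2)=\eta_0((f-\eta_0(f))^2)$. *)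

theory Defs
  imports "HOL-Probability.Probability"
begin

section \<open>Bounded measurable functions, Markov chains, Gaussian fields, convergence in law\<close>

definition bmf :: "'a measure \<Rightarrow> ('a \<Rightarrow> real) set" where
  "bmf S = {f \<in> borel_measurable S. bounded (f ` space S)}"

definition history :: "(nat \<Rightarrow> 'w \<Rightarrow> 'a) \<Rightarrow> nat \<Rightarrow> 'w \<Rightarrow> nat \<Rightarrow> 'a" where
  "history X n \<omega> = (\<lambda>i\<in>{..n}. X i \<omega>)"

text \<open>\<open>K n\<close>, used for \<open>n \<ge> 1\<close> only, is the transition from \<open>S (n - 1)\<close> into \<open>S n\<close>. The conditional
  law given the past is taken with respect to the \<open>\<sigma>\<close>-algebra generated by \<open>X 0, \<dots>, X n\<close>.\<close>

definition markov_chain ::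
  "'w measure \<Rightarrow> (nat \<Rightarrow> 'a measure) \<Rightarrow> 'a measure \<Rightarrow> (nat \<Rightarrow> 'a \<Rightarrow> 'a measure) \<Rightarrow> (nat \<Rightarrow> 'w \<Rightarrow> 'a) \<Rightarrow> bool"
where
  "markov_chain P S \<mu> K X \<longleftrightarrow>
     (\<forall>n. X n \<in> P \<rightarrow>\<^sub>M S n) \<and>
     distr P (S 0) (X 0) = \<mu> \<and>
     (\<forall>n. \<forall>A\<in>sets (S (Suc n)). AE \<omega> in P.
        real_cond_exp P (vimage_algebra (space P) (history X n) (PiM {..n} S))
          (\<lambda>\<omega>'. indicator A (X (Suc n) \<omega>')) \<omega>
        = measure (K (Suc n) (X n \<omega>)) A)"

definition centered_gaussian_law :: "real \<Rightarrow> real measure" where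
  "centered_gaussian_law v =
     (if v = 0 then return borel 0 else density lborel (\<lambda>x. ennreal (normal_density 0 (sqrt v) x)))"

definition centered_gaussian_field :: "'u measure \<Rightarrow> 'i set \<Rightarrow> ('i \<Rightarrow> 'u \<Rightarrow> real) \<Rightarrow> bool" where
  "centered_gaussian_field U T Z \<longleftrightarrow>
     (\<forall>f\<in>T. Z f \<in> borel_measurable U) \<and>
     (\<forall>I a. finite I \<and> I \<subseteq> T \<longrightarrow>
        (\<exists>v\<ge>0. distr U borel (\<lambda>\<omega>. \<Sum>f\<in>I. a f * Z f \<omega>) = centered_gaussian_law v))"

text \<open>Convergence of the finite-dimensional distributions of the random fields \<open>Y N\<close>, indexed by \<open>T\<close>
  and each defined on its own space \<open>R N\<close>, to those of \<open>Z\<close>: weak convergence of the laws on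
  \<open>\<real>\<^sup>k\<close>, tested against bounded continuous functions. Here \<open>\<real>\<^sup>k\<close> is the product topology on the
  extensional functions over \<open>{..<k}\<close>.\<close>

definition converges_fdd ::
  "'i set \<Rightarrow> (nat \<Rightarrow> 'v measure) \<Rightarrow> (nat \<Rightarrow> 'i \<Rightarrow> 'v \<Rightarrow> real) \<Rightarrow> 'u measure \<Rightarrow> ('i \<Rightarrow> 'u \<Rightarrow> real) \<Rightarrow> bool"
where
  "converges_fdd T R Y U Z \<longleftrightarrow>
     (\<forall>\<^sub>F N in sequentially. \<forall>f\<in>T. Y N f \<in> borel_measurable (R N)) \<and>
     (\<forall>f\<in>T. Z f \<in> borel_measurable U) \<and>
     (\<forall>k::nat. \<forall>F\<in>{..<k} \<rightarrow> T. \<forall>\<phi>::(nat \<Rightarrow> real) \<Rightarrow> real.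
        continuous_map (product_topology (\<lambda>_. euclideanreal) {..<k}) euclideanreal \<phi> \<and>
        bounded (\<phi> ` ({..<k} \<rightarrow>\<^sub>E UNIV)) \<longrightarrow>
        (\<lambda>N. \<integral>\<omega>. \<phi> (\<lambda>i\<in>{..<k}. Y N (F i) \<omega>) \<partial>R N) \<longlonglongrightarrow> (\<integral>\<omega>. \<phi> (\<lambda>i\<in>{..<k}. Z (F i) \<omega>) \<partial>U))"

text \<open>The Boltzmann-Gibbs transformation \<open>\<Psi>\<^sub>g(\<mu>)(dx) = g(x) \<mu>(dx) / \<mu>(g)\<close>.\<close>

definition Psi :: "('a \<Rightarrow> real) \<Rightarrow> 'a measure \<Rightarrow> 'a measure" where
  "Psi g \<mu> = density \<mu> (\<lambda>x. ennreal (g x / (\<integral>y. g y \<partial>\<mu>)))"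

text \<open>The empirical measure \<open>(1/N) \<Sum>\<^sub>j \<delta>\<^bsub>x j\<^esub>\<close> of \<open>x 0, \<dots>, x (N - 1)\<close>.\<close>

definition empirical :: "'a measure \<Rightarrow> nat \<Rightarrow> (nat \<Rightarrow> 'a) \<Rightarrow> 'a measure" where
  "empirical S N x = distr (uniform_count_measure {..<N}) S x"


section \<open>Feynman-Kac models\<close>

text \<open>The state spaces \<open>E n\<close> are arbitrary measurable spaces carried by subsets of a common type; only
  their \<open>\<sigma>\<close>-algebras matter. \<open>E\<^bsub>[p,n]\<^esub>\<close> is \<open>PiM {p..n} E\<close>. The quantities \<open>M n\<close>, \<open>lam n\<close>,
  \<open>H n\<close> belong to the step from time \<open>n - 1\<close> to time \<open>n\<close> and are meaningful for \<open>n \<ge> 1\<close> only; the same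
  holds for \<open>Phi n\<close>, \<open>K n\<close>, \<open>Mback n\<close> and \<open>Q n\<close> below. The constants \<open>eps n\<close> are the
  parameters of the particle transitions.\<close>

locale feynman_kac = prob_space P for P :: "'w measure" +
  fixes E :: "nat \<Rightarrow> 'a measure"
    and eta0 :: "'a measure"
    and M :: "nat \<Rightarrow> 'a \<Rightarrow> 'a measure"
    and G :: "nat \<Rightarrow> 'a \<Rightarrow> real"
    and lam :: "nat \<Rightarrow> 'a measure"
    and H :: "nat \<Rightarrow> 'a \<Rightarrow> 'a \<Rightarrow> real"
    and X :: "nat \<Rightarrow> 'w \<Rightarrow> 'a"
    and eps :: "nat \<Rightarrow> real"
  assumes eta0: "eta0 \<in> space (prob_algebra (E 0))"
    and M_kernel: "\<And>n. M (Suc n) \<in> E n \<rightarrow>\<^sub>M prob_algebra (E (Suc n))"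
    and G_measurable: "\<And>n. G n \<in> borel_measurable (E n)"
    and G_range: "\<And>n x. x \<in> space (E n) \<Longrightarrow> 0 < G n x \<and> G n x \<le> 1"
    and lam_sigma_finite: "\<And>n. sigma_finite_measure (lam (Suc n))"
    and sets_lam: "\<And>n. sets (lam (Suc n)) = sets (E (Suc n))"
    and H_measurable: "\<And>n. (\<lambda>(x, y). H (Suc n) x y) \<in> borel_measurable (E n \<Otimes>\<^sub>M E (Suc n))"
    and H_pos: "\<And>n x y. x \<in> space (E n) \<Longrightarrow> y \<in> space (E (Suc n)) \<Longrightarrow> 0 < H (Suc n) x y"
    and M_density: "\<And>n x. x \<in> space (E n) \<Longrightarrow>
      M (Suc n) x = density (lam (Suc n)) (\<lambda>y. ennreal (H (Suc n) x y))"
    and X_chain: "markov_chain P E eta0 M X"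
    and eps_nonneg: "\<And>n. 0 \<le> eps n"
    and eps_G_le_1: "\<And>n x. x \<in> space (E n) \<Longrightarrow> eps n * G n x \<le> 1"
begin

definition FK_Gamma :: "nat \<Rightarrow> ((nat \<Rightarrow> 'a) \<Rightarrow> real) \<Rightarrow> real" where
  "FK_Gamma n F = (\<integral>\<omega>. F (history X n \<omega>) * (\<Prod>p<n. G p (X p \<omega>)) \<partial>P)"

definition FK_Q :: "nat \<Rightarrow> ((nat \<Rightarrow> 'a) \<Rightarrow> real) \<Rightarrow> real" where
  "FK_Q n F = FK_Gamma n F / FK_Gamma n (\<lambda>_. 1)"

definition FK_gamma :: "nat \<Rightarrow> ('a \<Rightarrow> real) \<Rightarrow> real" where
  "FK_gamma n f = (\<integral>\<omega>. f (X n \<omega>) * (\<Prod>p<n. G p (X p \<omega>)) \<partial>P)"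

text \<open>\<open>eta n\<close> as a measure on \<open>E n\<close>: \<open>f\<close> has integral \<open>FK_gamma n f / FK_gamma n (\<lambda>_. 1)\<close>.\<close>

definition eta :: "nat \<Rightarrow> 'a measure" where
  "eta n = distr (density P (\<lambda>\<omega>. ennreal ((\<Prod>p<n. G p (X p \<omega>)) / FK_gamma n (\<lambda>_. 1)))) (E n) (X n)"

definition Phi :: "nat \<Rightarrow> 'a measure \<Rightarrow> 'a measure" where
  "Phi n \<mu> = Psi (G (n - 1)) \<mu> \<bind> M n"

text \<open>The mixture \<open>c M\<^sub>n(x, \<cdot>) + (1 - c) \<Phi>\<^sub>n(\<mu>)\<close> with \<open>c = \<epsilon>\<^bsub>n-1\<^esub> G\<^bsub>n-1\<^esub>(x)\<close>.\<close>

definition K :: "nat \<Rightarrow> 'a measure \<Rightarrow> 'a \<Rightarrow> 'a measure" where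
  "K n \<mu> x = measure_pmf (bernoulli_pmf (eps (n - 1) * G (n - 1) x))
               \<bind> (\<lambda>b. if b then M n x else Phi n \<mu>)"

definition Mback :: "nat \<Rightarrow> 'a measure \<Rightarrow> 'a \<Rightarrow> 'a measure" where
  "Mback n \<mu> x = Psi (\<lambda>y. G (n - 1) y * H n y x) \<mu>"

text \<open>\<open>backward \<mu> n x\<close> is \<open>\<Prod>\<^bsub>1 \<le> q \<le> n\<^esub> M\<^bsub>q, \<mu> (q - 1)\<^esub>(x\<^sub>q, dx\<^bsub>q-1\<^esub>)\<close> with \<open>x\<^sub>n = x\<close>, a measure on
  \<open>E 0 \<times> \<dots> \<times> E (n - 1)\<close>. The flow \<open>\<mu> = eta\<close> gives the limiting kernel, the flow of empirical measures
  its particle version.\<close>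

primrec backward :: "(nat \<Rightarrow> 'a measure) \<Rightarrow> nat \<Rightarrow> 'a \<Rightarrow> (nat \<Rightarrow> 'a) measure" where
  "backward \<mu> 0 x = return (PiM {..<0} E) (\<lambda>_. undefined)"
| "backward \<mu> (Suc n) x =
     Mback (Suc n) (\<mu> n) x \<bind> (\<lambda>y. distr (backward \<mu> n y) (PiM {..<Suc n} E) (\<lambda>w. w(n := y)))"

definition Q :: "nat \<Rightarrow> 'a \<Rightarrow> 'a measure" where
  "Q n x = scale_measure (ennreal (G (n - 1) x)) (M n x)"

text \<open>\<open>Q_semigroup k p\<close> is \<open>Q\<^bsub>p, p + k\<^esub> = Q\<^bsub>p+1\<^esub> \<dots> Q\<^bsub>p+k\<^esub>\<close>.\<close>

primrec Q_semigroup :: "nat \<Rightarrow> nat \<Rightarrow> 'a \<Rightarrow> 'a measure" where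
  "Q_semigroup 0 p x = return (E p) x"
| "Q_semigroup (Suc k) p x = Q (Suc p) x \<bind> Q_semigroup k (Suc p)"

text \<open>\<open>forward k p x\<close> is \<open>\<Prod>\<^bsub>p \<le> q < p + k\<^esub> Q\<^bsub>q+1\<^esub>(x\<^sub>q, dx\<^bsub>q+1\<^esub>)\<close> with \<open>x\<^sub>p = x\<close>, a measure on
  \<open>E (p + 1) \<times> \<dots> \<times> E (p + k)\<close>.\<close>

primrec forward :: "nat \<Rightarrow> nat \<Rightarrow> 'a \<Rightarrow> (nat \<Rightarrow> 'a) measure" where
  "forward 0 p x = return (PiM {p<..p} E) (\<lambda>_. undefined)"
| "forward (Suc k) p x =
     Q (Suc p) x \<bind> (\<lambda>y. distr (forward k (Suc p) y) (PiM {p<..p + Suc k} E) (\<lambda>w. w(Suc p := y)))"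

definition D :: "nat \<Rightarrow> nat \<Rightarrow> ((nat \<Rightarrow> 'a) \<Rightarrow> real) \<Rightarrow> 'a \<Rightarrow> real" where
  "D p n F x =
     (\<integral>w. (\<integral>z. F (\<lambda>i\<in>{..n}. if i < p then w i else if i = p then x else z i)
        \<partial>forward (n - p) p x) \<partial>backward eta p x)"

definition G_norm :: "nat \<Rightarrow> nat \<Rightarrow> 'a \<Rightarrow> real" where
  "G_norm p n x = (\<integral>y. 1 \<partial>Q_semigroup (n - p) p x) / (\<integral>x'. (\<integral>y. 1 \<partial>Q_semigroup (n - p) p x') \<partial>eta p)"

definition P_norm :: "nat \<Rightarrow> nat \<Rightarrow> ((nat \<Rightarrow> 'a) \<Rightarrow> real) \<Rightarrow> 'a \<Rightarrow> real" where
  "P_norm p n F x = D p n F x / D p n (\<lambda>_. 1) x"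

definition W_Gamma :: "(nat \<Rightarrow> ('a \<Rightarrow> real) \<Rightarrow> 'u \<Rightarrow> real) \<Rightarrow> nat \<Rightarrow> ((nat \<Rightarrow> 'a) \<Rightarrow> real) \<Rightarrow> 'u \<Rightarrow> real" where
  "W_Gamma V n F \<omega> = (\<Sum>p\<le>n. FK_gamma p (\<lambda>_. 1) * V p (D p n F) \<omega>)"

definition W_Q :: "(nat \<Rightarrow> ('a \<Rightarrow> real) \<Rightarrow> 'u \<Rightarrow> real) \<Rightarrow> nat \<Rightarrow> ((nat \<Rightarrow> 'a) \<Rightarrow> real) \<Rightarrow> 'u \<Rightarrow> real" where
  "W_Q V n F \<omega> = (\<Sum>p\<le>n. V p (\<lambda>x. G_norm p n x * P_norm p n (\<lambda>w. F w - FK_Q n F) x) \<omega>)"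

end


section \<open>Particle approximations\<close>

text \<open>The \<open>N\<close>-particle system \<open>xi N\<close> lives on its own probability space \<open>R N\<close>; the particles are
  numbered from \<open>0\<close> to \<open>N - 1\<close>, so the state space at time \<open>n\<close> is \<open>PiM {..<N} (\<lambda>_. E n)\<close>.\<close>

locale particle_model = feynman_kac P E eta0 M G lam H X eps
  for P :: "'w measure"
    and E :: "nat \<Rightarrow> 'a measure"
    and eta0 M G lam H X eps +
  fixes R :: "nat \<Rightarrow> 'v measure"
    and xi :: "nat \<Rightarrow> nat \<Rightarrow> 'v \<Rightarrow> nat \<Rightarrow> 'a"
  assumes R_prob_space: "\<And>N. 1 \<le> N \<Longrightarrow> prob_space (R N)"
    and xi_chain: "\<And>N. 1 \<le> N \<Longrightarrow>
      markov_chain (R N) (\<lambda>n. PiM {..<N} (\<lambda>_. E n)) (PiM {..<N} (\<lambda>_. eta0))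
        (\<lambda>n x. PiM {..<N} (\<lambda>i. K n (empirical (E (n - 1)) N x) (x i))) (xi N)"
begin

definition eta_N :: "nat \<Rightarrow> nat \<Rightarrow> 'v \<Rightarrow> 'a measure" where
  "eta_N N n \<omega> = empirical (E n) N (xi N n \<omega>)"

definition Q_N :: "nat \<Rightarrow> nat \<Rightarrow> 'v \<Rightarrow> (nat \<Rightarrow> 'a) measure" where
  "Q_N N n \<omega> = eta_N N n \<omega> \<bind>
     (\<lambda>x. distr (backward (\<lambda>q. eta_N N q \<omega>) n x) (PiM {..n} E) (\<lambda>w. w(n := x)))"

definition gamma_N_1 :: "nat \<Rightarrow> nat \<Rightarrow> 'v \<Rightarrow> real" where
  "gamma_N_1 N n \<omega> = (\<Prod>p<n. \<integral>x. G p x \<partial>eta_N N p \<omega>)"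

definition Gamma_N :: "nat \<Rightarrow> nat \<Rightarrow> 'v \<Rightarrow> (nat \<Rightarrow> 'a) measure" where
  "Gamma_N N n \<omega> = scale_measure (ennreal (gamma_N_1 N n \<omega>)) (Q_N N n \<omega>)"

definition W_Gamma_N :: "nat \<Rightarrow> nat \<Rightarrow> ((nat \<Rightarrow> 'a) \<Rightarrow> real) \<Rightarrow> 'v \<Rightarrow> real" where
  "W_Gamma_N n N F \<omega> = sqrt (real N) * ((\<integral>w. F w \<partial>Gamma_N N n \<omega>) - FK_Gamma n F)"

definition W_Q_N :: "nat \<Rightarrow> nat \<Rightarrow> ((nat \<Rightarrow> 'a) \<Rightarrow> real) \<Rightarrow> 'v \<Rightarrow> real" where
  "W_Q_N n N F \<omega> = sqrt (real N) * ((\<integral>w. F w \<partial>Q_N N n \<omega>) - FK_Q n F)"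

end


section \<open>The limiting fields\<close>

text \<open>Linearity in the index and Gaussianity make the law of \<open>V n\<close> determined by its variances. A field
  is a random element of the product space of copies of the reals indexed by \<open>bmf (E n)\<close>, which is
  the sense in which the fields \<open>V n\<close> are independent.\<close>

locale limit_fields = particle_model P E eta0 M G lam H X eps R xi
  for P :: "'w measure"
    and E :: "nat \<Rightarrow> 'a measure"
    and eta0 M G lam H X eps
    and R :: "nat \<Rightarrow> 'v measure"
    and xi +
  fixes U :: "'u measure"
    and V :: "nat \<Rightarrow> ('a \<Rightarrow> real) \<Rightarrow> 'u \<Rightarrow> real"
  assumes U_prob_space: "prob_space U"
    and V_gaussian: "\<And>n. centered_gaussian_field U (bmf (E n)) (V n)"
    and V_linear: "\<And>n f g a b. f \<in> bmf (E n) \<Longrightarrow> g \<in> bmf (E n) \<Longrightarrow>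
      AE \<omega> in U. V n (\<lambda>x. a * f x + b * g x) \<omega> = a * V n f \<omega> + b * V n g \<omega>"
    and V_indep: "prob_space.indep_vars U (\<lambda>n. PiM (bmf (E n)) (\<lambda>_. borel))
      (\<lambda>n \<omega>. \<lambda>f\<in>bmf (E n). V n f \<omega>) UNIV"
    and V_0_variance: "\<And>f. f \<in> bmf (E 0) \<Longrightarrow>
      (\<integral>\<omega>. (V 0 f \<omega>)\<^sup>2 \<partial>U) = (\<integral>x. (f x - (\<integral>y. f y \<partial>eta0))\<^sup>2 \<partial>eta0)"
    and V_Suc_variance: "\<And>n f. f \<in> bmf (E (Suc n)) \<Longrightarrow>
      (\<integral>\<omega>. (V (Suc n) f \<omega>)\<^sup>2 \<partial>U) =
      (\<integral>x. (\<integral>y. (f y - (\<integral>z. f z \<partial>K (Suc n) (eta n) x))\<^sup>2 \<partial>K (Suc n) (eta n) x) \<partial>eta n)"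

end

theory Submission
  imports Defs
begin

text \<open>
  Write \<open>\<eta>\<^sup>N\<close> for the flow of empirical measures and \<open>D\<^sup>N\<^bsub>p,n\<^esub>\<close> for \<open>D\<^bsub>p,n\<^esub>\<close> computed along it. For every flow
  \<open>\<mu>\<close> the duality \<open>\<mu>(G) \<Phi>(\<mu>)(dx) M\<^sub>\<mu>(x, dy) = \<mu>(dy) Q(y, dx)\<close> telescopes to the exact identity
  \<open>\<Gamma>\<^sup>N\<^sub>n(F) - \<Gamma>\<^sub>n(F) = \<Sum>\<^sub>p \<gamma>\<^sup>N\<^sub>p(1) (\<eta>\<^sup>N\<^sub>p - \<Phi>\<^sub>p(\<eta>\<^sup>N\<^bsub>p-1\<^esub>))(D\<^sup>N\<^bsub>p,n\<^esub> F)\<close>.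
  Given the past, \<open>\<gamma>\<^sup>N\<^sub>p(1) D\<^sup>N\<^bsub>p,n\<^esub> F\<close> is a fixed bounded function and the particles are independent, so a
  conditional variance bound makes each summand of order \<open>N\<^bsup>-1/2\<^esup>\<close> in \<open>L\<^sub>2\<close>. This law of large numbers
  gives \<open>\<gamma>\<^sup>N\<^sub>p(1) D\<^sup>N\<^bsub>p,n\<^esub> F(x) \<rightarrow> \<gamma>\<^sub>p(1) D\<^bsub>p,n\<^esub> F(x)\<close> for every \<open>x\<close>; since
  \<open>\<Phi>\<^sub>p(\<eta>\<^sup>N\<^bsub>p-1\<^esub>) \<le> h\<^sub>p\<^sup>+ \<lambda>\<^sub>p\<close>, dominated convergence lets \<open>\<gamma>\<^sub>p(1) D\<^bsub>p,n\<^esub> F\<close> replace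
  \<open>\<gamma>\<^sup>N\<^sub>p(1) D\<^sup>N\<^bsub>p,n\<^esub> F\<close> at scale \<open>N\<^bsup>-1/2\<^esup>\<close>. For fixed functions the conditional characteristic functions of
  the local errors converge to Gaussian ones, and \<open>W\<^sup>\<rat>\<close> follows from \<open>W\<^sup>\<Gamma>\<close> after dividing by \<open>\<gamma>\<^sup>N\<^sub>n(1)\<close>.
\<close>

section \<open>The Cramer-Wold device\<close>

text \<open>The obstacle is that D^N is random and contains quotients whose denominators \<eta>^N(G
  H(., x)) have no uniform lower bound, G being only positive. Randomness is harmless because D^N at
  time p involves particles strictly before p, and because its size never exceeds the bound of F:
  backward kernels are Markov and the kernels Q sub-Markov. Multiplied by the mass, D^N at a point
  becomes a quotient \<Gamma>(G) \<Gamma>(G H F') / \<Gamma>(G H) of unnormalised integrals one time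
  step earlier. Being bounded a priori, the quotient converges as soon as its three entries do and
  the limiting denominator is nonzero. The entries converge without induction over time, since the
  telescoping identity bounds the error at every time for every bounded test function. The
  identities are proved for an arbitrary flow of measures and used twice: along the empirical flow,
  and along \<open>eta\<close>, where all local errors vanish and the telescoping becomes the
  backward representation of \<Gamma>. Limits are taken on characteristic functions, which factorise
  under conditioning on the past; trigonometric polynomials carry them to bounded continuous test
  functions on R^k.\<close>

inductive cosine_span :: "nat \<Rightarrow> ((nat \<Rightarrow> real) \<Rightarrow> real) \<Rightarrow> bool" for k where
  cos: "cosine_span k (\<lambda>x. a * cos ((\<Sum>i<k. t i * x i) + c))"
| add: "cosine_span k f \<Longrightarrow> cosine_span k g \<Longrightarrow> cosine_span k (\<lambda>x. f x + g x)"

text \<open>Product-to-sum: a product of two cosines is half the sum of the cosines of the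
  difference and of the sum of their arguments. The span is thus an algebra although only sums are
  built into it.\<close>

lemma cosine_span_mult:
  assumes "cosine_span k f" "cosine_span k g"
  shows "cosine_span k (\<lambda>x. f x * g x)"
  using assms
proof (induction arbitrary: g)
  case (cos a t c)
  from cos.prems show ?case
  proof induction
    case (cos a' t' c')
    have "(\<lambda>x. a * cos ((\<Sum>i<k. t i * x i) + c) * (a' * cos ((\<Sum>i<k. t' i * x i) + c')))
      = (\<lambda>x. (a * a' / 2) * cos ((\<Sum>i<k. (t i - t' i) * x i) + (c - c'))
           + (a * a' / 2) * cos ((\<Sum>i<k. (t i + t' i) * x i) + (c + c')))"
    proof
      fix x :: "nat \<Rightarrow> real"
      have 1: "(\<Sum>i<k. (t i - t' i) * x i) + (c - c') = ((\<Sum>i<k. t i * x i) + c) - ((\<Sum>i<k. t' i * x i) + c')"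
        by (simp add: algebra_simps sum_subtractf)
      have 2: "(\<Sum>i<k. (t i + t' i) * x i) + (c + c') = ((\<Sum>i<k. t i * x i) + c) + ((\<Sum>i<k. t' i * x i) + c')"
        by (simp add: algebra_simps sum.distrib)
      show "a * cos ((\<Sum>i<k. t i * x i) + c) * (a' * cos ((\<Sum>i<k. t' i * x i) + c'))
        = (a * a' / 2) * cos ((\<Sum>i<k. (t i - t' i) * x i) + (c - c'))
           + (a * a' / 2) * cos ((\<Sum>i<k. (t i + t' i) * x i) + (c + c'))"
        unfolding 1 2 cos_add cos_diff by (simp add: algebra_simps)
    qed
    then show ?case by (simp only:) (rule cosine_span.add[OF cosine_span.cos cosine_span.cos])
  next
    case (add f g)
    show ?case unfolding distrib_left by (rule cosine_span.add[OF add.IH])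
  qed
next
  case (add f f')
  show ?case unfolding distrib_right by (rule cosine_span.add[OF add.IH(1)[OF add.prems] add.IH(2)[OF add.prems]])
qed

text \<open>One fixed frequency \<open>b\<close>, unlike \<open>cosine_span\<close>: an element sees
  \<open>x i\<close> only through \<open>sin (b * x i)\<close>, so a bound on one cube becomes a
  global bound. This is the algebra in which the approximation takes place.\<close>

inductive sine_algebra :: "nat \<Rightarrow> real \<Rightarrow> ((nat \<Rightarrow> real) \<Rightarrow> real) \<Rightarrow> bool" for k b where
  const: "sine_algebra k b (\<lambda>x. c)"
| sin: "i < k \<Longrightarrow> sine_algebra k b (\<lambda>x. sin (b * x i))"
| add: "sine_algebra k b f \<Longrightarrow> sine_algebra k b g \<Longrightarrow> sine_algebra k b (\<lambda>x. f x + g x)"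
| mult: "sine_algebra k b f \<Longrightarrow> sine_algebra k b g \<Longrightarrow> sine_algebra k b (\<lambda>x. f x * g x)"

lemma single_coefficient_sum:
  fixes x :: "nat \<Rightarrow> real"
  assumes "i < k"
  shows "(\<Sum>j<k. (if j = i then b else 0) * x j) = b * x i"
proof -
  have "(\<Sum>j<k. (if j = i then b else 0) * x j) = (\<Sum>j<k. if j = i then b * x i else 0)"
    by (intro sum.cong) auto
  then show ?thesis using assms by simp
qed

text \<open>The phase -pi/2 turns the generators into cosines and products are handled by
  product-to-sum, so characteristic functions control the whole sine algebra.\<close>

lemma sine_algebra_cosine_span: "sine_algebra k b f \<Longrightarrow> cosine_span k f"
proof (induction rule: sine_algebra.induct)
  case (const c)
  show ?case using cosine_span.cos[of k c "\<lambda>_. 0" 0] by simp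
next
  case (sin i)
  have "(\<Sum>j<k. (if j = i then b else 0) * x j) = b * x i" for x :: "nat \<Rightarrow> real"
    using single_coefficient_sum[OF sin] .
  then have "(\<lambda>x. sin (b * x i)) = (\<lambda>x. 1 * cos ((\<Sum>j<k. (if j = i then b else 0) * x j) + (- (pi / 2))))"
    by (simp only: cos_add cos_minus sin_minus cos_pi_half sin_pi_half) simp
  then show ?case by (simp only: cosine_span.cos)
next
  case (add f g)
  show ?case by (rule cosine_span.add[OF add.IH])
next
  case (mult f g)
  show ?case by (rule cosine_span_mult[OF mult.IH])
qed

text \<open>A polynomial in the functions \<open>sin (b x\<^sub>i)\<close> takes all its values on one cube, so an approximation on that
  cube is automatically bounded outside it.\<close>

definition sine_fold :: "nat \<Rightarrow> real \<Rightarrow> (nat \<Rightarrow> real) \<Rightarrow> nat \<Rightarrow> real" where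
  "sine_fold k b x i = (if i < k then arcsin (sin (b * x i)) / b else 0)"

lemma sine_algebra_fold: "sine_algebra k b f \<Longrightarrow> b \<noteq> 0 \<Longrightarrow> f x = f (sine_fold k b x)"
proof (induction rule: sine_algebra.induct)
  case (sin i)
  then have "b * sine_fold k b x i = arcsin (sin (b * x i))"
    by (simp add: sine_fold_def)
  then show ?case using sin_arcsin[of "sin (b * x i)"] by (simp add: abs_sin_le_one)
qed simp_all

text \<open>Pinning the coordinates from \<open>k\<close> on to 0 makes the cube a product of
  compact sets over all of \<open>nat\<close>, hence compact in the product topology of the full
  function space.\<close>

definition cube :: "nat \<Rightarrow> real \<Rightarrow> (nat \<Rightarrow> real) set" where
  "cube k a = (\<Pi>\<^sub>E i\<in>UNIV. if i < k then {-a..a} else {0})"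

lemma in_cube: "x \<in> cube k a \<longleftrightarrow> (\<forall>i<k. \<bar>x i\<bar> \<le> a) \<and> (\<forall>i\<ge>k. x i = 0)"
proof -
  have "x \<in> cube k a \<longleftrightarrow> (\<forall>i. x i \<in> (if i < k then {-a..a} else {0}))"
    by (simp add: cube_def PiE_iff)
  also have "\<dots> \<longleftrightarrow> (\<forall>i<k. \<bar>x i\<bar> \<le> a) \<and> (\<forall>i\<ge>k. x i = 0)"
    by (metis abs_le_iff atLeastAtMost_iff minus_le_iff not_le singletonD singletonI)
  finally show ?thesis .
qed

lemma sine_fold_in_cube: "0 < b \<Longrightarrow> sine_fold k b x \<in> cube k (pi / 2 / b)"
proof -
  assume b: "0 < b"
  have "\<bar>arcsin (sin y)\<bar> \<le> pi / 2" for y :: real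
    using arcsin_lbound[of "sin y"] arcsin_ubound[of "sin y"] by (simp add: abs_le_iff)
  then show ?thesis using b by (auto simp: in_cube sine_fold_def abs_div field_simps)
qed

lemma compact_cube: "compact (cube k a)"
  using compactin_PiE[of "\<lambda>_. euclidean :: real topology" UNIV "\<lambda>i. if i < k then {-a..a} else {0}"]
  by (simp add: cube_def euclidean_product_topology)

lemma continuous_on_sine_algebra: "sine_algebra k b f \<Longrightarrow> continuous_on S f"
proof (induction rule: sine_algebra.induct)
  case (sin i)
  have "continuous_on S (\<lambda>x::nat \<Rightarrow> real. x i)"
    by (rule continuous_on_subset[OF continuous_on_product_coordinates]) simp
  then show ?case by (intro continuous_intros)
qed (intro continuous_intros; assumption)+

text \<open>The half-side pi / 2 / b is the range on which z -> sin (b z) is injective, so the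
  generators separate the points of the cube and Stone-Weierstrass applies.\<close>

lemma sine_algebra_dense:
  assumes "continuous_on UNIV f" "0 < b" "0 < e"
  obtains g where "sine_algebra k b g" "\<And>x. x \<in> cube k (pi / 2 / b) \<Longrightarrow> \<bar>f x - g x\<bar> < e"
proof -
  interpret function_ring_on "{g. sine_algebra k b g}" "cube k (pi / 2 / b)"
  proof
    fix x y assume xy: "x \<in> cube k (pi / 2 / b)" "y \<in> cube k (pi / 2 / b)" "x \<noteq> y"
    then obtain i where i: "i < k" "x i \<noteq> y i"
      by (metis in_cube ext not_le)
    have "\<bar>b * x i\<bar> \<le> pi / 2" "\<bar>b * y i\<bar> \<le> pi / 2"
      using xy i assms(2) by (auto simp: in_cube abs_mult field_simps)
    moreover have "b * x i \<noteq> b * y i" using i assms by simp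
    ultimately have "sin (b * x i) \<noteq> sin (b * y i)"
      using sin_inj_pi by (metis abs_le_iff minus_le_iff)
    then show "\<exists>f\<in>{g. sine_algebra k b g}. f x \<noteq> f y"
      using sine_algebra.sin[OF i(1)] by auto
  qed (simp_all add: compact_cube continuous_on_sine_algebra sine_algebra.const sine_algebra.add sine_algebra.mult)
  show ?thesis
    using Stone_Weierstrass_basic[OF continuous_on_subset[OF assms(1)] assms(3)] that by blast
qed

lemma integral_cos_from_iexp:
  assumes "prob_space M" "f \<in> borel_measurable M"
  shows "(\<integral>\<omega>. a * cos (f \<omega> + c) \<partial>M) = a * Re (cis c * (\<integral>\<omega>. iexp (f \<omega>) \<partial>M))"
proof -
  interpret prob_space M by fact
  have [simp]: "integrable M (\<lambda>\<omega>. iexp (f \<omega>))"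
    by (rule integrable_const_bound[where B=1]) (use assms in auto)
  have "cis c * (\<integral>\<omega>. iexp (f \<omega>) \<partial>M) = (\<integral>\<omega>. cis c * iexp (f \<omega>) \<partial>M)"
    by simp
  also have "\<dots> = (\<integral>\<omega>. cis (f \<omega> + c) \<partial>M)"
    by (simp add: cis_conv_exp[symmetric] cis_mult add.commute)
  also have "Re \<dots> = (\<integral>\<omega>. cos (f \<omega> + c) \<partial>M)"
  proof (subst integral_Re[symmetric])
    show "integrable M (\<lambda>\<omega>. cis (f \<omega> + c))"
      by (rule integrable_const_bound[where B=1]) (use assms in \<open>auto simp: cis_conv_exp\<close>)
  qed simp
  finally show ?thesis by simp
qed

text \<open>The integral of a cosine is the real part of a rotated characteristic function; the rest
  is linearity. Integrability is part of the claim because the sum step of the induction needs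
  it.\<close>

lemma cosine_span_integral_tendsto:
  fixes Y :: "nat \<Rightarrow> nat \<Rightarrow> 'v \<Rightarrow> real" and Z :: "nat \<Rightarrow> 'u \<Rightarrow> real"
  assumes R: "\<And>N. prob_space (R N)" "\<And>N i. i < k \<Longrightarrow> Y N i \<in> borel_measurable (R N)"
    and U: "prob_space U" "\<And>i. i < k \<Longrightarrow> Z i \<in> borel_measurable U"
    and char: "\<And>t. (\<lambda>N. \<integral>\<omega>. iexp (\<Sum>i<k. t i * Y N i \<omega>) \<partial>R N) \<longlonglongrightarrow> (\<integral>\<omega>. iexp (\<Sum>i<k. t i * Z i \<omega>) \<partial>U)"
    and "cosine_span k g"
  shows "(\<forall>N. integrable (R N) (\<lambda>\<omega>. g (\<lambda>i. Y N i \<omega>))) \<and> integrable U (\<lambda>\<omega>. g (\<lambda>i. Z i \<omega>)) \<and>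
    (\<lambda>N. \<integral>\<omega>. g (\<lambda>i. Y N i \<omega>) \<partial>R N) \<longlonglongrightarrow> (\<integral>\<omega>. g (\<lambda>i. Z i \<omega>) \<partial>U)"
  using \<open>cosine_span k g\<close>
proof induction
  case (cos a t c)
  have [measurable]: "(\<lambda>\<omega>. \<Sum>i<k. t i * Y N i \<omega>) \<in> borel_measurable (R N)" for N
    using R(2) by measurable
  have [measurable]: "(\<lambda>\<omega>. \<Sum>i<k. t i * Z i \<omega>) \<in> borel_measurable U"
    using U(2) by measurable
  have bd: "\<bar>a * cos z\<bar> \<le> \<bar>a\<bar>" for z
    by (simp add: abs_mult mult_left_le)
  have "integrable (R N) (\<lambda>\<omega>. a * cos ((\<Sum>i<k. t i * Y N i \<omega>) + c))" for N
    by (rule finite_measure.integrable_const_bound[OF prob_space.finite_measure[OF R(1)], where B="\<bar>a\<bar>"])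
      (simp_all add: bd)
  moreover have "integrable U (\<lambda>\<omega>. a * cos ((\<Sum>i<k. t i * Z i \<omega>) + c))"
    by (rule finite_measure.integrable_const_bound[OF prob_space.finite_measure[OF U(1)], where B="\<bar>a\<bar>"])
      (simp_all add: bd)
  moreover have "(\<lambda>N. \<integral>\<omega>. a * cos ((\<Sum>i<k. t i * Y N i \<omega>) + c) \<partial>R N)
     \<longlonglongrightarrow> (\<integral>\<omega>. a * cos ((\<Sum>i<k. t i * Z i \<omega>) + c) \<partial>U)"
    unfolding integral_cos_from_iexp[OF R(1) \<open>\<And>N. (\<lambda>\<omega>. \<Sum>i<k. t i * Y N i \<omega>) \<in> borel_measurable (R N)\<close>]
      integral_cos_from_iexp[OF U(1) \<open>(\<lambda>\<omega>. \<Sum>i<k. t i * Z i \<omega>) \<in> borel_measurable U\<close>]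
    by (intro tendsto_intros char)
  ultimately show ?case by blast
next
  case (add f g)
  then show ?case by (auto intro!: tendsto_add)
qed

section \<open>Tail control and the multivariate limit\<close>

text \<open>A continuous substitute for the indicator of the tail beyond L: its integral passes to
  weak limits, so smallness of the tails of the limit is inherited by the approximating
  sequence.\<close>

definition escape :: "real \<Rightarrow> real \<Rightarrow> real" where
  "escape L x = max 0 (min 1 (\<bar>x\<bar> - L))"

lemma escape_bounds: "0 \<le> escape L x" "escape L x \<le> 1" "L + 1 \<le> \<bar>x\<bar> \<Longrightarrow> escape L x = 1"
  "\<bar>x\<bar> \<le> L \<Longrightarrow> escape L x = 0"
  by (auto simp: escape_def)

lemma continuous_escape: "isCont (escape L) x"
  unfolding escape_def by (intro continuous_intros)

lemma borel_measurable_escape [measurable]: "escape L \<in> borel_measurable borel"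
  unfolding escape_def by measurable

lemma escape_integral_tendsto_0:
  assumes "prob_space U" "Z \<in> borel_measurable U"
  shows "(\<lambda>m. \<integral>\<omega>. escape (real m) (Z \<omega>) \<partial>U) \<longlonglongrightarrow> 0"
proof -
  interpret prob_space U by fact
  have "(\<lambda>m. \<integral>\<omega>. escape (real m) (Z \<omega>) \<partial>U) \<longlonglongrightarrow> (\<integral>\<omega>. 0 \<partial>U)"
  proof (rule integral_dominated_convergence[where w="\<lambda>_. 1"])
    show "AE \<omega> in U. (\<lambda>m. escape (real m) (Z \<omega>)) \<longlonglongrightarrow> 0"
    proof (intro AE_I2 tendsto_eventually)
      fix \<omega>
      obtain m0 :: nat where "\<bar>Z \<omega>\<bar> \<le> real m0" using real_arch_simple by blast
      then show "\<forall>\<^sub>F m in sequentially. escape (real m) (Z \<omega>) = 0"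
        by (intro eventually_sequentiallyI[of m0] escape_bounds) linarith
    qed
  qed (use assms escape_bounds in auto)
  then show ?thesis by simp
qed

text \<open>Levy continuity in dimension one, applied to a single coordinate; the tail estimate in k
  dimensions needs no more.\<close>

lemma escape_integral_tendsto:
  fixes Y :: "nat \<Rightarrow> 'v \<Rightarrow> real" and Z :: "'u \<Rightarrow> real"
  assumes R: "\<And>N. prob_space (R N)" "\<And>N. Y N \<in> borel_measurable (R N)"
    and U: "prob_space U" "Z \<in> borel_measurable U"
    and char: "\<And>t::real. (\<lambda>N. \<integral>\<omega>. iexp (t * Y N \<omega>) \<partial>R N) \<longlonglongrightarrow> (\<integral>\<omega>. iexp (t * Z \<omega>) \<partial>U)"
  shows "(\<lambda>N. \<integral>\<omega>. escape L (Y N \<omega>) \<partial>R N) \<longlonglongrightarrow> (\<integral>\<omega>. escape L (Z \<omega>) \<partial>U)"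
proof -
  have RD: "real_distribution (distr (R N) borel (Y N))" for N
    using R by (auto intro!: real_distribution.intro prob_space.prob_space_distr simp: real_distribution_axioms_def)
  have UD: "real_distribution (distr U borel Z)"
    using U by (auto intro!: real_distribution.intro prob_space.prob_space_distr simp: real_distribution_axioms_def)
  have "weak_conv_m (\<lambda>N. distr (R N) borel (Y N)) (distr U borel Z)"
  proof (rule levy_continuity[OF RD UD])
    show "(\<lambda>n. char (distr (R n) borel (Y n)) t) \<longlonglongrightarrow> char (distr U borel Z) t" for t
      using char[of t] R U by (simp add: char_def integral_distr)
  qed
  from weak_conv_imp_integral_bdd_continuous_conv[OF RD UD this continuous_escape, where B=1]
  show ?thesis using R U by (simp add: integral_distr escape_bounds)
qed

lemma integral_diff_escape:
  fixes h :: "nat \<Rightarrow> 'c \<Rightarrow> real"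
  assumes M: "prob_space M" and h: "\<And>i. i < k \<Longrightarrow> h i \<in> borel_measurable M"
    and fh: "(\<lambda>\<omega>. f (\<lambda>i. h i \<omega>)) \<in> borel_measurable M" and B: "\<And>x. \<bar>f x\<bar> \<le> B"
    and gh: "integrable M (\<lambda>\<omega>. g (\<lambda>i. h i \<omega>))"
    and close: "\<And>x. \<bar>f x - g x\<bar> \<le> d + C * (\<Sum>i<k. escape L (x i))"
  shows "\<bar>(\<integral>\<omega>. f (\<lambda>i. h i \<omega>) \<partial>M) - (\<integral>\<omega>. g (\<lambda>i. h i \<omega>) \<partial>M)\<bar> \<le> d + C * (\<Sum>i<k. \<integral>\<omega>. escape L (h i \<omega>) \<partial>M)"
proof -
  interpret prob_space M by fact
  have fi: "integrable M (\<lambda>\<omega>. f (\<lambda>i. h i \<omega>))"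
    by (rule integrable_const_bound[where B=B]) (use fh B in auto)
  have ei: "integrable M (\<lambda>\<omega>. escape L (h i \<omega>))" if "i < k" for i
    by (rule integrable_const_bound[where B=1]) (use h[OF that] escape_bounds in auto)
  have si: "integrable M (\<lambda>\<omega>. C * (\<Sum>i<k. escape L (h i \<omega>)))"
    using ei by (intro integrable_mult_right Bochner_Integration.integrable_sum) auto
  have "\<bar>(\<integral>\<omega>. f (\<lambda>i. h i \<omega>) \<partial>M) - (\<integral>\<omega>. g (\<lambda>i. h i \<omega>) \<partial>M)\<bar>
    = \<bar>\<integral>\<omega>. f (\<lambda>i. h i \<omega>) - g (\<lambda>i. h i \<omega>) \<partial>M\<bar>"
    using fi gh by simp
  also have "\<dots> \<le> (\<integral>\<omega>. \<bar>f (\<lambda>i. h i \<omega>) - g (\<lambda>i. h i \<omega>)\<bar> \<partial>M)"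
    by (rule integral_abs_bound)
  also have "\<dots> \<le> (\<integral>\<omega>. d + C * (\<Sum>i<k. escape L (h i \<omega>)) \<partial>M)"
    using fi gh si close by (intro integral_mono) auto
  also have "\<dots> = d + C * (\<Sum>i<k. \<integral>\<omega>. escape L (h i \<omega>) \<partial>M)"
    using ei si by (simp add: prob_space Bochner_Integration.integral_sum)
  finally show ?thesis .
qed

text \<open>A sine polynomial \<open>g\<close> approximates the test function on a large cube and
  stays bounded outside it. Integrals of \<open>g\<close> converge by the hypothesis on
  characteristic functions, and the error of replacing the test function by \<open>g\<close> is paid
  for by \<open>escape\<close> of the coordinates, for the sequence as well as for the
  limit.\<close>

theorem cramer_wold:
  fixes Y :: "nat \<Rightarrow> nat \<Rightarrow> 'v \<Rightarrow> real" and Z :: "nat \<Rightarrow> 'u \<Rightarrow> real"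
  assumes R: "\<And>N. prob_space (R N)" "\<And>N i. i < k \<Longrightarrow> Y N i \<in> borel_measurable (R N)"
    and U: "prob_space U" "\<And>i. i < k \<Longrightarrow> Z i \<in> borel_measurable U"
    and char: "\<And>t. (\<lambda>N. \<integral>\<omega>. iexp (\<Sum>i<k. t i * Y N i \<omega>) \<partial>R N) \<longlonglongrightarrow> (\<integral>\<omega>. iexp (\<Sum>i<k. t i * Z i \<omega>) \<partial>U)"
    and cont: "continuous_map (product_topology (\<lambda>_. euclideanreal) {..<k}) euclideanreal \<phi>"
    and bdd: "bounded (\<phi> ` ({..<k} \<rightarrow>\<^sub>E UNIV))"
  shows "(\<lambda>N. \<integral>\<omega>. \<phi> (\<lambda>i\<in>{..<k}. Y N i \<omega>) \<partial>R N) \<longlonglongrightarrow> (\<integral>\<omega>. \<phi> (\<lambda>i\<in>{..<k}. Z i \<omega>) \<partial>U)"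
proof -
  define f where "f x = \<phi> (restrict x {..<k})" for x
  have "continuous_map euclidean (product_topology (\<lambda>_. euclideanreal) {..<k}) (\<lambda>x. restrict x {..<k})"
    by (auto simp: continuous_map_componentwise intro: continuous_on_product_coordinates)
  from continuous_map_compose[OF this cont] have f_cont: "continuous_on UNIV f"
    by (simp add: f_def comp_def)
  obtain B where B: "0 < B" "\<And>x. \<bar>f x\<bar> \<le> B"
  proof -
    obtain B where "\<forall>x\<in>{..<k} \<rightarrow>\<^sub>E UNIV. \<bar>\<phi> x\<bar> \<le> B" using bdd by (auto simp: bounded_iff)
    then have "\<bar>f x\<bar> \<le> max 1 B" for x
      unfolding f_def by (metis max.coboundedI2 restrict_PiE_iff UNIV_I)
    then show ?thesis by (intro that[of "max 1 B"]) auto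
  qed
  have f_restrict: "f x = f (\<lambda>i. if i < k then x i else 0)" for x
    unfolding f_def by (auto intro: arg_cong[where f=\<phi>] simp: restrict_def fun_eq_iff)
  have f_meas: "f \<in> borel_measurable (PiM UNIV (\<lambda>_::nat. borel :: real measure))"
    using borel_measurable_continuous_onI[OF f_cont]
    by (simp add: sets_PiM_equal_borel cong: measurable_cong_sets)
  have fY: "(\<lambda>\<omega>. f (\<lambda>i. Y N i \<omega>)) \<in> borel_measurable (R N)" for N
  proof -
    have "(\<lambda>\<omega>. if i < k then Y N i \<omega> else 0) \<in> borel_measurable (R N)" for i
      by (cases "i < k") (simp_all add: R)
    then have "(\<lambda>\<omega>. f (\<lambda>i. if i < k then Y N i \<omega> else 0)) \<in> borel_measurable (R N)"
      by (intro measurable_compose[OF _ f_meas] measurable_PiM_single') auto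
    moreover have "(\<lambda>\<omega>. f (\<lambda>i. Y N i \<omega>)) = (\<lambda>\<omega>. f (\<lambda>i. if i < k then Y N i \<omega> else 0))"
      by (rule ext, rule f_restrict)
    ultimately show ?thesis by (simp only:)
  qed
  have fZ: "(\<lambda>\<omega>. f (\<lambda>i. Z i \<omega>)) \<in> borel_measurable U"
  proof -
    have "(\<lambda>\<omega>. if i < k then Z i \<omega> else 0) \<in> borel_measurable U" for i
      by (cases "i < k") (simp_all add: U)
    then have "(\<lambda>\<omega>. f (\<lambda>i. if i < k then Z i \<omega> else 0)) \<in> borel_measurable U"
      by (intro measurable_compose[OF _ f_meas] measurable_PiM_single') auto
    moreover have "(\<lambda>\<omega>. f (\<lambda>i. Z i \<omega>)) = (\<lambda>\<omega>. f (\<lambda>i. if i < k then Z i \<omega> else 0))"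
      by (rule ext, rule f_restrict)
    ultimately show ?thesis by (simp only:)
  qed
  have char1: "(\<lambda>N. \<integral>\<omega>. iexp (t * Y N i \<omega>) \<partial>R N) \<longlonglongrightarrow> (\<integral>\<omega>. iexp (t * Z i \<omega>) \<partial>U)" if "i < k" for t i
  proof -
    have eq: "(\<Sum>j<k. (if j = i then t else 0) * x j) = t * x i" for x :: "nat \<Rightarrow> real"
      using single_coefficient_sum[OF that] .
    show ?thesis using char[of "\<lambda>j. if j = i then t else 0"] unfolding eq .
  qed
  have "(\<lambda>N. \<integral>\<omega>. f (\<lambda>i. Y N i \<omega>) \<partial>R N) \<longlonglongrightarrow> (\<integral>\<omega>. f (\<lambda>i. Z i \<omega>) \<partial>U)"
  proof (rule tendstoI)
    fix e :: real assume e: "0 < e"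
    \<comment> \<open>Error budget: each of the two replacements of \<open>f\<close> by
      \<open>g\<close> costs less than 2 d, the convergence of the integrals of \<open>g\<close>
      less than d, in all 5 d < e. The bound d <= B keeps |g| below 2 B.\<close>
    define d where "d = min B (e / 6)"
    have d: "0 < d" "d \<le> B" "d \<le> e / 6" using e B by (auto simp: d_def)
    have "(\<lambda>m. \<Sum>i<k. \<integral>\<omega>. escape (real m) (Z i \<omega>) \<partial>U) \<longlonglongrightarrow> (\<Sum>i<k. 0)"
      by (intro tendsto_sum escape_integral_tendsto_0) (auto simp: U)
    from order_tendstoD(2)[OF this, of "d / (3 * B)"]
    have "\<forall>\<^sub>F m in sequentially. (\<Sum>i<k. \<integral>\<omega>. escape (real m) (Z i \<omega>) \<partial>U) < d / (3 * B)"
      using d B by simp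
    then obtain m where m: "(\<Sum>i<k. \<integral>\<omega>. escape (real m) (Z i \<omega>) \<partial>U) < d / (3 * B)"
      using eventually_happens'[OF sequentially_bot] by blast
    \<comment> \<open>The frequency is tuned to give the cube half-side m + 1, the point from which
      \<open>escape (real m)\<close> equals 1.\<close>
    define b where "b = pi / 2 / (real m + 1)"
    have b: "0 < b" "pi / 2 / b = real m + 1" by (simp_all add: b_def)
    obtain g where g: "sine_algebra k b g" "\<And>x. x \<in> cube k (real m + 1) \<Longrightarrow> \<bar>f x - g x\<bar> < d"
      using sine_algebra_dense[OF f_cont b(1) d(1), of k] b(2) by metis
    \<comment> \<open>Folding moves x into the cube without changing \<open>g\<close>, and there
      \<open>g\<close> is within d of \<open>f\<close>.\<close>
    have g_bd: "\<bar>g x\<bar> \<le> 2 * B" for x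
    proof -
      have "\<bar>g (sine_fold k b x)\<bar> \<le> \<bar>f (sine_fold k b x)\<bar> + d"
        using g(2)[of "sine_fold k b x"] sine_fold_in_cube[OF b(1), of k x] b(2) by simp
      then show ?thesis using B(2)[of "sine_fold k b x"] d sine_algebra_fold[OF g(1), of x] b(1) by simp
    qed
    have g_restrict: "g x = g (\<lambda>i. if i < k then x i else 0)" for x
      using g(1) by induction auto
    \<comment> \<open>Outside the cube some coordinate has \<open>escape\<close> equal to 1, which
      pays for |f| + |g| <= B + 2 B.\<close>
    have close: "\<bar>f x - g x\<bar> \<le> d + 3 * B * (\<Sum>i<k. escape (real m) (x i))" for x
    proof (cases "\<forall>i<k. \<bar>x i\<bar> \<le> real m + 1")
      case True
      then have "(\<lambda>i. if i < k then x i else 0) \<in> cube k (real m + 1)"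
        by (auto simp: in_cube)
      from g(2)[OF this] have "\<bar>f x - g x\<bar> \<le> d" using f_restrict g_restrict by simp
      moreover have "0 \<le> 3 * B * (\<Sum>i<k. escape (real m) (x i))"
        using B by (intro mult_nonneg_nonneg sum_nonneg escape_bounds) auto
      ultimately show ?thesis by simp
    next
      case False
      then obtain j where j: "j < k" "real m + 1 \<le> \<bar>x j\<bar>" by force
      have "1 = escape (real m) (x j)" using escape_bounds(3)[OF j(2)] by simp
      also have "\<dots> \<le> (\<Sum>i<k. escape (real m) (x i))"
        using j by (intro member_le_sum) (auto simp: escape_bounds)
      finally have "3 * B * 1 \<le> 3 * B * (\<Sum>i<k. escape (real m) (x i))"
        using B by (intro mult_left_mono) auto
      moreover have "\<bar>f x - g x\<bar> \<le> 3 * B" using g_bd[of x] B(2)[of x] by simp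
      ultimately show ?thesis using d by linarith
    qed
    note gspan = cosine_span_integral_tendsto[where R=R and Y=Y and U=U and Z=Z, OF R U char sine_algebra_cosine_span[OF g(1)]]
    have escZ: "3 * B * (\<Sum>i<k. \<integral>\<omega>. escape (real m) (Z i \<omega>) \<partial>U) < d"
      using m B by (simp add: field_simps)
    have "(\<lambda>N. 3 * B * (\<Sum>i<k. \<integral>\<omega>. escape (real m) (Y N i \<omega>) \<partial>R N))
        \<longlonglongrightarrow> 3 * B * (\<Sum>i<k. \<integral>\<omega>. escape (real m) (Z i \<omega>) \<partial>U)"
      by (intro tendsto_intros tendsto_sum escape_integral_tendsto) (use R U char1 in \<open>simp_all del: of_real_mult\<close>)
    from order_tendstoD(2)[OF this escZ]
    have ev1: "\<forall>\<^sub>F N in sequentially. 3 * B * (\<Sum>i<k. \<integral>\<omega>. escape (real m) (Y N i \<omega>) \<partial>R N) < d" .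
    have ev2: "\<forall>\<^sub>F N in sequentially. \<bar>(\<integral>\<omega>. g (\<lambda>i. Y N i \<omega>) \<partial>R N) - (\<integral>\<omega>. g (\<lambda>i. Z i \<omega>) \<partial>U)\<bar> < d"
      using gspan d(1) by (auto dest!: tendstoD simp: dist_real_def)
    show "\<forall>\<^sub>F N in sequentially. dist (\<integral>\<omega>. f (\<lambda>i. Y N i \<omega>) \<partial>R N) (\<integral>\<omega>. f (\<lambda>i. Z i \<omega>) \<partial>U) < e"
      using ev1 ev2
    proof eventually_elim
      case (elim N)
      have "\<bar>(\<integral>\<omega>. f (\<lambda>i. Y N i \<omega>) \<partial>R N) - (\<integral>\<omega>. g (\<lambda>i. Y N i \<omega>) \<partial>R N)\<bar>
          \<le> d + 3 * B * (\<Sum>i<k. \<integral>\<omega>. escape (real m) (Y N i \<omega>) \<partial>R N)"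
        by (rule integral_diff_escape[OF R fY B(2) _ close]) (use gspan in auto)
      moreover have "\<bar>(\<integral>\<omega>. f (\<lambda>i. Z i \<omega>) \<partial>U) - (\<integral>\<omega>. g (\<lambda>i. Z i \<omega>) \<partial>U)\<bar>
          \<le> d + 3 * B * (\<Sum>i<k. \<integral>\<omega>. escape (real m) (Z i \<omega>) \<partial>U)"
        by (rule integral_diff_escape[OF U fZ B(2) _ close]) (use gspan in auto)
      ultimately show ?case
        using elim escZ d(3) unfolding dist_real_def by linarith
    qed
  qed
  then show ?thesis by (simp add: f_def restrict_def)
qed

section \<open>Markov chains and their transition kernels\<close>

lemma kernel_prob_space:
  "K \<in> M \<rightarrow>\<^sub>M prob_algebra N \<Longrightarrow> x \<in> space M \<Longrightarrow> prob_space (K x) \<and> sets (K x) = sets N"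
  using measurable_space[of K M "prob_algebra N" x] by (simp add: space_prob_algebra)

text \<open>The definition gives, for each set separately, an almost sure identity with its own null
  set. Integrating it against an indicator of the history gives equality of the two laws on
  rectangles, an intersection-stable generator, hence equality as measures.\<close>

lemma markov_chain_joint:
  assumes P: "prob_space P" and mc: "markov_chain P S \<mu> K X"
    and K [measurable]: "\<And>n. K (Suc n) \<in> S n \<rightarrow>\<^sub>M prob_algebra (S (Suc n))"
  shows "distr P (PiM {..n} S \<Otimes>\<^sub>M S (Suc n)) (\<lambda>\<omega>. (history X n \<omega>, X (Suc n) \<omega>))
    = P \<bind> (\<lambda>\<omega>. distr (K (Suc n) (X n \<omega>)) (PiM {..n} S \<Otimes>\<^sub>M S (Suc n)) (\<lambda>y. (history X n \<omega>, y)))"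
    (is "?L = ?R")
proof -
  interpret prob_space P by fact
  have X [measurable]: "X m \<in> P \<rightarrow>\<^sub>M S m" for m
    using mc by (simp add: markov_chain_def)
  have h [measurable]: "history X n \<in> P \<rightarrow>\<^sub>M PiM {..n} S"
    unfolding history_def by measurable
  let ?F = "vimage_algebra (space P) (history X n) (PiM {..n} S)"
  have hsp: "history X n \<in> space P \<rightarrow> space (PiM {..n} S)"
    using measurable_space[OF h] by auto
  have "subalgebra P ?F"
    using h by (auto simp: subalgebra_def sets_vimage_algebra2[OF hsp] intro!: measurable_sets)
  then interpret sa: finite_measure_subalgebra P ?F
    by unfold_locales
  let ?J = "PiM {..n} S \<Otimes>\<^sub>M S (Suc n)"
  have k: "(\<lambda>\<omega>. distr (K (Suc n) (X n \<omega>)) ?J (\<lambda>y. (history X n \<omega>, y))) \<in> P \<rightarrow>\<^sub>M prob_algebra ?J"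
    by measurable
  have Rs: "prob_space ?R" "sets ?R = sets ?J"
    using prob_space_bind'[OF _ k, of P] sets_bind'[OF _ k, of P] by (simp_all add: space_prob_algebra prob_space_axioms)
  show ?thesis
  proof (rule measure_eqI_generator_eq[OF Int_stable_pair_measure_generator[of "PiM {..n} S" "S (Suc n)"]])
    show "{a \<times> b | a b. a \<in> sets (PiM {..n} S) \<and> b \<in> sets (S (Suc n))} \<subseteq> Pow (space (PiM {..n} S) \<times> space (S (Suc n)))"
      using pair_measure_closed[of "PiM {..n} S" "S (Suc n)"] .
    show "sets ?L = sigma_sets (space (PiM {..n} S) \<times> space (S (Suc n))) {a \<times> b | a b. a \<in> sets (PiM {..n} S) \<and> b \<in> sets (S (Suc n))}"
      by (simp add: sets_pair_measure)
    show "sets ?R = sigma_sets (space (PiM {..n} S) \<times> space (S (Suc n))) {a \<times> b | a b. a \<in> sets (PiM {..n} S) \<and> b \<in> sets (S (Suc n))}"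
      by (simp add: Rs(2) sets_pair_measure)
    show "range (\<lambda>i::nat. space (PiM {..n} S) \<times> space (S (Suc n))) \<subseteq> {a \<times> b | a b. a \<in> sets (PiM {..n} S) \<and> b \<in> sets (S (Suc n))}"
      by auto
    show "emeasure ?L (space (PiM {..n} S) \<times> space (S (Suc n))) \<noteq> \<infinity>" for i :: nat
      using finite_measure.emeasure_finite[OF prob_space.finite_measure[OF prob_space_distr], of "\<lambda>\<omega>. (history X n \<omega>, X (Suc n) \<omega>)" ?J]
      by (simp del: emeasure_distr)
    fix C assume "C \<in> {a \<times> b | a b. a \<in> sets (PiM {..n} S) \<and> b \<in> sets (S (Suc n))}"
    then obtain A B where C: "C = A \<times> B" and A [measurable]: "A \<in> sets (PiM {..n} S)"
      and B [measurable]: "B \<in> sets (S (Suc n))" by blast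
    have KB [measurable]: "(\<lambda>\<omega>. measure (K (Suc n) (X n \<omega>)) B) \<in> borel_measurable P"
      by measurable
    let ?h = "\<lambda>\<omega>. indicator A (history X n \<omega>) :: real"
    have hF: "?h \<in> borel_measurable ?F"
      by (rule measurable_compose[OF measurable_vimage_algebra1[OF hsp] borel_measurable_indicator[OF A]])
    have hP [measurable]: "?h \<in> borel_measurable P" by measurable
    have "emeasure ?L C = (\<integral>\<^sup>+\<omega>. indicator C (history X n \<omega>, X (Suc n) \<omega>) \<partial>P)"
    proof -
      have "emeasure ?L C = (\<integral>\<^sup>+z. indicator C z \<partial>?L)"
        by (rule nn_integral_indicator[symmetric]) (simp add: C)
      also have "\<dots> = (\<integral>\<^sup>+\<omega>. indicator C (history X n \<omega>, X (Suc n) \<omega>) \<partial>P)"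
        by (rule nn_integral_distr) (simp_all add: C)
      finally show ?thesis .
    qed
    also have "\<dots> = (\<integral>\<^sup>+\<omega>. ennreal (?h \<omega> * indicator B (X (Suc n) \<omega>)) \<partial>P)"
      by (intro nn_integral_cong) (auto simp: C indicator_def)
    also have "\<dots> = ennreal (\<integral>\<omega>. ?h \<omega> * indicator B (X (Suc n) \<omega>) \<partial>P)"
      by (intro nn_integral_eq_integral integrable_const_bound[where B=1]) (auto simp: indicator_def)
    also have "(\<integral>\<omega>. ?h \<omega> * indicator B (X (Suc n) \<omega>) \<partial>P)
      = (\<integral>\<omega>. ?h \<omega> * real_cond_exp P ?F (\<lambda>\<omega>. indicator B (X (Suc n) \<omega>)) \<omega> \<partial>P)"
      by (rule sa.real_cond_exp_intg(2)[OF _ hF, symmetric])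
        (auto intro!: integrable_const_bound[where B=1] split: split_indicator)
    also have "\<dots> = (\<integral>\<omega>. ?h \<omega> * measure (K (Suc n) (X n \<omega>)) B \<partial>P)"
    proof (rule integral_cong_AE)
      have "AE \<omega> in P. real_cond_exp P ?F (\<lambda>\<omega>. indicator B (X (Suc n) \<omega>)) \<omega> = measure (K (Suc n) (X n \<omega>)) B"
        using mc B unfolding markov_chain_def by blast
      then show "AE \<omega> in P. ?h \<omega> * real_cond_exp P ?F (\<lambda>\<omega>. indicator B (X (Suc n) \<omega>)) \<omega>
          = ?h \<omega> * measure (K (Suc n) (X n \<omega>)) B"
        by eventually_elim simp
    qed auto
    also have "ennreal \<dots> = (\<integral>\<^sup>+\<omega>. ennreal (?h \<omega> * measure (K (Suc n) (X n \<omega>)) B) \<partial>P)"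
    proof (intro nn_integral_eq_integral[symmetric] integrable_const_bound[where B=1] AE_I2)
      fix \<omega> assume "\<omega> \<in> space P"
      then have "prob_space (K (Suc n) (X n \<omega>))"
        using kernel_prob_space[OF K, of "X n \<omega>" n] measurable_space[OF X] by auto
      then show "norm (?h \<omega> * measure (K (Suc n) (X n \<omega>)) B) \<le> 1"
        by (auto simp: indicator_def prob_space.prob_le_1)
    qed (auto simp: indicator_def)
    also have "\<dots> = (\<integral>\<^sup>+\<omega>. emeasure (distr (K (Suc n) (X n \<omega>)) ?J (\<lambda>y. (history X n \<omega>, y))) C \<partial>P)"
    proof (intro nn_integral_cong)
      fix \<omega> assume w: "\<omega> \<in> space P"
      then have K': "prob_space (K (Suc n) (X n \<omega>))" "sets (K (Suc n) (X n \<omega>)) = sets (S (Suc n))"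
        using kernel_prob_space[OF K, of "X n \<omega>" n] measurable_space[OF X] by auto
      have hw: "history X n \<omega> \<in> space (PiM {..n} S)" using w hsp by auto
      have "emeasure (distr (K (Suc n) (X n \<omega>)) ?J (\<lambda>y. (history X n \<omega>, y))) C
        = emeasure (K (Suc n) (X n \<omega>)) ((\<lambda>y. (history X n \<omega>, y)) -` C \<inter> space (K (Suc n) (X n \<omega>)))"
        using hw by (intro emeasure_distr) (auto simp: C K'(2) cong: measurable_cong_sets)
      also have "(\<lambda>y. (history X n \<omega>, y)) -` C \<inter> space (K (Suc n) (X n \<omega>)) = (if history X n \<omega> \<in> A then B else {})"
        using sets.sets_into_space[OF B] sets_eq_imp_space_eq[OF K'(2)] by (auto simp: C)
      finally show "ennreal (?h \<omega> * measure (K (Suc n) (X n \<omega>)) B) = emeasure (distr (K (Suc n) (X n \<omega>)) ?J (\<lambda>y. (history X n \<omega>, y))) C"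
        using prob_space.finite_measure[OF K'(1)]
        by (auto simp: indicator_def finite_measure.emeasure_eq_measure)
    qed
    also have "\<dots> = emeasure ?R C"
      by (rule emeasure_bind_prob_algebra[OF _ k, symmetric])
        (auto simp: C space_prob_algebra prob_space_axioms)
    finally show "emeasure ?L C = emeasure ?R C" .
  qed simp
qed

lemma markov_chain_integral:
  fixes f :: "_ \<Rightarrow> real"
  assumes P: "prob_space P" and mc: "markov_chain P S \<mu> K X"
    and K: "\<And>n. K (Suc n) \<in> S n \<rightarrow>\<^sub>M prob_algebra (S (Suc n))"
    and f: "f \<in> borel_measurable (PiM {..n} S \<Otimes>\<^sub>M S (Suc n))"
    and bd: "\<And>v y. v \<in> space (PiM {..n} S) \<Longrightarrow> y \<in> space (S (Suc n)) \<Longrightarrow> \<bar>f (v, y)\<bar> \<le> C"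
  shows "(\<integral>\<omega>. f (history X n \<omega>, X (Suc n) \<omega>) \<partial>P) = (\<integral>\<omega>. (\<integral>y. f (history X n \<omega>, y) \<partial>K (Suc n) (X n \<omega>)) \<partial>P)"
proof -
  interpret prob_space P by fact
  have X [measurable]: "X m \<in> P \<rightarrow>\<^sub>M S m" for m
    using mc by (simp add: markov_chain_def)
  have h [measurable]: "history X n \<in> P \<rightarrow>\<^sub>M PiM {..n} S"
    unfolding history_def by measurable
  note K [measurable] f [measurable]
  let ?J = "PiM {..n} S \<Otimes>\<^sub>M S (Suc n)"
  have k: "(\<lambda>\<omega>. distr (K (Suc n) (X n \<omega>)) ?J (\<lambda>y. (history X n \<omega>, y))) \<in> P \<rightarrow>\<^sub>M prob_algebra ?J"
    by measurable
  have "(\<integral>\<omega>. f (history X n \<omega>, X (Suc n) \<omega>) \<partial>P) = (\<integral>z. f z \<partial>distr P ?J (\<lambda>\<omega>. (history X n \<omega>, X (Suc n) \<omega>)))"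
    by (subst integral_distr) auto
  also have "\<dots> = (\<integral>\<omega>. (\<integral>z. f z \<partial>distr (K (Suc n) (X n \<omega>)) ?J (\<lambda>y. (history X n \<omega>, y))) \<partial>P)"
    unfolding markov_chain_joint[OF P mc K]
  proof (rule integral_bind[where B=C and B'=1])
    show "AE x in P. emeasure (distr (K (Suc n) (X n x)) ?J (Pair (history X n x)))
        (space (distr (K (Suc n) (X n x)) ?J (Pair (history X n x)))) \<le> ennreal 1"
      using kernel_prob_space[OF k] by (auto intro!: AE_I2 dest: prob_space_imp_subprob_space intro: subprob_space.subprob_emeasure_le_1)
  qed (use f bd measurable_prob_algebraD[OF k] in \<open>auto simp: space_pair_measure intro: finite_measure_axioms\<close>)
  also have "\<dots> = (\<integral>\<omega>. (\<integral>y. f (history X n \<omega>, y) \<partial>K (Suc n) (X n \<omega>)) \<partial>P)"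
  proof (intro Bochner_Integration.integral_cong refl integral_distr f)
    fix \<omega> assume w: "\<omega> \<in> space P"
    then have K': "sets (K (Suc n) (X n \<omega>)) = sets (S (Suc n))"
      using kernel_prob_space[OF K, of "X n \<omega>" n] measurable_space[OF X] by auto
    show "Pair (history X n \<omega>) \<in> K (Suc n) (X n \<omega>) \<rightarrow>\<^sub>M ?J"
      using measurable_space[OF h w] by (simp cong: measurable_cong_sets add: K')
  qed
  finally show ?thesis .
qed

text \<open>Pushing \<open>L x\<close> forward along y -> (x, y) moves the parameter from the
  integrand into the measure; what remains is the integral of a fixed function against a measurable
  kernel.\<close>

lemma integral_measurable_kernel:
  fixes f :: "_ \<Rightarrow> real"
  assumes f [measurable]: "f \<in> borel_measurable (M \<Otimes>\<^sub>M N)" and L: "L \<in> M \<rightarrow>\<^sub>M subprob_algebra N"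
  shows "(\<lambda>x. \<integral>y. f (x, y) \<partial>L x) \<in> borel_measurable M"
proof -
  note measurable_distr2[measurable] L[measurable]
  have "(\<lambda>x. integral\<^sup>L (distr (L x) (M \<Otimes>\<^sub>M N) (\<lambda>y. (x, y))) f) \<in> borel_measurable M"
    by measurable
  then show ?thesis
    by (rule measurable_cong[THEN iffD1, rotated]) (auto simp: integral_distr subprob_measurableD[OF L] cong: measurable_cong_sets)
qed

text \<open>The real case applied to real and imaginary parts. Integrability of the conditional
  integral is included because conditional characteristic functions are later subtracted under the
  integral sign.\<close>

lemma markov_chain_complex_integral:
  fixes f :: "_ \<Rightarrow> complex"
  assumes P: "prob_space P" and mc: "markov_chain P S \<mu> K X"
    and K: "\<And>n. K (Suc n) \<in> S n \<rightarrow>\<^sub>M prob_algebra (S (Suc n))"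
    and f: "f \<in> borel_measurable (PiM {..n} S \<Otimes>\<^sub>M S (Suc n))"
    and bd: "\<And>v y. v \<in> space (PiM {..n} S) \<Longrightarrow> y \<in> space (S (Suc n)) \<Longrightarrow> cmod (f (v, y)) \<le> C"
  shows "integrable P (\<lambda>\<omega>. \<integral>y. f (history X n \<omega>, y) \<partial>K (Suc n) (X n \<omega>))"
    and "(\<integral>\<omega>. f (history X n \<omega>, X (Suc n) \<omega>) \<partial>P) = (\<integral>\<omega>. (\<integral>y. f (history X n \<omega>, y) \<partial>K (Suc n) (X n \<omega>)) \<partial>P)"
proof -
  interpret prob_space P by fact
  have X [measurable]: "X m \<in> P \<rightarrow>\<^sub>M S m" for m
    using mc by (simp add: markov_chain_def)
  have h [measurable]: "history X n \<in> P \<rightarrow>\<^sub>M PiM {..n} S"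
    unfolding history_def by measurable
  note K [measurable] f [measurable]
  have hsp: "history X n \<omega> \<in> space (PiM {..n} S)" "X m \<omega> \<in> space (S m)" if "\<omega> \<in> space P" for \<omega> m
    using measurable_space[OF h that] measurable_space[OF X that] by auto
  have Kp: "prob_space (K (Suc n) (X n \<omega>))" "sets (K (Suc n) (X n \<omega>)) = sets (S (Suc n))" if "\<omega> \<in> space P" for \<omega>
    using kernel_prob_space[OF K hsp(2)[OF that, of n]] by auto
  have i1: "integrable P (\<lambda>\<omega>. f (history X n \<omega>, X (Suc n) \<omega>))"
    by (rule integrable_const_bound[where B=C]) (use hsp bd in auto)
  have i2: "integrable (K (Suc n) (X n \<omega>)) (\<lambda>y. f (history X n \<omega>, y))" if w: "\<omega> \<in> space P" for \<omega>
  proof (rule finite_measure.integrable_const_bound[OF prob_space.finite_measure[OF Kp(1)[OF w]], where B=C])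
    show "AE y in K (Suc n) (X n \<omega>). cmod (f (history X n \<omega>, y)) \<le> C"
      using hsp[OF w] bd sets_eq_imp_space_eq[OF Kp(2)[OF w]] by (auto intro!: AE_I2)
    have "(\<lambda>y. f (history X n \<omega>, y)) \<in> borel_measurable (S (Suc n))"
      using hsp[OF w] by simp
    then show "(\<lambda>y. f (history X n \<omega>, y)) \<in> borel_measurable (K (Suc n) (X n \<omega>))"
      using Kp(2)[OF w] by (simp cong: measurable_cong_sets)
  qed
  have L: "K (Suc n) \<in> S n \<rightarrow>\<^sub>M subprob_algebra (S (Suc n))" using measurable_prob_algebraD[OF K] .
  have m2: "(\<lambda>\<omega>. \<integral>y. g (f (history X n \<omega>, y)) \<partial>K (Suc n) (X n \<omega>)) \<in> borel_measurable P"
    if [measurable]: "g \<in> borel_measurable borel" for g :: "complex \<Rightarrow> real"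
    using integral_measurable_kernel[of "\<lambda>(\<omega>, y). g (f (history X n \<omega>, y))" P "S (Suc n)" "\<lambda>\<omega>. K (Suc n) (X n \<omega>)"] L
    by (simp add: measurable_compose[OF X L])
  have eq: "(\<integral>y. f (history X n \<omega>, y) \<partial>K (Suc n) (X n \<omega>)) =
      Complex (\<integral>y. Re (f (history X n \<omega>, y)) \<partial>K (Suc n) (X n \<omega>)) (\<integral>y. Im (f (history X n \<omega>, y)) \<partial>K (Suc n) (X n \<omega>))"
    if "\<omega> \<in> space P" for \<omega>
    using i2[OF that] by (simp add: complex_eq_iff)
  have m3: "(\<lambda>\<omega>. \<integral>y. f (history X n \<omega>, y) \<partial>K (Suc n) (X n \<omega>)) \<in> borel_measurable P"
    by (subst measurable_cong[OF eq]) (auto simp: borel_measurable_complex_iff intro!: m2)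
  show i3: "integrable P (\<lambda>\<omega>. \<integral>y. f (history X n \<omega>, y) \<partial>K (Suc n) (X n \<omega>))"
  proof (rule integrable_const_bound[where B=C, OF AE_I2 m3])
    fix \<omega> assume w: "\<omega> \<in> space P"
    interpret k: prob_space "K (Suc n) (X n \<omega>)" using Kp[OF w] by simp
    have "cmod (\<integral>y. f (history X n \<omega>, y) \<partial>K (Suc n) (X n \<omega>)) \<le> (\<integral>y. cmod (f (history X n \<omega>, y)) \<partial>K (Suc n) (X n \<omega>))"
      by (rule integral_norm_bound)
    also have "\<dots> \<le> C"
      using i2[OF w] hsp[OF w] bd sets_eq_imp_space_eq[OF Kp(2)[OF w]]
      by (intro k.integral_le_const) (auto intro!: AE_I2)
    finally show "cmod (\<integral>y. f (history X n \<omega>, y) \<partial>K (Suc n) (X n \<omega>)) \<le> C" .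
  qed
  have bd': "\<bar>Re (f (v, y))\<bar> \<le> C" "\<bar>Im (f (v, y))\<bar> \<le> C" if "v \<in> space (PiM {..n} S)" "y \<in> space (S (Suc n))" for v y
    using bd[OF that] abs_Re_le_cmod[of "f (v, y)"] abs_Im_le_cmod[of "f (v, y)"] by auto
  show "(\<integral>\<omega>. f (history X n \<omega>, X (Suc n) \<omega>) \<partial>P) = (\<integral>\<omega>. (\<integral>y. f (history X n \<omega>, y) \<partial>K (Suc n) (X n \<omega>)) \<partial>P)"
  proof (rule complex_eqI)
    have "Re (\<integral>\<omega>. f (history X n \<omega>, X (Suc n) \<omega>) \<partial>P) = (\<integral>\<omega>. Re (f (history X n \<omega>, X (Suc n) \<omega>)) \<partial>P)"
      using i1 by simp
    also have "\<dots> = (\<integral>\<omega>. (\<integral>y. Re (f (history X n \<omega>, y)) \<partial>K (Suc n) (X n \<omega>)) \<partial>P)"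
      using markov_chain_integral[OF P mc K, of "\<lambda>z. Re (f z)" n C] bd' by auto
    also have "\<dots> = (\<integral>\<omega>. Re (\<integral>y. f (history X n \<omega>, y) \<partial>K (Suc n) (X n \<omega>)) \<partial>P)"
      by (intro Bochner_Integration.integral_cong refl integral_Re i2)
    also have "\<dots> = Re (\<integral>\<omega>. (\<integral>y. f (history X n \<omega>, y) \<partial>K (Suc n) (X n \<omega>)) \<partial>P)"
      by (rule integral_Re[OF i3])
    finally show "Re (\<integral>\<omega>. f (history X n \<omega>, X (Suc n) \<omega>) \<partial>P) = Re (\<integral>\<omega>. (\<integral>y. f (history X n \<omega>, y) \<partial>K (Suc n) (X n \<omega>)) \<partial>P)" .
    have "Im (\<integral>\<omega>. f (history X n \<omega>, X (Suc n) \<omega>) \<partial>P) = (\<integral>\<omega>. Im (f (history X n \<omega>, X (Suc n) \<omega>)) \<partial>P)"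
      using i1 by simp
    also have "\<dots> = (\<integral>\<omega>. (\<integral>y. Im (f (history X n \<omega>, y)) \<partial>K (Suc n) (X n \<omega>)) \<partial>P)"
      using markov_chain_integral[OF P mc K, of "\<lambda>z. Im (f z)" n C] bd' by auto
    also have "\<dots> = (\<integral>\<omega>. Im (\<integral>y. f (history X n \<omega>, y) \<partial>K (Suc n) (X n \<omega>)) \<partial>P)"
      by (intro Bochner_Integration.integral_cong refl integral_Im i2)
    also have "\<dots> = Im (\<integral>\<omega>. (\<integral>y. f (history X n \<omega>, y) \<partial>K (Suc n) (X n \<omega>)) \<partial>P)"
      by (rule integral_Im[OF i3])
    finally show "Im (\<integral>\<omega>. f (history X n \<omega>, X (Suc n) \<omega>) \<partial>P) = Im (\<integral>\<omega>. (\<integral>y. f (history X n \<omega>, y) \<partial>K (Suc n) (X n \<omega>)) \<partial>P)" .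
  qed
qed

section \<open>Boltzmann-Gibbs kernels and sums of independent variables\<close>

text \<open>Strict positivity of \<open>g\<close> makes the normaliser positive under every
  probability measure. The bound \<open>c a\<close> may vary with the parameter, as it only serves
  integrability at fixed \<open>a\<close>; for the backward kernels it will be the envelope at x,
  which need not be bounded in x.\<close>

lemma Psi_kernel:
  fixes g :: "'b \<times> 'a \<Rightarrow> real"
  assumes k: "k \<in> A \<rightarrow>\<^sub>M prob_algebra B" and g [measurable]: "g \<in> borel_measurable (A \<Otimes>\<^sub>M B)"
    and pos: "\<And>a b. a \<in> space A \<Longrightarrow> b \<in> space B \<Longrightarrow> 0 < g (a, b)"
    and bd: "\<And>a b. a \<in> space A \<Longrightarrow> b \<in> space B \<Longrightarrow> g (a, b) \<le> c a"
  shows "(\<lambda>a. Psi (\<lambda>b. g (a, b)) (k a)) \<in> A \<rightarrow>\<^sub>M prob_algebra B"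
proof -
  have ks: "k \<in> A \<rightarrow>\<^sub>M subprob_algebra B" by (rule measurable_prob_algebraD[OF k])
  have kp: "prob_space (k a)" "sets (k a) = sets B" "space (k a) = space B" if "a \<in> space A" for a
    using measurable_space[OF k that] sets_eq_imp_space_eq[of "k a" B] by (auto simp: space_prob_algebra)
  have ga [measurable]: "(\<lambda>b. g (a, b)) \<in> borel_measurable (k a)" "(\<lambda>b. g (a, b)) \<in> borel_measurable B" if "a \<in> space A" for a
    using measurable_compose[OF measurable_Pair1'[OF that] g] kp(2)[OF that] by (simp_all cong: measurable_cong_sets)
  have gi: "integrable (k a) (\<lambda>b. g (a, b))" if "a \<in> space A" for a
    using prob_space.finite_measure[OF kp(1)[OF that]] ga[OF that] pos[OF that] bd[OF that]
    by (intro finite_measure.integrable_const_bound[where B="c a"] AE_I2) (auto simp: kp(3)[OF that] less_imp_le)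
  have Z: "0 < (\<integral>b. g (a, b) \<partial>k a)" if a: "a \<in> space A" for a
  proof -
    interpret prob_space "k a" by (rule kp(1)[OF a])
    show ?thesis
      using integral_less_AE_space[of "\<lambda>_. 0" "\<lambda>b. g (a, b)"] gi[OF a] emeasure_space_1
        AE_I2[of "k a" "\<lambda>b. 0 < g (a, b)"] pos[OF a] by (simp add: kp(3)[OF a])
  qed
  have Zm [measurable]: "(\<lambda>a. \<integral>b. g (a, b) \<partial>k a) \<in> borel_measurable A"
  proof -
    note measurable_distr2[measurable] ks[measurable]
    have "(\<lambda>x. integral\<^sup>L (distr (k x) (A \<Otimes>\<^sub>M B) (\<lambda>y. (x, y))) g) \<in> borel_measurable A"
      by measurable
    then show ?thesis
      by (rule measurable_cong[THEN iffD1, rotated]) (auto simp: integral_distr subprob_measurableD[OF ks] cong: measurable_cong_sets)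
  qed
  have em: "emeasure (Psi (\<lambda>b. g (a, b)) (k a)) S = (\<integral>\<^sup>+b. ennreal (g (a, b) / (\<integral>b. g (a, b) \<partial>k a)) * indicator S b \<partial>k a)"
    if "a \<in> space A" "S \<in> sets B" for a S
    using that kp(2)[OF that(1)] ga[OF that(1)] unfolding Psi_def by (subst emeasure_density) auto
  show ?thesis
  proof (rule measurable_prob_algebraI)
    show "prob_space (Psi (\<lambda>b. g (a, b)) (k a))" if a: "a \<in> space A" for a
    proof
      have "(\<integral>\<^sup>+b. ennreal (g (a, b) / (\<integral>b. g (a, b) \<partial>k a)) * indicator (space B) b \<partial>k a) = (\<integral>\<^sup>+b. ennreal (g (a, b) / (\<integral>b. g (a, b) \<partial>k a)) \<partial>k a)"
        by (intro nn_integral_cong) (simp add: kp(3)[OF a])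
      also have "\<dots> = ennreal (\<integral>b. g (a, b) / (\<integral>b. g (a, b) \<partial>k a) \<partial>k a)"
        using gi[OF a] Z[OF a] pos[OF a] by (intro nn_integral_eq_integral) (auto simp: kp(3)[OF a] less_imp_le)
      also have "\<dots> = 1" using Z[OF a] by simp
      finally show "emeasure (Psi (\<lambda>b. g (a, b)) (k a)) (space (Psi (\<lambda>b. g (a, b)) (k a))) = 1"
        using em[OF a, of "space B"] by (simp add: Psi_def kp(3)[OF a])
    qed
    show "(\<lambda>a. Psi (\<lambda>b. g (a, b)) (k a)) \<in> A \<rightarrow>\<^sub>M subprob_algebra B"
    proof (rule measurable_subprob_algebra)
      show "sets (Psi (\<lambda>b. g (a, b)) (k a)) = sets B" if "a \<in> space A" for a
        by (simp add: Psi_def kp(2)[OF that])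
      show "subprob_space (Psi (\<lambda>b. g (a, b)) (k a))" if "a \<in> space A" for a
        using \<open>\<And>a. a \<in> space A \<Longrightarrow> prob_space (Psi (\<lambda>b. g (a, b)) (k a))\<close>[OF that] by (rule prob_space_imp_subprob_space)
      fix S assume [measurable]: "S \<in> sets B"
      have "(\<lambda>a. \<integral>\<^sup>+b. ennreal (g (a, b) / (\<integral>b. g (a, b) \<partial>k a)) * indicator S b \<partial>k a) \<in> borel_measurable A"
        by (rule nn_integral_measurable_subprob_algebra2[OF _ ks]) measurable
      then show "(\<lambda>a. emeasure (Psi (\<lambda>b. g (a, b)) (k a)) S) \<in> borel_measurable A"
        by (rule measurable_cong[THEN iffD1, rotated]) (simp add: em)
    qed
  qed
qed

lemma integral_Psi:
  fixes f g :: "'a \<Rightarrow> real"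
  assumes "g \<in> borel_measurable \<mu>" "\<And>y. y \<in> space \<mu> \<Longrightarrow> 0 \<le> g y" "f \<in> borel_measurable \<mu>"
  shows "(\<integral>y. f y \<partial>Psi g \<mu>) = (\<integral>y. g y * f y \<partial>\<mu>) / (\<integral>y. g y \<partial>\<mu>)"
proof -
  have "0 \<le> (\<integral>y. g y \<partial>\<mu>)" using assms by simp
  then show ?thesis unfolding Psi_def
    using assms by (subst integral_real_density) (auto intro!: AE_I2)
qed

section \<open>Sums of bounded independent variables\<close>

definition var_of :: "'a measure \<Rightarrow> ('a \<Rightarrow> real) \<Rightarrow> real" where
  "var_of \<kappa> f = (\<integral>y. (f y - (\<integral>z. f z \<partial>\<kappa>))\<^sup>2 \<partial>\<kappa>)"

lemma bounded_integrable:
  fixes f :: "'a \<Rightarrow> 'b::{banach, second_countable_topology}"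
  assumes "prob_space M" "f \<in> borel_measurable M" "\<And>x. x \<in> space M \<Longrightarrow> norm (f x) \<le> C"
  shows "integrable M f"
  by (rule finite_measure.integrable_const_bound[OF prob_space.finite_measure[OF assms(1)], where B=C])
    (use assms in auto)

lemma bounded_integral:
  fixes f :: "'a \<Rightarrow> real"
  assumes "prob_space M" "f \<in> borel_measurable M" "\<And>x. x \<in> space M \<Longrightarrow> \<bar>f x\<bar> \<le> C"
  shows "\<bar>\<integral>x. f x \<partial>M\<bar> \<le> C"
proof -
  have "\<bar>\<integral>x. f x \<partial>M\<bar> \<le> (\<integral>x. \<bar>f x\<bar> \<partial>M)" by (rule integral_abs_bound)
  also have "\<dots> \<le> C"
    using assms by (intro prob_space.integral_le_const integrable_abs bounded_integrable[of M f C]) (auto intro!: AE_I2)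
  finally show ?thesis .
qed

lemma square_le_of_abs_le: "\<bar>y\<bar> \<le> C \<Longrightarrow> y\<^sup>2 \<le> (C::real)\<^sup>2"
  by (metis abs_ge_zero power2_abs power_mono)

lemma var_of_eq:
  assumes "prob_space M" "f \<in> borel_measurable M" "\<And>x. x \<in> space M \<Longrightarrow> \<bar>f x\<bar> \<le> C"
  shows "var_of M f = (\<integral>x. (f x)\<^sup>2 \<partial>M) - (\<integral>x. f x \<partial>M)\<^sup>2"
proof -
  interpret prob_space M by fact
  have 1: "integrable M f" by (rule bounded_integrable[where C=C]) (use assms in auto)
  have "integrable M (\<lambda>x. (f x)\<^sup>2)"
    by (rule bounded_integrable[where C="C\<^sup>2"]) (use assms in \<open>auto intro: square_le_of_abs_le\<close>)
  from variance_eq[OF 1 this] show ?thesis by (simp add: var_of_def)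
qed

lemma prod_kernels_cong:
  assumes "\<And>i. i < N \<Longrightarrow> \<kappa> i = \<kappa>' i"
  shows "PiM {..<N::nat} \<kappa> = PiM {..<N} \<kappa>'"
  using assms by (intro PiM_cong) auto

lemma exp_minus_le_quadratic: "0 \<le> (u::real) \<Longrightarrow> exp (- u) \<le> 1 - u + u\<^sup>2 / 2"
proof -
  assume u: "0 \<le> u"
  define h where "h x = 1 - x + x\<^sup>2 / 2 - exp (- x)" for x :: real
  have "h 0 \<le> h u"
  proof (rule DERIV_nonneg_imp_nondecreasing[OF u])
    fix x :: real
    show "\<exists>y. (h has_real_derivative y) (at x) \<and> y \<ge> 0"
      by (rule exI[of _ "- 1 + x + exp (- x)"]) (use exp_ge_add_one_self[of "-x"] in \<open>auto simp: h_def[abs_def] intro!: derivative_eq_intros\<close>)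
  qed
  then show ?thesis by (simp add: h_def)
qed

text \<open>The third-order Taylor remainder gives |s|^3 C^3 / 6. With u = s^2 v / 2 <= s^2 C^2 / 2,
  replacing 1 - u by exp (-u) costs at most u^2 / 2, hence s^4 C^4 / 8.\<close>

lemma char_approx_variance:
  assumes "prob_space \<kappa>" "g \<in> borel_measurable \<kappa>" "\<And>x. x \<in> space \<kappa> \<Longrightarrow> \<bar>g x\<bar> \<le> C" "(\<integral>x. g x \<partial>\<kappa>) = 0"
  shows "cmod ((\<integral>x. iexp (s * g x) \<partial>\<kappa>) - complex_of_real (exp (- (s\<^sup>2 * (\<integral>x. (g x)\<^sup>2 \<partial>\<kappa>) / 2))))
    \<le> \<bar>s\<bar> ^ 3 * C ^ 3 / 6 + s ^ 4 * C ^ 4 / 8"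
proof -
  interpret prob_space \<kappa> by fact
  let ?v = "\<integral>x. (g x)\<^sup>2 \<partial>\<kappa>"
  obtain x0 where "x0 \<in> space \<kappa>" using not_empty by auto
  then have C: "0 \<le> C" using assms(3)[of x0] by linarith
  have gi: "integrable \<kappa> g" by (rule bounded_integrable[where C=C]) (use assms in auto)
  have sq: "(g x)\<^sup>2 \<le> C\<^sup>2" if "x \<in> space \<kappa>" for x
    using assms(3)[OF that] C by (simp add: abs_le_square_iff[symmetric])
  have g2i: "integrable \<kappa> (\<lambda>x. (g x)\<^sup>2)" by (rule bounded_integrable[where C="C\<^sup>2"]) (use assms sq in auto)
  have ei: "integrable \<kappa> (\<lambda>x. iexp (s * g x))"
    by (rule bounded_integrable[where C=1]) (use assms in auto)
  let ?p = "\<lambda>x. 1 + \<i> * complex_of_real (s * g x) - complex_of_real (s\<^sup>2 * (g x)\<^sup>2 / 2)"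
  define a b where "a x = s * g x" and "b x = s\<^sup>2 * (g x)\<^sup>2 / 2" for x
  have ai: "integrable \<kappa> (\<lambda>x. complex_of_real (a x))" and bi: "integrable \<kappa> (\<lambda>x. complex_of_real (b x))"
    using gi g2i by (simp_all only: a_def b_def integrable_of_real integrable_mult_right integrable_divide)
  have pi: "integrable \<kappa> ?p" using ai bi unfolding a_def[symmetric] b_def[symmetric] by simp
  have "(\<integral>x. a x \<partial>\<kappa>) = 0" "(\<integral>x. b x \<partial>\<kappa>) = s\<^sup>2 * ?v / 2"
    using gi g2i assms(4) by (simp_all add: a_def b_def)
  then have "(\<integral>x. ?p x \<partial>\<kappa>) = 1 - complex_of_real (s\<^sup>2 * ?v / 2)"
    using ai bi unfolding a_def[symmetric] b_def[symmetric] by (simp add: prob_space del: of_real_mult of_real_divide of_real_power)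
  then have "cmod ((\<integral>x. iexp (s * g x) \<partial>\<kappa>) - complex_of_real (1 - s\<^sup>2 * ?v / 2)) = cmod (\<integral>x. iexp (s * g x) - ?p x \<partial>\<kappa>)"
    using ei pi by simp
  also have "\<dots> \<le> (\<integral>x. cmod (iexp (s * g x) - ?p x) \<partial>\<kappa>)"
    by (rule integral_norm_bound)
  also have "\<dots> \<le> \<bar>s\<bar> ^ 3 * C ^ 3 / 6"
  proof (rule integral_le_const)
    show "integrable \<kappa> (\<lambda>x. cmod (iexp (s * g x) - ?p x))" using ei pi by simp
    show "AE x in \<kappa>. cmod (iexp (s * g x) - ?p x) \<le> \<bar>s\<bar> ^ 3 * C ^ 3 / 6"
    proof (rule AE_I2)
      fix x assume x: "x \<in> space \<kappa>"
      have "(\<Sum>k\<le>2. (\<i> * (s * g x)) ^ k / fact k) = ?p x"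
        by (simp add: numeral_2_eq_2 power2_eq_square algebra_simps)
      with iexp_approx1[of "s * g x" 2] have "cmod (iexp (s * g x) - ?p x) \<le> \<bar>s * g x\<bar> ^ 3 / 6"
        by (simp add: numeral_3_eq_3 fact_numeral)
      also have "\<dots> \<le> (\<bar>s\<bar> * C) ^ 3 / 6"
        using assms(3)[OF x] by (intro divide_right_mono power_mono) (auto simp: abs_mult intro: mult_left_mono)
      finally show "cmod (iexp (s * g x) - ?p x) \<le> \<bar>s\<bar> ^ 3 * C ^ 3 / 6" by (simp add: power_mult_distrib)
    qed
  qed
  finally have 1: "cmod ((\<integral>x. iexp (s * g x) \<partial>\<kappa>) - complex_of_real (1 - s\<^sup>2 * ?v / 2)) \<le> \<bar>s\<bar> ^ 3 * C ^ 3 / 6" .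
  let ?u = "s\<^sup>2 * ?v / 2"
  have v: "0 \<le> ?v" "?v \<le> C\<^sup>2" using sq g2i by (auto intro!: integral_le_const)
  have u: "0 \<le> ?u" "?u \<le> s\<^sup>2 * C\<^sup>2 / 2" using v by (auto intro!: mult_left_mono divide_right_mono)
  have "\<bar>exp (- ?u) - (1 - ?u)\<bar> \<le> ?u\<^sup>2 / 2"
  proof -
    have "1 - ?u \<le> exp (- ?u)" using exp_ge_add_one_self[of "- ?u"] by simp
    moreover have "exp (- ?u) \<le> 1 - ?u + ?u\<^sup>2 / 2"
      by (rule exp_minus_le_quadratic[OF u(1)])
    ultimately show ?thesis by simp
  qed
  also have "\<dots> \<le> (s\<^sup>2 * C\<^sup>2 / 2)\<^sup>2 / 2" using u by (intro divide_right_mono power_mono) auto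
  also have "\<dots> = s ^ 4 * C ^ 4 / 8" by (simp add: power2_eq_square power4_eq_xxxx)
  finally have 2: "\<bar>exp (- ?u) - (1 - ?u)\<bar> \<le> s ^ 4 * C ^ 4 / 8" .
  have "cmod (complex_of_real (1 - ?u) - complex_of_real (exp (- ?u))) = \<bar>exp (- ?u) - (1 - ?u)\<bar>"
    unfolding of_real_diff[symmetric] norm_of_real by (rule abs_minus_commute)
  with 2 have "cmod (complex_of_real (1 - ?u) - complex_of_real (exp (- ?u))) \<le> s ^ 4 * C ^ 4 / 8" by simp
  with 1 show ?thesis
    using norm_triangle_ineq[of "(\<integral>x. iexp (s * g x) \<partial>\<kappa>) - complex_of_real (1 - ?u)" "complex_of_real (1 - ?u) - complex_of_real (exp (- ?u))"]
    by (simp only: diff_add_cancel add_diff_eq)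
qed

text \<open>The laws may differ, since each particle moves from its own position; only the average
  variance enters. Independence turns the characteristic function into a product of factors of
  modulus at most 1, and the distance between two such products is at most the sum of the N
  factorwise distances. Centring doubles the bound to 2 C, whence 8 C^3 / 6 and 16 C^4 / 8 = 2
  C^4.\<close>

lemma prod_char_approx_variance:
  fixes \<kappa> :: "nat \<Rightarrow> 'a measure" and f :: "'a \<Rightarrow> real"
  assumes "\<And>i. i < N \<Longrightarrow> prob_space (\<kappa> i)" "\<And>i. i < N \<Longrightarrow> f \<in> borel_measurable (\<kappa> i)"
    and bd: "\<And>i y. i < N \<Longrightarrow> y \<in> space (\<kappa> i) \<Longrightarrow> \<bar>f y\<bar> \<le> C" and N: "0 < N"
  shows "cmod ((\<integral>y. iexp ((\<Sum>i<N. f (y i) - (\<integral>z. f z \<partial>\<kappa> i)) / sqrt N) \<partial>PiM {..<N} \<kappa>)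
      - complex_of_real (exp (- ((\<Sum>i<N. var_of (\<kappa> i) f) / N / 2)))) \<le> (8 * C ^ 3 / 6 + 2 * C ^ 4) / sqrt N"
proof -
  \<comment> \<open>The product locale asks for a probability measure at every index, so the family
    is continued beyond N by \<open>\<kappa> 0\<close>, which is one because N > 0.\<close>
  define \<kappa>' where "\<kappa>' i = (if i < N then \<kappa> i else \<kappa> 0)" for i
  have pk: "prob_space (\<kappa>' i)" "f \<in> borel_measurable (\<kappa>' i)" "y \<in> space (\<kappa>' i) \<Longrightarrow> \<bar>f y\<bar> \<le> C" for i y
    using assms by (auto simp: \<kappa>'_def split: if_splits)
  have eqk: "i < N \<Longrightarrow> \<kappa> i = \<kappa>' i" for i by (simp add: \<kappa>'_def)
  have prodk: "PiM {..<N} \<kappa> = PiM {..<N} \<kappa>'" by (rule prod_kernels_cong) (rule eqk)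
  interpret product_prob_space \<kappa>' "{..<N}"
    by (intro product_prob_spaceI pk)
  define s where "s = 1 / sqrt N"
  define g where "g i y = f y - (\<integral>z. f z \<partial>\<kappa>' i)" for i y
  have fint: "\<bar>\<integral>z. f z \<partial>\<kappa>' i\<bar> \<le> C" for i by (rule bounded_integral[OF pk])
  have gb: "\<bar>g i y\<bar> \<le> 2 * C" if "y \<in> space (\<kappa>' i)" for i y
    using pk(3)[OF that] fint[of i] unfolding g_def by linarith
  have gm [measurable]: "g i \<in> borel_measurable (\<kappa>' i)" for i
    using pk(2)[of i] unfolding g_def by measurable
  have fi: "integrable (\<kappa>' i) f" for i
    by (rule bounded_integrable[where C=C]) (use pk in auto)
  have g0: "(\<integral>y. g i y \<partial>\<kappa>' i) = 0" for i
    using fi[of i] by (simp add: g_def prob_space.prob_space[OF pk(1)])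
  have ei: "integrable (\<kappa>' i) (\<lambda>y. iexp (s * g i y))" for i
    by (rule bounded_integrable[where C=1]) (use pk in auto)
  have sums: "(\<Sum>i<N. f (y i) - (\<integral>z. f z \<partial>\<kappa> i)) / sqrt N = (\<Sum>i<N. s * g i (y i))" for y
    by (simp add: g_def s_def eqk sum_divide_distrib cong: sum.cong_simp)
  have "(\<integral>y. iexp ((\<Sum>i<N. f (y i) - (\<integral>z. f z \<partial>\<kappa> i)) / sqrt N) \<partial>PiM {..<N} \<kappa>)
    = (\<integral>y. iexp (\<Sum>i<N. s * g i (y i)) \<partial>PiM {..<N} \<kappa>')"
    unfolding prodk sums ..
  also have "\<dots> = (\<integral>y. (\<Prod>i<N. iexp (s * g i (y i))) \<partial>PiM {..<N} \<kappa>')"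
    by (simp add: exp_sum sum_distrib_left)
  also have "\<dots> = (\<Prod>i<N. \<integral>y. iexp (s * g i y) \<partial>\<kappa>' i)"
    by (rule product_integral_prod) (simp_all add: ei del: of_real_mult)
  finally have 1: "(\<integral>y. iexp ((\<Sum>i<N. f (y i) - (\<integral>z. f z \<partial>\<kappa> i)) / sqrt N) \<partial>PiM {..<N} \<kappa>)
    = (\<Prod>i<N. \<integral>y. iexp (s * g i y) \<partial>\<kappa>' i)" .
  let ?w = "\<lambda>i. complex_of_real (exp (- (s\<^sup>2 * (\<integral>y. (g i y)\<^sup>2 \<partial>\<kappa>' i) / 2)))"
  have s2: "s\<^sup>2 = 1 / N" by (simp add: s_def power_divide)
  have vg: "var_of (\<kappa> i) f = (\<integral>y. (g i y)\<^sup>2 \<partial>\<kappa>' i)" if "i < N" for i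
    using that by (simp add: var_of_def g_def eqk)
  have "- ((\<Sum>i<N. var_of (\<kappa> i) f) / N / 2) = (\<Sum>i<N. - (s\<^sup>2 * (\<integral>y. (g i y)\<^sup>2 \<partial>\<kappa>' i) / 2))"
    by (simp add: vg s2 sum_divide_distrib sum_negf)
  then have 2: "complex_of_real (exp (- ((\<Sum>i<N. var_of (\<kappa> i) f) / N / 2))) = (\<Prod>i<N. ?w i)"
    by (simp only: exp_sum finite_lessThan of_real_prod)
  have "cmod ((\<Prod>i<N. \<integral>y. iexp (s * g i y) \<partial>\<kappa>' i) - (\<Prod>i<N. ?w i))
     \<le> (\<Sum>i<N. cmod ((\<integral>y. iexp (s * g i y) \<partial>\<kappa>' i) - ?w i))"
  proof (rule norm_prod_diff)
    fix i
    have "cmod (\<integral>y. iexp (s * g i y) \<partial>\<kappa>' i) \<le> (\<integral>y. cmod (iexp (s * g i y)) \<partial>\<kappa>' i)"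
      by (rule integral_norm_bound)
    also have "\<dots> = 1" by (simp add: prob_space.prob_space[OF pk(1)] del: of_real_mult)
    finally show "cmod (\<integral>y. iexp (s * g i y) \<partial>\<kappa>' i) \<le> 1" .
    show "cmod (?w i) \<le> 1" by (simp only: norm_of_real) simp
  qed
  also have "\<dots> \<le> (\<Sum>i<N. \<bar>s\<bar> ^ 3 * (2 * C) ^ 3 / 6 + s ^ 4 * (2 * C) ^ 4 / 8)"
    by (intro sum_mono char_approx_variance pk gm gb g0)
  also have "\<dots> = real N * (\<bar>s\<bar> ^ 3 * (2 * C) ^ 3 / 6 + s ^ 4 * (2 * C) ^ 4 / 8)" by simp
  also have "\<dots> \<le> (8 * C ^ 3 / 6 + 2 * C ^ 4) / sqrt N"
  proof -
    have s: "0 < s" "s \<le> 1" "real N * s\<^sup>2 = 1" "1 / sqrt N = s" using N by (auto simp: s_def power_divide)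
    have "real N * (\<bar>s\<bar> ^ 3 * (2 * C) ^ 3 / 6 + s ^ 4 * (2 * C) ^ 4 / 8) = (real N * s\<^sup>2) * (8 * C ^ 3 / 6 * s + 2 * C ^ 4 * s * s)"
      using s(1) by (simp add: power2_eq_square power3_eq_cube power4_eq_xxxx algebra_simps)
    also have "\<dots> = 8 * C ^ 3 / 6 * s + 2 * C ^ 4 * s * s" using s(3) by simp
    also have "\<dots> \<le> 8 * C ^ 3 / 6 * s + 2 * C ^ 4 * s * 1"
      using s by (intro add_left_mono mult_left_mono) auto
    also have "\<dots> = (8 * C ^ 3 / 6 + 2 * C ^ 4) * (1 / sqrt N)" unfolding s(4) by (simp add: algebra_simps)
    finally show ?thesis by simp
  qed
  finally show ?thesis unfolding 1 2 .
qed

text \<open>Independence of the centred summands kills the off-diagonal terms, and each variance is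
  at most the second moment.\<close>

lemma prod_variance_le:
  fixes \<kappa> :: "nat \<Rightarrow> 'a measure" and f :: "'a \<Rightarrow> real"
  assumes "\<And>i. i < N \<Longrightarrow> prob_space (\<kappa> i)" "\<And>i. i < N \<Longrightarrow> f \<in> borel_measurable (\<kappa> i)"
    and bd: "\<And>i y. i < N \<Longrightarrow> y \<in> space (\<kappa> i) \<Longrightarrow> \<bar>f y\<bar> \<le> C" and N: "0 < N"
  shows "(\<integral>y. (\<Sum>i<N. f (y i) - (\<integral>z. f z \<partial>\<kappa> i))\<^sup>2 \<partial>PiM {..<N} \<kappa>) \<le> (\<Sum>i<N. \<integral>y. (f y)\<^sup>2 \<partial>\<kappa> i)"
proof -
  define \<kappa>' where "\<kappa>' i = (if i < N then \<kappa> i else \<kappa> 0)" for i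
  have pk: "prob_space (\<kappa>' i)" "f \<in> borel_measurable (\<kappa>' i)" "y \<in> space (\<kappa>' i) \<Longrightarrow> \<bar>f y\<bar> \<le> C" for i y
    using assms by (auto simp: \<kappa>'_def split: if_splits)
  have eqk: "i < N \<Longrightarrow> \<kappa> i = \<kappa>' i" for i by (simp add: \<kappa>'_def)
  have prodk: "PiM {..<N} \<kappa> = PiM {..<N} \<kappa>'" by (rule prod_kernels_cong) (rule eqk)
  interpret product_prob_space \<kappa>' "{..<N}"
    by (intro product_prob_spaceI pk)
  define g where "g i y = f y - (\<integral>z. f z \<partial>\<kappa>' i)" for i y
  have fint: "\<bar>\<integral>z. f z \<partial>\<kappa>' i\<bar> \<le> C" for i by (rule bounded_integral[OF pk])
  have gb: "\<bar>g i y\<bar> \<le> 2 * C" if "y \<in> space (\<kappa>' i)" for i y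
    using pk(3)[OF that] fint[of i] unfolding g_def by linarith
  have gm [measurable]: "g i \<in> borel_measurable (\<kappa>' i)" for i
    using pk(2)[of i] unfolding g_def by measurable
  have fi: "integrable (\<kappa>' i) f" for i
    by (rule bounded_integrable[where C=C]) (use pk in auto)
  have gi: "integrable (\<kappa>' i) (g i)" for i
    by (rule bounded_integrable[where C="2 * C"]) (use pk gb in auto)
  have g2i: "integrable (\<kappa>' i) (\<lambda>y. g i y * g i y)" for i
  proof (rule bounded_integrable[where C="(2 * C)\<^sup>2"])
    show "norm (g i y * g i y) \<le> (2 * C)\<^sup>2" if "y \<in> space (\<kappa>' i)" for y
      using square_le_of_abs_le[OF gb[OF that]] by (simp add: power2_eq_square)
  qed (use pk in auto)
  have g0: "(\<integral>y. g i y \<partial>\<kappa>' i) = 0" for i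
    using fi[of i] by (simp add: g_def prob_space.prob_space[OF pk(1)])
  \<comment> \<open>Writes g_i g_j as a product over all N coordinates with factor 1 away from i and
    j, so that diagonal and off-diagonal terms come from the same product formula.\<close>
  let ?q = "\<lambda>i j k y. (if k = i then g i y else 1) * (if k = j then g j y else 1)"
  have q: "integrable (\<kappa>' k) (?q i j k)" for i j k
    using gi[of k] g2i[of k] finite_measure.integrable_const[OF prob_space.finite_measure[OF pk(1)], of k "1::real"]
    by (cases "k = i"; cases "k = j") auto
  have pq: "g i (y i) * g j (y j) = (\<Prod>k<N. ?q i j k (y k))" if "i < N" "j < N" for i j y
    using that by (simp add: prod.distrib cong: if_cong)
  have I: "integrable (PiM {..<N} \<kappa>') (\<lambda>y. g i (y i) * g j (y j))" if "i < N" "j < N" for i j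
    unfolding pq[OF that] by (rule product_integrable_prod) (use q in auto)
  have V: "(\<integral>y. g i (y i) * g j (y j) \<partial>PiM {..<N} \<kappa>') = (if i = j then \<integral>y. (g i y)\<^sup>2 \<partial>\<kappa>' i else 0)"
    if "i < N" "j < N" for i j
  proof -
    have "(\<integral>y. g i (y i) * g j (y j) \<partial>PiM {..<N} \<kappa>') = (\<Prod>k<N. \<integral>y. ?q i j k y \<partial>\<kappa>' k)"
      unfolding pq[OF that] by (rule product_integral_prod) (use q in auto)
    also have "\<dots> = (if i = j then \<integral>y. (g i y)\<^sup>2 \<partial>\<kappa>' i else 0)"
    proof (cases "i = j")
      case True
      have "(\<Prod>k<N. \<integral>y. ?q i j k y \<partial>\<kappa>' k) = (\<Prod>k<N. if k = i then \<integral>y. (g i y)\<^sup>2 \<partial>\<kappa>' i else 1)"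
        by (intro prod.cong) (auto simp: True power2_eq_square prob_space.prob_space[OF pk(1)])
      then show ?thesis using that True by simp
    next
      case False
      then have "(\<integral>y. ?q i j i y \<partial>\<kappa>' i) = 0" by (simp add: g0)
      then have "(\<Prod>k<N. \<integral>y. ?q i j k y \<partial>\<kappa>' k) = 0"
        using that by (intro prod_zero bexI[of _ i]) simp_all
      then show ?thesis using False by simp
    qed
    finally show ?thesis .
  qed
  have "(\<integral>y. (\<Sum>i<N. f (y i) - (\<integral>z. f z \<partial>\<kappa> i))\<^sup>2 \<partial>PiM {..<N} \<kappa>) = (\<integral>y. (\<Sum>i<N. \<Sum>j<N. g i (y i) * g j (y j)) \<partial>PiM {..<N} \<kappa>')"
    unfolding prodk by (simp add: g_def eqk power2_eq_square sum_product cong: sum.cong_simp)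
  also have "\<dots> = (\<Sum>i<N. \<Sum>j<N. if i = j then \<integral>y. (g i y)\<^sup>2 \<partial>\<kappa>' i else 0)"
  proof (subst Bochner_Integration.integral_sum)
    show "integrable (PiM {..<N} \<kappa>') (\<lambda>y. \<Sum>j<N. g i (y i) * g j (y j))" if "i \<in> {..<N}" for i
      by (rule Bochner_Integration.integrable_sum) (use I that in auto)
    show "(\<Sum>i<N. \<integral>y. (\<Sum>j<N. g i (y i) * g j (y j)) \<partial>PiM {..<N} \<kappa>')
      = (\<Sum>i<N. \<Sum>j<N. if i = j then \<integral>y. (g i y)\<^sup>2 \<partial>\<kappa>' i else 0)"
    proof (rule sum.cong[OF refl])
      fix i assume i: "i \<in> {..<N}"
      have "(\<integral>y. (\<Sum>j<N. g i (y i) * g j (y j)) \<partial>PiM {..<N} \<kappa>') = (\<Sum>j<N. \<integral>y. g i (y i) * g j (y j) \<partial>PiM {..<N} \<kappa>')"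
        by (rule Bochner_Integration.integral_sum) (use I i in auto)
      then show "(\<integral>y. (\<Sum>j<N. g i (y i) * g j (y j)) \<partial>PiM {..<N} \<kappa>')
        = (\<Sum>j<N. if i = j then \<integral>y. (g i y)\<^sup>2 \<partial>\<kappa>' i else 0)"
        using V i by simp
    qed
  qed
  also have "\<dots> = (\<Sum>i<N. \<integral>y. (g i y)\<^sup>2 \<partial>\<kappa>' i)" by simp
  also have "\<dots> \<le> (\<Sum>i<N. \<integral>y. (f y)\<^sup>2 \<partial>\<kappa> i)"
  proof (rule sum_mono)
    fix i assume "i \<in> {..<N}"
    then show "(\<integral>y. (g i y)\<^sup>2 \<partial>\<kappa>' i) \<le> (\<integral>y. (f y)\<^sup>2 \<partial>\<kappa> i)"
      using var_of_eq[OF pk(1)[of i] pk(2)[of i] pk(3)] by (simp add: eqk var_of_def g_def)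
  qed
  finally show ?thesis .
qed

section \<open>Kernels of a dominated Feynman-Kac model\<close>

lemma scale_measure_density: "scale_measure r M = density M (\<lambda>_. r)"
  by (rule measure_eqI) (auto simp: emeasure_density nn_integral_cmult_indicator)

lemma integral_scale_measure:
  fixes f :: "'a \<Rightarrow> real"
  assumes "0 \<le> c" "f \<in> borel_measurable M"
  shows "(\<integral>x. f x \<partial>scale_measure (ennreal c) M) = c * (\<integral>x. f x \<partial>M)"
  unfolding scale_measure_density using assms by (subst integral_real_density) auto

lemma integral_pos:
  fixes f :: "'a \<Rightarrow> real"
  assumes "prob_space M" "integrable M f" "\<And>x. x \<in> space M \<Longrightarrow> 0 < f x"
  shows "0 < (\<integral>x. f x \<partial>M)"
proof -
  interpret prob_space M by fact
  show ?thesis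
    using integral_less_AE_space[of "\<lambda>_. 0" f] assms(2) emeasure_space_1 AE_I2[of M "\<lambda>b. 0 < f b"] assms(3) by simp
qed

text \<open>Membership in \<open>bmf\<close> with the bound made explicit: the later estimates must
  be uniform in N, so every operation has to track its constant.\<close>

definition bounded_on :: "'a measure \<Rightarrow> real \<Rightarrow> ('a \<Rightarrow> real) \<Rightarrow> bool" where
  "bounded_on S C f \<longleftrightarrow> f \<in> borel_measurable S \<and> (\<forall>x\<in>space S. \<bar>f x\<bar> \<le> C)"

lemma bounded_onD: "bounded_on S C f \<Longrightarrow> f \<in> borel_measurable S"
  "bounded_on S C f \<Longrightarrow> x \<in> space S \<Longrightarrow> \<bar>f x\<bar> \<le> C"
  by (auto simp: bounded_on_def)

lemma bounded_onI: "f \<in> borel_measurable S \<Longrightarrow> (\<And>x. x \<in> space S \<Longrightarrow> \<bar>f x\<bar> \<le> C) \<Longrightarrow> bounded_on S C f"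
  by (auto simp: bounded_on_def)

lemma in_bmf: "f \<in> bmf S \<longleftrightarrow> (\<exists>C. bounded_on S C f)"
  by (auto simp: bmf_def bounded_on_def bounded_iff)

lemma bounded_on_compose:
  "bounded_on S C f \<Longrightarrow> h \<in> T \<rightarrow>\<^sub>M S \<Longrightarrow> bounded_on T C (\<lambda>x. f (h x))"
  by (auto simp: bounded_on_def dest: measurable_space)

lemma bounded_on_mult:
  assumes "bounded_on S C f" "bounded_on S D g"
  shows "bounded_on S (C * D) (\<lambda>x. f x * g x)"
  using assms by (auto simp: bounded_on_def abs_mult intro!: mult_mono' borel_measurable_times)

lemma bounded_on_diff:
  assumes "bounded_on S C f" "bounded_on S D g"
  shows "bounded_on S (C + D) (\<lambda>x. f x - g x)"
  using assms by (auto simp: bounded_on_def intro!: borel_measurable_diff abs_triangle_ineq4[THEN order_trans] add_mono)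

lemma bounded_on_cmult: "bounded_on S C f \<Longrightarrow> bounded_on S (\<bar>c\<bar> * C) (\<lambda>x. c * f x)"
  by (auto simp: bounded_on_def abs_mult intro!: mult_left_mono)

lemma bounded_on_const: "bounded_on S \<bar>c\<bar> (\<lambda>_. c)"
  by (auto simp: bounded_on_def)

lemma bounded_on_power2: "bounded_on S C f \<Longrightarrow> bounded_on S (C\<^sup>2) (\<lambda>x. (f x)\<^sup>2)"
  by (auto simp: bounded_on_def intro: square_le_of_abs_le)

lemma in_space_prob_algebraD:
  assumes "\<mu> \<in> space (prob_algebra S)"
  shows "prob_space \<mu>" "sets \<mu> = sets S" "space \<mu> = space S"
  using assms sets_eq_imp_space_eq[of \<mu> S] by (auto simp: space_prob_algebra)

lemma prob_algebra_kernelD: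
  assumes "k \<in> A \<rightarrow>\<^sub>M prob_algebra S" "a \<in> space A"
  shows "k a \<in> space (prob_algebra S)" "prob_space (k a)" "sets (k a) = sets S" "space (k a) = space S"
  using measurable_space[OF assms] in_space_prob_algebraD[of "k a" S] by auto

lemma bounded_on_measure:
  assumes "\<mu> \<in> space (prob_algebra S)" "bounded_on S C f"
  shows "f \<in> borel_measurable \<mu>" "integrable \<mu> f" "\<bar>\<integral>x. f x \<partial>\<mu>\<bar> \<le> C"
proof -
  note [simp] = in_space_prob_algebraD[OF assms(1)]
  show 1: "f \<in> borel_measurable \<mu>"
    using bounded_onD[OF assms(2)] by (simp cong: measurable_cong_sets)
  show "integrable \<mu> f" by (rule bounded_integrable[OF _ 1, of C]) (use bounded_onD[OF assms(2)] in auto)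
  show "\<bar>\<integral>x. f x \<partial>\<mu>\<bar> \<le> C" by (rule bounded_integral[OF _ 1]) (use bounded_onD[OF assms(2)] in auto)
qed

lemma bounded_on_kernel_integral:
  assumes "k \<in> A \<rightarrow>\<^sub>M prob_algebra S" "bounded_on (A \<Otimes>\<^sub>M S) C f"
  shows "bounded_on A C (\<lambda>a. \<integral>y. f (a, y) \<partial>k a)"
proof (rule bounded_onI)
  show "(\<lambda>a. \<integral>y. f (a, y) \<partial>k a) \<in> borel_measurable A"
    by (rule integral_measurable_kernel[OF bounded_onD(1)[OF assms(2)] measurable_prob_algebraD[OF assms(1)]])
  fix a assume a: "a \<in> space A"
  have "bounded_on S C (\<lambda>y. f (a, y))"
    by (rule bounded_on_compose[OF assms(2)]) (use a in simp)
  then show "\<bar>\<integral>y. f (a, y) \<partial>k a\<bar> \<le> C"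
    using bounded_on_measure(3) prob_algebra_kernelD(1)[OF assms(1) a] by blast
qed

lemma integral_bind_bounded:
  fixes f :: "'b \<Rightarrow> real"
  assumes "\<mu> \<in> space (prob_algebra S)" "N \<in> S \<rightarrow>\<^sub>M prob_algebra T" "bounded_on T C f"
  shows "(\<integral>y. f y \<partial>(\<mu> \<bind> N)) = (\<integral>x. (\<integral>y. f y \<partial>N x) \<partial>\<mu>)"
proof (rule integral_bind[where B=C and B'=1])
  note [simp] = in_space_prob_algebraD[OF assms(1)]
  show "f \<in> borel_measurable T" "\<And>x. x \<in> space T \<Longrightarrow> \<bar>f x\<bar> \<le> C"
    using bounded_onD[OF assms(3)] by auto
  show "N \<in> \<mu> \<rightarrow>\<^sub>M subprob_algebra T"
    using measurable_prob_algebraD[OF assms(2)] by (simp cong: measurable_cong_sets)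
  show "AE x in \<mu>. emeasure (N x) (space (N x)) \<le> ennreal 1"
    using prob_algebra_kernelD(2)[OF assms(2)] by (intro AE_I2) (simp add: prob_space.emeasure_space_1)
  show "finite_measure \<mu>" by (simp add: prob_space.finite_measure)
qed

lemma integral_distr_bounded:
  fixes f :: "'b \<Rightarrow> real"
  assumes "\<mu> \<in> space (prob_algebra S)" "h \<in> S \<rightarrow>\<^sub>M T" "bounded_on T C f"
  shows "(\<integral>y. f y \<partial>distr \<mu> T h) = (\<integral>x. f (h x) \<partial>\<mu>)"
  using assms in_space_prob_algebraD(2)[OF assms(1)] bounded_onD(1)[OF assms(3)]
  by (intro integral_distr) (simp_all cong: measurable_cong_sets)

text \<open>A fixed law is treated as a kernel from a one-point space, so that statements about kernels
  specialise to laws.\<close>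

lemma const_kernel: "\<mu> \<in> space (prob_algebra S) \<Longrightarrow> (\<lambda>_. \<mu>) \<in> A \<rightarrow>\<^sub>M prob_algebra S"
  by simp

text \<open>\<open>hp\<close> is the envelope h^+. Pointwise it bounds G H(., x), which makes the
  backward kernels well defined; its integrability under \<open>lam\<close> supports Fubini in the
  duality and dominated convergence in the remainder.\<close>

locale dominated_feynman_kac = feynman_kac P E eta0 M G lam H X eps
  for P :: "'w measure"
    and E :: "nat \<Rightarrow> 'a measure"
    and eta0 M G lam H X eps +
  fixes hp :: "nat \<Rightarrow> 'a \<Rightarrow> real"
  assumes hp_measurable [measurable]: "\<And>n. hp (Suc n) \<in> borel_measurable (E (Suc n))"
    and H_le_hp: "\<And>n x y. x \<in> space (E n) \<Longrightarrow> y \<in> space (E (Suc n)) \<Longrightarrow> H (Suc n) x y \<le> hp (Suc n) y"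
    and hp_integrable: "\<And>n. integrable (lam (Suc n)) (hp (Suc n))"
begin

declare G_measurable [measurable] M_kernel [measurable] H_measurable [measurable]

lemma space_lam: "space (lam (Suc n)) = space (E (Suc n))"
  by (rule sets_eq_imp_space_eq[OF sets_lam])

lemma G_bounded: "bounded_on (E n) 1 (G n)"
proof (rule bounded_onI)
  show "\<bar>G n x\<bar> \<le> 1" if "x \<in> space (E n)" for x using G_range[OF that] by simp
qed simp

lemma M_integral_bounded:
  "bounded_on (E (Suc n)) C f \<Longrightarrow> bounded_on (E n) C (\<lambda>x. \<integral>y. f y \<partial>M (Suc n) x)"
  using bounded_on_kernel_integral[OF M_kernel[of n], of C "\<lambda>(x, y). f y"]
  by (auto intro: bounded_on_compose[of "E (Suc n)" C f snd "E n \<Otimes>\<^sub>M E (Suc n)"] simp: case_prod_unfold)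

lemma G_pos: "x \<in> space (E n) \<Longrightarrow> 0 < G n x" and G_le_1: "x \<in> space (E n) \<Longrightarrow> G n x \<le> 1"
  using G_range[of x n] by auto

lemma G_integral_pos:
  assumes "\<mu> \<in> space (prob_algebra (E n))"
  shows "0 < (\<integral>x. G n x \<partial>\<mu>)" "(\<integral>x. G n x \<partial>\<mu>) \<le> 1"
proof -
  note [simp] = in_space_prob_algebraD[OF assms]
  note i = bounded_on_measure[OF assms G_bounded]
  show "0 < (\<integral>x. G n x \<partial>\<mu>)"
    by (rule integral_pos) (use i G_pos in auto)
  show "(\<integral>x. G n x \<partial>\<mu>) \<le> 1" using i(3) by simp
qed

lemma Phi_kernel [measurable]:
  assumes k: "k \<in> A \<rightarrow>\<^sub>M prob_algebra (E n)"
  shows "(\<lambda>a. Phi (Suc n) (k a)) \<in> A \<rightarrow>\<^sub>M prob_algebra (E (Suc n))"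
proof -
  have [measurable]: "(\<lambda>a. Psi (G n) (k a)) \<in> A \<rightarrow>\<^sub>M prob_algebra (E n)"
    using Psi_kernel[OF k, of "\<lambda>(a, b). G n b" "\<lambda>_. 1"] by (auto simp: G_pos G_le_1)
  show ?thesis unfolding Phi_def by simp
qed

lemma Phi_in_prob_algebra:
  "\<mu> \<in> space (prob_algebra (E n)) \<Longrightarrow> Phi (Suc n) \<mu> \<in> space (prob_algebra (E (Suc n)))"
  using prob_algebra_kernelD(1)[OF Phi_kernel[OF const_kernel, of \<mu> n "count_space {()}"]] by simp

lemma integral_Phi:
  assumes \<mu>: "\<mu> \<in> space (prob_algebra (E n))" and f: "bounded_on (E (Suc n)) C f"
  shows "(\<integral>y. f y \<partial>Phi (Suc n) \<mu>) = (\<integral>x. G n x * (\<integral>y. f y \<partial>M (Suc n) x) \<partial>\<mu>) / (\<integral>x. G n x \<partial>\<mu>)"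
proof -
  have P: "Psi (G n) \<mu> \<in> space (prob_algebra (E n))"
    using prob_algebra_kernelD(1)[OF Psi_kernel[OF const_kernel[OF \<mu>], of "\<lambda>(a, b). G n b" "count_space {()}" "\<lambda>_. 1"]]
    by (simp add: G_pos G_le_1 case_prod_unfold)
  have "(\<integral>y. f y \<partial>Phi (Suc n) \<mu>) = (\<integral>x. (\<integral>y. f y \<partial>M (Suc n) x) \<partial>Psi (G n) \<mu>)"
    unfolding Phi_def using integral_bind_bounded[OF P M_kernel f] by simp
  also have "\<dots> = (\<integral>x. G n x * (\<integral>y. f y \<partial>M (Suc n) x) \<partial>\<mu>) / (\<integral>x. G n x \<partial>\<mu>)"
    using bounded_on_measure(1)[OF \<mu>] G_bounded M_integral_bounded[OF f] G_pos in_space_prob_algebraD(3)[OF \<mu>]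
    by (intro integral_Psi) (auto simp: less_imp_le)
  finally show ?thesis .
qed

lemma eps_G: "x \<in> space (E n) \<Longrightarrow> 0 \<le> eps n * G n x" "x \<in> space (E n) \<Longrightarrow> eps n * G n x \<le> 1"
  using eps_nonneg[of n] eps_G_le_1[of x n] G_pos[of x n] by auto

lemma K_mixture_kernel:
  assumes "\<mu> \<in> space (prob_algebra (E n))" "x \<in> space (E n)"
  shows "(\<lambda>b. if b then M (Suc n) x else Phi (Suc n) \<mu>) \<in> measure_pmf (bernoulli_pmf p) \<rightarrow>\<^sub>M prob_algebra (E (Suc n))"
  using Phi_in_prob_algebra[OF assms(1)] prob_algebra_kernelD(1)[OF M_kernel assms(2)] by simp

lemma K_in_prob_algebra:
  assumes "\<mu> \<in> space (prob_algebra (E n))" "x \<in> space (E n)"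
  shows "K (Suc n) \<mu> x \<in> space (prob_algebra (E (Suc n)))"
  unfolding K_def using prob_space_bind'[OF _ K_mixture_kernel[OF assms]] sets_bind'[OF _ K_mixture_kernel[OF assms]]
  by (simp add: space_prob_algebra measure_pmf.prob_space_axioms)

lemma integral_K:
  assumes "\<mu> \<in> space (prob_algebra (E n))" "x \<in> space (E n)" "bounded_on (E (Suc n)) C f"
  shows "(\<integral>y. f y \<partial>K (Suc n) \<mu> x) = eps n * G n x * (\<integral>y. f y \<partial>M (Suc n) x) + (1 - eps n * G n x) * (\<integral>y. f y \<partial>Phi (Suc n) \<mu>)"
proof -
  have "(\<integral>y. f y \<partial>K (Suc n) \<mu> x) = (\<integral>b. (\<integral>y. f y \<partial>(if b then M (Suc n) x else Phi (Suc n) \<mu>)) \<partial>measure_pmf (bernoulli_pmf (eps n * G n x)))"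
    unfolding K_def diff_Suc_1
    by (rule integral_bind_bounded[OF _ K_mixture_kernel[OF assms(1,2)] assms(3)])
      (simp add: space_prob_algebra measure_pmf.prob_space_axioms)
  then show ?thesis using eps_G[OF assms(2)] by simp
qed

text \<open>Measures of sets are explicit mixtures with weights eps G and 1 - eps G, which reduces
  joint measurability to that of \<open>M\<close> and \<open>Phi\<close>.\<close>

lemma K_kernel [measurable]:
  assumes k: "k \<in> A \<rightarrow>\<^sub>M prob_algebra (E n)"
  shows "(\<lambda>(a, x). K (Suc n) (k a) x) \<in> A \<Otimes>\<^sub>M E n \<rightarrow>\<^sub>M prob_algebra (E (Suc n))"
proof (rule measurable_prob_algebraI)
  have Kp: "K (Suc n) (k a) x \<in> space (prob_algebra (E (Suc n)))" if "a \<in> space A" "x \<in> space (E n)" for a x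
    using K_in_prob_algebra prob_algebra_kernelD(1)[OF k that(1)] that(2) by blast
  then show "prob_space (case z of (a, x) \<Rightarrow> K (Suc n) (k a) x)" if "z \<in> space (A \<Otimes>\<^sub>M E n)" for z
    using that by (auto simp: space_pair_measure space_prob_algebra)
  show "(\<lambda>(a, x). K (Suc n) (k a) x) \<in> A \<Otimes>\<^sub>M E n \<rightarrow>\<^sub>M subprob_algebra (E (Suc n))"
  proof (rule measurable_subprob_algebra)
    show "subprob_space (case z of (a, x) \<Rightarrow> K (Suc n) (k a) x)" "sets (case z of (a, x) \<Rightarrow> K (Suc n) (k a) x) = sets (E (Suc n))"
      if "z \<in> space (A \<Otimes>\<^sub>M E n)" for z
      using that Kp by (auto simp: space_pair_measure space_prob_algebra prob_space_imp_subprob_space)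
    fix S assume S: "S \<in> sets (E (Suc n))"
    have [measurable]: "(\<lambda>z. emeasure (M (Suc n) (snd z)) S) \<in> borel_measurable (A \<Otimes>\<^sub>M E n)"
      using measurable_compose[OF measurable_prob_algebraD[OF M_kernel] measurable_emeasure_subprob_algebra[OF S]] by measurable
    have [measurable]: "(\<lambda>z. emeasure (Phi (Suc n) (k (fst z))) S) \<in> borel_measurable (A \<Otimes>\<^sub>M E n)"
      using measurable_compose[OF measurable_prob_algebraD[OF Phi_kernel[OF k]] measurable_emeasure_subprob_algebra[OF S]] by measurable
    have "(\<lambda>z. emeasure (M (Suc n) (snd z)) S * ennreal (eps n * G n (snd z)) + emeasure (Phi (Suc n) (k (fst z))) S * ennreal (1 - eps n * G n (snd z)))
      \<in> borel_measurable (A \<Otimes>\<^sub>M E n)" by measurable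
    then show "(\<lambda>z. emeasure (case z of (a, x) \<Rightarrow> K (Suc n) (k a) x) S) \<in> borel_measurable (A \<Otimes>\<^sub>M E n)"
    proof (rule measurable_cong[THEN iffD1, rotated])
      fix z assume z: "z \<in> space (A \<Otimes>\<^sub>M E n)"
      then have ax: "k (fst z) \<in> space (prob_algebra (E n))" "snd z \<in> space (E n)"
        using prob_algebra_kernelD(1)[OF k] by (auto simp: space_pair_measure)
      have "emeasure (K (Suc n) (k (fst z)) (snd z)) S = (\<integral>\<^sup>+b. emeasure (if b then M (Suc n) (snd z) else Phi (Suc n) (k (fst z))) S \<partial>bernoulli_pmf (eps n * G n (snd z)))"
        unfolding K_def diff_Suc_1
        by (rule emeasure_bind[OF _ measurable_prob_algebraD[OF K_mixture_kernel[OF ax]] S]) simp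
      then show "emeasure (M (Suc n) (snd z)) S * ennreal (eps n * G n (snd z)) + emeasure (Phi (Suc n) (k (fst z))) S * ennreal (1 - eps n * G n (snd z))
        = emeasure (case z of (a, x) \<Rightarrow> K (Suc n) (k a) x) S"
        using eps_G[OF ax(2)] by (simp add: case_prod_unfold)
    qed
  qed
qed

lemma GH_pos: "y \<in> space (E n) \<Longrightarrow> x \<in> space (E (Suc n)) \<Longrightarrow> 0 < G n y * H (Suc n) y x"
  using G_pos H_pos by simp

lemma GH_le_hp: "y \<in> space (E n) \<Longrightarrow> x \<in> space (E (Suc n)) \<Longrightarrow> G n y * H (Suc n) y x \<le> hp (Suc n) x"
  using mult_mono[OF G_le_1[of y n] H_le_hp[of y n x]] H_pos[of y n x] by (simp add: less_imp_le)

lemma GH_bounded: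
  assumes "x \<in> space (E (Suc n))"
  shows "bounded_on (E n) (hp (Suc n) x) (\<lambda>y. G n y * H (Suc n) y x)"
proof (rule bounded_onI)
  have "(\<lambda>y. H (Suc n) y x) \<in> borel_measurable (E n)"
    using measurable_compose[OF measurable_Pair2'[OF assms] H_measurable[of n]] by simp
  then show "(\<lambda>y. G n y * H (Suc n) y x) \<in> borel_measurable (E n)" by measurable
qed (use GH_pos[OF _ assms] GH_le_hp[OF _ assms] in \<open>auto simp: abs_le_iff less_imp_le intro: order_trans[of _ 0]\<close>)

lemma GH_integral_pos:
  assumes "\<mu> \<in> space (prob_algebra (E n))" "x \<in> space (E (Suc n))"
  shows "0 < (\<integral>y. G n y * H (Suc n) y x \<partial>\<mu>)"
proof -
  note [simp] = in_space_prob_algebraD[OF assms(1)]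
  note i = bounded_on_measure[OF assms(1) GH_bounded[OF assms(2)]]
  show ?thesis
    by (rule integral_pos) (use i GH_pos assms in auto)
qed

text \<open>An instance of \<open>Psi_kernel\<close> whose parameter is the pair (a, x) and whose
  pointwise bound is \<open>hp (Suc n) x\<close>, by G <= 1.\<close>

lemma Mback_kernel [measurable]:
  assumes k: "k \<in> A \<rightarrow>\<^sub>M prob_algebra (E n)"
  shows "(\<lambda>(a, x). Mback (Suc n) (k a) x) \<in> A \<Otimes>\<^sub>M E (Suc n) \<rightarrow>\<^sub>M prob_algebra (E n)"
proof -
  have k': "(\<lambda>z. k (fst z)) \<in> A \<Otimes>\<^sub>M E (Suc n) \<rightarrow>\<^sub>M prob_algebra (E n)"
    using measurable_compose[OF measurable_fst k] .
  have H': "(\<lambda>z. H (Suc n) (snd z) (snd (fst z))) \<in> borel_measurable ((A \<Otimes>\<^sub>M E (Suc n)) \<Otimes>\<^sub>M E n)"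
    using measurable_compose[of "\<lambda>z. (snd z, snd (fst z))" "(A \<Otimes>\<^sub>M E (Suc n)) \<Otimes>\<^sub>M E n", OF _ H_measurable[of n]] by simp
  have "(\<lambda>z. G n (snd z) * H (Suc n) (snd z) (snd (fst z))) \<in> borel_measurable ((A \<Otimes>\<^sub>M E (Suc n)) \<Otimes>\<^sub>M E n)"
    using H' by measurable
  from Psi_kernel[OF k' this, of "\<lambda>z. hp (Suc n) (snd z)"]
  have "(\<lambda>z. Psi (\<lambda>y. G n y * H (Suc n) y (snd z)) (k (fst z))) \<in> A \<Otimes>\<^sub>M E (Suc n) \<rightarrow>\<^sub>M prob_algebra (E n)"
    by (auto simp: space_pair_measure GH_pos GH_le_hp)
  then show ?thesis by (simp add: Mback_def case_prod_unfold)
qed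

lemma Mback_in_prob_algebra:
  assumes "\<mu> \<in> space (prob_algebra (E n))" "x \<in> space (E (Suc n))"
  shows "Mback (Suc n) \<mu> x \<in> space (prob_algebra (E n))"
  using prob_algebra_kernelD(1)[OF Mback_kernel[OF const_kernel[OF assms(1), of "count_space {()}"]], of "((), x)"] assms(2)
  by (simp add: space_pair_measure)

lemma integral_Mback:
  assumes "\<mu> \<in> space (prob_algebra (E n))" "x \<in> space (E (Suc n))" "bounded_on (E n) C f"
  shows "(\<integral>y. f y \<partial>Mback (Suc n) \<mu> x) = (\<integral>y. G n y * H (Suc n) y x * f y \<partial>\<mu>) / (\<integral>y. G n y * H (Suc n) y x \<partial>\<mu>)"
  unfolding Mback_def diff_Suc_1
  using bounded_on_measure(1)[OF assms(1)] GH_bounded[OF assms(2)] assms(3) GH_pos in_space_prob_algebraD(3)[OF assms(1)] assms(2)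
  by (intro integral_Psi) (auto simp: less_imp_le)

lemma fun_upd_last_measurable [measurable]:
  "(\<lambda>(w, y). w(n := y)) \<in> PiM {..<n} E \<Otimes>\<^sub>M E n \<rightarrow>\<^sub>M PiM {..n} E"
  by (simp add: case_prod_unfold, rule measurable_fun_upd[where J="{..<n}"]) auto

lemma fun_upd_Suc_measurable [measurable]:
  "(\<lambda>(w, y). w(Suc p := y)) \<in> PiM {..p} E \<Otimes>\<^sub>M E (Suc p) \<rightarrow>\<^sub>M PiM {..Suc p} E"
  by (simp add: case_prod_unfold, rule measurable_fun_upd[where J="{..p}"]) auto

text \<open>The flow carries a parameter because it will be the random flow of empirical measures;
  integrals over the particle space need measurability jointly in that parameter and in x.\<close>

lemma backward_kernel:
  "(\<And>q. q < n \<Longrightarrow> (\<lambda>a. \<mu> a q) \<in> A \<rightarrow>\<^sub>M prob_algebra (E q)) \<Longrightarrow>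
   (\<lambda>(a, x). backward (\<mu> a) n x) \<in> A \<Otimes>\<^sub>M E n \<rightarrow>\<^sub>M prob_algebra (PiM {..<n} E)"
proof (induction n)
  case 0
  have "return (PiM {} E) (\<lambda>_. undefined) \<in> space (prob_algebra (PiM {} E))"
    by (simp add: space_prob_algebra prob_space_return space_PiM)
  then show ?case by (simp add: case_prod_unfold)
next
  case (Suc n)
  have 1: "(\<lambda>(a, x). Mback (Suc n) (\<mu> a n) x) \<in> A \<Otimes>\<^sub>M E (Suc n) \<rightarrow>\<^sub>M prob_algebra (E n)"
    by (rule Mback_kernel) (rule Suc.prems, simp)
  have IH: "(\<lambda>(a, x). backward (\<mu> a) n x) \<in> A \<Otimes>\<^sub>M E n \<rightarrow>\<^sub>M prob_algebra (PiM {..<n} E)"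
    by (rule Suc.IH, rule Suc.prems) simp
  have IH': "(\<lambda>z. backward (\<mu> (fst (fst z))) n (snd z)) \<in> (A \<Otimes>\<^sub>M E (Suc n)) \<Otimes>\<^sub>M E n \<rightarrow>\<^sub>M prob_algebra (PiM {..<n} E)"
    using measurable_compose[of "\<lambda>z. (fst (fst z), snd z)" "(A \<Otimes>\<^sub>M E (Suc n)) \<Otimes>\<^sub>M E n", OF _ IH] by simp
  have up: "(\<lambda>(z, w). w(n := snd z)) \<in> ((A \<Otimes>\<^sub>M E (Suc n)) \<Otimes>\<^sub>M E n) \<Otimes>\<^sub>M PiM {..<n} E \<rightarrow>\<^sub>M PiM {..<Suc n} E"
    unfolding case_prod_unfold by (rule measurable_fun_upd[where J="{..<n}"]) auto
  have "(\<lambda>z. distr (backward (\<mu> (fst (fst z))) n (snd z)) (PiM {..<Suc n} E) (\<lambda>w. w(n := snd z)))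
    \<in> (A \<Otimes>\<^sub>M E (Suc n)) \<Otimes>\<^sub>M E n \<rightarrow>\<^sub>M prob_algebra (PiM {..<Suc n} E)"
    by (rule measurable_distr_prob_space2[OF IH' up])
  then have "(\<lambda>z. (case z of (a, x) \<Rightarrow> Mback (Suc n) (\<mu> a n) x) \<bind>
       (\<lambda>y. distr (backward (\<mu> (fst z)) n y) (PiM {..<Suc n} E) (\<lambda>w. w(n := y))))
    \<in> A \<Otimes>\<^sub>M E (Suc n) \<rightarrow>\<^sub>M prob_algebra (PiM {..<Suc n} E)"
    by (intro measurable_bind_prob_space2[OF 1]) (simp add: case_prod_unfold)
  then show ?case by (simp add: case_prod_unfold)
qed

end

lemma bounded_on_cong: "(\<And>x. x \<in> space S \<Longrightarrow> f x = g x) \<Longrightarrow> bounded_on S C f \<longleftrightarrow> bounded_on S C g"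
  by (auto simp: bounded_on_def cong: measurable_cong)

lemma integral_bind_bounded_subprob:
  fixes f :: "'b \<Rightarrow> real"
  assumes "\<mu> \<in> space (subprob_algebra S)" "N \<in> S \<rightarrow>\<^sub>M subprob_algebra T" "bounded_on T C f"
  shows "(\<integral>y. f y \<partial>(\<mu> \<bind> N)) = (\<integral>x. (\<integral>y. f y \<partial>N x) \<partial>\<mu>)"
proof (rule integral_bind[where B=C and B'=1])
  have \<mu> [simp]: "sets \<mu> = sets S" "subprob_space \<mu>" "space \<mu> = space S"
    using assms(1) sets_eq_imp_space_eq[of \<mu> S] by (auto simp: space_subprob_algebra)
  show "f \<in> borel_measurable T" "\<And>x. x \<in> space T \<Longrightarrow> \<bar>f x\<bar> \<le> C"
    using bounded_onD[OF assms(3)] by auto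
  show "N \<in> \<mu> \<rightarrow>\<^sub>M subprob_algebra T"
    using assms(2) by (simp cong: measurable_cong_sets)
  show "AE x in \<mu>. emeasure (N x) (space (N x)) \<le> ennreal 1"
    using subprob_space_kernel[OF assms(2)] by (intro AE_I2) (simp add: subprob_space.subprob_emeasure_le_1)
  show "finite_measure \<mu>" using \<mu>(2) by (rule subprob_space.axioms)
qed

section \<open>Unnormalised forward kernels and integrals over future paths\<close>

context dominated_feynman_kac
begin

lemma Q_kernel: "Q (Suc p) \<in> E p \<rightarrow>\<^sub>M subprob_algebra (E (Suc p))"
proof (rule measurable_subprob_algebra)
  fix x assume x: "x \<in> space (E p)"
  note Mp = prob_algebra_kernelD[OF M_kernel x]
  show "sets (Q (Suc p) x) = sets (E (Suc p))" by (simp add: Q_def Mp)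
  show "subprob_space (Q (Suc p) x)"
  proof
    have "emeasure (Q (Suc p) x) (space (Q (Suc p) x)) = ennreal (G p x)"
      using Mp(2) by (simp add: Q_def space_scale_measure prob_space.emeasure_space_1)
    then show "emeasure (Q (Suc p) x) (space (Q (Suc p) x)) \<le> 1"
      using G_le_1[OF x] by simp
    show "space (Q (Suc p) x) \<noteq> {}"
      using Mp(2) by (simp add: Q_def space_scale_measure prob_space.not_empty)
  qed
next
  fix S assume S: "S \<in> sets (E (Suc p))"
  have [measurable]: "(\<lambda>x. emeasure (M (Suc p) x) S) \<in> borel_measurable (E p)"
    using measurable_compose[OF measurable_prob_algebraD[OF M_kernel] measurable_emeasure_subprob_algebra[OF S]] by simp
  show "(\<lambda>x. emeasure (Q (Suc p) x) S) \<in> borel_measurable (E p)"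
    unfolding Q_def by simp
qed

lemma integral_Q:
  assumes "x \<in> space (E p)" "f \<in> borel_measurable (E (Suc p))"
  shows "(\<integral>y. f y \<partial>Q (Suc p) x) = G p x * (\<integral>y. f y \<partial>M (Suc p) x)"
  unfolding Q_def diff_Suc_1 using G_pos[OF assms(1)] assms(2) prob_algebra_kernelD(3)[OF M_kernel assms(1)]
  by (intro integral_scale_measure) (auto cong: measurable_cong_sets)

lemma forward_step_kernel:
  assumes "forward k (Suc p) \<in> E (Suc p) \<rightarrow>\<^sub>M subprob_algebra (PiM {Suc p<..Suc p + k} E)"
  shows "(\<lambda>y. distr (forward k (Suc p) y) (PiM {p<..p + Suc k} E) (\<lambda>w. w(Suc p := y)))
     \<in> E (Suc p) \<rightarrow>\<^sub>M subprob_algebra (PiM {p<..p + Suc k} E)"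
proof (rule measurable_distr2[OF _ assms])
  show "(\<lambda>(y, w). w(Suc p := y)) \<in> E (Suc p) \<Otimes>\<^sub>M PiM {Suc p<..Suc p + k} E \<rightarrow>\<^sub>M PiM {p<..p + Suc k} E"
    unfolding case_prod_unfold by (rule measurable_fun_upd[where J="{Suc p<..Suc (p + k)}"]) auto
qed

lemma forward_kernel: "forward k p \<in> E p \<rightarrow>\<^sub>M subprob_algebra (PiM {p<..p + k} E)"
proof (induction k arbitrary: p)
  case 0
  have "return (PiM {} E) (\<lambda>_. undefined) \<in> space (subprob_algebra (PiM {} E))"
    by (simp add: space_subprob_algebra subprob_space_return space_PiM)
  then have "(\<lambda>x. return (PiM {} E) (\<lambda>_. undefined)) \<in> E p \<rightarrow>\<^sub>M subprob_algebra (PiM {} E)"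
    by simp
  then have "(\<lambda>x. forward 0 p x) \<in> E p \<rightarrow>\<^sub>M subprob_algebra (PiM {p<..p + 0} E)" by simp
  then show ?case by simp
next
  case (Suc k)
  have "(\<lambda>x. forward (Suc k) p x) \<in> E p \<rightarrow>\<^sub>M subprob_algebra (PiM {p<..p + Suc k} E)"
    unfolding forward.simps by (rule measurable_bind2[OF Q_kernel forward_step_kernel[OF Suc.IH]])
  then show ?case by simp
qed

lemma integral_forward_Suc:
  assumes x: "x \<in> space (E p)" and f: "bounded_on (PiM {p<..p + Suc k} E) C f"
  shows "(\<integral>z. f z \<partial>forward (Suc k) p x) = G p x * (\<integral>y. (\<integral>w. f (w(Suc p := y)) \<partial>forward k (Suc p) y) \<partial>M (Suc p) x)"
proof -
  note st = forward_step_kernel[OF forward_kernel, of k p]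
  have "(\<integral>z. f z \<partial>forward (Suc k) p x)
    = (\<integral>y. (\<integral>z. f z \<partial>distr (forward k (Suc p) y) (PiM {p<..p + Suc k} E) (\<lambda>w. w(Suc p := y))) \<partial>Q (Suc p) x)"
    unfolding forward.simps
    by (rule integral_bind_bounded_subprob[OF _ st f]) (rule measurable_space[OF Q_kernel x])
  also have "\<dots> = G p x * (\<integral>y. (\<integral>z. f z \<partial>distr (forward k (Suc p) y) (PiM {p<..p + Suc k} E) (\<lambda>w. w(Suc p := y))) \<partial>M (Suc p) x)"
    by (rule integral_Q[OF x])
      (rule measurable_compose[OF st integral_measurable_subprob_algebra[OF bounded_onD(1)[OF f]]])
  also have "(\<integral>y. (\<integral>z. f z \<partial>distr (forward k (Suc p) y) (PiM {p<..p + Suc k} E) (\<lambda>w. w(Suc p := y))) \<partial>M (Suc p) x)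
    = (\<integral>y. (\<integral>w. f (w(Suc p := y)) \<partial>forward k (Suc p) y) \<partial>M (Suc p) x)"
  proof (rule Bochner_Integration.integral_cong[OF refl])
    fix y assume "y \<in> space (M (Suc p) x)"
    then have y: "y \<in> space (E (Suc p))" using prob_algebra_kernelD(4)[OF M_kernel x] by simp
    have "(\<lambda>w. w(Suc p := y)) \<in> PiM {Suc p<..Suc p + k} E \<rightarrow>\<^sub>M PiM {p<..p + Suc k} E"
      using y by (intro measurable_fun_upd[where J="{Suc p<..Suc (p + k)}"]) auto
    then have "(\<lambda>w. w(Suc p := y)) \<in> forward k (Suc p) y \<rightarrow>\<^sub>M PiM {p<..p + Suc k} E"
      using sets_kernel[OF forward_kernel y] by (simp cong: measurable_cong_sets)
    then show "(\<integral>z. f z \<partial>distr (forward k (Suc p) y) (PiM {p<..p + Suc k} E) (\<lambda>w. w(Suc p := y)))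
      = (\<integral>w. f (w(Suc p := y)) \<partial>forward k (Suc p) y)"
      using bounded_onD(1)[OF f] by (rule integral_distr)
  qed
  finally show ?thesis .
qed

text \<open>The kernel Q_{p+1} lifted to path functions: it integrates out the last coordinate and
  keeps the dependence on the whole past. Inductions over time go through this operator.\<close>

definition step_back :: "nat \<Rightarrow> ((nat \<Rightarrow> 'a) \<Rightarrow> real) \<Rightarrow> (nat \<Rightarrow> 'a) \<Rightarrow> real" where
  "step_back p F v = G p (v p) * (\<integral>y. F (v(Suc p := y)) \<partial>M (Suc p) (v p))"

text \<open>The inner integral of \<open>D\<close>, kept as a function of the whole path up to
  \<open>p\<close>, because the backward kernel still has to integrate the coordinates before
  \<open>p\<close>.\<close>

definition forward_integral :: "nat \<Rightarrow> nat \<Rightarrow> ((nat \<Rightarrow> 'a) \<Rightarrow> real) \<Rightarrow> (nat \<Rightarrow> 'a) \<Rightarrow> real" where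
  "forward_integral p n F v = (\<integral>z. F (\<lambda>i\<in>{..n}. if i \<le> p then v i else z i) \<partial>forward (n - p) p (v p))"

lemma forward_integral_refl:
  assumes "v \<in> space (PiM {..n} E)"
  shows "forward_integral n n F v = F v"
proof -
  have "restrict v {..n} = v" using assms by (simp add: space_PiM PiE_restrict)
  moreover have "(\<lambda>i\<in>{..n}. if i \<le> n then v i else z i) = restrict v {..n}" for z by (auto simp: restrict_def)
  ultimately have "forward_integral n n F v = (\<integral>z. F v \<partial>return (PiM {n<..n} E) (\<lambda>_. undefined))"
    by (simp add: forward_integral_def)
  also have "\<dots> = F v" by (rule integral_return) (auto simp: space_PiM)
  finally show ?thesis .
qed

lemma coordinate_in_space: "v \<in> space (PiM {..p} E) \<Longrightarrow> i \<le> p \<Longrightarrow> v i \<in> space (E i)"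
  by (auto simp: space_PiM)

text \<open>Peeling off the first step of \<open>forward\<close> gives a recursion in
  \<open>p\<close>; boundedness, measurability and linearity then follow by downward induction from
  \<open>n\<close>.\<close>

lemma forward_integral_Suc:
  assumes pn: "p < n" and v: "v \<in> space (PiM {..p} E)" and F: "bounded_on (PiM {..n} E) C F"
  shows "forward_integral p n F v = step_back p (forward_integral (Suc p) n F) v"
proof -
  obtain k where k: "n - p = Suc k" "n - Suc p = k" "n = p + Suc k" using pn by (metis Suc_diff_Suc le_add_diff_inverse less_imp_le)
  let ?f = "\<lambda>z. F (\<lambda>i\<in>{..n}. if i \<le> p then v i else z i)"
  have vp: "v p \<in> space (E p)" using coordinate_in_space[OF v] by simp
  have "(\<lambda>z. \<lambda>i\<in>{..n}. if i \<le> p then v i else z i) \<in> PiM {p<..p + Suc k} E \<rightarrow>\<^sub>M PiM {..n} E"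
  proof (rule measurable_restrict)
    fix i assume i: "i \<in> {..n}"
    show "(\<lambda>z. if i \<le> p then v i else z i) \<in> PiM {p<..p + Suc k} E \<rightarrow>\<^sub>M E i"
      using coordinate_in_space[OF v, of i] i k by (cases "i \<le> p") (auto intro!: measurable_component_singleton)
  qed
  then have f: "bounded_on (PiM {p<..p + Suc k} E) C ?f"
    by (rule bounded_on_compose[OF F])
  have eq: "(\<lambda>i\<in>{..n}. if i \<le> p then v i else (w(Suc p := y)) i) = (\<lambda>i\<in>{..n}. if i \<le> Suc p then (v(Suc p := y)) i else w i)" for w y
    by (auto simp: restrict_def fun_eq_iff le_Suc_eq)
  show ?thesis
    unfolding forward_integral_def step_back_def k(1,2) integral_forward_Suc[OF vp f] eq by simp
qed

lemma step_back_bounded: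
  assumes F: "bounded_on (PiM {..Suc p} E) C F"
  shows "bounded_on (PiM {..p} E) C (step_back p F)"
proof -
  have 1: "(\<lambda>v. M (Suc p) (v p)) \<in> PiM {..p} E \<rightarrow>\<^sub>M prob_algebra (E (Suc p))"
    by (rule measurable_compose[OF _ M_kernel]) simp
  have 2: "bounded_on (PiM {..p} E \<Otimes>\<^sub>M E (Suc p)) C (\<lambda>(v, y). F (v(Suc p := y)))"
    using bounded_on_compose[OF F fun_upd_Suc_measurable] by (simp add: case_prod_unfold)
  have 3: "bounded_on (PiM {..p} E) 1 (\<lambda>v. G p (v p))"
    by (rule bounded_on_compose[OF G_bounded]) simp
  show ?thesis
    using bounded_on_mult[OF 3 bounded_on_kernel_integral[OF 1 2]] by (simp add: step_back_def[abs_def])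
qed

lemma forward_integral_bounded:
  assumes "p \<le> n" and F: "bounded_on (PiM {..n} E) C F"
  shows "bounded_on (PiM {..p} E) C (forward_integral p n F)"
  using assms(1)
proof (induction rule: inc_induct)
  case base
  then show ?case using F by (subst bounded_on_cong[OF forward_integral_refl])
next
  case (step m)
  show ?case
    by (subst bounded_on_cong[OF forward_integral_Suc[OF step(2) _ F]]) (auto intro: step_back_bounded step(3))
qed

lemma X_measurable [measurable]: "X n \<in> P \<rightarrow>\<^sub>M E n"
  using X_chain by (simp add: markov_chain_def)

lemma history_measurable [measurable]: "history X n \<in> P \<rightarrow>\<^sub>M PiM {..n} E"
  unfolding history_def by measurable

lemma X_space: "\<omega> \<in> space P \<Longrightarrow> X n \<omega> \<in> space (E n)"
  using measurable_space[OF X_measurable] .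

lemma history_space: "\<omega> \<in> space P \<Longrightarrow> history X n \<omega> \<in> space (PiM {..n} E)"
  using measurable_space[OF history_measurable] .

lemma history_Suc: "history Y (Suc n) \<omega> = (history Y n \<omega>)(Suc n := Y (Suc n) \<omega>)"
  by (auto simp: history_def fun_eq_iff)

lemma history_apply: "i \<le> n \<Longrightarrow> history Y n \<omega> i = Y i \<omega>"
  by (simp add: history_def)

lemma FK_Gamma_cong: "(\<And>v. v \<in> space (PiM {..n} E) \<Longrightarrow> F v = F' v) \<Longrightarrow> FK_Gamma n F = FK_Gamma n F'"
  unfolding FK_Gamma_def by (intro Bochner_Integration.integral_cong) (auto simp: history_space)

lemma prod_G_bounded: "bounded_on (PiM {..n} E) 1 (\<lambda>v. \<Prod>p<m. G p (v p))" if "m \<le> Suc n"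
  using that
proof (induction m)
  case 0
  show ?case using bounded_on_const[of _ 1] by simp
next
  case (Suc m)
  have "bounded_on (PiM {..n} E) 1 (\<lambda>v. G m (v m))"
    using Suc.prems by (intro bounded_on_compose[OF G_bounded]) simp
  from bounded_on_mult[OF Suc.IH this] Suc.prems show ?case by simp
qed

text \<open>The Markov property at time n: the weight G_0 ... G_n is a function of the past, so
  X_{n+1} is integrated out by \<open>M\<close>, and the factor G_n is absorbed into
  \<open>step_back\<close>.\<close>

lemma FK_Gamma_Suc:
  assumes F: "bounded_on (PiM {..Suc n} E) C F"
  shows "FK_Gamma (Suc n) F = FK_Gamma n (step_back n F)"
proof -
  let ?f = "\<lambda>(v, y). F (v(Suc n := y)) * (\<Prod>p<Suc n. G p (v p))"
  have f: "bounded_on (PiM {..n} E \<Otimes>\<^sub>M E (Suc n)) (C * 1) ?f"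
    unfolding case_prod_unfold
    using bounded_on_compose[OF F fun_upd_Suc_measurable]
      bounded_on_compose[OF prod_G_bounded[OF order_refl] measurable_fst[of "PiM {..n} E" "E (Suc n)"]]
    by (intro bounded_on_mult) (simp_all add: case_prod_unfold)
  have "FK_Gamma (Suc n) F = (\<integral>\<omega>. ?f (history X n \<omega>, X (Suc n) \<omega>) \<partial>P)"
    unfolding FK_Gamma_def by (intro Bochner_Integration.integral_cong refl)
      (simp add: history_Suc history_apply)
  also have "\<dots> = (\<integral>\<omega>. (\<integral>y. ?f (history X n \<omega>, y) \<partial>M (Suc n) (X n \<omega>)) \<partial>P)"
    by (rule markov_chain_integral[OF prob_space_axioms X_chain M_kernel bounded_onD(1)[OF f]])
      (use bounded_onD(2)[OF f] in \<open>auto simp: space_pair_measure\<close>)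
  also have "\<dots> = FK_Gamma n (step_back n F)"
    unfolding FK_Gamma_def step_back_def
    by (intro Bochner_Integration.integral_cong refl) (simp add: history_apply)
  finally show ?thesis .
qed

lemma FK_Gamma_forward:
  assumes "p \<le> n" and F: "bounded_on (PiM {..n} E) C F"
  shows "FK_Gamma n F = FK_Gamma p (forward_integral p n F)"
  using assms(1)
proof (induction rule: inc_induct)
  case base
  then show ?case by (rule FK_Gamma_cong) (simp add: forward_integral_refl)
next
  case (step m)
  have "FK_Gamma n F = FK_Gamma m (step_back m (forward_integral (Suc m) n F))"
    using step FK_Gamma_Suc[OF forward_integral_bounded[OF _ F, of "Suc m"]] by simp
  then show ?case
    using FK_Gamma_cong[of m "forward_integral m n F", OF forward_integral_Suc[OF step(2) _ F]] by simp
qed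

lemma FK_Gamma_0:
  assumes F: "bounded_on (PiM {..0} E) C F"
  shows "FK_Gamma 0 F = (\<integral>x. F ((\<lambda>_. undefined)(0 := x)) \<partial>eta0)"
proof -
  have "FK_Gamma 0 F = (\<integral>\<omega>. F ((\<lambda>_. undefined)(0 := X 0 \<omega>)) \<partial>P)"
    unfolding FK_Gamma_def
    by (intro Bochner_Integration.integral_cong refl) (auto intro!: arg_cong[where f=F] simp: history_def restrict_def fun_eq_iff)
  also have "\<dots> = (\<integral>x. F ((\<lambda>_. undefined)(0 := x)) \<partial>distr P (E 0) (X 0))"
  proof (rule integral_distr[symmetric])
    have "(\<lambda>x. (\<lambda>_. undefined)(0 := x)) \<in> E 0 \<rightarrow>\<^sub>M PiM {..0} E"
      by (rule measurable_fun_upd[where J="{}"]) (auto simp: space_PiM)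
    then show "(\<lambda>x. F ((\<lambda>_. undefined)(0 := x))) \<in> borel_measurable (E 0)"
      using bounded_onD(1)[OF F] by (rule measurable_compose)
  qed simp
  also have "distr P (E 0) (X 0) = eta0" using X_chain by (simp add: markov_chain_def)
  finally show ?thesis .
qed

end

section \<open>Flows of measures, backward duality and the telescoping identity\<close>

context dominated_feynman_kac
begin

definition flow :: "nat \<Rightarrow> (nat \<Rightarrow> 'a measure) \<Rightarrow> bool" where
  "flow n \<mu> \<longleftrightarrow> (\<forall>q\<le>n. \<mu> q \<in> space (prob_algebra (E q)))"

lemma flowD: "flow n \<mu> \<Longrightarrow> q \<le> n \<Longrightarrow> \<mu> q \<in> space (prob_algebra (E q))"
  by (simp add: flow_def)

lemma flow_mono: "flow n \<mu> \<Longrightarrow> m \<le> n \<Longrightarrow> flow m \<mu>"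
  by (simp add: flow_def)

definition bwd :: "(nat \<Rightarrow> 'a measure) \<Rightarrow> nat \<Rightarrow> ((nat \<Rightarrow> 'a) \<Rightarrow> real) \<Rightarrow> 'a \<Rightarrow> real" where
  "bwd \<mu> p F x = (\<integral>w. F (w(p := x)) \<partial>backward \<mu> p x)"

text \<open>Both the flow and the test function may carry the parameter: the flow when it is random,
  the test function when a later coordinate has been frozen in it.\<close>

lemma bwd_bounded_param:
  assumes \<mu>: "\<And>q. q < p \<Longrightarrow> (\<lambda>a. \<mu> a q) \<in> A \<rightarrow>\<^sub>M prob_algebra (E q)"
    and F: "bounded_on (A \<Otimes>\<^sub>M PiM {..p} E) C F"
  shows "bounded_on (A \<Otimes>\<^sub>M E p) C (\<lambda>(a, x). bwd (\<mu> a) p (\<lambda>v. F (a, v)) x)"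
proof -
  have "(\<lambda>z. (fst (fst z), (snd z)(p := snd (fst z)))) \<in> (A \<Otimes>\<^sub>M E p) \<Otimes>\<^sub>M PiM {..<p} E \<rightarrow>\<^sub>M A \<Otimes>\<^sub>M PiM {..p} E"
    by (intro measurable_Pair measurable_fun_upd[where J="{..<p}"]) auto
  note F' = bounded_on_compose[OF F this]
  have "(\<lambda>z. backward (\<mu> (fst z)) p (snd z)) \<in> A \<Otimes>\<^sub>M E p \<rightarrow>\<^sub>M prob_algebra (PiM {..<p} E)"
    using backward_kernel[of p \<mu> A] \<mu> by (simp add: case_prod_unfold)
  from bounded_on_kernel_integral[OF this F'] show ?thesis
    by (simp only: bwd_def case_prod_unfold fst_conv snd_conv)
qed

lemma bwd_bounded:
  assumes "\<And>q. q < p \<Longrightarrow> \<mu> q \<in> space (prob_algebra (E q))" and F: "bounded_on (PiM {..p} E) C F"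
  shows "bounded_on (E p) C (bwd \<mu> p F)"
proof -
  have "bounded_on (count_space {()} \<Otimes>\<^sub>M E p) C (\<lambda>(a, x). bwd \<mu> p (\<lambda>v. F (snd (a, v))) x)"
    by (rule bwd_bounded_param[where \<mu>="\<lambda>_. \<mu>"]) (use assms(1) bounded_on_compose[OF F measurable_snd] in auto)
  from bounded_on_compose[OF this, of "\<lambda>x. ((), x)" "E p"] show ?thesis by simp
qed

lemma bwd_0:
  assumes "bounded_on (PiM {..0} E) C F" "x \<in> space (E 0)"
  shows "bwd \<mu> 0 F x = F ((\<lambda>_. undefined)(0 := x))"
proof -
  have "(\<lambda>w. w(0 := x)) \<in> PiM {..<0} E \<rightarrow>\<^sub>M PiM {..0} E"
    using assms(2) by (intro measurable_fun_upd[where J="{..<0}"]) auto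
  from measurable_compose[OF this bounded_onD(1)[OF assms(1)]]
  show ?thesis unfolding bwd_def backward.simps by (subst integral_return) (auto simp: space_PiM)
qed

lemma backward_kernel_fixed:
  assumes "\<And>q. q < n \<Longrightarrow> \<mu> q \<in> space (prob_algebra (E q))"
  shows "backward \<mu> n \<in> E n \<rightarrow>\<^sub>M prob_algebra (PiM {..<n} E)"
proof -
  have "(\<lambda>(a, x). backward \<mu> n x) \<in> count_space {()} \<Otimes>\<^sub>M E n \<rightarrow>\<^sub>M prob_algebra (PiM {..<n} E)"
    by (rule backward_kernel) (use assms in auto)
  from measurable_compose[OF _ this, of "\<lambda>x. ((), x)" "E n"] show ?thesis by simp
qed

lemma bwd_Suc:
  assumes \<mu>: "flow p \<mu>" and F: "bounded_on (PiM {..Suc p} E) C F" and x: "x \<in> space (E (Suc p))"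
  shows "bwd \<mu> (Suc p) F x = (\<integral>y. bwd \<mu> p (\<lambda>v. F (v(Suc p := x))) y \<partial>Mback (Suc p) (\<mu> p) x)"
proof -
  have bk: "backward \<mu> p \<in> E p \<rightarrow>\<^sub>M prob_algebra (PiM {..<p} E)"
    by (rule backward_kernel_fixed) (use flowD[OF \<mu>] in auto)
  have up: "(\<lambda>(y, w). w(p := y)) \<in> E p \<Otimes>\<^sub>M PiM {..<p} E \<rightarrow>\<^sub>M PiM {..<Suc p} E"
    unfolding case_prod_unfold by (rule measurable_fun_upd[where J="{..<p}"]) auto
  have "(\<lambda>w. w(Suc p := x)) \<in> PiM {..<Suc p} E \<rightarrow>\<^sub>M PiM {..Suc p} E"
    using x by (intro measurable_fun_upd[where J="{..<Suc p}"]) auto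
  then have F': "bounded_on (PiM {..<Suc p} E) C (\<lambda>w. F (w(Suc p := x)))"
    by (rule bounded_on_compose[OF F])
  have "bwd \<mu> (Suc p) F x = (\<integral>y. (\<integral>w. F (w(Suc p := x)) \<partial>distr (backward \<mu> p y) (PiM {..<Suc p} E) (\<lambda>w. w(p := y))) \<partial>Mback (Suc p) (\<mu> p) x)"
    unfolding bwd_def backward.simps
    by (rule integral_bind_bounded[OF Mback_in_prob_algebra[OF flowD[OF \<mu> order_refl] x] measurable_distr_prob_space2[OF bk up] F'])
  also have "\<dots> = (\<integral>y. bwd \<mu> p (\<lambda>v. F (v(Suc p := x))) y \<partial>Mback (Suc p) (\<mu> p) x)"
  proof (rule Bochner_Integration.integral_cong[OF refl])
    fix y assume "y \<in> space (Mback (Suc p) (\<mu> p) x)"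
    then have y: "y \<in> space (E p)"
      using in_space_prob_algebraD(3)[OF Mback_in_prob_algebra[OF flowD[OF \<mu> order_refl] x]] by simp
    have "(\<lambda>w. w(p := y)) \<in> PiM {..<p} E \<rightarrow>\<^sub>M PiM {..<Suc p} E"
      using y by (intro measurable_fun_upd[where J="{..<p}"]) auto
    from integral_distr_bounded[OF prob_algebra_kernelD(1)[OF bk y] this F']
    show "(\<integral>w. F (w(Suc p := x)) \<partial>distr (backward \<mu> p y) (PiM {..<Suc p} E) (\<lambda>w. w(p := y))) = bwd \<mu> p (\<lambda>v. F (v(Suc p := x))) y"
      by (simp add: bwd_def)
  qed
  finally show ?thesis .
qed

lemma bwd_fun_upd_bounded:
  assumes \<mu>: "flow p \<mu>" and F: "bounded_on (PiM {..Suc p} E) C F"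
  shows "bounded_on (E p \<Otimes>\<^sub>M E (Suc p)) C (\<lambda>(y, x). bwd \<mu> p (\<lambda>v. F (v(Suc p := x))) y)"
proof -
  have "(\<lambda>z. (snd z)(Suc p := fst z)) \<in> E (Suc p) \<Otimes>\<^sub>M PiM {..p} E \<rightarrow>\<^sub>M PiM {..Suc p} E"
    by (rule measurable_fun_upd[where J="{..p}"]) auto
  note F' = bounded_on_compose[OF F this]
  have "bounded_on (E (Suc p) \<Otimes>\<^sub>M E p) C (\<lambda>(x, y). bwd \<mu> p (\<lambda>v. F ((snd (x, v))(Suc p := fst (x, v)))) y)"
    by (rule bwd_bounded_param[where \<mu>="\<lambda>_. \<mu>", OF _ F']) (use flowD[OF \<mu>] in auto)
  from bounded_on_compose[OF this, of "\<lambda>(y, x). (x, y)" "E p \<Otimes>\<^sub>M E (Suc p)"]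
  show ?thesis by (simp add: case_prod_unfold)
qed

text \<open>Once x_p = y is fixed, the past drawn from the backward kernel and the next point drawn
  from \<open>M\<close> are independent, so Fubini exchanges them.\<close>

lemma bwd_step_back:
  assumes \<mu>: "flow p \<mu>" and F: "bounded_on (PiM {..Suc p} E) C F" and y: "y \<in> space (E p)"
  shows "bwd \<mu> p (step_back p F) y = G p y * (\<integral>x. bwd \<mu> p (\<lambda>v. F (v(Suc p := x))) y \<partial>M (Suc p) y)"
proof -
  have bk: "backward \<mu> p y \<in> space (prob_algebra (PiM {..<p} E))"
    by (rule prob_algebra_kernelD(1)[OF backward_kernel_fixed y]) (use flowD[OF \<mu>] in auto)
  have My: "M (Suc p) y \<in> space (prob_algebra (E (Suc p)))"
    by (rule prob_algebra_kernelD(1)[OF M_kernel y])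
  note bk' = in_space_prob_algebraD[OF bk] and My' = in_space_prob_algebraD[OF My]
  interpret pair_prob_space "backward \<mu> p y" "M (Suc p) y"
    using bk'(1) My'(1) by (simp add: pair_prob_space_def pair_sigma_finite_def prob_space_imp_sigma_finite)
  have "(\<lambda>z. (fst z)(p := y, Suc p := snd z)) \<in> PiM {..<p} E \<Otimes>\<^sub>M E (Suc p) \<rightarrow>\<^sub>M PiM {..Suc p} E"
    using y by (intro measurable_fun_upd[where J="{..p}"] measurable_fun_upd[where J="{..<p}"]) auto
  from bounded_on_compose[OF F this]
  have b: "bounded_on (PiM {..<p} E \<Otimes>\<^sub>M E (Suc p)) C (\<lambda>(w, x). F (w(p := y, Suc p := x)))"
    by (simp add: case_prod_unfold)
  have m: "(\<lambda>(w, x). F (w(p := y, Suc p := x))) \<in> borel_measurable (backward \<mu> p y \<Otimes>\<^sub>M M (Suc p) y)"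
    using bounded_onD(1)[OF b] bk'(2) My'(2) by (simp cong: measurable_cong_sets sets_pair_measure_cong)
  have i: "integrable (backward \<mu> p y \<Otimes>\<^sub>M M (Suc p) y) (\<lambda>(w, x). F (w(p := y, Suc p := x)))"
    by (rule P.integrable_const_bound[OF AE_I2 m, where B=C]) (use bounded_onD(2)[OF b] in \<open>auto simp: space_pair_measure bk' My'\<close>)
  have "bwd \<mu> p (step_back p F) y = (\<integral>w. G p y * (\<integral>x. F (w(p := y, Suc p := x)) \<partial>M (Suc p) y) \<partial>backward \<mu> p y)"
    by (simp add: bwd_def step_back_def)
  also have "\<dots> = G p y * (\<integral>w. (\<integral>x. F (w(p := y, Suc p := x)) \<partial>M (Suc p) y) \<partial>backward \<mu> p y)"
    by simp
  also have "(\<integral>w. (\<integral>x. F (w(p := y, Suc p := x)) \<partial>M (Suc p) y) \<partial>backward \<mu> p y)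
    = (\<integral>x. (\<integral>w. F (w(p := y, Suc p := x)) \<partial>backward \<mu> p y) \<partial>M (Suc p) y)"
    using Fubini_integral[OF i] by simp
  finally show ?thesis by (simp add: bwd_def)
qed

lemma integral_M:
  assumes "y \<in> space (E n)" "f \<in> borel_measurable (E (Suc n))"
  shows "(\<integral>x. f x \<partial>M (Suc n) y) = (\<integral>x. H (Suc n) y x * f x \<partial>lam (Suc n))"
proof -
  have "(\<lambda>x. H (Suc n) y x) \<in> borel_measurable (E (Suc n))"
    using measurable_compose[OF measurable_Pair1'[OF assms(1)] H_measurable[of n]] by simp
  then show ?thesis unfolding M_density[OF assms(1)]
    using assms H_pos[OF assms(1)] by (intro integral_real_density) (auto simp: sets_lam space_lam less_imp_le cong: measurable_cong_sets)
qed

lemma sigma_finite_pair_lam: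
  assumes "\<mu> \<in> space (prob_algebra (E n))"
  shows "pair_sigma_finite \<mu> (lam (Suc n))"
  using in_space_prob_algebraD(1)[OF assms] lam_sigma_finite
  by (simp add: pair_sigma_finite_def prob_space_imp_sigma_finite)

text \<open>After \<open>M\<close> is written through its density H, the integrand is dominated by
  |C| hp(x), integrable under the product of a probability measure with \<open>lam\<close>.\<close>

lemma GH_Fubini:
  assumes \<mu>: "\<mu> \<in> space (prob_algebra (E n))" and f: "bounded_on (E n \<Otimes>\<^sub>M E (Suc n)) C f"
  shows "(\<integral>y. G n y * (\<integral>x. f (y, x) \<partial>M (Suc n) y) \<partial>\<mu>) = (\<integral>x. (\<integral>y. G n y * H (Suc n) y x * f (y, x) \<partial>\<mu>) \<partial>lam (Suc n))"
proof -
  note \<mu>' = in_space_prob_algebraD[OF \<mu>]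
  interpret pair_sigma_finite \<mu> "lam (Suc n)" by (rule sigma_finite_pair_lam[OF \<mu>])
  let ?f = "\<lambda>(y, x). G n y * H (Suc n) y x * f (y, x)"
  have H': "(\<lambda>z. H (Suc n) (fst z) (snd z)) \<in> borel_measurable (E n \<Otimes>\<^sub>M E (Suc n))"
    using H_measurable[of n] by (simp add: case_prod_unfold)
  have "?f \<in> borel_measurable (E n \<Otimes>\<^sub>M E (Suc n))"
    using H' bounded_onD(1)[OF f] by (simp add: case_prod_unfold)
  then have m: "?f \<in> borel_measurable (\<mu> \<Otimes>\<^sub>M lam (Suc n))"
    using \<mu>'(2) sets_lam by (simp cong: measurable_cong_sets sets_pair_measure_cong)
  have hp: "(\<lambda>z. \<bar>C\<bar> * hp (Suc n) (snd z)) \<in> borel_measurable (\<mu> \<Otimes>\<^sub>M lam (Suc n))"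
    using measurable_compose[OF measurable_snd, of "hp (Suc n)"] hp_integrable by simp
  have int_hp: "integrable (\<mu> \<Otimes>\<^sub>M lam (Suc n)) (\<lambda>z. \<bar>C\<bar> * hp (Suc n) (snd z))"
  proof (rule Fubini_integrable[OF hp])
    show "integrable \<mu> (\<lambda>x. \<integral>y. norm (\<bar>C\<bar> * hp (Suc n) (snd (x, y))) \<partial>lam (Suc n))"
      using finite_measure.integrable_const[OF prob_space.finite_measure[OF \<mu>'(1)]] by simp
    show "AE x in \<mu>. integrable (lam (Suc n)) (\<lambda>y. \<bar>C\<bar> * hp (Suc n) (snd (x, y)))"
      using hp_integrable by simp
  qed
  have i: "integrable (\<mu> \<Otimes>\<^sub>M lam (Suc n)) ?f"
  proof (rule Bochner_Integration.integrable_bound[OF int_hp m], rule AE_I2)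
    fix z assume "z \<in> space (\<mu> \<Otimes>\<^sub>M lam (Suc n))"
    then have z: "fst z \<in> space (E n)" "snd z \<in> space (E (Suc n))"
      by (auto simp: space_pair_measure \<mu>' space_lam)
    then have "\<bar>f z\<bar> \<le> \<bar>C\<bar>" using bounded_onD(2)[OF f, of z] by (auto simp: space_pair_measure mem_Times_iff)
    then have "(G n (fst z) * H (Suc n) (fst z) (snd z)) * \<bar>f z\<bar> \<le> hp (Suc n) (snd z) * \<bar>C\<bar>"
      using GH_pos[OF z] GH_le_hp[OF z] by (intro mult_mono) auto
    then show "norm (?f z) \<le> norm (\<bar>C\<bar> * hp (Suc n) (snd z))"
    proof -
      have "norm (?f z) = (G n (fst z) * H (Suc n) (fst z) (snd z)) * \<bar>f z\<bar>"
        using G_pos[OF z(1)] H_pos[OF z] by (simp add: case_prod_unfold abs_mult)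
      moreover have "norm (\<bar>C\<bar> * hp (Suc n) (snd z)) = hp (Suc n) (snd z) * \<bar>C\<bar>"
        using GH_pos[OF z] GH_le_hp[OF z] by (simp add: abs_mult)
      ultimately show ?thesis using \<open>(G n (fst z) * H (Suc n) (fst z) (snd z)) * \<bar>f z\<bar> \<le> hp (Suc n) (snd z) * \<bar>C\<bar>\<close> by simp
    qed
  qed
  have "(\<integral>y. G n y * (\<integral>x. f (y, x) \<partial>M (Suc n) y) \<partial>\<mu>) = (\<integral>y. (\<integral>x. G n y * H (Suc n) y x * f (y, x) \<partial>lam (Suc n)) \<partial>\<mu>)"
  proof (rule Bochner_Integration.integral_cong[OF refl])
    fix y assume "y \<in> space \<mu>"
    then have y: "y \<in> space (E n)" by (simp add: \<mu>')
    have "(\<lambda>x. f (y, x)) \<in> borel_measurable (E (Suc n))"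
      using measurable_compose[OF measurable_Pair1'[OF y] bounded_onD(1)[OF f]] .
    from integral_M[OF y this] show "G n y * (\<integral>x. f (y, x) \<partial>M (Suc n) y) = (\<integral>x. G n y * H (Suc n) y x * f (y, x) \<partial>lam (Suc n))"
      by (simp add: mult.assoc)
  qed
  also have "\<dots> = (\<integral>x. (\<integral>y. G n y * H (Suc n) y x * f (y, x) \<partial>\<mu>) \<partial>lam (Suc n))"
    using Fubini_integral[OF i] by simp
  finally show ?thesis .
qed

text \<open>With respect to \<open>lam\<close>, the measure \<mu>(G) \<Phi>(\<mu>) has density x ->
  \<mu>(G H(., x)), which is precisely the normaliser of the backward kernel at x. It cancels, and
  Fubini turns what is left into one forward step under \<mu>.\<close>

lemma backward_duality:
  assumes \<mu>: "flow p \<mu>" and F: "bounded_on (PiM {..Suc p} E) C F"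
  shows "(\<integral>x. G p x \<partial>\<mu> p) * (\<integral>x. bwd \<mu> (Suc p) F x \<partial>Phi (Suc p) (\<mu> p)) = (\<integral>y. bwd \<mu> p (step_back p F) y \<partial>\<mu> p)"
proof -
  note \<mu>p = flowD[OF \<mu> order_refl]
  note \<mu>' = in_space_prob_algebraD[OF \<mu>p]
  let ?\<phi> = "\<lambda>(y, x). bwd \<mu> p (\<lambda>v. F (v(Suc p := x))) y"
  have \<phi>: "bounded_on (E p \<Otimes>\<^sub>M E (Suc p)) C ?\<phi>" by (rule bwd_fun_upd_bounded[OF \<mu> F])
  have b: "bounded_on (E (Suc p)) C (bwd \<mu> (Suc p) F)"
    by (rule bwd_bounded[OF _ F]) (use flowD[OF \<mu>] in auto)
  have "(\<integral>x. G p x \<partial>\<mu> p) * (\<integral>x. bwd \<mu> (Suc p) F x \<partial>Phi (Suc p) (\<mu> p))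
    = (\<integral>y. G p y * (\<integral>x. bwd \<mu> (Suc p) F x \<partial>M (Suc p) y) \<partial>\<mu> p)"
    using integral_Phi[OF \<mu>p b] G_integral_pos(1)[OF \<mu>p] by simp
  also have "\<dots> = (\<integral>x. (\<integral>y. G p y * H (Suc p) y x * bwd \<mu> (Suc p) F x \<partial>\<mu> p) \<partial>lam (Suc p))"
    using GH_Fubini[OF \<mu>p bounded_on_compose[OF b measurable_snd]] by simp
  also have "\<dots> = (\<integral>x. (\<integral>y. G p y * H (Suc p) y x * ?\<phi> (y, x) \<partial>\<mu> p) \<partial>lam (Suc p))"
  proof (rule Bochner_Integration.integral_cong[OF refl])
    fix x assume "x \<in> space (lam (Suc p))"
    then have x: "x \<in> space (E (Suc p))" by (simp add: space_lam)
    have "bounded_on (E p) C (\<lambda>y. ?\<phi> (y, x))"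
      by (rule bounded_on_compose[OF \<phi>]) (use x in simp)
    from integral_Mback[OF \<mu>p x this] bwd_Suc[OF \<mu> F x]
    have "bwd \<mu> (Suc p) F x = (\<integral>y. G p y * H (Suc p) y x * ?\<phi> (y, x) \<partial>\<mu> p) / (\<integral>y. G p y * H (Suc p) y x \<partial>\<mu> p)"
      by simp
    then show "(\<integral>y. G p y * H (Suc p) y x * bwd \<mu> (Suc p) F x \<partial>\<mu> p) = (\<integral>y. G p y * H (Suc p) y x * ?\<phi> (y, x) \<partial>\<mu> p)"
      using GH_integral_pos[OF \<mu>p x] by simp
  qed
  also have "\<dots> = (\<integral>y. G p y * (\<integral>x. ?\<phi> (y, x) \<partial>M (Suc p) y) \<partial>\<mu> p)"
    by (rule GH_Fubini[OF \<mu>p \<phi>, symmetric])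
  also have "\<dots> = (\<integral>y. bwd \<mu> p (step_back p F) y \<partial>\<mu> p)"
    by (intro Bochner_Integration.integral_cong refl) (simp add: bwd_step_back[OF \<mu> F] \<mu>')
  finally show ?thesis .
qed

section \<open>The telescoping identity\<close>

definition mass :: "(nat \<Rightarrow> 'a measure) \<Rightarrow> nat \<Rightarrow> real" where
  "mass \<mu> p = (\<Prod>q<p. \<integral>x. G q x \<partial>\<mu> q)"

text \<open>Along the empirical flow this is the conditional mean of the measure at time p given the
  past; \<open>eta0\<close> plays this role at time 0, whatever the flow.\<close>

definition predict :: "(nat \<Rightarrow> 'a measure) \<Rightarrow> nat \<Rightarrow> 'a measure" where
  "predict \<mu> p = (case p of 0 \<Rightarrow> eta0 | Suc q \<Rightarrow> Phi (Suc q) (\<mu> q))"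

definition flow_D :: "(nat \<Rightarrow> 'a measure) \<Rightarrow> nat \<Rightarrow> nat \<Rightarrow> ((nat \<Rightarrow> 'a) \<Rightarrow> real) \<Rightarrow> 'a \<Rightarrow> real" where
  "flow_D \<mu> p n F = bwd \<mu> p (forward_integral p n F)"

lemma flow_D_bounded:
  assumes "p \<le> n" "\<And>q. q < p \<Longrightarrow> \<mu> q \<in> space (prob_algebra (E q))" "bounded_on (PiM {..n} E) C F"
  shows "bounded_on (E p) C (flow_D \<mu> p n F)"
  unfolding flow_D_def by (intro bwd_bounded assms forward_integral_bounded)

lemma mass_bounds: "(\<And>q. q < p \<Longrightarrow> \<mu> q \<in> space (prob_algebra (E q))) \<Longrightarrow> 0 < mass \<mu> p \<and> mass \<mu> p \<le> 1"
  unfolding mass_def using G_integral_pos by (auto intro!: prod_pos prod_le_1 simp: less_imp_le)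

lemma bwd_cong_space:
  assumes "\<And>q. q < p \<Longrightarrow> \<mu> q \<in> space (prob_algebra (E q))" "x \<in> space (E p)"
    "\<And>v. v \<in> space (PiM {..p} E) \<Longrightarrow> F v = F' v"
  shows "bwd \<mu> p F x = bwd \<mu> p F' x"
  unfolding bwd_def
proof (rule Bochner_Integration.integral_cong[OF refl])
  fix w assume "w \<in> space (backward \<mu> p x)"
  then have "w \<in> space (PiM {..<p} E)"
    using prob_algebra_kernelD(4)[OF backward_kernel_fixed[OF assms(1)] assms(2)] by simp
  then have "w(p := x) \<in> space (PiM {..p} E)"
    using measurable_space[OF fun_upd_last_measurable[of p], of "(w, x)"] assms(2) by (simp add: space_pair_measure)
  then show "F (w(p := x)) = F' (w(p := x))" by (rule assms(3))
qed

text \<open>The extra factor \<mu>_p(G) by which the mass grows from p to p + 1 is the one on the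
  left of \<open>backward_duality\<close>.\<close>

lemma flow_D_duality:
  assumes \<mu>: "flow p \<mu>" and F: "bounded_on (PiM {..n} E) C F" and pn: "p < n"
  shows "mass \<mu> (Suc p) * (\<integral>x. flow_D \<mu> (Suc p) n F x \<partial>predict \<mu> (Suc p)) = mass \<mu> p * (\<integral>x. flow_D \<mu> p n F x \<partial>\<mu> p)"
proof -
  have "(\<integral>x. flow_D \<mu> p n F x \<partial>\<mu> p) = (\<integral>y. bwd \<mu> p (step_back p (forward_integral (Suc p) n F)) y \<partial>\<mu> p)"
    unfolding flow_D_def
    by (intro Bochner_Integration.integral_cong refl bwd_cong_space forward_integral_Suc[OF pn _ F])
      (use flowD[OF \<mu>] in \<open>auto simp: in_space_prob_algebraD(3)[OF flowD[OF \<mu> order_refl]]\<close>)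
  then show ?thesis
    using backward_duality[OF \<mu> forward_integral_bounded[OF _ F, of "Suc p"]] pn
    by (simp add: mass_def predict_def flow_D_def)
qed

lemma FK_Gamma_eq_predict_0:
  assumes F: "bounded_on (PiM {..n} E) C F"
  shows "FK_Gamma n F = (\<integral>x. flow_D \<mu> 0 n F x \<partial>predict \<mu> 0)"
proof -
  have b: "bounded_on (PiM {..0} E) C (forward_integral 0 n F)" by (rule forward_integral_bounded[OF _ F]) simp
  show ?thesis
    unfolding FK_Gamma_forward[OF le0 F] FK_Gamma_0[OF b]
    by (intro Bochner_Integration.integral_cong) (auto simp: predict_def flow_D_def bwd_0[OF b] in_space_prob_algebraD(3)[OF eta0])
qed

lemma telescoping:
  assumes "flow n \<mu>" and F: "bounded_on (PiM {..n} E) C F"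
  shows "mass \<mu> n * (\<integral>x. bwd \<mu> n F x \<partial>\<mu> n) - FK_Gamma n F =
    (\<Sum>p\<le>n. mass \<mu> p * ((\<integral>x. flow_D \<mu> p n F x \<partial>\<mu> p) - (\<integral>x. flow_D \<mu> p n F x \<partial>predict \<mu> p)))"
proof -
  let ?a = "\<lambda>p. mass \<mu> p * (\<integral>x. flow_D \<mu> p n F x \<partial>\<mu> p)"
  let ?b = "\<lambda>p. mass \<mu> p * (\<integral>x. flow_D \<mu> p n F x \<partial>predict \<mu> p)"
  \<comment> \<open>Duality says that \<open>?b (Suc m)\<close> equals \<open>?a m\<close>, so
    neighbouring terms cancel. The surviving \<open>?b 0\<close> is the exact value
    \<open>FK_Gamma n F\<close>, because prediction at time 0 starts from the true initial
    law.\<close>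
  have "(\<Sum>p\<le>m. ?a p - ?b p) = ?a m - ?b 0" if "m \<le> n" for m
    using that
  proof (induction m)
    case (Suc m)
    then have "?b (Suc m) = ?a m"
      using flow_mono[OF assms(1), of m] by (intro flow_D_duality[OF _ F]) auto
    with Suc show ?case by simp
  qed simp
  from this[OF order_refl] have "(\<Sum>p\<le>n. ?a p - ?b p) = ?a n - ?b 0" .
  moreover have "?a n = mass \<mu> n * (\<integral>x. bwd \<mu> n F x \<partial>\<mu> n)"
  proof -
    have "(\<integral>x. flow_D \<mu> n n F x \<partial>\<mu> n) = (\<integral>x. bwd \<mu> n F x \<partial>\<mu> n)"
      unfolding flow_D_def
      by (intro Bochner_Integration.integral_cong refl bwd_cong_space forward_integral_refl)
        (use flowD[OF assms(1)] in \<open>auto simp: in_space_prob_algebraD(3)[OF flowD[OF assms(1) order_refl]]\<close>)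
    then show ?thesis by simp
  qed
  moreover have "?b 0 = FK_Gamma n F"
    using FK_Gamma_eq_predict_0[OF F] by (simp add: mass_def)
  ultimately show ?thesis by (simp add: right_diff_distrib)
qed

end

text \<open>Rectangles form an intersection-stable generator on which the product measure is a
  finite product of measurable functions of the parameter.\<close>

lemma PiM_kernel:
  assumes I: "finite I" and k: "\<And>i. i \<in> I \<Longrightarrow> k i \<in> A \<rightarrow>\<^sub>M prob_algebra (S i)"
  shows "(\<lambda>a. PiM I (\<lambda>i. k i a)) \<in> A \<rightarrow>\<^sub>M prob_algebra (PiM I S)"
proof (rule measurable_prob_algebra_generated[OF sets_PiM Int_stable_prod_algebra prod_algebra_sets_into_space])
  fix a assume a: "a \<in> space A"
  note ka = prob_algebra_kernelD[OF k a]
  \<comment> \<open>Indices outside \<open>I\<close> receive a point mass, since probability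
    measures are required at every index; the product over \<open>I\<close> does not see
    them.\<close>
  have prodk: "PiM I (\<lambda>i. k i a) = PiM I (\<lambda>i. if i \<in> I then k i a else return (count_space UNIV) undefined)"
    by (intro PiM_cong) auto
  show "prob_space (PiM I (\<lambda>i. k i a))"
    unfolding prodk by (intro prob_space_PiM) (use ka in \<open>auto intro: prob_space_return\<close>)
  show "sets (PiM I (\<lambda>i. k i a)) = sets (PiM I S)"
    by (intro sets_PiM_cong refl ka)
next
  fix B assume "B \<in> prod_algebra I S"
  then obtain X where X: "B = PiE I X" "\<And>i. i \<in> I \<Longrightarrow> X i \<in> sets (S i)"
    by (auto simp: prod_algebra_eq_finite[OF I])
  have eq: "emeasure (PiM I (\<lambda>i. k i a)) B = (\<Prod>i\<in>I. emeasure (k i a) (X i))" if a: "a \<in> space A" for a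
  proof -
    note ka = prob_algebra_kernelD[OF k a]
    let ?M = "\<lambda>i. if i \<in> I then k i a else return (count_space UNIV) undefined"
    have prodk: "PiM I (\<lambda>i. k i a) = PiM I ?M" by (intro PiM_cong) auto
    interpret product_prob_space ?M I
      by (intro product_prob_spaceI) (use ka in \<open>auto intro: prob_space_return\<close>)
    show ?thesis unfolding prodk X(1) using X(2) ka I by (subst emeasure_PiM) auto
  qed
  have "(\<lambda>a. \<Prod>i\<in>I. emeasure (k i a) (X i)) \<in> borel_measurable A"
    using measurable_compose[OF measurable_prob_algebraD[OF k] measurable_emeasure_subprob_algebra[OF X(2)]]
    by (intro borel_measurable_prod_ennreal) auto
  then show "(\<lambda>a. emeasure (PiM I (\<lambda>i. k i a)) B) \<in> borel_measurable A"
    by (rule measurable_cong[THEN iffD1, rotated]) (simp add: eq)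
qed

section \<open>The limiting flow and its backward representation\<close>

context dominated_feynman_kac
begin

lemma FK_gamma_eq: "FK_gamma n f = FK_Gamma n (\<lambda>v. f (v n))"
  by (simp add: FK_gamma_def FK_Gamma_def history_apply)

lemma prod_G_P_bounded: "bounded_on P 1 (\<lambda>\<omega>. \<Prod>p<n. G p (X p \<omega>))"
  using bounded_on_compose[OF prod_G_bounded[of n n] history_measurable]
  by (simp add: history_apply)

lemma prod_G_P_pos: "\<omega> \<in> space P \<Longrightarrow> 0 < (\<Prod>p<n. G p (X p \<omega>))"
  by (intro prod_pos) (auto intro: G_pos X_space)

lemma prob_in_prob_algebra: "P \<in> space (prob_algebra P)"
  by (simp add: space_prob_algebra prob_space_axioms)

lemma FK_gamma_1_pos: "0 < FK_gamma n (\<lambda>_. 1)"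
  unfolding FK_gamma_def
  by (rule integral_pos[OF prob_space_axioms])
    (use bounded_on_measure(2)[OF prob_in_prob_algebra prod_G_P_bounded] prod_G_P_pos in auto)

lemma eta_in_prob_algebra: "eta n \<in> space (prob_algebra (E n))"
proof -
  let ?w = "\<lambda>\<omega>. (\<Prod>p<n. G p (X p \<omega>)) / FK_gamma n (\<lambda>_. 1)"
  have w: "integrable P ?w" "?w \<in> borel_measurable P"
    using bounded_on_measure(1,2)[OF prob_in_prob_algebra prod_G_P_bounded] by auto
  have "emeasure (density P (\<lambda>\<omega>. ennreal (?w \<omega>))) (space P) = (\<integral>\<^sup>+\<omega>. ennreal (?w \<omega>) * indicator (space P) \<omega> \<partial>P)"
    using w by (intro emeasure_density) auto
  also have "\<dots> = (\<integral>\<^sup>+\<omega>. ennreal (?w \<omega>) \<partial>P)"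
    by (intro nn_integral_cong) simp
  also have "\<dots> = ennreal (\<integral>\<omega>. ?w \<omega> \<partial>P)"
    using w prod_G_P_pos FK_gamma_1_pos[of n] by (intro nn_integral_eq_integral) (auto simp: less_imp_le)
  also have "(\<integral>\<omega>. ?w \<omega> \<partial>P) = 1"
    using FK_gamma_1_pos[of n] by (simp add: FK_gamma_def)
  finally have "prob_space (density P (\<lambda>\<omega>. ennreal (?w \<omega>)))"
    by (intro prob_spaceI) simp
  then have "prob_space (eta n)" unfolding eta_def
    by (rule prob_space.prob_space_distr) (subst measurable_cong_sets[OF sets_density refl], rule X_measurable)
  then show ?thesis by (simp add: space_prob_algebra eta_def)
qed

lemma integral_eta:
  assumes f: "f \<in> borel_measurable (E n)"
  shows "(\<integral>x. f x \<partial>eta n) = FK_gamma n f / FK_gamma n (\<lambda>_. 1)"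
proof -
  have w: "(\<lambda>\<omega>. (\<Prod>p<n. G p (X p \<omega>))) \<in> borel_measurable P"
    using bounded_on_measure(1)[OF prob_in_prob_algebra prod_G_P_bounded] .
  have "(\<integral>x. f x \<partial>eta n) = (\<integral>\<omega>. f (X n \<omega>) \<partial>density P (\<lambda>\<omega>. ennreal ((\<Prod>p<n. G p (X p \<omega>)) / FK_gamma n (\<lambda>_. 1))))"
    unfolding eta_def using f by (intro integral_distr) simp_all
  also have "\<dots> = (\<integral>\<omega>. (\<Prod>p<n. G p (X p \<omega>)) / FK_gamma n (\<lambda>_. 1) * f (X n \<omega>) \<partial>P)"
    using f w FK_gamma_1_pos[of n] prod_G_P_pos by (intro integral_real_density) (auto intro!: AE_I2 simp: less_imp_le)
  also have "\<dots> = (\<integral>\<omega>. f (X n \<omega>) * (\<Prod>p<n. G p (X p \<omega>)) / FK_gamma n (\<lambda>_. 1) \<partial>P)"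
    by (simp add: mult.commute)
  also have "\<dots> = FK_gamma n f / FK_gamma n (\<lambda>_. 1)"
    unfolding FK_gamma_def by simp
  finally show ?thesis .
qed

lemma flow_eta: "flow n eta"
  by (simp add: flow_def eta_in_prob_algebra)

lemma last_coordinate_bounded: "bounded_on (E n) C f \<Longrightarrow> bounded_on (PiM {..n} E) C (\<lambda>v. f (v n))"
  by (erule bounded_on_compose) simp

lemma FK_gamma_Suc:
  assumes "bounded_on (E (Suc n)) C f"
  shows "FK_gamma (Suc n) f = FK_gamma n (\<lambda>x. G n x * (\<integral>y. f y \<partial>M (Suc n) x))"
  using FK_Gamma_Suc[OF last_coordinate_bounded[OF assms]] by (simp add: FK_gamma_eq step_back_def[abs_def])

lemma FK_gamma_Suc_1: "FK_gamma (Suc n) (\<lambda>_. 1) = FK_gamma n (G n)"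
proof -
  have "FK_gamma (Suc n) (\<lambda>_. 1) = FK_gamma n (\<lambda>x. G n x * (\<integral>y. 1 \<partial>M (Suc n) x))"
    by (rule FK_gamma_Suc[OF bounded_on_const])
  also have "\<dots> = FK_gamma n (G n)"
    unfolding FK_gamma_def
    by (intro Bochner_Integration.integral_cong refl)
      (use prob_algebra_kernelD(2)[OF M_kernel X_space] in \<open>simp add: prob_space.prob_space\<close>)
  finally show ?thesis .
qed

text \<open>Each factor \<eta>_n(G_n) is the ratio \<gamma>_{n+1}(1) / \<gamma>_n(1), so the product
  telescopes.\<close>

lemma mass_eta: "mass eta n = FK_gamma n (\<lambda>_. 1)"
proof (induction n)
  case 0
  then show ?case by (simp add: mass_def FK_gamma_def prob_space)
next
  case (Suc n)
  then show ?case
    using FK_gamma_1_pos[of n] by (simp add: mass_def FK_gamma_Suc_1 integral_eta)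
qed

text \<open>The recursion \<eta>_{n+1} = \<Phi>(\<eta>_n), tested on bounded functions: along
  \<open>eta\<close> there is no local error.\<close>

lemma integral_predict_eta:
  assumes f: "bounded_on (E p) C f"
  shows "(\<integral>x. f x \<partial>predict eta p) = (\<integral>x. f x \<partial>eta p)"
proof (cases p)
  case 0
  have "FK_gamma 0 f = (\<integral>x. f x \<partial>distr P (E 0) (X 0))"
    using bounded_onD(1)[OF f] 0 unfolding FK_gamma_def by (subst integral_distr) auto
  also have "distr P (E 0) (X 0) = eta0" using X_chain by (simp add: markov_chain_def)
  finally show ?thesis
    using integral_eta[OF bounded_onD(1)[OF f]] 0 by (simp add: predict_def FK_gamma_def prob_space)
next
  case (Suc n)
  have b: "bounded_on (E n) (1 * C) (\<lambda>x. G n x * (\<integral>y. f y \<partial>M (Suc n) x))"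
    using f Suc by (intro bounded_on_mult G_bounded M_integral_bounded) simp
  show ?thesis
    using integral_Phi[OF eta_in_prob_algebra f[unfolded Suc]] FK_gamma_1_pos[of n]
      integral_eta[OF bounded_onD(1)[OF b]] integral_eta[OF bounded_onD(1)[OF f[unfolded Suc]]]
    by (simp add: Suc predict_def integral_eta FK_gamma_Suc[OF f[unfolded Suc]] FK_gamma_Suc_1)
qed

definition flow_Gamma :: "(nat \<Rightarrow> 'a measure) \<Rightarrow> nat \<Rightarrow> ((nat \<Rightarrow> 'a) \<Rightarrow> real) \<Rightarrow> real" where
  "flow_Gamma \<mu> n F = mass \<mu> n * (\<integral>x. bwd \<mu> n F x \<partial>\<mu> n)"

text \<open>All local errors vanish along \<open>eta\<close>, so the telescoping identity itself
  yields the backward representation of \<Gamma>_n; no separate disintegration of the path law is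
  made.\<close>

lemma flow_Gamma_eta:
  assumes F: "bounded_on (PiM {..n} E) C F"
  shows "flow_Gamma eta n F = FK_Gamma n F"
proof -
  have "flow_Gamma eta n F - FK_Gamma n F = (\<Sum>p\<le>n. 0)"
    unfolding flow_Gamma_def telescoping[OF flow_eta F]
  proof (rule sum.cong[OF refl])
    fix p assume "p \<in> {..n}"
    then have "bounded_on (E p) C (flow_D eta p n F)"
      by (intro flow_D_bounded[OF _ _ F] eta_in_prob_algebra) auto
    from integral_predict_eta[OF this]
    show "mass eta p * ((\<integral>x. flow_D eta p n F x \<partial>eta p) - (\<integral>x. flow_D eta p n F x \<partial>predict eta p)) = 0" by simp
  qed
  then show ?thesis by simp
qed

lemma bwd_last_factor:
  "bwd \<mu> p (\<lambda>v. g (v p) * F v) y = g y * bwd \<mu> p F y"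
  by (simp add: bwd_def)

lemma bwd_last:
  assumes "\<And>q. q < p \<Longrightarrow> \<mu> q \<in> space (prob_algebra (E q))" "y \<in> space (E p)"
  shows "bwd \<mu> p (\<lambda>v. g (v p)) y = g y"
  using prob_algebra_kernelD(2)[OF backward_kernel_fixed[OF assms(1)] assms(2)]
  by (simp add: bwd_def prob_space.prob_space)

lemma flow_Gamma_last:
  assumes "flow n \<mu>"
  shows "flow_Gamma \<mu> n (\<lambda>v. g (v n)) = mass \<mu> n * (\<integral>x. g x \<partial>\<mu> n)"
proof -
  have "(\<integral>x. bwd \<mu> n (\<lambda>v. g (v n)) x \<partial>\<mu> n) = (\<integral>x. g x \<partial>\<mu> n)"
    by (intro Bochner_Integration.integral_cong refl bwd_last)
      (use flowD[OF assms] in \<open>auto simp: in_space_prob_algebraD(3)[OF flowD[OF assms order_refl]]\<close>)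
  then show ?thesis by (simp add: flow_Gamma_def)
qed

lemma mass_Suc: "mass \<mu> (Suc n) = mass \<mu> n * (\<integral>x. G n x \<partial>\<mu> n)"
  by (simp add: mass_def)

text \<open>The backward kernel is a quotient of \<mu>_p integrals; multiplying numerator and
  denominator by the mass turns them into unnormalised integrals at time p. The law of large numbers
  is proved for exactly these, and each of the three is linear in its test function.\<close>

lemma bwd_Suc_ratio:
  assumes \<mu>: "flow p \<mu>" and F: "bounded_on (PiM {..Suc p} E) C F" and x: "x \<in> space (E (Suc p))"
  shows "mass \<mu> (Suc p) * bwd \<mu> (Suc p) F x = flow_Gamma \<mu> p (\<lambda>v. G p (v p))
    * flow_Gamma \<mu> p (\<lambda>v. G p (v p) * H (Suc p) (v p) x * F (v(Suc p := x)))
    / flow_Gamma \<mu> p (\<lambda>v. G p (v p) * H (Suc p) (v p) x)"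
proof -
  note \<mu>p = flowD[OF \<mu> order_refl]
  have b: "bounded_on (E p) C (\<lambda>y. bwd \<mu> p (\<lambda>v. F (v(Suc p := x))) y)"
    using bounded_on_compose[OF bwd_fun_upd_bounded[OF \<mu> F], of "\<lambda>y. (y, x)" "E p"] x by simp
  have 1: "bwd \<mu> (Suc p) F x = (\<integral>y. G p y * H (Suc p) y x * bwd \<mu> p (\<lambda>v. F (v(Suc p := x))) y \<partial>\<mu> p) / (\<integral>y. G p y * H (Suc p) y x \<partial>\<mu> p)"
    unfolding bwd_Suc[OF \<mu> F x] by (rule integral_Mback[OF \<mu>p x b])
  have 2: "flow_Gamma \<mu> p (\<lambda>v. G p (v p) * H (Suc p) (v p) x * F (v(Suc p := x)))
    = mass \<mu> p * (\<integral>y. G p y * H (Suc p) y x * bwd \<mu> p (\<lambda>v. F (v(Suc p := x))) y \<partial>\<mu> p)"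
  proof -
    have "bwd \<mu> p (\<lambda>v. G p (v p) * H (Suc p) (v p) x * F (v(Suc p := x)))
      = (\<lambda>y. G p y * H (Suc p) y x * bwd \<mu> p (\<lambda>v. F (v(Suc p := x))) y)"
      by (rule ext) (rule bwd_last_factor)
    then show ?thesis by (simp only: flow_Gamma_def)
  qed
  have "mass \<mu> p \<noteq> 0" using mass_bounds[of p \<mu>] flowD[OF \<mu>] by simp
  then show ?thesis
    unfolding 1 2 flow_Gamma_last[OF \<mu>, of "\<lambda>y. G p y * H (Suc p) y x"] flow_Gamma_last[OF \<mu>, of "G p"] mass_Suc
    by (simp add: field_simps)
qed

lemma D_eq_flow_D: "D p n F x = flow_D eta p n F x"
proof -
  have "(\<lambda>i\<in>{..n}. if i \<le> p then (w(p := x)) i else z i) = (\<lambda>i\<in>{..n}. if i < p then w i else if i = p then x else z i)" for w z :: "nat \<Rightarrow> 'a"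
    by (auto simp: restrict_def fun_eq_iff)
  then show ?thesis by (simp add: D_def flow_D_def bwd_def forward_integral_def)
qed

lemma D_bounded: "p \<le> n \<Longrightarrow> bounded_on (PiM {..n} E) C F \<Longrightarrow> bounded_on (E p) C (D p n F)"
  unfolding D_eq_flow_D[abs_def] by (rule flow_D_bounded) (auto intro: eta_in_prob_algebra)

end

section \<open>The particle system\<close>

lemma uniform_in_prob_algebra:
  fixes N :: nat
  assumes "1 \<le> N"
  shows "uniform_count_measure {..<N} \<in> space (prob_algebra (count_space {..<N}))"
proof -
  have "0 \<in> {..<N}" using assms by simp
  then have "{..<N} \<noteq> {}" by blast
  then show ?thesis by (simp add: space_prob_algebra sets_uniform_count_measure prob_space_uniform_count_measure)
qed

locale dominated_particle_model =
  particle_model P E eta0 M G lam H X eps R xi + dominated_feynman_kac P E eta0 M G lam H X eps hp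
  for P :: "'w measure"
    and E :: "nat \<Rightarrow> 'a measure"
    and eta0 M G lam H X eps
    and R :: "nat \<Rightarrow> 'v measure"
    and xi
    and hp :: "nat \<Rightarrow> 'a \<Rightarrow> real"
begin

abbreviation config :: "nat \<Rightarrow> nat \<Rightarrow> (nat \<Rightarrow> 'a) measure" where
  "config N n \<equiv> PiM {..<N} (\<lambda>_. E n)"

definition config_kernel :: "nat \<Rightarrow> nat \<Rightarrow> (nat \<Rightarrow> 'a) \<Rightarrow> (nat \<Rightarrow> 'a) measure" where
  "config_kernel N n x = PiM {..<N} (\<lambda>i. K n (empirical (E (n - 1)) N x) (x i))"

lemma empirical_kernel [measurable]:
  assumes "1 \<le> N"
  shows "empirical (E n) N \<in> config N n \<rightarrow>\<^sub>M prob_algebra (E n)"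
proof -
  have "(\<lambda>(i, x). x i) \<in> count_space {..<N} \<Otimes>\<^sub>M config N n \<rightarrow>\<^sub>M E n"
    by (rule measurable_pair_measure_countable1) auto
  from measurable_compose[OF measurable_pair_swap' this]
  have "(\<lambda>(x, i). x i) \<in> config N n \<Otimes>\<^sub>M count_space {..<N} \<rightarrow>\<^sub>M E n"
    by (simp add: case_prod_unfold)
  from measurable_distr_prob_space2[OF const_kernel[OF uniform_in_prob_algebra[OF assms]] this]
  have "(\<lambda>x. distr (uniform_count_measure {..<N}) (E n) x) \<in> config N n \<rightarrow>\<^sub>M prob_algebra (E n)" by simp
  then show ?thesis by (simp add: empirical_def[abs_def])
qed

lemma config_coordinate: "x \<in> space (config N n) \<Longrightarrow> i < N \<Longrightarrow> x i \<in> space (E n)"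
  by (auto simp: space_PiM)

lemma integral_empirical:
  fixes f :: "'a \<Rightarrow> real"
  assumes "1 \<le> N" "x \<in> space (config N n)" "f \<in> borel_measurable (E n)"
  shows "(\<integral>y. f y \<partial>empirical (E n) N x) = (\<Sum>i<N. f (x i)) / N"
proof -
  have "x \<in> uniform_count_measure {..<N} \<rightarrow>\<^sub>M E n"
    using config_coordinate[OF assms(2)] by (auto simp: measurable_def space_uniform_count_measure sets_uniform_count_measure)
  then have "(\<integral>y. f y \<partial>empirical (E n) N x) = (\<integral>i. f (x i) \<partial>uniform_count_measure {..<N})"
    unfolding empirical_def using assms(3) by (rule integral_distr)
  then show ?thesis by (simp add: integral_uniform_count_measure)
qed

lemma empirical_in_prob_algebra:
  "1 \<le> N \<Longrightarrow> x \<in> space (config N n) \<Longrightarrow> empirical (E n) N x \<in> space (prob_algebra (E n))"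
  using prob_algebra_kernelD(1)[OF empirical_kernel] .

lemma config_kernel_measurable:
  assumes "1 \<le> N"
  shows "config_kernel N (Suc n) \<in> config N n \<rightarrow>\<^sub>M prob_algebra (config N (Suc n))"
proof -
  have "(\<lambda>x. K (Suc n) (empirical (E n) N x) (x i)) \<in> config N n \<rightarrow>\<^sub>M prob_algebra (E (Suc n))" if "i \<in> {..<N}" for i
    using measurable_compose[of "\<lambda>x. (x, x i)" "config N n", OF _ K_kernel[OF empirical_kernel[OF assms], of n]] that
    by simp
  then have "(\<lambda>x. PiM {..<N} (\<lambda>i. K (Suc n) (empirical (E n) N x) (x i))) \<in> config N n \<rightarrow>\<^sub>M prob_algebra (config N (Suc n))"
    by (intro PiM_kernel) auto
  then show ?thesis by (simp add: config_kernel_def[abs_def])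
qed

lemma chain: "1 \<le> N \<Longrightarrow> markov_chain (R N) (config N) (PiM {..<N} (\<lambda>_. eta0)) (config_kernel N) (xi N)"
  using xi_chain[of N] by (simp add: config_kernel_def[abs_def])

lemma xi_measurable: "1 \<le> N \<Longrightarrow> xi N n \<in> R N \<rightarrow>\<^sub>M config N n"
  using chain[of N] by (simp add: markov_chain_def)

lemma xi_history_measurable: "1 \<le> N \<Longrightarrow> history (xi N) n \<in> R N \<rightarrow>\<^sub>M PiM {..n} (config N)"
  unfolding history_def using xi_measurable by (intro measurable_restrict) auto

lemma R_in_prob_algebra: "1 \<le> N \<Longrightarrow> R N \<in> space (prob_algebra (R N))"
  by (simp add: space_prob_algebra R_prob_space)

lemma eta_N_kernel: "1 \<le> N \<Longrightarrow> eta_N N n \<in> R N \<rightarrow>\<^sub>M prob_algebra (E n)"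
  using measurable_compose[OF xi_measurable empirical_kernel] by (simp add: eta_N_def[abs_def])

abbreviation eta_flow :: "nat \<Rightarrow> 'v \<Rightarrow> nat \<Rightarrow> 'a measure" where
  "eta_flow N \<omega> \<equiv> (\<lambda>q. eta_N N q \<omega>)"

lemma eta_N_in_prob_algebra: "1 \<le> N \<Longrightarrow> \<omega> \<in> space (R N) \<Longrightarrow> eta_N N n \<omega> \<in> space (prob_algebra (E n))"
  using prob_algebra_kernelD(1)[OF eta_N_kernel] .

lemma flow_eta_N: "1 \<le> N \<Longrightarrow> \<omega> \<in> space (R N) \<Longrightarrow> flow n (eta_flow N \<omega>)"
  by (simp add: flow_def eta_N_in_prob_algebra)

text \<open>The compatibility \<eta> K_\<eta> = \<Phi>(\<eta>) for empirical measures: since \<mu>(G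
  M(f)) = \<mu>(G) \<Phi>(\<mu>)(f), the two contributions containing \<open>eps n\<close>
  cancel.\<close>

lemma K_average:
  assumes N: "1 \<le> N" and x: "x \<in> space (config N n)" and f: "bounded_on (E (Suc n)) C f"
  shows "(\<Sum>i<N. \<integral>y. f y \<partial>K (Suc n) (empirical (E n) N x) (x i)) / N = (\<integral>y. f y \<partial>Phi (Suc n) (empirical (E n) N x))"
proof -
  let ?\<mu> = "empirical (E n) N x"
  note \<mu> = empirical_in_prob_algebra[OF N x]
  let ?m = "\<lambda>x. \<integral>y. f y \<partial>M (Suc n) x"
  let ?\<Phi> = "\<integral>y. f y \<partial>Phi (Suc n) ?\<mu>"
  note b = bounded_on_mult[OF G_bounded M_integral_bounded[OF f]]
  have "(\<Sum>i<N. \<integral>y. f y \<partial>K (Suc n) ?\<mu> (x i)) = (\<Sum>i<N. eps n * (G n (x i) * ?m (x i)) + (1 - eps n * G n (x i)) * ?\<Phi>)"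
    by (intro sum.cong refl) (simp add: integral_K[OF \<mu> _ f] config_coordinate[OF x])
  also have "\<dots> = eps n * (\<Sum>i<N. G n (x i) * ?m (x i)) + (N - eps n * (\<Sum>i<N. G n (x i))) * ?\<Phi>"
    by (simp add: sum.distrib sum_distrib_left sum_distrib_right left_diff_distrib sum_subtractf mult.assoc)
  finally have "(\<Sum>i<N. \<integral>y. f y \<partial>K (Suc n) ?\<mu> (x i)) / N
    = eps n * ((\<Sum>i<N. G n (x i) * ?m (x i)) / N) + (1 - eps n * ((\<Sum>i<N. G n (x i)) / N)) * ?\<Phi>"
    using N by (simp add: field_simps)
  also have "(\<Sum>i<N. G n (x i) * ?m (x i)) / N = (\<integral>x. G n x * ?m x \<partial>?\<mu>)"
    by (rule integral_empirical[OF N x bounded_onD(1)[OF b], symmetric])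
  also have "(\<Sum>i<N. G n (x i)) / N = (\<integral>x. G n x \<partial>?\<mu>)"
    by (rule integral_empirical[OF N x G_measurable, symmetric])
  also have "(\<integral>x. G n x * ?m x \<partial>?\<mu>) = (\<integral>x. G n x \<partial>?\<mu>) * ?\<Phi>"
    using integral_Phi[OF \<mu> f] G_integral_pos(1)[OF \<mu>] by simp
  finally show ?thesis by (simp add: algebra_simps)
qed

text \<open>The local sampling error, whose limit is the field V_p. Given the past it is N^(-1/2)
  times a sum of N independent centred variables.\<close>

definition VN :: "nat \<Rightarrow> nat \<Rightarrow> ('a \<Rightarrow> real) \<Rightarrow> 'v \<Rightarrow> real" where
  "VN N p f \<omega> = sqrt N * ((\<integral>x. f x \<partial>eta_N N p \<omega>) - (\<integral>x. f x \<partial>predict (eta_flow N \<omega>) p))"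

lemma predict_eta_N_kernel:
  assumes "1 \<le> N"
  shows "(\<lambda>\<omega>. predict (eta_flow N \<omega>) p) \<in> R N \<rightarrow>\<^sub>M prob_algebra (E p)"
  using eta0 Phi_kernel[OF eta_N_kernel[OF assms]] by (cases p) (simp_all add: predict_def)

lemma VN_bounded:
  assumes N: "1 \<le> N" and g: "bounded_on (R N \<Otimes>\<^sub>M E p) C g"
  shows "bounded_on (R N) (sqrt N * (C + C)) (\<lambda>\<omega>. VN N p (\<lambda>x. g (\<omega>, x)) \<omega>)"
proof -
  have "bounded_on (R N) (\<bar>sqrt N\<bar> * (C + C)) (\<lambda>\<omega>. VN N p (\<lambda>x. g (\<omega>, x)) \<omega>)"
    unfolding VN_def
    by (intro bounded_on_cmult bounded_on_diff bounded_on_kernel_integral[OF eta_N_kernel[OF N] g]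
      bounded_on_kernel_integral[OF predict_eta_N_kernel[OF N] g])
  then show ?thesis by simp
qed

lemma VN_diff:
  assumes "1 \<le> N" "\<omega> \<in> space (R N)" "bounded_on (E p) C f" "bounded_on (E p) C' g"
  shows "VN N p (\<lambda>x. f x - g x) \<omega> = VN N p f \<omega> - VN N p g \<omega>"
  using bounded_on_measure(2)[OF eta_N_in_prob_algebra[OF assms(1,2)]]
    bounded_on_measure(2)[OF prob_algebra_kernelD(1)[OF predict_eta_N_kernel[OF assms(1)] assms(2)]] assms(3,4)
  by (simp add: VN_def algebra_simps)

lemma config_integral_predict:
  assumes N: "1 \<le> N" and x: "x \<in> space (config N n)" and f: "bounded_on (E (Suc n)) C f" and y: "y \<in> space (config N (Suc n))"
  shows "sqrt N * ((\<integral>z. f z \<partial>empirical (E (Suc n)) N y) - (\<integral>z. f z \<partial>Phi (Suc n) (empirical (E n) N x)))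
    = (\<Sum>i<N. f (y i) - (\<integral>z. f z \<partial>K (Suc n) (empirical (E n) N x) (x i))) / sqrt N"
proof -
  have "sqrt N * (a / N - b / N) = (a - b) / sqrt N" for a b :: real
    using N by (simp add: field_simps)
  then show ?thesis
    unfolding K_average[OF N x f, symmetric] integral_empirical[OF N y bounded_onD(1)[OF f]] sum_subtractf .
qed

text \<open>Given the configuration x the new particles are independent, so the variance is at most
  the average of their second moments; by \<open>K_average\<close> that average is again an integral
  under the prediction.\<close>

lemma empirical_predict_variance:
  assumes N: "1 \<le> N" and x: "x \<in> space (config N n)" and f: "bounded_on (E (Suc n)) C f"
  shows "(\<integral>y. (sqrt N * ((\<integral>z. f z \<partial>empirical (E (Suc n)) N y) - (\<integral>z. f z \<partial>Phi (Suc n) (empirical (E n) N x))))\<^sup>2 \<partial>config_kernel N (Suc n) x)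
    \<le> (\<integral>z. (f z)\<^sup>2 \<partial>Phi (Suc n) (empirical (E n) N x))"
proof -
  let ?\<kappa> = "\<lambda>i. K (Suc n) (empirical (E n) N x) (x i)"
  have \<kappa>: "?\<kappa> i \<in> space (prob_algebra (E (Suc n)))" if "i < N" for i
    using K_in_prob_algebra[OF empirical_in_prob_algebra[OF N x] config_coordinate[OF x that]] .
  have sp: "space (config_kernel N (Suc n) x) = space (config N (Suc n))"
    using prob_algebra_kernelD(4)[OF config_kernel_measurable[OF N] x] .
  have "(\<integral>y. (sqrt N * ((\<integral>z. f z \<partial>empirical (E (Suc n)) N y) - (\<integral>z. f z \<partial>Phi (Suc n) (empirical (E n) N x))))\<^sup>2 \<partial>config_kernel N (Suc n) x)
    = (\<integral>y. (\<Sum>i<N. f (y i) - (\<integral>z. f z \<partial>?\<kappa> i))\<^sup>2 / N \<partial>config_kernel N (Suc n) x)"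
    by (intro Bochner_Integration.integral_cong refl)
      (simp add: config_integral_predict[OF N x f] sp power_divide)
  also have "\<dots> = (\<integral>y. (\<Sum>i<N. f (y i) - (\<integral>z. f z \<partial>?\<kappa> i))\<^sup>2 \<partial>PiM {..<N} ?\<kappa>) / N"
    by (simp add: config_kernel_def)
  also have "\<dots> \<le> (\<Sum>i<N. \<integral>z. (f z)\<^sup>2 \<partial>?\<kappa> i) / N"
    by (intro divide_right_mono prod_variance_le[where C=C])
      (use N in_space_prob_algebraD[OF \<kappa>] bounded_on_measure(1)[OF \<kappa> f] bounded_onD(2)[OF f] in auto)
  also have "\<dots> = (\<integral>z. (f z)\<^sup>2 \<partial>Phi (Suc n) (empirical (E n) N x))"
    by (rule K_average[OF N x bounded_on_power2[OF f]])
  finally show ?thesis .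
qed

lemma eta_N_history: "q \<le> n \<Longrightarrow> empirical (E q) N (history (xi N) n \<omega> q) = eta_N N q \<omega>"
  by (simp add: eta_N_def history_apply)

text \<open>The test function may depend on the particle history up to time n. The Markov property
  freezes that history, after which the estimate for deterministic functions applies; this admits
  D^N as a test function.\<close>

lemma VN_square_Suc:
  assumes N: "1 \<le> N" and f: "bounded_on (PiM {..n} (config N) \<Otimes>\<^sub>M E (Suc n)) C f"
  shows "(\<integral>\<omega>. (VN N (Suc n) (\<lambda>x. f (history (xi N) n \<omega>, x)) \<omega>)\<^sup>2 \<partial>R N)
    \<le> (\<integral>\<omega>. (\<integral>x. (f (history (xi N) n \<omega>, x))\<^sup>2 \<partial>Phi (Suc n) (eta_N N n \<omega>)) \<partial>R N)"
proof -
  let ?S = "PiM {..n} (config N)"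
  let ?J = "?S \<Otimes>\<^sub>M config N (Suc n)"
  have hs: "history (xi N) n \<omega> \<in> space ?S" if "\<omega> \<in> space (R N)" for \<omega>
    using measurable_space[OF xi_history_measurable[OF N] that] .
  let ?\<Psi> = "\<lambda>(h, y). (sqrt N * ((\<integral>z. f (h, z) \<partial>empirical (E (Suc n)) N y) - (\<integral>z. f (h, z) \<partial>Phi (Suc n) (empirical (E n) N (h n)))))\<^sup>2"
  have ky: "(\<lambda>z. empirical (E (Suc n)) N (snd z)) \<in> ?J \<rightarrow>\<^sub>M prob_algebra (E (Suc n))"
    using empirical_kernel[OF N] by measurable
  have kh: "(\<lambda>z. Phi (Suc n) (empirical (E n) N (fst z n))) \<in> ?J \<rightarrow>\<^sub>M prob_algebra (E (Suc n))"
    by (rule Phi_kernel, rule measurable_compose[OF _ empirical_kernel[OF N]]) simp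
  have fJ: "bounded_on (?J \<Otimes>\<^sub>M E (Suc n)) C (\<lambda>w. f (fst (fst w), snd w))"
    by (rule bounded_on_compose[OF f]) simp
  have "bounded_on ?J ((\<bar>sqrt N\<bar> * (C + C))\<^sup>2) (\<lambda>z. (sqrt N * ((\<integral>x. f (fst (fst (z, x)), snd (z, x)) \<partial>empirical (E (Suc n)) N (snd z))
      - (\<integral>x. f (fst (fst (z, x)), snd (z, x)) \<partial>Phi (Suc n) (empirical (E n) N (fst z n)))))\<^sup>2)"
    by (intro bounded_on_power2 bounded_on_cmult bounded_on_diff bounded_on_kernel_integral[OF ky fJ] bounded_on_kernel_integral[OF kh fJ])
  then have \<Psi>: "bounded_on ?J ((\<bar>sqrt N\<bar> * (C + C))\<^sup>2) ?\<Psi>" by (simp add: case_prod_unfold)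
  have fh: "bounded_on (E (Suc n)) C (\<lambda>x. f (h, x))" if "h \<in> space ?S" for h
    by (rule bounded_on_compose[OF f]) (use that in simp)
  have "(\<integral>\<omega>. (VN N (Suc n) (\<lambda>x. f (history (xi N) n \<omega>, x)) \<omega>)\<^sup>2 \<partial>R N) = (\<integral>\<omega>. ?\<Psi> (history (xi N) n \<omega>, xi N (Suc n) \<omega>) \<partial>R N)"
    by (simp add: VN_def predict_def eta_N_history) (simp add: eta_N_def)
  also have "\<dots> = (\<integral>\<omega>. (\<integral>y. ?\<Psi> (history (xi N) n \<omega>, y) \<partial>config_kernel N (Suc n) (xi N n \<omega>)) \<partial>R N)"
    by (rule markov_chain_integral[OF R_prob_space[OF N] chain[OF N] config_kernel_measurable[OF N] bounded_onD(1)[OF \<Psi>]])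
      (rule bounded_onD(2)[OF \<Psi>], simp add: space_pair_measure)
  also have "\<dots> \<le> (\<integral>\<omega>. (\<integral>x. (f (history (xi N) n \<omega>, x))\<^sup>2 \<partial>Phi (Suc n) (eta_N N n \<omega>)) \<partial>R N)"
  proof (rule integral_mono)
    have k: "(\<lambda>\<omega>. config_kernel N (Suc n) (xi N n \<omega>)) \<in> R N \<rightarrow>\<^sub>M prob_algebra (config N (Suc n))"
      by (rule measurable_compose[OF xi_measurable[OF N] config_kernel_measurable[OF N]])
    have "(\<lambda>z. (history (xi N) n (fst z), snd z)) \<in> R N \<Otimes>\<^sub>M config N (Suc n) \<rightarrow>\<^sub>M ?J"
      by (intro measurable_Pair measurable_compose[OF measurable_fst xi_history_measurable[OF N]] measurable_snd)
    from bounded_on_measure(2)[OF R_in_prob_algebra[OF N] bounded_on_kernel_integral[OF k bounded_on_compose[OF \<Psi> this]]]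
    show "integrable (R N) (\<lambda>\<omega>. \<integral>y. ?\<Psi> (history (xi N) n \<omega>, y) \<partial>config_kernel N (Suc n) (xi N n \<omega>))" by simp
    have "(\<lambda>z. (history (xi N) n (fst z), snd z)) \<in> R N \<Otimes>\<^sub>M E (Suc n) \<rightarrow>\<^sub>M ?S \<Otimes>\<^sub>M E (Suc n)"
      by (intro measurable_Pair measurable_compose[OF measurable_fst xi_history_measurable[OF N]] measurable_snd)
    from bounded_on_measure(2)[OF R_in_prob_algebra[OF N] bounded_on_kernel_integral[OF Phi_kernel[OF eta_N_kernel[OF N]] bounded_on_compose[OF bounded_on_power2[OF f] this]]]
    show "integrable (R N) (\<lambda>\<omega>. \<integral>x. (f (history (xi N) n \<omega>, x))\<^sup>2 \<partial>Phi (Suc n) (eta_N N n \<omega>))" by simp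
    fix \<omega> assume w: "\<omega> \<in> space (R N)"
    show "(\<integral>y. ?\<Psi> (history (xi N) n \<omega>, y) \<partial>config_kernel N (Suc n) (xi N n \<omega>)) \<le> (\<integral>x. (f (history (xi N) n \<omega>, x))\<^sup>2 \<partial>Phi (Suc n) (eta_N N n \<omega>))"
      using empirical_predict_variance[OF N measurable_space[OF xi_measurable[OF N] w] fh[OF hs[OF w]]]
      by (simp add: history_apply eta_N_def)
  qed
  finally show ?thesis .
qed

lemma VN_0_eq:
  assumes N: "1 \<le> N" and f: "bounded_on (E 0) C f" and w: "\<omega> \<in> space (R N)"
  shows "VN N 0 f \<omega> = (\<Sum>i<N. f (xi N 0 \<omega> i) - (\<integral>z. f z \<partial>eta0)) / sqrt N"
proof -
  have "sqrt N * (a / N - b) = (a - N * b) / sqrt N" for a b :: real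
    using N by (simp add: field_simps)
  then show ?thesis
    unfolding VN_def predict_def eta_N_def integral_empirical[OF N measurable_space[OF xi_measurable[OF N] w] bounded_onD(1)[OF f]]
    by (simp add: sum_subtractf)
qed

lemma eta0_sum_measurable:
  assumes "bounded_on (E 0) C f"
  shows "(\<lambda>y. (\<Sum>i<N. f (y i) - c)) \<in> borel_measurable (config N 0)"
proof -
  have "(\<lambda>y. f (y i)) \<in> borel_measurable (config N 0)" if "i < N" for i
    by (rule measurable_compose[OF _ bounded_onD(1)[OF assms]]) (use that in simp)
  then show ?thesis by (intro borel_measurable_sum borel_measurable_diff) auto
qed

lemma VN_square_0:
  assumes N: "1 \<le> N" and f: "bounded_on (E 0) C f"
  shows "(\<integral>\<omega>. (VN N 0 f \<omega>)\<^sup>2 \<partial>R N) \<le> (\<integral>x. (f x)\<^sup>2 \<partial>eta0)"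
proof -
  let ?S = "\<lambda>y. (\<Sum>i<N. f (y i) - (\<integral>z. f z \<partial>eta0))"
  note e0 = in_space_prob_algebraD[OF eta0]
  have "(\<integral>\<omega>. (VN N 0 f \<omega>)\<^sup>2 \<partial>R N) = (\<integral>\<omega>. (?S (xi N 0 \<omega>))\<^sup>2 / N \<partial>R N)"
    by (intro Bochner_Integration.integral_cong refl) (simp add: VN_0_eq[OF N f] power_divide)
  also have "\<dots> = (\<integral>y. (?S y)\<^sup>2 / N \<partial>distr (R N) (config N 0) (xi N 0))"
    using eta0_sum_measurable[OF f] by (intro integral_distr[symmetric] xi_measurable[OF N]) simp
  also have "distr (R N) (config N 0) (xi N 0) = PiM {..<N} (\<lambda>_. eta0)"
    using chain[OF N] by (simp add: markov_chain_def)
  also have "(\<integral>y. (?S y)\<^sup>2 / N \<partial>PiM {..<N} (\<lambda>_. eta0)) = (\<integral>y. (?S y)\<^sup>2 \<partial>PiM {..<N} (\<lambda>_. eta0)) / N" by simp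
  also have "\<dots> \<le> (\<Sum>i<N. \<integral>z. (f z)\<^sup>2 \<partial>eta0) / N"
    by (intro divide_right_mono prod_variance_le[where C=C])
      (use N e0 bounded_on_measure(1)[OF eta0 f] bounded_onD(2)[OF f] in auto)
  also have "\<dots> = (\<integral>x. (f x)\<^sup>2 \<partial>eta0)" using N by simp
  finally show ?thesis .
qed

end

section \<open>Mass-weighted backward functions\<close>

context dominated_feynman_kac
begin

lemma backward_cong: "(\<And>q. q < n \<Longrightarrow> \<mu> q = \<mu>' q) \<Longrightarrow> backward \<mu> n = backward \<mu>' n"
proof (induction n)
  case (Suc n)
  then have "backward \<mu> n = backward \<mu>' n" "\<mu> n = \<mu>' n" by auto
  then show ?case by (simp add: fun_eq_iff)
qed (simp add: fun_eq_iff)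

definition weighted_D :: "(nat \<Rightarrow> 'a measure) \<Rightarrow> nat \<Rightarrow> nat \<Rightarrow> ((nat \<Rightarrow> 'a) \<Rightarrow> real) \<Rightarrow> 'a \<Rightarrow> real" where
  "weighted_D \<mu> p n F x = mass \<mu> p * flow_D \<mu> p n F x"

text \<open>Predictability: only the flow strictly before \<open>p\<close> enters, the mass
  included. For \<open>p = 0\<close> the function is the same for all flows.\<close>

lemma weighted_D_cong: "(\<And>q. q < p \<Longrightarrow> \<mu> q = \<mu>' q) \<Longrightarrow> weighted_D \<mu> p n F = weighted_D \<mu>' p n F"
  using backward_cong[of p \<mu> \<mu>'] by (simp add: weighted_D_def fun_eq_iff flow_D_def bwd_def mass_def)

lemma mass_bounded_param:
  "(\<And>q. q < p \<Longrightarrow> (\<lambda>a. \<mu> a q) \<in> A \<rightarrow>\<^sub>M prob_algebra (E q)) \<Longrightarrow> bounded_on A 1 (\<lambda>a. mass (\<mu> a) p)"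
proof (induction p)
  case 0
  then show ?case using bounded_on_const[of A 1] by (simp add: mass_def)
next
  case (Suc p)
  have "bounded_on (A \<Otimes>\<^sub>M E p) 1 (\<lambda>z. G p (snd z))"
    by (rule bounded_on_compose[OF G_bounded measurable_snd])
  from bounded_on_kernel_integral[OF Suc.prems this]
  have "bounded_on A 1 (\<lambda>a. \<integral>x. G p x \<partial>\<mu> a p)" by simp
  from bounded_on_mult[OF Suc.IH this] Suc.prems show ?case by (simp add: mass_Suc)
qed

lemma weighted_D_bounded_param:
  assumes \<mu>: "\<And>q. q < p \<Longrightarrow> (\<lambda>a. \<mu> a q) \<in> A \<rightarrow>\<^sub>M prob_algebra (E q)"
    and "p \<le> n" and F: "bounded_on (PiM {..n} E) C F"
  shows "bounded_on (A \<Otimes>\<^sub>M E p) C (\<lambda>z. weighted_D (\<mu> (fst z)) p n F (snd z))"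
proof -
  have "bounded_on (A \<Otimes>\<^sub>M PiM {..p} E) C (\<lambda>z. forward_integral p n F (snd z))"
    by (rule bounded_on_compose[OF forward_integral_bounded[OF assms(2) F] measurable_snd])
  from bwd_bounded_param[of p \<mu> A, OF \<mu> this]
  have "bounded_on (A \<Otimes>\<^sub>M E p) C (\<lambda>z. flow_D (\<mu> (fst z)) p n F (snd z))"
    by (simp add: case_prod_unfold flow_D_def)
  from bounded_on_mult[OF bounded_on_compose[OF mass_bounded_param[OF \<mu>] measurable_fst[of A "E p"]] this]
  show ?thesis by (simp add: weighted_D_def)
qed

lemma weighted_D_bounded:
  assumes "\<And>q. q < p \<Longrightarrow> \<mu> q \<in> space (prob_algebra (E q))" "p \<le> n" "bounded_on (PiM {..n} E) C F"
  shows "bounded_on (E p) C (weighted_D \<mu> p n F)"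
proof -
  have "bounded_on (count_space {()} \<Otimes>\<^sub>M E p) C (\<lambda>z. weighted_D \<mu> p n F (snd z))"
    by (rule weighted_D_bounded_param[of _ "\<lambda>_. \<mu>"]) (use assms in auto)
  from bounded_on_compose[OF this, of "\<lambda>x. ((), x)" "E p"] show ?thesis by simp
qed

lemma flow_Gamma_bounded_param:
  assumes \<mu>: "\<And>q. q \<le> n \<Longrightarrow> (\<lambda>a. \<mu> a q) \<in> A \<rightarrow>\<^sub>M prob_algebra (E q)"
    and F: "bounded_on (PiM {..n} E) C F"
  shows "bounded_on A C (\<lambda>a. flow_Gamma (\<mu> a) n F)"
proof -
  have "bounded_on (A \<Otimes>\<^sub>M PiM {..n} E) C (\<lambda>z. F (snd z))"
    by (rule bounded_on_compose[OF F measurable_snd])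
  from bwd_bounded_param[of n \<mu> A, OF _ this] \<mu>
  have "bounded_on (A \<Otimes>\<^sub>M E n) C (\<lambda>z. bwd (\<mu> (fst z)) n F (snd z))"
    by (simp add: case_prod_unfold)
  from bounded_on_mult[OF mass_bounded_param[of n \<mu> A] bounded_on_kernel_integral[OF \<mu>[OF order_refl] this]] \<mu>
  show ?thesis by (simp add: flow_Gamma_def)
qed

lemma weighted_D_ratio:
  assumes \<mu>: "flow p \<mu>" and F: "bounded_on (PiM {..n} E) C F" and pn: "Suc p \<le> n" and x: "x \<in> space (E (Suc p))"
  shows "weighted_D \<mu> (Suc p) n F x = flow_Gamma \<mu> p (\<lambda>v. G p (v p))
    * flow_Gamma \<mu> p (\<lambda>v. G p (v p) * H (Suc p) (v p) x * forward_integral (Suc p) n F (v(Suc p := x)))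
    / flow_Gamma \<mu> p (\<lambda>v. G p (v p) * H (Suc p) (v p) x)"
  unfolding weighted_D_def flow_D_def by (rule bwd_Suc_ratio[OF \<mu> forward_integral_bounded[OF pn F] x])

lemma GH_path_bounded:
  assumes "x \<in> space (E (Suc p))"
  shows "bounded_on (PiM {..p} E) (hp (Suc p) x) (\<lambda>v. G p (v p) * H (Suc p) (v p) x)"
  by (rule last_coordinate_bounded[OF GH_bounded[OF assms]])

lemma flow_Gamma_GH_pos:
  assumes "flow p \<mu>" "x \<in> space (E (Suc p))"
  shows "0 < flow_Gamma \<mu> p (\<lambda>v. G p (v p) * H (Suc p) (v p) x)"
  unfolding flow_Gamma_last[OF assms(1), of "\<lambda>y. G p y * H (Suc p) y x"]
  using mass_bounds[of p \<mu>] flowD[OF assms(1)] GH_integral_pos[OF flowD[OF assms(1) order_refl] assms(2)]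
  by (intro mult_pos_pos) auto

text \<open>The domination \<Phi>(\<mu>) <= hp lam, inherited from M = H lam with H <= hp, because
  \<Phi>(\<mu>) averages the laws M(y, .). The bound does not involve \<mu>, so it holds for random
  empirical measures with a deterministic right-hand side.\<close>

lemma Phi_integral_le_hp:
  assumes \<mu>: "\<mu> \<in> space (prob_algebra (E n))" and g: "bounded_on (E (Suc n)) C g" and nn: "\<And>x. x \<in> space (E (Suc n)) \<Longrightarrow> 0 \<le> g x"
  shows "(\<integral>x. g x \<partial>Phi (Suc n) \<mu>) \<le> (\<integral>x. hp (Suc n) x * g x \<partial>lam (Suc n))"
proof -
  let ?A = "\<integral>x. hp (Suc n) x * g x \<partial>lam (Suc n)"
  have gm: "g \<in> borel_measurable (lam (Suc n))"
    using bounded_onD(1)[OF g] sets_lam by (simp cong: measurable_cong_sets)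
  have hpos: "0 < hp (Suc n) x" if "y \<in> space (E n)" "x \<in> space (E (Suc n))" for x y
    using GH_pos[OF that] GH_le_hp[OF that] by simp
  have C_hp: "integrable (lam (Suc n)) (\<lambda>x. C * hp (Suc n) x)" using hp_integrable by simp
  have dom: "integrable (lam (Suc n)) (\<lambda>x. h x * g x)"
    if h: "h \<in> borel_measurable (E (Suc n))" "\<And>x. x \<in> space (E (Suc n)) \<Longrightarrow> 0 \<le> h x \<and> h x \<le> hp (Suc n) x" for h
  proof (rule Bochner_Integration.integrable_bound[OF C_hp])
    show "(\<lambda>x. h x * g x) \<in> borel_measurable (lam (Suc n))"
      using h(1) gm sets_lam by (intro borel_measurable_times) (simp_all cong: measurable_cong_sets)
    show "AE x in lam (Suc n). norm (h x * g x) \<le> norm (C * hp (Suc n) x)"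
    proof (rule AE_I2)
      fix x assume "x \<in> space (lam (Suc n))"
      then have x: "x \<in> space (E (Suc n))" by (simp add: space_lam)
      have "h x * g x \<le> hp (Suc n) x * C"
        using h(2)[OF x] nn[OF x] bounded_onD(2)[OF g x] by (intro mult_mono) auto
      then show "norm (h x * g x) \<le> norm (C * hp (Suc n) x)" using h(2)[OF x] nn[OF x] by (simp add: mult.commute)
    qed
  qed
  \<comment> \<open>A point of \<open>E n\<close>, available because \<mu> is a probability measure,
    gives 0 < G H <= hp.\<close>
  have hp_nn: "0 \<le> hp (Suc n) x" if "x \<in> space (E (Suc n))" for x
    using hpos[OF _ that] prob_space.not_empty[OF in_space_prob_algebraD(1)[OF \<mu>]] in_space_prob_algebraD(3)[OF \<mu>]
    by (metis ex_in_conv less_imp_le)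
  have le: "(\<integral>x. g x \<partial>M (Suc n) y) \<le> ?A" if y: "y \<in> space (E n)" for y
    unfolding integral_M[OF y bounded_onD(1)[OF g]]
  proof (rule integral_mono)
    have "(\<lambda>x. H (Suc n) y x) \<in> borel_measurable (E (Suc n))"
      using measurable_compose[OF measurable_Pair1'[OF y] H_measurable[of n]] by simp
    then show "integrable (lam (Suc n)) (\<lambda>x. H (Suc n) y x * g x)"
      by (rule dom) (use H_pos[OF y] H_le_hp[OF y] in \<open>auto simp: less_imp_le\<close>)
    show "integrable (lam (Suc n)) (\<lambda>x. hp (Suc n) x * g x)"
      by (rule dom) (use hp_nn in auto)
    show "H (Suc n) y x * g x \<le> hp (Suc n) x * g x" if "x \<in> space (lam (Suc n))" for x
      using that H_le_hp[OF y] nn by (intro mult_right_mono) (auto simp: space_lam)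
  qed
  note b = bounded_on_mult[OF G_bounded M_integral_bounded[OF g]]
  have "(\<integral>y. G n y * (\<integral>x. g x \<partial>M (Suc n) y) \<partial>\<mu>) \<le> (\<integral>y. G n y * ?A \<partial>\<mu>)"
  proof (rule integral_mono)
    show "integrable \<mu> (\<lambda>y. G n y * (\<integral>x. g x \<partial>M (Suc n) y))" by (rule bounded_on_measure(2)[OF \<mu> b])
    show "integrable \<mu> (\<lambda>y. G n y * ?A)" using bounded_on_measure(2)[OF \<mu> G_bounded] by simp
    show "G n y * (\<integral>x. g x \<partial>M (Suc n) y) \<le> G n y * ?A" if "y \<in> space \<mu>" for y
      using that le G_pos by (intro mult_left_mono) (auto simp: in_space_prob_algebraD(3)[OF \<mu>] less_imp_le)
  qed
  then show ?thesis
    using G_integral_pos(1)[OF \<mu>] by (simp add: integral_Phi[OF \<mu> g] field_simps)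
qed

end

section \<open>Decomposition of the particle field and its second moments\<close>

context dominated_particle_model
begin

lemma integral_Q_N:
  assumes N: "1 \<le> N" and w: "\<omega> \<in> space (R N)" and F: "bounded_on (PiM {..n} E) C F"
  shows "(\<integral>v. F v \<partial>Q_N N n \<omega>) = (\<integral>x. bwd (eta_flow N \<omega>) n F x \<partial>eta_N N n \<omega>)"
    "Q_N N n \<omega> \<in> space (prob_algebra (PiM {..n} E))"
proof -
  have bk: "backward (eta_flow N \<omega>) n \<in> E n \<rightarrow>\<^sub>M prob_algebra (PiM {..<n} E)"
    by (rule backward_kernel_fixed) (rule eta_N_in_prob_algebra[OF N w])
  have up: "(\<lambda>(x, w). w(n := x)) \<in> E n \<Otimes>\<^sub>M PiM {..<n} E \<rightarrow>\<^sub>M PiM {..n} E"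
    unfolding case_prod_unfold by (rule measurable_fun_upd[where J="{..<n}"]) auto
  note k = measurable_distr_prob_space2[OF bk up]
  note e = eta_N_in_prob_algebra[OF N w, of n]
  show "Q_N N n \<omega> \<in> space (prob_algebra (PiM {..n} E))"
    unfolding Q_N_def using prob_space_bind'[OF e k] sets_bind'[OF e k] by (simp add: space_prob_algebra)
  show "(\<integral>v. F v \<partial>Q_N N n \<omega>) = (\<integral>x. bwd (eta_flow N \<omega>) n F x \<partial>eta_N N n \<omega>)"
    unfolding Q_N_def integral_bind_bounded[OF e k F]
  proof (rule Bochner_Integration.integral_cong[OF refl])
    fix y assume "y \<in> space (eta_N N n \<omega>)"
    then have y: "y \<in> space (E n)" using in_space_prob_algebraD(3)[OF e] by simp
    have "(\<lambda>w. w(n := y)) \<in> PiM {..<n} E \<rightarrow>\<^sub>M PiM {..n} E"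
      using y by (intro measurable_fun_upd[where J="{..<n}"]) auto
    from integral_distr_bounded[OF prob_algebra_kernelD(1)[OF bk y] this F]
    show "(\<integral>v. F v \<partial>distr (backward (eta_flow N \<omega>) n y) (PiM {..n} E) (\<lambda>w. w(n := y))) = bwd (eta_flow N \<omega>) n F y"
      by (simp add: bwd_def)
  qed
qed

lemma integral_Gamma_N:
  assumes N: "1 \<le> N" and w: "\<omega> \<in> space (R N)" and F: "bounded_on (PiM {..n} E) C F"
  shows "(\<integral>v. F v \<partial>Gamma_N N n \<omega>) = flow_Gamma (eta_flow N \<omega>) n F"
proof -
  have "gamma_N_1 N n \<omega> = mass (eta_flow N \<omega>) n" by (simp add: gamma_N_1_def mass_def)
  moreover have "0 \<le> mass (eta_flow N \<omega>) n"
    using mass_bounds[of n "eta_flow N \<omega>"] eta_N_in_prob_algebra[OF N w] by simp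
  ultimately show ?thesis
    unfolding Gamma_N_def using bounded_on_measure(1)[OF integral_Q_N(2)[OF N w F] F] integral_Q_N(1)[OF N w F]
    by (simp add: integral_scale_measure flow_Gamma_def)
qed

text \<open>The telescoping identity along the empirical flow, with the mass moved into the test
  function; this is allowed since the mass at time p is also determined by the earlier
  particles.\<close>

lemma W_Gamma_N_eq:
  assumes N: "1 \<le> N" and w: "\<omega> \<in> space (R N)" and F: "bounded_on (PiM {..n} E) C F"
  shows "W_Gamma_N n N F \<omega> = (\<Sum>p\<le>n. VN N p (weighted_D (eta_flow N \<omega>) p n F) \<omega>)"
proof -
  have "W_Gamma_N n N F \<omega> = sqrt N * (flow_Gamma (eta_flow N \<omega>) n F - FK_Gamma n F)"
    by (simp add: W_Gamma_N_def integral_Gamma_N[OF N w F])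
  then show ?thesis
    unfolding flow_Gamma_def telescoping[OF flow_eta_N[OF N w] F] sum_distrib_left
    by (simp add: VN_def weighted_D_def right_diff_distrib mult.left_commute)
qed

lemma W_Gamma_N_bounded:
  assumes N: "1 \<le> N" and F: "bounded_on (PiM {..n} E) C F"
  shows "\<exists>C'. bounded_on (R N) C' (W_Gamma_N n N F)"
proof -
  have "bounded_on (R N) (\<bar>sqrt N\<bar> * (C + \<bar>FK_Gamma n F\<bar>)) (\<lambda>\<omega>. sqrt N * (flow_Gamma (eta_flow N \<omega>) n F - FK_Gamma n F))"
    by (intro bounded_on_cmult bounded_on_diff bounded_on_const flow_Gamma_bounded_param F eta_N_kernel[OF N])
  then have "bounded_on (R N) (\<bar>sqrt N\<bar> * (C + \<bar>FK_Gamma n F\<bar>)) (W_Gamma_N n N F)"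
    by (rule bounded_on_cong[THEN iffD1, rotated]) (simp add: W_Gamma_N_def integral_Gamma_N[OF N _ F])
  then show ?thesis ..
qed

lemma VN_square_Suc_bound:
  assumes N: "1 \<le> N" and f: "bounded_on (PiM {..n} (config N) \<Otimes>\<^sub>M E (Suc n)) C f"
  shows "(\<integral>\<omega>. (VN N (Suc n) (\<lambda>x. f (history (xi N) n \<omega>, x)) \<omega>)\<^sup>2 \<partial>R N) \<le> C\<^sup>2"
proof -
  have "(\<lambda>z. (history (xi N) n (fst z), snd z)) \<in> R N \<Otimes>\<^sub>M E (Suc n) \<rightarrow>\<^sub>M PiM {..n} (config N) \<Otimes>\<^sub>M E (Suc n)"
    by (intro measurable_Pair measurable_compose[OF measurable_fst xi_history_measurable[OF N]] measurable_snd)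
  note bounded_on_kernel_integral[OF Phi_kernel[OF eta_N_kernel[OF N]] bounded_on_compose[OF bounded_on_power2[OF f] this]]
  from bounded_on_measure(3)[OF R_in_prob_algebra[OF N] this]
  have "(\<integral>\<omega>. (\<integral>x. (f (history (xi N) n \<omega>, x))\<^sup>2 \<partial>Phi (Suc n) (eta_N N n \<omega>)) \<partial>R N) \<le> C\<^sup>2" by simp
  with VN_square_Suc[OF N f] show ?thesis by simp
qed

lemma weighted_D_eta_N_history:
  "weighted_D (eta_flow N \<omega>) (Suc p) n F = weighted_D (\<lambda>q. empirical (E q) N (history (xi N) p \<omega> q)) (Suc p) n F"
  by (rule weighted_D_cong) (simp add: eta_N_history)

lemma weighted_D_history_bounded:
  assumes N: "1 \<le> N" and p: "Suc p \<le> n" and F: "bounded_on (PiM {..n} E) C F"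
  shows "bounded_on (PiM {..p} (config N) \<Otimes>\<^sub>M E (Suc p)) C
    (\<lambda>z. weighted_D (\<lambda>q. empirical (E q) N (fst z q)) (Suc p) n F (snd z))"
proof (rule weighted_D_bounded_param[OF _ p F, where \<mu>="\<lambda>h q. empirical (E q) N (h q)"])
  show "(\<lambda>h. empirical (E q) N (h q)) \<in> PiM {..p} (config N) \<rightarrow>\<^sub>M prob_algebra (E q)" if "q < Suc p" for q
    by (rule measurable_compose[OF _ empirical_kernel[OF N]]) (use that in simp)
qed

text \<open>The weighted function is bounded by C for every flow (mass at most 1, Markov backward
  kernels, sub-Markov forward kernels), so the conditional variance bound is uniform in N.\<close>

lemma VN_weighted_D_square:
  assumes N: "1 \<le> N" and pn: "p \<le> n" and F: "bounded_on (PiM {..n} E) C F"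
  shows "(\<integral>\<omega>. (VN N p (weighted_D (eta_flow N \<omega>) p n F) \<omega>)\<^sup>2 \<partial>R N) \<le> C\<^sup>2"
proof (cases p)
  case 0
  have b: "bounded_on (E 0) C (weighted_D eta 0 n F)" by (rule weighted_D_bounded[OF _ _ F]) auto
  have "weighted_D (eta_flow N \<omega>) p n F = weighted_D eta 0 n F" for \<omega>
    unfolding 0 by (rule weighted_D_cong) simp
  then show ?thesis
    using VN_square_0[OF N b] bounded_on_measure(3)[OF eta0 bounded_on_power2[OF b]] 0 by simp
next
  case (Suc m)
  show ?thesis
    using VN_square_Suc_bound[OF N weighted_D_history_bounded[OF N pn[unfolded Suc] F]]
    unfolding Suc weighted_D_eta_N_history by simp
qed

lemma VN_weighted_D_bounded:
  assumes N: "1 \<le> N" and pn: "p \<le> n" and F: "bounded_on (PiM {..n} E) C F"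
  shows "bounded_on (R N) (sqrt N * (C + C)) (\<lambda>\<omega>. VN N p (weighted_D (eta_flow N \<omega>) p n F) \<omega>)"
  using VN_bounded[OF N weighted_D_bounded_param[of p "eta_flow N", OF eta_N_kernel[OF N] pn F]] by simp

text \<open>Cauchy-Schwarz over the n + 1 local errors gives one factor n + 1, the sum of their
  second moments the other.\<close>

lemma W_Gamma_N_square:
  fixes C :: real
  assumes N: "1 \<le> N" and F: "bounded_on (PiM {..n} E) C F"
  shows "(\<integral>\<omega>. (W_Gamma_N n N F \<omega>)\<^sup>2 \<partial>R N) \<le> (real (Suc n) * C)\<^sup>2"
proof -
  let ?Y = "\<lambda>p \<omega>. VN N p (weighted_D (eta_flow N \<omega>) p n F) \<omega>"
  note Yb = bounded_on_power2[OF VN_weighted_D_bounded[OF N _ F]]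
  have Yi: "integrable (R N) (\<lambda>\<omega>. (?Y p \<omega>)\<^sup>2)" if "p \<le> n" for p
    by (rule bounded_on_measure(2)[OF R_in_prob_algebra[OF N] Yb[OF that]])
  obtain C' where W: "bounded_on (R N) C' (W_Gamma_N n N F)" using W_Gamma_N_bounded[OF N F] ..
  have "(\<integral>\<omega>. (W_Gamma_N n N F \<omega>)\<^sup>2 \<partial>R N) \<le> (\<integral>\<omega>. (\<Sum>p\<le>n. (?Y p \<omega>)\<^sup>2) * real (Suc n) \<partial>R N)"
  proof (rule integral_mono)
    show "integrable (R N) (\<lambda>\<omega>. (W_Gamma_N n N F \<omega>)\<^sup>2)"
      by (rule bounded_on_measure(2)[OF R_in_prob_algebra[OF N] bounded_on_power2[OF W]])
    show "integrable (R N) (\<lambda>\<omega>. (\<Sum>p\<le>n. (?Y p \<omega>)\<^sup>2) * real (Suc n))"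
      using Yi by (intro integrable_mult_left Bochner_Integration.integrable_sum) auto
    show "(W_Gamma_N n N F \<omega>)\<^sup>2 \<le> (\<Sum>p\<le>n. (?Y p \<omega>)\<^sup>2) * real (Suc n)" if "\<omega> \<in> space (R N)" for \<omega>
      unfolding W_Gamma_N_eq[OF N that F] using sum_squared_le_sum_of_squares[of "\<lambda>p. ?Y p \<omega>" "{..n}"] by simp
  qed
  also have "\<dots> = (\<Sum>p\<le>n. \<integral>\<omega>. (?Y p \<omega>)\<^sup>2 \<partial>R N) * Suc n"
    using Yi by (simp add: Bochner_Integration.integral_sum)
  also have "\<dots> \<le> (\<Sum>p\<le>n. C\<^sup>2) * real (Suc n)"
    by (intro mult_right_mono sum_mono VN_weighted_D_square[OF N _ F]) auto
  also have "\<dots> = (real (Suc n) * C)\<^sup>2" by (simp add: power2_eq_square)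
  finally show ?thesis .
qed

end

section \<open>Laws of large numbers\<close>

lemma bounded_on_add:
  assumes "bounded_on S C f" "bounded_on S D g"
  shows "bounded_on S (C + D) (\<lambda>x. f x + g x)"
  using assms by (auto simp: bounded_on_def intro!: borel_measurable_add abs_triangle_ineq[THEN order_trans] add_mono)

lemma tendsto_0_sandwich:
  fixes f g :: "nat \<Rightarrow> real"
  assumes "\<And>N. 1 \<le> N \<Longrightarrow> 0 \<le> f N" "\<And>N. 1 \<le> N \<Longrightarrow> f N \<le> g N" "g \<longlonglongrightarrow> 0"
  shows "f \<longlonglongrightarrow> 0"
  by (rule tendsto_sandwich[OF _ _ tendsto_const assms(3)])
    (use assms in \<open>auto intro!: eventually_sequentiallyI[of 1]\<close>)

lemma inverse_sqrt_tendsto_0: "(\<lambda>N. c / sqrt (real N)) \<longlonglongrightarrow> 0"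
  by (rule real_tendsto_divide_at_top[OF tendsto_const filterlim_compose[OF sqrt_at_top filterlim_real_sequentially]])

text \<open>Convergence in mean to a constant together with a bound uniform in N. The bound makes
  the notion stable under products and under quotients that are bounded a priori.\<close>

definition L1_conv :: "(nat \<Rightarrow> 'v measure) \<Rightarrow> (nat \<Rightarrow> 'v \<Rightarrow> real) \<Rightarrow> real \<Rightarrow> bool" where
  "L1_conv R Y c \<longleftrightarrow> (\<exists>B. \<forall>N\<ge>1. bounded_on (R N) B (Y N)) \<and> (\<lambda>N. \<integral>\<omega>. \<bar>Y N \<omega> - c\<bar> \<partial>R N) \<longlonglongrightarrow> 0"

context dominated_particle_model
begin

lemma R_integrable: "1 \<le> N \<Longrightarrow> bounded_on (R N) B f \<Longrightarrow> integrable (R N) f"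
  by (rule bounded_on_measure(2)[OF R_in_prob_algebra])

lemma L1_conv_integrable:
  assumes "L1_conv R Y c" "1 \<le> N"
  shows "integrable (R N) (\<lambda>\<omega>. \<bar>Y N \<omega> - d\<bar>)"
proof -
  obtain B where "bounded_on (R N) B (Y N)" using assms by (auto simp: L1_conv_def)
  from R_integrable[OF assms(2) bounded_on_diff[OF this bounded_on_const[of _ d]]] show ?thesis by simp
qed

text \<open>Reduces the calculus of such limits to a pointwise Lipschitz estimate; the rules for
  sums, products and quotients are instances.\<close>

lemma L1_conv_dominated:
  assumes Y: "\<And>N. 1 \<le> N \<Longrightarrow> bounded_on (R N) B (Y N)"
    and le: "\<And>N \<omega>. 1 \<le> N \<Longrightarrow> \<omega> \<in> space (R N) \<Longrightarrow> \<bar>Y N \<omega> - c\<bar> \<le> k1 * \<bar>Y1 N \<omega> - c1\<bar> + k2 * \<bar>Y2 N \<omega> - c2\<bar>"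
    and 1: "L1_conv R Y1 c1" and 2: "L1_conv R Y2 c2"
  shows "L1_conv R Y c"
proof -
  have "(\<lambda>N. \<integral>\<omega>. \<bar>Y N \<omega> - c\<bar> \<partial>R N) \<longlonglongrightarrow> 0"
  proof (rule tendsto_0_sandwich)
    fix N :: nat assume N: "1 \<le> N"
    note i1 = L1_conv_integrable[OF 1 N, of c1] and i2 = L1_conv_integrable[OF 2 N, of c2]
    have "integrable (R N) (\<lambda>\<omega>. \<bar>Y N \<omega> - c\<bar>)"
      using R_integrable[OF N bounded_on_diff[OF Y[OF N] bounded_on_const[of _ c]]] by simp
    then have "(\<integral>\<omega>. \<bar>Y N \<omega> - c\<bar> \<partial>R N) \<le> (\<integral>\<omega>. k1 * \<bar>Y1 N \<omega> - c1\<bar> + k2 * \<bar>Y2 N \<omega> - c2\<bar> \<partial>R N)"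
      using i1 i2 le[OF N] by (intro integral_mono) auto
    also have "\<dots> = k1 * (\<integral>\<omega>. \<bar>Y1 N \<omega> - c1\<bar> \<partial>R N) + k2 * (\<integral>\<omega>. \<bar>Y2 N \<omega> - c2\<bar> \<partial>R N)"
      using i1 i2 by simp
    finally show "(\<integral>\<omega>. \<bar>Y N \<omega> - c\<bar> \<partial>R N) \<le> k1 * (\<integral>\<omega>. \<bar>Y1 N \<omega> - c1\<bar> \<partial>R N) + k2 * (\<integral>\<omega>. \<bar>Y2 N \<omega> - c2\<bar> \<partial>R N)" .
  next
    have "(\<lambda>N. k1 * (\<integral>\<omega>. \<bar>Y1 N \<omega> - c1\<bar> \<partial>R N) + k2 * (\<integral>\<omega>. \<bar>Y2 N \<omega> - c2\<bar> \<partial>R N)) \<longlonglongrightarrow> k1 * 0 + k2 * 0"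
      using 1 2 by (intro tendsto_intros) (auto simp: L1_conv_def)
    then show "(\<lambda>N. k1 * (\<integral>\<omega>. \<bar>Y1 N \<omega> - c1\<bar> \<partial>R N) + k2 * (\<integral>\<omega>. \<bar>Y2 N \<omega> - c2\<bar> \<partial>R N)) \<longlonglongrightarrow> 0" by simp
  qed simp
  with Y show ?thesis unfolding L1_conv_def by blast
qed

lemma L1_conv_bounded:
  assumes "L1_conv R Y c"
  obtains B where "0 \<le> B" "\<And>N. 1 \<le> N \<Longrightarrow> bounded_on (R N) B (Y N)"
proof -
  obtain B where B: "\<And>N. 1 \<le> N \<Longrightarrow> bounded_on (R N) B (Y N)" using assms by (auto simp: L1_conv_def)
  have "bounded_on (R N) \<bar>B\<bar> (Y N)" if "1 \<le> N" for N
    using B[OF that] by (fastforce simp: bounded_on_def)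
  then show ?thesis by (intro that[of "\<bar>B\<bar>"]) auto
qed

lemma L1_conv_const: "L1_conv R (\<lambda>_ _. c) c"
  unfolding L1_conv_def by (auto intro: bounded_on_const)

lemma L1_conv_cong:
  assumes "\<And>N \<omega>. 1 \<le> N \<Longrightarrow> \<omega> \<in> space (R N) \<Longrightarrow> Y N \<omega> = Y' N \<omega>" "L1_conv R Y' c"
  shows "L1_conv R Y c"
proof -
  obtain B where B: "\<And>N. 1 \<le> N \<Longrightarrow> bounded_on (R N) B (Y' N)" using L1_conv_bounded[OF assms(2)] by blast
  show ?thesis
  proof (rule L1_conv_dominated[OF _ _ assms(2) assms(2)])
    show "bounded_on (R N) B (Y N)" if "1 \<le> N" for N
      using B[OF that] bounded_on_cong[of "R N" "Y N" "Y' N"] assms(1)[OF that] by simp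
    show "\<bar>Y N \<omega> - c\<bar> \<le> 1 * \<bar>Y' N \<omega> - c\<bar> + 0 * \<bar>Y' N \<omega> - c\<bar>" if "1 \<le> N" "\<omega> \<in> space (R N)" for N \<omega>
      using assms(1)[OF that] by simp
  qed
qed

lemma L1_conv_add:
  assumes "L1_conv R Y c" "L1_conv R Z d"
  shows "L1_conv R (\<lambda>N \<omega>. Y N \<omega> + Z N \<omega>) (c + d)"
proof -
  obtain B where B: "0 \<le> B" "\<And>N. 1 \<le> N \<Longrightarrow> bounded_on (R N) B (Y N)" using L1_conv_bounded[OF assms(1)] by blast
  obtain B' where B': "0 \<le> B'" "\<And>N. 1 \<le> N \<Longrightarrow> bounded_on (R N) B' (Z N)" using L1_conv_bounded[OF assms(2)] by blast
  show ?thesis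
  proof (rule L1_conv_dominated[OF _ _ assms])
    show "bounded_on (R N) (B + B') (\<lambda>\<omega>. Y N \<omega> + Z N \<omega>)" if "1 \<le> N" for N
      by (rule bounded_on_add[OF B(2)[OF that] B'(2)[OF that]])
    show "\<bar>Y N \<omega> + Z N \<omega> - (c + d)\<bar> \<le> 1 * \<bar>Y N \<omega> - c\<bar> + 1 * \<bar>Z N \<omega> - d\<bar>" for N \<omega>
      using abs_triangle_ineq[of "Y N \<omega> - c" "Z N \<omega> - d"] by (simp add: algebra_simps)
  qed
qed

lemma L1_conv_mult:
  assumes "L1_conv R Y c" "L1_conv R Z d"
  shows "L1_conv R (\<lambda>N \<omega>. Y N \<omega> * Z N \<omega>) (c * d)"
proof -
  obtain B where B: "0 \<le> B" "\<And>N. 1 \<le> N \<Longrightarrow> bounded_on (R N) B (Y N)" using L1_conv_bounded[OF assms(1)] by blast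
  obtain B' where B': "0 \<le> B'" "\<And>N. 1 \<le> N \<Longrightarrow> bounded_on (R N) B' (Z N)" using L1_conv_bounded[OF assms(2)] by blast
  show ?thesis
  proof (rule L1_conv_dominated[OF _ _ assms])
    show "bounded_on (R N) (B * B') (\<lambda>\<omega>. Y N \<omega> * Z N \<omega>)" if "1 \<le> N" for N
      by (rule bounded_on_mult[OF B(2)[OF that] B'(2)[OF that]])
    fix N :: nat and \<omega> assume N: "1 \<le> N" "\<omega> \<in> space (R N)"
    have Yb: "\<bar>Y N \<omega>\<bar> \<le> B" by (rule bounded_onD(2)[OF B(2)[OF N(1)] N(2)])
    have "Y N \<omega> * Z N \<omega> - c * d = d * (Y N \<omega> - c) + Y N \<omega> * (Z N \<omega> - d)" by (simp add: algebra_simps)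
    then have "\<bar>Y N \<omega> * Z N \<omega> - c * d\<bar> \<le> \<bar>d\<bar> * \<bar>Y N \<omega> - c\<bar> + \<bar>Y N \<omega>\<bar> * \<bar>Z N \<omega> - d\<bar>"
      using abs_triangle_ineq[of "d * (Y N \<omega> - c)" "Y N \<omega> * (Z N \<omega> - d)"] by (simp add: abs_mult)
    also have "\<dots> \<le> \<bar>d\<bar> * \<bar>Y N \<omega> - c\<bar> + B * \<bar>Z N \<omega> - d\<bar>" using Yb by (intro add_left_mono mult_right_mono) auto
    finally show "\<bar>Y N \<omega> * Z N \<omega> - c * d\<bar> \<le> \<bar>d\<bar> * \<bar>Y N \<omega> - c\<bar> + B * \<bar>Z N \<omega> - d\<bar>" .
  qed
qed

lemma L1_conv_cmult: "L1_conv R Y c \<Longrightarrow> L1_conv R (\<lambda>N \<omega>. k * Y N \<omega>) (k * c)"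
  by (rule L1_conv_mult[OF L1_conv_const])

lemma L1_conv_diff:
  assumes "L1_conv R Y c" "L1_conv R Z d"
  shows "L1_conv R (\<lambda>N \<omega>. Y N \<omega> - Z N \<omega>) (c - d)"
  using L1_conv_add[OF assms(1) L1_conv_cmult[OF assms(2), of "-1"]] by simp

text \<open>The estimate is \<open>\<bar>q - A / B\<bar> \<le> (\<bar>a - A\<bar> + C \<bar>b - B\<bar>) / \<bar>B\<bar>\<close>, in which only the limiting denominator occurs.\<close>

lemma L1_conv_divide:
  assumes q: "\<And>N. 1 \<le> N \<Longrightarrow> bounded_on (R N) C (q N)"
    and eq: "\<And>N \<omega>. 1 \<le> N \<Longrightarrow> \<omega> \<in> space (R N) \<Longrightarrow> a N \<omega> = q N \<omega> * b N \<omega>"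
    and a: "L1_conv R a A" and b: "L1_conv R b B" and B: "B \<noteq> 0"
  shows "L1_conv R q (A / B)"
proof (rule L1_conv_dominated[OF q _ a b])
  fix N :: nat and \<omega> assume N: "1 \<le> N" "\<omega> \<in> space (R N)"
  have qb: "\<bar>q N \<omega>\<bar> \<le> C" by (rule bounded_onD(2)[OF q[OF N(1)] N(2)])
  have "q N \<omega> - A / B = ((a N \<omega> - A) - q N \<omega> * (b N \<omega> - B)) / B"
    using B by (simp add: field_simps eq[OF N])
  then have "\<bar>q N \<omega> - A / B\<bar> = \<bar>(a N \<omega> - A) - q N \<omega> * (b N \<omega> - B)\<bar> / \<bar>B\<bar>" by simp
  also have "\<dots> \<le> (\<bar>a N \<omega> - A\<bar> + \<bar>q N \<omega>\<bar> * \<bar>b N \<omega> - B\<bar>) / \<bar>B\<bar>"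
    using abs_triangle_ineq4[of "a N \<omega> - A" "q N \<omega> * (b N \<omega> - B)"] by (intro divide_right_mono) (simp_all add: abs_mult)
  also have "\<dots> \<le> (\<bar>a N \<omega> - A\<bar> + C * \<bar>b N \<omega> - B\<bar>) / \<bar>B\<bar>"
    using qb by (intro divide_right_mono add_left_mono mult_right_mono) auto
  finally show "\<bar>q N \<omega> - A / B\<bar> \<le> (1 / \<bar>B\<bar>) * \<bar>a N \<omega> - A\<bar> + (C / \<bar>B\<bar>) * \<bar>b N \<omega> - B\<bar>"
    by (simp add: add_divide_distrib)
qed

text \<open>The error is |W| / sqrt N, and |W| <= (W^2 + 1) / 2 turns the uniform second moment into
  a uniform first moment. The rate 1 / sqrt N holds at each time separately.\<close>

lemma flow_Gamma_eta_N_L1_conv: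
  assumes F: "bounded_on (PiM {..n} E) C F"
  shows "L1_conv R (\<lambda>N \<omega>. flow_Gamma (eta_flow N \<omega>) n F) (FK_Gamma n F)"
proof -
  let ?Y = "\<lambda>N \<omega>. flow_Gamma (eta_flow N \<omega>) n F"
  have Y: "bounded_on (R N) C (?Y N)" if "1 \<le> N" for N
    by (rule flow_Gamma_bounded_param[OF eta_N_kernel[OF that] F])
  let ?D = "real (Suc n) * C"
  have "(\<lambda>N. \<integral>\<omega>. \<bar>?Y N \<omega> - FK_Gamma n F\<bar> \<partial>R N) \<longlonglongrightarrow> 0"
  proof (rule tendsto_0_sandwich)
    fix N :: nat assume N: "1 \<le> N"
    obtain C' where W: "bounded_on (R N) C' (W_Gamma_N n N F)" using W_Gamma_N_bounded[OF N F] ..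
    have Wi: "integrable (R N) (\<lambda>\<omega>. (W_Gamma_N n N F \<omega>)\<^sup>2)"
      by (rule R_integrable[OF N bounded_on_power2[OF W]])
    have Ci: "integrable (R N) (\<lambda>\<omega>. 1::real)"
      by (rule R_integrable[OF N bounded_on_const])
    have "(\<integral>\<omega>. \<bar>?Y N \<omega> - FK_Gamma n F\<bar> \<partial>R N) \<le> (\<integral>\<omega>. ((W_Gamma_N n N F \<omega>)\<^sup>2 + 1) / 2 / sqrt N \<partial>R N)"
    proof (rule integral_mono)
      show "integrable (R N) (\<lambda>\<omega>. \<bar>?Y N \<omega> - FK_Gamma n F\<bar>)"
        using R_integrable[OF N bounded_on_diff[OF Y[OF N] bounded_on_const]] by simp
      show "integrable (R N) (\<lambda>\<omega>. ((W_Gamma_N n N F \<omega>)\<^sup>2 + 1) / 2 / sqrt N)"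
        using Wi Ci by simp
      fix \<omega> assume w: "\<omega> \<in> space (R N)"
      let ?w = "W_Gamma_N n N F \<omega>"
      have "\<bar>?w\<bar> = sqrt N * \<bar>?Y N \<omega> - FK_Gamma n F\<bar>"
        by (simp add: W_Gamma_N_def integral_Gamma_N[OF N w F] abs_mult)
      then have "\<bar>?Y N \<omega> - FK_Gamma n F\<bar> = \<bar>?w\<bar> / sqrt N" using N by simp
      also have "\<bar>?w\<bar> \<le> (?w\<^sup>2 + 1) / 2"
        using zero_le_power2[of "\<bar>?w\<bar> - 1"] by (simp add: power2_eq_square algebra_simps)
      finally show "\<bar>?Y N \<omega> - FK_Gamma n F\<bar> \<le> (?w\<^sup>2 + 1) / 2 / sqrt N"
        by (simp add: divide_right_mono)
    qed
    also have "\<dots> = ((\<integral>\<omega>. (W_Gamma_N n N F \<omega>)\<^sup>2 \<partial>R N) + 1) / 2 / sqrt N"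
      using Wi Ci by (simp add: prob_space.prob_space[OF R_prob_space[OF N]])
    also have "\<dots> \<le> (?D\<^sup>2 + 1) / 2 / sqrt N"
      using W_Gamma_N_square[OF N F] by (intro divide_right_mono) auto
    finally show "(\<integral>\<omega>. \<bar>?Y N \<omega> - FK_Gamma n F\<bar> \<partial>R N) \<le> (?D\<^sup>2 + 1) / 2 / sqrt N" .
  next
    show "(\<lambda>N. (?D\<^sup>2 + 1) / 2 / sqrt N) \<longlonglongrightarrow> 0" by (rule inverse_sqrt_tendsto_0)
  qed simp
  with Y show ?thesis unfolding L1_conv_def by blast
qed

lemma mass_eta_N_L1_conv: "L1_conv R (\<lambda>N \<omega>. mass (eta_flow N \<omega>) n) (FK_gamma n (\<lambda>_. 1))"
proof (rule L1_conv_cong)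
  show "L1_conv R (\<lambda>N \<omega>. flow_Gamma (eta_flow N \<omega>) n (\<lambda>_. 1)) (FK_gamma n (\<lambda>_. 1))"
    unfolding FK_gamma_eq by (rule flow_Gamma_eta_N_L1_conv[OF bounded_on_const])
  fix N :: nat and \<omega> assume "1 \<le> N" "\<omega> \<in> space (R N)"
  then show "mass (eta_flow N \<omega>) n = flow_Gamma (eta_flow N \<omega>) n (\<lambda>_. 1)"
    using flow_Gamma_last[OF flow_eta_N, of N \<omega> n "\<lambda>_. 1"] in_space_prob_algebraD(1)[OF eta_N_in_prob_algebra]
    by (simp add: prob_space.prob_space)
qed

lemma eta_N_integral_bounded:
  assumes "1 \<le> N" "bounded_on (E n) C f"
  shows "bounded_on (R N) C (\<lambda>\<omega>. \<integral>x. f x \<partial>eta_N N n \<omega>)"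
  using bounded_on_kernel_integral[OF eta_N_kernel[OF assms(1)] bounded_on_compose[OF assms(2) measurable_snd]] by simp

text \<open>A normalised integral is the quotient of an unnormalised one by the total mass; it is
  bounded by C in advance, so only positivity of \<gamma>_n(1) matters.\<close>

lemma eta_N_L1_conv:
  assumes f: "bounded_on (E n) C f"
  shows "L1_conv R (\<lambda>N \<omega>. \<integral>x. f x \<partial>eta_N N n \<omega>) (\<integral>x. f x \<partial>eta n)"
  unfolding integral_eta[OF bounded_onD(1)[OF f]] FK_gamma_eq[of n f]
proof (rule L1_conv_divide[OF eta_N_integral_bounded[OF _ f] _ flow_Gamma_eta_N_L1_conv[OF last_coordinate_bounded[OF f]] mass_eta_N_L1_conv])
  show "flow_Gamma (eta_flow N \<omega>) n (\<lambda>v. f (v n)) = (\<integral>x. f x \<partial>eta_N N n \<omega>) * mass (eta_flow N \<omega>) n"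
    if "1 \<le> N" "\<omega> \<in> space (R N)" for N \<omega>
    using flow_Gamma_last[OF flow_eta_N[OF that], of n f] by simp
qed (use FK_gamma_1_pos[of n] in auto)

lemma Phi_eta_N_L1_conv:
  assumes f: "bounded_on (E (Suc n)) C f"
  shows "L1_conv R (\<lambda>N \<omega>. \<integral>x. f x \<partial>Phi (Suc n) (eta_N N n \<omega>)) (\<integral>x. f x \<partial>Phi (Suc n) (eta n))"
  unfolding integral_Phi[OF eta_in_prob_algebra f]
proof (rule L1_conv_divide[OF _ _ eta_N_L1_conv[OF bounded_on_mult[OF G_bounded M_integral_bounded[OF f]]] eta_N_L1_conv[OF G_bounded]])
  show "bounded_on (R N) C (\<lambda>\<omega>. \<integral>x. f x \<partial>Phi (Suc n) (eta_N N n \<omega>))" if "1 \<le> N" for N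
    using bounded_on_kernel_integral[OF Phi_kernel[OF eta_N_kernel[OF that]] bounded_on_compose[OF f measurable_snd]] by simp
  show "(\<integral>x. G n x * (\<integral>y. f y \<partial>M (Suc n) x) \<partial>eta_N N n \<omega>) = (\<integral>x. f x \<partial>Phi (Suc n) (eta_N N n \<omega>)) * (\<integral>x. G n x \<partial>eta_N N n \<omega>)"
    if "1 \<le> N" "\<omega> \<in> space (R N)" for N \<omega>
    unfolding integral_Phi[OF eta_N_in_prob_algebra[OF that] f]
    using G_integral_pos(1)[OF eta_N_in_prob_algebra[OF that], of n] by simp
qed (use G_integral_pos(1)[OF eta_in_prob_algebra, of n] in auto)

lemma weighted_D_eta_N_bounded:
  assumes "1 \<le> N" "p \<le> n" "bounded_on (PiM {..n} E) C F"
  shows "bounded_on (R N \<Otimes>\<^sub>M E p) C (\<lambda>z. weighted_D (eta_flow N (fst z)) p n F (snd z))"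
  by (rule weighted_D_bounded_param[OF eta_N_kernel[OF assms(1)] assms(2,3)])

text \<open>The ratio formula holds along both flows, and its three entries converge. The random
  denominator at x may be arbitrarily small, but the quotient never exceeds C, so only the limiting
  denominator has to be nonzero. Convergence is for each x separately, as all constants depend on x
  through the envelope.\<close>

lemma weighted_D_L1_conv:
  assumes F: "bounded_on (PiM {..n} E) C F" and p: "Suc p \<le> n" and x: "x \<in> space (E (Suc p))"
  shows "L1_conv R (\<lambda>N \<omega>. weighted_D (eta_flow N \<omega>) (Suc p) n F x) (weighted_D eta (Suc p) n F x)"
proof -
  let ?F = "\<lambda>v. G p (v p) * H (Suc p) (v p) x * forward_integral (Suc p) n F (v(Suc p := x))"
  let ?GH = "\<lambda>v. G p (v p) * H (Suc p) (v p) x"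
  have "(\<lambda>v. v(Suc p := x)) \<in> PiM {..p} E \<rightarrow>\<^sub>M PiM {..Suc p} E"
    using x by (intro measurable_fun_upd[where J="{..p}"]) auto
  note Fb = bounded_on_mult[OF GH_path_bounded[OF x] bounded_on_compose[OF forward_integral_bounded[OF p F] this]]
  note Gb = last_coordinate_bounded[OF G_bounded[of p]]
  have lim: "weighted_D eta (Suc p) n F x = FK_Gamma p (\<lambda>v. G p (v p)) * FK_Gamma p ?F / FK_Gamma p ?GH"
    unfolding weighted_D_ratio[OF flow_eta F p x] flow_Gamma_eta[OF Fb] flow_Gamma_eta[OF Gb] flow_Gamma_eta[OF GH_path_bounded[OF x]] ..
  show ?thesis unfolding lim
  proof (rule L1_conv_divide[OF _ _ L1_conv_mult[OF flow_Gamma_eta_N_L1_conv[OF Gb] flow_Gamma_eta_N_L1_conv[OF Fb]] flow_Gamma_eta_N_L1_conv[OF GH_path_bounded[OF x]]])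
    show "bounded_on (R N) C (\<lambda>\<omega>. weighted_D (eta_flow N \<omega>) (Suc p) n F x)" if "1 \<le> N" for N
      using bounded_on_compose[OF weighted_D_eta_N_bounded[OF that p F], of "\<lambda>\<omega>. (\<omega>, x)" "R N"] x by simp
    show "flow_Gamma (eta_flow N \<omega>) p (\<lambda>v. G p (v p)) * flow_Gamma (eta_flow N \<omega>) p ?F
      = weighted_D (eta_flow N \<omega>) (Suc p) n F x * flow_Gamma (eta_flow N \<omega>) p ?GH" if "1 \<le> N" "\<omega> \<in> space (R N)" for N \<omega>
      unfolding weighted_D_ratio[OF flow_eta_N[OF that] F p x]
      using flow_Gamma_GH_pos[OF flow_eta_N[OF that] x] by simp
    show "FK_Gamma p ?GH \<noteq> 0"
      using flow_Gamma_GH_pos[OF flow_eta x] flow_Gamma_eta[OF GH_path_bounded[OF x]] by simp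
  qed
qed

section \<open>Conditional variances of the particle transitions\<close>

definition step_variance :: "nat \<Rightarrow> 'a measure \<Rightarrow> ('a \<Rightarrow> real) \<Rightarrow> real" where
  "step_variance n \<mu> f = (\<integral>x. var_of (K (Suc n) \<mu> x) f \<partial>\<mu>)"

text \<open>Both the measure and the transition \<open>K\<close> depend on \<mu>. Since
  \<open>K\<close> is an affine mixture of \<open>M\<close> and \<Phi>(\<mu>), the variance is a
  polynomial in integrals of fixed functions under \<mu> and \<Phi>(\<mu>), to which the law of
  large numbers applies.\<close>

lemma step_variance_expand:
  assumes \<mu>: "\<mu> \<in> space (prob_algebra (E n))" and f: "bounded_on (E (Suc n)) C f"
  defines "a \<equiv> \<lambda>x. eps n * G n x" and "m1 \<equiv> \<lambda>x. \<integral>y. f y \<partial>M (Suc n) x" and "m2 \<equiv> \<lambda>x. \<integral>y. (f y)\<^sup>2 \<partial>M (Suc n) x"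
  defines "p1 \<equiv> (\<integral>y. f y \<partial>Phi (Suc n) \<mu>)" and "p2 \<equiv> (\<integral>y. (f y)\<^sup>2 \<partial>Phi (Suc n) \<mu>)"
  shows "step_variance n \<mu> f = (\<integral>x. a x * m2 x \<partial>\<mu>) + (\<integral>x. 1 - a x \<partial>\<mu>) * p2
    - ((\<integral>x. (a x * m1 x)\<^sup>2 \<partial>\<mu>) + 2 * p1 * (\<integral>x. (1 - a x) * (a x * m1 x) \<partial>\<mu>) + p1\<^sup>2 * (\<integral>x. (1 - a x)\<^sup>2 \<partial>\<mu>))"
proof -
  note f2 = bounded_on_power2[OF f]
  have a: "bounded_on (E n) (\<bar>eps n\<bar> * 1) a" unfolding a_def by (rule bounded_on_cmult[OF G_bounded])
  have m1: "bounded_on (E n) C m1" unfolding m1_def by (rule M_integral_bounded[OF f])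
  have m2: "bounded_on (E n) (C\<^sup>2) m2" unfolding m2_def by (rule M_integral_bounded[OF f2])
  have a': "bounded_on (E n) (\<bar>1\<bar> + \<bar>eps n\<bar> * 1) (\<lambda>x. 1 - a x)" by (intro bounded_on_diff bounded_on_const a)
  note i1 = bounded_on_measure(2)[OF \<mu> bounded_on_mult[OF a m2]]
  note i2 = bounded_on_measure(2)[OF \<mu> a']
  note i3 = bounded_on_measure(2)[OF \<mu> bounded_on_power2[OF bounded_on_mult[OF a m1]]]
  note i4 = bounded_on_measure(2)[OF \<mu> bounded_on_mult[OF a' bounded_on_mult[OF a m1]]]
  note i5 = bounded_on_measure(2)[OF \<mu> bounded_on_power2[OF a']]
  have "step_variance n \<mu> f = (\<integral>x. (a x * m2 x + (1 - a x) * p2)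
      - ((a x * m1 x)\<^sup>2 + 2 * p1 * ((1 - a x) * (a x * m1 x)) + p1\<^sup>2 * (1 - a x)\<^sup>2) \<partial>\<mu>)"
    unfolding step_variance_def
  proof (rule Bochner_Integration.integral_cong[OF refl])
    fix x assume "x \<in> space \<mu>"
    then have x: "x \<in> space (E n)" by (simp add: in_space_prob_algebraD(3)[OF \<mu>])
    note Kx = K_in_prob_algebra[OF \<mu> x]
    have "var_of (K (Suc n) \<mu> x) f = (\<integral>y. (f y)\<^sup>2 \<partial>K (Suc n) \<mu> x) - (\<integral>y. f y \<partial>K (Suc n) \<mu> x)\<^sup>2"
      by (rule var_of_eq[OF in_space_prob_algebraD(1)[OF Kx] bounded_on_measure(1)[OF Kx f], of C])
        (use bounded_onD(2)[OF f] in_space_prob_algebraD(3)[OF Kx] in auto)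
    also have "\<dots> = (a x * m2 x + (1 - a x) * p2) - (a x * m1 x + (1 - a x) * p1)\<^sup>2"
      unfolding integral_K[OF \<mu> x f] integral_K[OF \<mu> x f2] a_def m1_def m2_def p1_def p2_def ..
    finally show "var_of (K (Suc n) \<mu> x) f = (a x * m2 x + (1 - a x) * p2)
      - ((a x * m1 x)\<^sup>2 + 2 * p1 * ((1 - a x) * (a x * m1 x)) + p1\<^sup>2 * (1 - a x)\<^sup>2)"
      by (simp add: power2_eq_square algebra_simps)
  qed
  then show ?thesis using i1 i2 i3 i4 i5 by simp
qed

lemma step_variance_L1_conv:
  assumes f: "bounded_on (E (Suc n)) C f"
  shows "L1_conv R (\<lambda>N \<omega>. step_variance n (eta_N N n \<omega>) f) (step_variance n (eta n) f)"
proof (rule L1_conv_cong[OF step_variance_expand[OF eta_N_in_prob_algebra f]])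
  note f2 = bounded_on_power2[OF f]
  have a: "bounded_on (E n) (\<bar>eps n\<bar> * 1) (\<lambda>x. eps n * G n x)" by (rule bounded_on_cmult[OF G_bounded])
  note m1 = M_integral_bounded[OF f] and m2 = M_integral_bounded[OF f2]
  have a': "bounded_on (E n) (\<bar>1\<bar> + \<bar>eps n\<bar> * 1) (\<lambda>x. 1 - eps n * G n x)" by (intro bounded_on_diff bounded_on_const a)
  note c = eta_N_L1_conv[OF bounded_on_mult[OF a m2]] eta_N_L1_conv[OF a']
    eta_N_L1_conv[OF bounded_on_power2[OF bounded_on_mult[OF a m1]]]
    eta_N_L1_conv[OF bounded_on_mult[OF a' bounded_on_mult[OF a m1]]]
    eta_N_L1_conv[OF bounded_on_power2[OF a']] Phi_eta_N_L1_conv[OF f] Phi_eta_N_L1_conv[OF f2]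
  show "L1_conv R (\<lambda>N \<omega>. (\<integral>x. eps n * G n x * (\<integral>y. (f y)\<^sup>2 \<partial>M (Suc n) x) \<partial>eta_N N n \<omega>) + (\<integral>x. 1 - eps n * G n x \<partial>eta_N N n \<omega>) * (\<integral>y. (f y)\<^sup>2 \<partial>Phi (Suc n) (eta_N N n \<omega>))
    - ((\<integral>x. (eps n * G n x * (\<integral>y. f y \<partial>M (Suc n) x))\<^sup>2 \<partial>eta_N N n \<omega>)
      + 2 * (\<integral>y. f y \<partial>Phi (Suc n) (eta_N N n \<omega>)) * (\<integral>x. (1 - eps n * G n x) * (eps n * G n x * (\<integral>y. f y \<partial>M (Suc n) x)) \<partial>eta_N N n \<omega>)
      + (\<integral>y. f y \<partial>Phi (Suc n) (eta_N N n \<omega>))\<^sup>2 * (\<integral>x. (1 - eps n * G n x)\<^sup>2 \<partial>eta_N N n \<omega>))) (step_variance n (eta n) f)"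
    unfolding step_variance_expand[OF eta_in_prob_algebra f] power2_eq_square[of "\<integral>y. f y \<partial>Phi (Suc n) _"]
    by (intro L1_conv_add L1_conv_diff L1_conv_mult L1_conv_cmult c)
qed

end

section \<open>The central limit theorem for the local errors\<close>

lemma exp_minus_Lipschitz:
  assumes "0 \<le> x" "0 \<le> (y::real)"
  shows "\<bar>exp (- x) - exp (- y)\<bar> \<le> \<bar>x - y\<bar>"
proof -
  have *: "\<bar>exp (- x) - exp (- y)\<bar> \<le> \<bar>x - y\<bar>" if "0 \<le> x" "x \<le> y" for x y :: real
  proof -
    have "exp (- x) - exp (- y) = exp (- x) * (1 - exp (x - y))" by (simp add: algebra_simps exp_add[symmetric])
    also have "\<dots> \<le> 1 * (y - x)"
    proof (rule mult_mono)
      show "1 - exp (x - y) \<le> y - x" using exp_ge_add_one_self[of "x - y"] by linarith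
    qed (use that in auto)
    finally show ?thesis using that by simp
  qed
  show ?thesis using *[of x y] *[of y x] assms by (cases "x \<le> y") (auto simp: abs_minus_commute)
qed

lemma cmod_iexp_diff: "cmod (iexp a - iexp b) \<le> \<bar>a - b\<bar>"
proof -
  have "iexp a - iexp b = iexp b * (iexp (a - b) - 1)" by (simp add: algebra_simps exp_add[symmetric])
  then have "cmod (iexp a - iexp b) = cmod (iexp (a - b) - 1)" by (simp add: norm_mult)
  also have "\<dots> \<le> \<bar>a - b\<bar>" using iexp_approx1[of "a - b" 0] by simp
  finally show ?thesis .
qed

text \<open>Nonnegativity of the variance of |f|.\<close>

lemma expectation_abs_le_sqrt:
  assumes "prob_space M" "f \<in> borel_measurable M" "\<And>x. x \<in> space M \<Longrightarrow> \<bar>f x\<bar> \<le> C"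
  shows "(\<integral>x. \<bar>f x\<bar> \<partial>M) \<le> sqrt (\<integral>x. (f x)\<^sup>2 \<partial>M)"
proof -
  have "0 \<le> var_of M (\<lambda>x. \<bar>f x\<bar>)" unfolding var_of_def by simp
  then have "(\<integral>x. \<bar>f x\<bar> \<partial>M)\<^sup>2 \<le> (\<integral>x. (f x)\<^sup>2 \<partial>M)"
    using var_of_eq[OF assms(1), of "\<lambda>x. \<bar>f x\<bar>" C] assms by simp
  then show ?thesis by (rule real_le_rsqrt)
qed

section \<open>Replacing the random test functions by their limits\<close>

context dominated_particle_model
begin

text \<open>Let \<delta> be the difference of the two weighted functions. The conditional variance
  bound and \<Phi>(\<eta>^N) <= hp lam give, by Fubini, at most the integral of hp(x)
  E(\<delta>(x)^2) under \<open>lam\<close>. For each x the expectation tends to 0, and hp(x) (2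
  C)^2 dominates.\<close>

lemma remainder_tendsto_0:
  assumes F: "bounded_on (PiM {..n} E) C F" and pn: "p \<le> n"
  shows "(\<lambda>N. \<integral>\<omega>. (VN N p (\<lambda>x. weighted_D (eta_flow N \<omega>) p n F x - weighted_D eta p n F x) \<omega>)\<^sup>2 \<partial>R N) \<longlonglongrightarrow> 0"
proof (cases p)
  case 0
  \<comment> \<open>At time 0 no earlier particles enter, so the two functions coincide and there is
    nothing to estimate.\<close>
  have "weighted_D (eta_flow N \<omega>) p n F = weighted_D eta p n F" for N \<omega>
    unfolding 0 by (rule weighted_D_cong) simp
  then show ?thesis by (simp add: VN_def)
next
  case (Suc m)
  have mn: "Suc m \<le> n" using pn Suc by simp
  let ?\<delta> = "\<lambda>N \<omega> x. weighted_D (eta_flow N \<omega>) (Suc m) n F x - weighted_D eta (Suc m) n F x"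
  let ?b = "\<lambda>N x. \<integral>\<omega>. (?\<delta> N \<omega> x)\<^sup>2 \<partial>R N"
  let ?L = "lam (Suc m)"
  have wb: "bounded_on (E (Suc m)) C (weighted_D eta (Suc m) n F)"
    by (rule weighted_D_bounded[OF _ mn F]) (rule eta_in_prob_algebra)
  obtain x0 where "x0 \<in> space (E (Suc m))"
    using prob_space.not_empty[OF in_space_prob_algebraD(1)[OF eta_in_prob_algebra[of "Suc m"]]]
      in_space_prob_algebraD(3)[OF eta_in_prob_algebra[of "Suc m"]] by auto
  then have C: "0 \<le> C" using bounded_onD(2)[OF wb] abs_ge_zero order_trans by blast
  have \<delta>b: "bounded_on (R N \<Otimes>\<^sub>M E (Suc m)) (C + C) (\<lambda>z. ?\<delta> N (fst z) (snd z))" if "1 \<le> N" for N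
    by (intro bounded_on_diff weighted_D_eta_N_bounded[OF that mn F] bounded_on_compose[OF wb measurable_snd])
  have \<delta>2b: "bounded_on (R N \<Otimes>\<^sub>M E (Suc m)) ((C + C)\<^sup>2) (\<lambda>z. (?\<delta> N (fst z) (snd z))\<^sup>2)" if "1 \<le> N" for N
    by (rule bounded_on_power2[OF \<delta>b[OF that]])
  have bb: "bounded_on (E (Suc m)) ((C + C)\<^sup>2) (?b N)" if "1 \<le> N" for N
  proof -
    have "(\<lambda>z. (snd z, fst z)) \<in> E (Suc m) \<Otimes>\<^sub>M R N \<rightarrow>\<^sub>M R N \<Otimes>\<^sub>M E (Suc m)" by simp
    from bounded_on_kernel_integral[OF const_kernel[OF R_in_prob_algebra[OF that]] bounded_on_compose[OF \<delta>2b[OF that] this]]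
    show ?thesis by simp
  qed
  have hp_nn: "0 \<le> hp (Suc m) x" if "x \<in> space (E (Suc m))" for x
  proof -
    obtain y where "y \<in> space (E m)"
      using prob_space.not_empty[OF in_space_prob_algebraD(1)[OF eta_in_prob_algebra[of m]]]
        in_space_prob_algebraD(3)[OF eta_in_prob_algebra[of m]] by auto
    then show ?thesis using GH_pos[of y m x] GH_le_hp[of y m x] that by simp
  qed
  have hpb_int: "integrable ?L (\<lambda>x. hp (Suc m) x * (C + C)\<^sup>2)" using hp_integrable by simp
  have hp_m: "hp (Suc m) \<in> borel_measurable ?L" using hp_integrable by auto
  have b_m: "?b N \<in> borel_measurable ?L" if "1 \<le> N" for N
    using bounded_onD(1)[OF bb[OF that]] sets_lam by (simp cong: measurable_cong_sets)
  have main: "(\<integral>\<omega>. (VN N (Suc m) (\<lambda>x. ?\<delta> N \<omega> x) \<omega>)\<^sup>2 \<partial>R N) \<le> (\<integral>x. hp (Suc m) x * ?b N x \<partial>?L)" if N: "1 \<le> N" for N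
  proof -
    interpret pair_sigma_finite "R N" ?L
      using R_prob_space[OF N] lam_sigma_finite by (simp add: pair_sigma_finite_def prob_space_imp_sigma_finite)
    let ?f = "\<lambda>z. weighted_D (\<lambda>q. empirical (E q) N (fst z q)) (Suc m) n F (snd z) - weighted_D eta (Suc m) n F (snd z)"
    have f: "bounded_on (PiM {..m} (config N) \<Otimes>\<^sub>M E (Suc m)) (C + C) ?f"
      by (intro bounded_on_diff weighted_D_history_bounded[OF N mn F] bounded_on_compose[OF wb measurable_snd])
    have fe: "?f (history (xi N) m \<omega>, x) = ?\<delta> N \<omega> x" for \<omega> x
      by (simp add: weighted_D_eta_N_history[symmetric])
    have hp2: "(\<lambda>z. hp (Suc m) (snd z) * (C + C)\<^sup>2) \<in> borel_measurable (R N \<Otimes>\<^sub>M ?L)"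
      by (intro borel_measurable_times borel_measurable_const measurable_compose[OF measurable_snd hp_m])
    have i1: "integrable (R N \<Otimes>\<^sub>M ?L) (\<lambda>z. hp (Suc m) (snd z) * (C + C)\<^sup>2)"
    proof (rule Fubini_integrable[OF hp2])
      show "integrable (R N) (\<lambda>x. \<integral>y. norm (hp (Suc m) (snd (x, y)) * (C + C)\<^sup>2) \<partial>?L)"
        using finite_measure.integrable_const[OF prob_space.finite_measure[OF R_prob_space[OF N]]] by simp
      show "AE x in R N. integrable ?L (\<lambda>y. hp (Suc m) (snd (x, y)) * (C + C)\<^sup>2)" using hpb_int by simp
    qed
    have m2: "(\<lambda>z. hp (Suc m) (snd z) * (?\<delta> N (fst z) (snd z))\<^sup>2) \<in> borel_measurable (R N \<Otimes>\<^sub>M ?L)"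
    proof (rule borel_measurable_times)
      show "(\<lambda>z. (?\<delta> N (fst z) (snd z))\<^sup>2) \<in> borel_measurable (R N \<Otimes>\<^sub>M ?L)"
        using bounded_onD(1)[OF \<delta>2b[OF N]] sets_lam by (simp cong: measurable_cong_sets sets_pair_measure_cong)
    qed (rule measurable_compose[OF measurable_snd hp_m])
    have i2: "integrable (R N \<Otimes>\<^sub>M ?L) (\<lambda>z. hp (Suc m) (snd z) * (?\<delta> N (fst z) (snd z))\<^sup>2)"
    proof (rule Bochner_Integration.integrable_bound[OF i1 m2], rule AE_I2)
      fix z assume "z \<in> space (R N \<Otimes>\<^sub>M ?L)"
      then have z: "z \<in> space (R N \<Otimes>\<^sub>M E (Suc m))" "snd z \<in> space (E (Suc m))"
        by (auto simp: space_pair_measure space_lam)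
      have "hp (Suc m) (snd z) * (?\<delta> N (fst z) (snd z))\<^sup>2 \<le> hp (Suc m) (snd z) * (C + C)\<^sup>2"
        using bounded_onD(2)[OF \<delta>2b[OF N] z(1)] hp_nn[OF z(2)] by (intro mult_left_mono) auto
      then show "norm (hp (Suc m) (snd z) * (?\<delta> N (fst z) (snd z))\<^sup>2) \<le> norm (hp (Suc m) (snd z) * (C + C)\<^sup>2)"
        using hp_nn[OF z(2)] by (simp add: abs_mult)
    qed
    have "(\<integral>\<omega>. (VN N (Suc m) (\<lambda>x. ?\<delta> N \<omega> x) \<omega>)\<^sup>2 \<partial>R N) \<le> (\<integral>\<omega>. (\<integral>x. (?\<delta> N \<omega> x)\<^sup>2 \<partial>Phi (Suc m) (eta_N N m \<omega>)) \<partial>R N)"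
      using VN_square_Suc[OF N f] unfolding fe .
    also have "\<dots> \<le> (\<integral>\<omega>. (\<integral>x. hp (Suc m) x * (?\<delta> N \<omega> x)\<^sup>2 \<partial>?L) \<partial>R N)"
    proof (rule integral_mono)
      show "integrable (R N) (\<lambda>\<omega>. \<integral>x. (?\<delta> N \<omega> x)\<^sup>2 \<partial>Phi (Suc m) (eta_N N m \<omega>))"
        using R_integrable[OF N bounded_on_kernel_integral[OF Phi_kernel[OF eta_N_kernel[OF N]] \<delta>2b[OF N]]] by simp
      show "integrable (R N) (\<lambda>\<omega>. \<integral>x. hp (Suc m) x * (?\<delta> N \<omega> x)\<^sup>2 \<partial>?L)"
        using integrable_fst'[OF i2] by simp
      show "(\<integral>x. (?\<delta> N \<omega> x)\<^sup>2 \<partial>Phi (Suc m) (eta_N N m \<omega>)) \<le> (\<integral>x. hp (Suc m) x * (?\<delta> N \<omega> x)\<^sup>2 \<partial>?L)" if w: "\<omega> \<in> space (R N)" for \<omega>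
      proof (rule Phi_integral_le_hp[OF eta_N_in_prob_algebra[OF N w]])
        show "bounded_on (E (Suc m)) ((C + C)\<^sup>2) (\<lambda>x. (?\<delta> N \<omega> x)\<^sup>2)"
          using bounded_on_compose[OF \<delta>2b[OF N], of "\<lambda>x. (\<omega>, x)" "E (Suc m)"] w by simp
      qed simp
    qed
    also have "\<dots> = (\<integral>x. hp (Suc m) x * ?b N x \<partial>?L)"
      using Fubini_integral[of "\<lambda>\<omega> x. hp (Suc m) x * (?\<delta> N \<omega> x)\<^sup>2"] i2 by (simp add: case_prod_unfold)
    finally show ?thesis .
  qed
  \<comment> \<open>The index is shifted because \<open>R N\<close> is a probability space only from
    N = 1 on, while dominated convergence asks for every index.\<close>
  have "(\<lambda>N. \<integral>x. hp (Suc m) x * ?b (Suc N) x \<partial>?L) \<longlonglongrightarrow> (\<integral>x. 0 \<partial>?L)"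
  proof (rule integral_dominated_convergence[OF _ _ hpb_int])
    show "(\<lambda>x. hp (Suc m) x * ?b (Suc N) x) \<in> borel_measurable ?L" for N
      using hp_m b_m[of "Suc N"] by simp
    show "AE x in ?L. norm (hp (Suc m) x * ?b (Suc N) x) \<le> hp (Suc m) x * (C + C)\<^sup>2" for N
    proof (rule AE_I2)
      fix x assume "x \<in> space ?L"
      then have x: "x \<in> space (E (Suc m))" by (simp add: space_lam)
      show "norm (hp (Suc m) x * ?b (Suc N) x) \<le> hp (Suc m) x * (C + C)\<^sup>2"
        unfolding norm_mult using hp_nn[OF x] bounded_onD(2)[OF bb[of "Suc N"] x] by (intro mult_mono) auto
    qed
    show "AE x in ?L. (\<lambda>N. hp (Suc m) x * ?b (Suc N) x) \<longlonglongrightarrow> 0"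
    proof (rule AE_I2)
      fix x assume "x \<in> space ?L"
      then have x: "x \<in> space (E (Suc m))" by (simp add: space_lam)
      note L1 = weighted_D_L1_conv[OF F mn x]
      have "(\<lambda>N. ?b N x) \<longlonglongrightarrow> 0"
      proof (rule tendsto_0_sandwich)
        fix N :: nat assume N: "1 \<le> N"
        have d: "bounded_on (R N) (C + C) (\<lambda>\<omega>. ?\<delta> N \<omega> x)"
          using bounded_on_compose[OF \<delta>b[OF N], of "\<lambda>\<omega>. (\<omega>, x)" "R N"] x by simp
        \<comment> \<open>Since |\<delta>| <= 2 C, convergence in mean already gives convergence of
          second moments.\<close>
        have "?b N x \<le> (\<integral>\<omega>. (C + C) * \<bar>?\<delta> N \<omega> x\<bar> \<partial>R N)"
        proof (rule integral_mono)
          show "integrable (R N) (\<lambda>\<omega>. (?\<delta> N \<omega> x)\<^sup>2)" by (rule R_integrable[OF N bounded_on_power2[OF d]])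
          show "integrable (R N) (\<lambda>\<omega>. (C + C) * \<bar>?\<delta> N \<omega> x\<bar>)" using R_integrable[OF N d] by simp
          show "(?\<delta> N \<omega> x)\<^sup>2 \<le> (C + C) * \<bar>?\<delta> N \<omega> x\<bar>" if "\<omega> \<in> space (R N)" for \<omega>
          proof -
            have "\<bar>?\<delta> N \<omega> x\<bar> * \<bar>?\<delta> N \<omega> x\<bar> \<le> (C + C) * \<bar>?\<delta> N \<omega> x\<bar>"
              using bounded_onD(2)[OF d that] by (intro mult_right_mono) auto
            then show ?thesis by (simp add: power2_eq_square)
          qed
        qed
        then show "?b N x \<le> (C + C) * (\<integral>\<omega>. \<bar>?\<delta> N \<omega> x\<bar> \<partial>R N)" by simp
      next
        show "(\<lambda>N. (C + C) * (\<integral>\<omega>. \<bar>?\<delta> N \<omega> x\<bar> \<partial>R N)) \<longlonglongrightarrow> 0"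
          using L1 by (intro tendsto_mult_right_zero) (simp add: L1_conv_def)
      qed simp
      then have "(\<lambda>N. ?b (Suc N) x) \<longlonglongrightarrow> 0" by (rule LIMSEQ_Suc)
      then show "(\<lambda>N. hp (Suc m) x * ?b (Suc N) x) \<longlonglongrightarrow> 0" by (rule tendsto_mult_right_zero)
    qed
  qed simp
  then have "(\<lambda>N. \<integral>x. hp (Suc m) x * ?b N x \<partial>?L) \<longlonglongrightarrow> 0"
    using LIMSEQ_imp_Suc[of "\<lambda>N. \<integral>x. hp (Suc m) x * ?b N x \<partial>?L" 0] by simp
  from tendsto_0_sandwich[OF _ main this] show ?thesis unfolding Suc by simp
qed

end

lemma borel_measurable_iexp: "f \<in> borel_measurable M \<Longrightarrow> (\<lambda>x. iexp (f x)) \<in> borel_measurable M"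
  by measurable

lemma complex_tendsto_sandwich:
  fixes a :: "nat \<Rightarrow> complex"
  assumes "\<And>N. 1 \<le> N \<Longrightarrow> cmod (a N - b N) \<le> g N" "g \<longlonglongrightarrow> 0" "b \<longlonglongrightarrow> l"
  shows "a \<longlonglongrightarrow> l"
proof -
  have "(\<lambda>N. cmod (a N - b N)) \<longlonglongrightarrow> 0"
    by (rule tendsto_0_sandwich[OF _ assms(1,2)]) simp_all
  then have "(\<lambda>N. a N - b N) \<longlonglongrightarrow> 0" by (simp add: tendsto_norm_zero_iff)
  from tendsto_add[OF this assms(3)] show ?thesis by simp
qed

section \<open>Characteristic functions of the local errors\<close>

context dominated_particle_model
begin

definition limit_variance :: "nat \<Rightarrow> ('a \<Rightarrow> real) \<Rightarrow> real" where
  "limit_variance p f = (case p of 0 \<Rightarrow> var_of eta0 f | Suc m \<Rightarrow> step_variance m (eta m) f)"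

lemma step_variance_nonneg: "0 \<le> step_variance n \<mu> f"
  unfolding step_variance_def var_of_def by simp

lemma limit_variance_nonneg: "0 \<le> limit_variance p f"
  by (cases p) (simp_all add: limit_variance_def step_variance_nonneg var_of_def)

text \<open>The local error as a function of the recorded history, so that earlier errors can serve
  as a weight measurable with respect to the past when the next one is conditioned upon it.\<close>

definition VN_history :: "nat \<Rightarrow> nat \<Rightarrow> ('a \<Rightarrow> real) \<Rightarrow> (nat \<Rightarrow> nat \<Rightarrow> 'a) \<Rightarrow> real" where
  "VN_history N p f h = sqrt N * ((\<integral>x. f x \<partial>empirical (E p) N (h p)) - (\<integral>x. f x \<partial>predict (\<lambda>q. empirical (E q) N (h q)) p))"

lemma predict_cong: "(\<And>q. q < p \<Longrightarrow> \<mu> q = \<mu>' q) \<Longrightarrow> predict \<mu> p = predict \<mu>' p"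
  by (auto simp: predict_def split: nat.split)

lemma VN_history_eq:
  assumes "p \<le> m"
  shows "VN_history N p f (history (xi N) m \<omega>) = VN N p f \<omega>"
proof -
  have "predict (\<lambda>q. empirical (E q) N (history (xi N) m \<omega> q)) p = predict (eta_flow N \<omega>) p"
    by (rule predict_cong) (use assms in \<open>simp add: eta_N_history\<close>)
  then show ?thesis using assms by (simp add: VN_history_def VN_def eta_N_history)
qed

lemma VN_history_measurable:
  assumes N: "1 \<le> N" and p: "p \<le> m" and f: "bounded_on (E p) C f"
  shows "VN_history N p f \<in> borel_measurable (PiM {..m} (config N))"
proof -
  let ?S = "PiM {..m} (config N)"
  have k: "(\<lambda>h. empirical (E q) N (h q)) \<in> ?S \<rightarrow>\<^sub>M prob_algebra (E q)" if "q \<le> m" for q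
    by (rule measurable_compose[OF _ empirical_kernel[OF N]]) (use that in simp)
  have k': "(\<lambda>h. predict (\<lambda>q. empirical (E q) N (h q)) p) \<in> ?S \<rightarrow>\<^sub>M prob_algebra (E p)"
    using eta0 Phi_kernel[OF k] p by (cases p) (simp_all add: predict_def)
  have fb: "bounded_on (?S \<Otimes>\<^sub>M E p) C (\<lambda>z. f (snd z))" by (rule bounded_on_compose[OF f measurable_snd])
  from bounded_onD(1)[OF bounded_on_kernel_integral[OF k[OF p] fb]] bounded_onD(1)[OF bounded_on_kernel_integral[OF k' fb]]
  show ?thesis unfolding VN_history_def[abs_def] by simp
qed

lemma VN_measurable:
  assumes "1 \<le> N" "bounded_on (E p) C f"
  shows "VN N p f \<in> borel_measurable (R N)"
  using bounded_onD(1)[OF VN_bounded[OF assms(1) bounded_on_compose[OF assms(2) measurable_snd]]] by simp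

text \<open>Given the configuration, the average of the N individual variances is
  \<open>step_variance\<close> at the empirical measure; the estimate for independent sums then
  applies with that random variance.\<close>

lemma config_kernel_char:
  assumes N: "1 \<le> N" and x: "x \<in> space (config N n)" and f: "bounded_on (E (Suc n)) C f"
  shows "cmod ((\<integral>y. iexp (sqrt N * ((\<integral>z. f z \<partial>empirical (E (Suc n)) N y) - (\<integral>z. f z \<partial>Phi (Suc n) (empirical (E n) N x)))) \<partial>config_kernel N (Suc n) x)
      - complex_of_real (exp (- (step_variance n (empirical (E n) N x) f / 2)))) \<le> (8 * C ^ 3 / 6 + 2 * C ^ 4) / sqrt N"
proof -
  let ?\<mu> = "empirical (E n) N x"
  let ?\<kappa> = "\<lambda>i. K (Suc n) ?\<mu> (x i)"
  note \<mu> = empirical_in_prob_algebra[OF N x]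
  have \<kappa>: "?\<kappa> i \<in> space (prob_algebra (E (Suc n)))" if "i < N" for i
    using K_in_prob_algebra[OF \<mu> config_coordinate[OF x that]] .
  have sp: "space (config_kernel N (Suc n) x) = space (config N (Suc n))"
    using prob_algebra_kernelD(4)[OF config_kernel_measurable[OF N] x] .
  have Kk: "(\<lambda>y. K (Suc n) ?\<mu> y) \<in> E n \<rightarrow>\<^sub>M prob_algebra (E (Suc n))"
    using measurable_compose[OF _ K_kernel[OF const_kernel[OF \<mu>, of "count_space {()}"]], of "\<lambda>y. ((), y)" "E n"] by simp
  have kf: "(\<lambda>y. \<integral>z. g z \<partial>K (Suc n) ?\<mu> y) \<in> borel_measurable (E n)" if "bounded_on (E (Suc n)) C' g" for C' g
    using bounded_onD(1)[OF bounded_on_kernel_integral[OF Kk bounded_on_compose[OF that measurable_snd]]] by simp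
  have "(\<lambda>y. (\<integral>z. (f z)\<^sup>2 \<partial>K (Suc n) ?\<mu> y) - (\<integral>z. f z \<partial>K (Suc n) ?\<mu> y)\<^sup>2) \<in> borel_measurable (E n)"
    using kf[OF f] kf[OF bounded_on_power2[OF f]] by simp
  then have "(\<lambda>y. var_of (K (Suc n) ?\<mu> y) f) \<in> borel_measurable (E n)"
  proof (rule measurable_cong[THEN iffD1, rotated])
    fix y assume y: "y \<in> space (E n)"
    note Ky = K_in_prob_algebra[OF \<mu> y]
    show "(\<integral>z. (f z)\<^sup>2 \<partial>K (Suc n) ?\<mu> y) - (\<integral>z. f z \<partial>K (Suc n) ?\<mu> y)\<^sup>2 = var_of (K (Suc n) ?\<mu> y) f"
      by (rule var_of_eq[OF in_space_prob_algebraD(1)[OF Ky] bounded_on_measure(1)[OF Ky f], of C, symmetric])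
        (use bounded_onD(2)[OF f] in_space_prob_algebraD(3)[OF Ky] in auto)
  qed
  then have sv: "step_variance n ?\<mu> f = (\<Sum>i<N. var_of (?\<kappa> i) f) / N"
    unfolding step_variance_def by (rule integral_empirical[OF N x])
  have "(\<integral>y. iexp (sqrt N * ((\<integral>z. f z \<partial>empirical (E (Suc n)) N y) - (\<integral>z. f z \<partial>Phi (Suc n) ?\<mu>))) \<partial>config_kernel N (Suc n) x)
    = (\<integral>y. iexp ((\<Sum>i<N. f (y i) - (\<integral>z. f z \<partial>?\<kappa> i)) / sqrt N) \<partial>PiM {..<N} ?\<kappa>)"
  proof -
    have "(\<integral>y. iexp (sqrt N * ((\<integral>z. f z \<partial>empirical (E (Suc n)) N y) - (\<integral>z. f z \<partial>Phi (Suc n) ?\<mu>))) \<partial>config_kernel N (Suc n) x)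
      = (\<integral>y. iexp ((\<Sum>i<N. f (y i) - (\<integral>z. f z \<partial>?\<kappa> i)) / sqrt N) \<partial>config_kernel N (Suc n) x)"
      by (rule Bochner_Integration.integral_cong[OF refl]) (simp only: config_integral_predict[OF N x f] sp)
    then show ?thesis by (simp add: config_kernel_def)
  qed
  moreover have "cmod ((\<integral>y. iexp ((\<Sum>i<N. f (y i) - (\<integral>z. f z \<partial>?\<kappa> i)) / sqrt N) \<partial>PiM {..<N} ?\<kappa>)
      - complex_of_real (exp (- ((\<Sum>i<N. var_of (?\<kappa> i) f) / N / 2)))) \<le> (8 * C ^ 3 / 6 + 2 * C ^ 4) / sqrt N"
    by (rule prod_char_approx_variance)
      (use N in_space_prob_algebraD[OF \<kappa>] bounded_on_measure(1)[OF \<kappa> f] bounded_onD(2)[OF f] in auto)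
  ultimately show ?thesis unfolding sv by simp
qed

text \<open>Conditioning on the history pulls the weight \<open>Z\<close> out, and |Z| <= 1 costs
  nothing. Two errors remain: the Gaussian approximation at the random conditional variance, and the
  replacement of that variance by its limit. The factor 1/2 in the second is the Lipschitz constant
  of v -> exp (-(v / 2)).\<close>

lemma VN_char_Suc:
  fixes Z :: "(nat \<Rightarrow> nat \<Rightarrow> 'a) \<Rightarrow> complex"
  assumes N: "1 \<le> N" and f: "bounded_on (E (Suc m)) C f"
    and Z: "Z \<in> borel_measurable (PiM {..m} (config N))" "\<And>h. cmod (Z h) \<le> 1"
  defines "v \<equiv> step_variance m (eta m) f"
  shows "cmod ((\<integral>\<omega>. Z (history (xi N) m \<omega>) * iexp (VN N (Suc m) f \<omega>) \<partial>R N)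
      - complex_of_real (exp (- (v / 2))) * (\<integral>\<omega>. Z (history (xi N) m \<omega>) \<partial>R N))
    \<le> (8 * C ^ 3 / 6 + 2 * C ^ 4) / sqrt N + (\<integral>\<omega>. \<bar>step_variance m (eta_N N m \<omega>) f - v\<bar> \<partial>R N) / 2"
proof -
  let ?S = "PiM {..m} (config N)"
  let ?J = "?S \<Otimes>\<^sub>M config N (Suc m)"
  let ?D = "(8 * C ^ 3 / 6 + 2 * C ^ 4) / sqrt N"
  let ?s = "complex_of_real (exp (- (v / 2)))"
  interpret RN: prob_space "R N" by (rule R_prob_space[OF N])
  let ?\<Phi> = "\<lambda>(h, y). sqrt N * ((\<integral>z. f z \<partial>empirical (E (Suc m)) N y) - (\<integral>z. f z \<partial>Phi (Suc m) (empirical (E m) N (h m))))"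
  have ky: "(\<lambda>z. empirical (E (Suc m)) N (snd z)) \<in> ?J \<rightarrow>\<^sub>M prob_algebra (E (Suc m))"
    using empirical_kernel[OF N] by measurable
  have kh: "(\<lambda>z. Phi (Suc m) (empirical (E m) N (fst z m))) \<in> ?J \<rightarrow>\<^sub>M prob_algebra (E (Suc m))"
    by (rule Phi_kernel, rule measurable_compose[OF _ empirical_kernel[OF N]]) simp
  have fJ: "bounded_on (?J \<Otimes>\<^sub>M E (Suc m)) C (\<lambda>w. f (snd w))"
    by (rule bounded_on_compose[OF f measurable_snd])
  have "(\<lambda>z. sqrt N * ((\<integral>x. f (snd (z, x)) \<partial>empirical (E (Suc m)) N (snd z)) - (\<integral>x. f (snd (z, x)) \<partial>Phi (Suc m) (empirical (E m) N (fst z m))))) \<in> borel_measurable ?J"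
    using bounded_onD(1)[OF bounded_on_kernel_integral[OF ky fJ]] bounded_onD(1)[OF bounded_on_kernel_integral[OF kh fJ]] by simp
  then have \<Phi>m: "?\<Phi> \<in> borel_measurable ?J" by (simp add: case_prod_unfold)
  let ?f = "\<lambda>z. Z (fst z) * iexp (?\<Phi> z)"
  have fm: "?f \<in> borel_measurable ?J"
    by (rule borel_measurable_times[OF measurable_compose[OF measurable_fst Z(1)] borel_measurable_iexp[OF \<Phi>m]])
  have fb: "cmod (?f (h, y)) \<le> 1" for h y
    using Z(2)[of h] by (simp add: norm_mult del: of_real_mult of_real_diff)
  note mc = markov_chain_complex_integral[OF R_prob_space[OF N] chain[OF N] config_kernel_measurable[OF N] fm fb]
  let ?c = "\<lambda>\<omega>. \<integral>y. iexp (?\<Phi> (history (xi N) m \<omega>, y)) \<partial>config_kernel N (Suc m) (xi N m \<omega>)"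
  let ?Z = "\<lambda>\<omega>. Z (history (xi N) m \<omega>)"
  have ci: "integrable (R N) (\<lambda>\<omega>. ?Z \<omega> * ?c \<omega>)"
    using mc(1) by simp
  have Zi: "integrable (R N) ?Z"
    by (rule RN.integrable_const_bound[where B=1])
      (use Z(2) measurable_compose[OF xi_history_measurable[OF N] Z(1)] in auto)
  have sZi: "integrable (R N) (\<lambda>\<omega>. ?s * ?Z \<omega>)" using Zi by (rule integrable_mult_right)
  have VNe: "VN N (Suc m) f \<omega> = ?\<Phi> (history (xi N) m \<omega>, xi N (Suc m) \<omega>)" for \<omega>
    by (simp add: VN_def predict_def eta_N_history) (simp add: eta_N_def)
  have "(\<integral>\<omega>. ?Z \<omega> * iexp (VN N (Suc m) f \<omega>) \<partial>R N) = (\<integral>\<omega>. ?f (history (xi N) m \<omega>, xi N (Suc m) \<omega>) \<partial>R N)"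
    unfolding VNe fst_conv ..
  also have "\<dots> = (\<integral>\<omega>. ?Z \<omega> * ?c \<omega> \<partial>R N)"
    unfolding mc(2) by simp
  finally have "(\<integral>\<omega>. ?Z \<omega> * iexp (VN N (Suc m) f \<omega>) \<partial>R N) - ?s * (\<integral>\<omega>. ?Z \<omega> \<partial>R N) = (\<integral>\<omega>. ?Z \<omega> * ?c \<omega> \<partial>R N) - (\<integral>\<omega>. ?s * ?Z \<omega> \<partial>R N)"
    by (simp only: integral_mult_right_zero)
  also have "\<dots> = (\<integral>\<omega>. ?Z \<omega> * ?c \<omega> - ?s * ?Z \<omega> \<partial>R N)"
    by (rule Bochner_Integration.integral_diff[OF ci sZi, symmetric])
  finally have diff: "(\<integral>\<omega>. ?Z \<omega> * iexp (VN N (Suc m) f \<omega>) \<partial>R N) - ?s * (\<integral>\<omega>. ?Z \<omega> \<partial>R N) = (\<integral>\<omega>. ?Z \<omega> * ?c \<omega> - ?s * ?Z \<omega> \<partial>R N)" .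
  have "cmod (\<integral>\<omega>. ?Z \<omega> * ?c \<omega> - ?s * ?Z \<omega> \<partial>R N) \<le> (\<integral>\<omega>. cmod (?Z \<omega> * ?c \<omega> - ?s * ?Z \<omega>) \<partial>R N)" by (rule integral_norm_bound)
  also have "\<dots> \<le> (\<integral>\<omega>. ?D + \<bar>step_variance m (eta_N N m \<omega>) f - v\<bar> / 2 \<partial>R N)"
  proof (rule integral_mono)
    show "integrable (R N) (\<lambda>\<omega>. cmod (?Z \<omega> * ?c \<omega> - ?s * ?Z \<omega>))"
      using Bochner_Integration.integrable_diff[OF ci sZi] by (rule integrable_norm)
    show "integrable (R N) (\<lambda>\<omega>. ?D + \<bar>step_variance m (eta_N N m \<omega>) f - v\<bar> / 2)"
      using L1_conv_integrable[OF step_variance_L1_conv[OF f] N, of v] by simp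
    fix \<omega> assume w: "\<omega> \<in> space (R N)"
    let ?e = "complex_of_real (exp (- (step_variance m (eta_N N m \<omega>) f / 2)))"
    have "cmod (?c \<omega> - ?e) \<le> ?D"
      using config_kernel_char[OF N measurable_space[OF xi_measurable[OF N] w] f]
      by (simp add: history_apply eta_N_def)
    moreover have "cmod (?e - ?s) \<le> \<bar>step_variance m (eta_N N m \<omega>) f - v\<bar> / 2"
    proof -
      have "cmod (?e - ?s) = \<bar>exp (- (step_variance m (eta_N N m \<omega>) f / 2)) - exp (- (v / 2))\<bar>"
        by (simp only: of_real_diff[symmetric] norm_of_real)
      also have "\<dots> \<le> \<bar>step_variance m (eta_N N m \<omega>) f / 2 - v / 2\<bar>"
        by (rule exp_minus_Lipschitz) (simp_all add: step_variance_nonneg v_def)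
      finally show ?thesis by simp
    qed
    ultimately have "cmod (?c \<omega> - ?s) \<le> ?D + \<bar>step_variance m (eta_N N m \<omega>) f - v\<bar> / 2"
      using norm_triangle_ineq[of "?c \<omega> - ?e" "?e - ?s"] by simp
    moreover have "cmod (?Z \<omega> * ?c \<omega> - ?s * ?Z \<omega>) = cmod (?Z \<omega>) * cmod (?c \<omega> - ?s)"
      by (simp only: norm_mult[symmetric]) (simp add: algebra_simps)
    moreover have "cmod (?Z \<omega>) * cmod (?c \<omega> - ?s) \<le> 1 * cmod (?c \<omega> - ?s)"
      by (intro mult_right_mono Z(2)) simp
    ultimately show "cmod (?Z \<omega> * ?c \<omega> - ?s * ?Z \<omega>) \<le> ?D + \<bar>step_variance m (eta_N N m \<omega>) f - v\<bar> / 2" by simp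
  qed
  also have "\<dots> = ?D + (\<integral>\<omega>. \<bar>step_variance m (eta_N N m \<omega>) f - v\<bar> \<partial>R N) / 2"
    using L1_conv_integrable[OF step_variance_L1_conv[OF f] N, of v] by (simp add: RN.prob_space)
  finally show ?thesis unfolding diff .
qed

lemma VN_char_0:
  assumes N: "1 \<le> N" and f: "bounded_on (E 0) C f"
  shows "cmod ((\<integral>\<omega>. iexp (VN N 0 f \<omega>) \<partial>R N) - complex_of_real (exp (- (var_of eta0 f / 2)))) \<le> (8 * C ^ 3 / 6 + 2 * C ^ 4) / sqrt N"
proof -
  let ?S = "\<lambda>y. (\<Sum>i<N. f (y i) - (\<integral>z. f z \<partial>eta0))"
  note e0 = in_space_prob_algebraD[OF eta0]
  have "(\<integral>\<omega>. iexp (VN N 0 f \<omega>) \<partial>R N) = (\<integral>\<omega>. iexp (?S (xi N 0 \<omega>) / sqrt N) \<partial>R N)"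
    by (rule Bochner_Integration.integral_cong[OF refl]) (simp only: VN_0_eq[OF N f])
  also have "\<dots> = (\<integral>y. iexp (?S y / sqrt N) \<partial>distr (R N) (config N 0) (xi N 0))"
    by (rule integral_distr[symmetric, OF xi_measurable[OF N]
      borel_measurable_iexp[OF borel_measurable_divide[OF eta0_sum_measurable[OF f] borel_measurable_const]]])
  also have "distr (R N) (config N 0) (xi N 0) = PiM {..<N} (\<lambda>_. eta0)"
    using chain[OF N] by (simp add: markov_chain_def)
  finally have 1: "(\<integral>\<omega>. iexp (VN N 0 f \<omega>) \<partial>R N) = (\<integral>y. iexp (?S y / sqrt N) \<partial>PiM {..<N} (\<lambda>_. eta0))" .
  have "cmod ((\<integral>y. iexp (?S y / sqrt N) \<partial>PiM {..<N} (\<lambda>_. eta0)) - complex_of_real (exp (- ((\<Sum>i<N. var_of eta0 f) / N / 2))))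
     \<le> (8 * C ^ 3 / 6 + 2 * C ^ 4) / sqrt N"
    by (rule prod_char_approx_variance)
      (use N e0 bounded_on_measure(1)[OF eta0 f] bounded_onD(2)[OF f] in auto)
  moreover have "(\<Sum>i<N. var_of eta0 f) / N = var_of eta0 f" using N by simp
  ultimately show ?thesis unfolding 1 by simp
qed

text \<open>The limiting conditional characteristic function is deterministic, so each step in time
  multiplies the limit by one Gaussian factor. Asymptotic independence of the local errors over time
  is thus obtained along with normality.\<close>

theorem VN_sum_char_tendsto:
  assumes "\<And>p. p \<le> n \<Longrightarrow> bounded_on (E p) C (f p)"
  shows "(\<lambda>N. \<integral>\<omega>. iexp (\<Sum>p\<le>n. VN N p (f p) \<omega>) \<partial>R N) \<longlonglongrightarrow> complex_of_real (exp (- ((\<Sum>p\<le>n. limit_variance p (f p)) / 2)))"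
  using assms
proof (induction n)
  case 0
  show ?case
    by (rule complex_tendsto_sandwich[where b="\<lambda>_. complex_of_real (exp (- (var_of eta0 (f 0) / 2)))", OF _ inverse_sqrt_tendsto_0])
      (use VN_char_0[of _ C "f 0"] "0" in \<open>simp_all add: limit_variance_def\<close>)
next
  case (Suc m)
  have fm: "bounded_on (E p) C (f p)" if "p \<le> Suc m" for p by (rule Suc.prems[OF that])
  let ?v = "step_variance m (eta m) (f (Suc m))"
  let ?s = "complex_of_real (exp (- (?v / 2)))"
  have IH: "(\<lambda>N. \<integral>\<omega>. iexp (\<Sum>p\<le>m. VN N p (f p) \<omega>) \<partial>R N) \<longlonglongrightarrow> complex_of_real (exp (- ((\<Sum>p\<le>m. limit_variance p (f p)) / 2)))"
    by (rule Suc.IH) (rule fm, simp)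
  show ?case
  proof (rule complex_tendsto_sandwich)
    fix N :: nat assume N: "1 \<le> N"
    \<comment> \<open>The exponential of all earlier errors is the weight of modulus 1 carried
      through the conditioning.\<close>
    let ?Z = "\<lambda>h. iexp (\<Sum>p\<le>m. VN_history N p (f p) h)"
    have Zm: "?Z \<in> borel_measurable (PiM {..m} (config N))"
    proof -
      have "(\<lambda>h. \<Sum>p\<le>m. VN_history N p (f p) h) \<in> borel_measurable (PiM {..m} (config N))"
        by (rule borel_measurable_sum) (rule VN_history_measurable[OF N _ fm], simp_all)
      then show ?thesis by measurable
    qed
    have Ze: "?Z (history (xi N) m \<omega>) = iexp (\<Sum>p\<le>m. VN N p (f p) \<omega>)" for \<omega>
      by (simp add: VN_history_eq)
    have eq: "iexp (\<Sum>p\<le>Suc m. VN N p (f p) \<omega>) = iexp (\<Sum>p\<le>m. VN N p (f p) \<omega>) * iexp (VN N (Suc m) (f (Suc m)) \<omega>)" for \<omega>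
      by (simp add: exp_add[symmetric] algebra_simps)
    show "cmod ((\<integral>\<omega>. iexp (\<Sum>p\<le>Suc m. VN N p (f p) \<omega>) \<partial>R N) - ?s * (\<integral>\<omega>. iexp (\<Sum>p\<le>m. VN N p (f p) \<omega>) \<partial>R N))
      \<le> (8 * C ^ 3 / 6 + 2 * C ^ 4) / sqrt N + (\<integral>\<omega>. \<bar>step_variance m (eta_N N m \<omega>) (f (Suc m)) - ?v\<bar> \<partial>R N) / 2"
      using VN_char_Suc[OF N fm[OF order_refl] Zm] unfolding eq Ze by simp
  next
    have "(\<lambda>N. (8 * C ^ 3 / 6 + 2 * C ^ 4) / sqrt N + (\<integral>\<omega>. \<bar>step_variance m (eta_N N m \<omega>) (f (Suc m)) - ?v\<bar> \<partial>R N) / 2) \<longlonglongrightarrow> 0 + 0 / 2"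
      using step_variance_L1_conv[OF fm[OF order_refl]] by (intro tendsto_intros inverse_sqrt_tendsto_0) (auto simp: L1_conv_def)
    then show "(\<lambda>N. (8 * C ^ 3 / 6 + 2 * C ^ 4) / sqrt N + (\<integral>\<omega>. \<bar>step_variance m (eta_N N m \<omega>) (f (Suc m)) - ?v\<bar> \<partial>R N) / 2) \<longlonglongrightarrow> 0" by simp
    have "?s * complex_of_real (exp (- ((\<Sum>p\<le>m. limit_variance p (f p)) / 2))) = complex_of_real (exp (- ((\<Sum>p\<le>Suc m. limit_variance p (f p)) / 2)))"
      unfolding of_real_mult[symmetric] exp_add[symmetric] by (simp add: limit_variance_def add_divide_distrib add.commute)
    with tendsto_mult[OF tendsto_const[of ?s] IH]
    show "(\<lambda>N. ?s * (\<integral>\<omega>. iexp (\<Sum>p\<le>m. VN N p (f p) \<omega>) \<partial>R N)) \<longlonglongrightarrow> complex_of_real (exp (- ((\<Sum>p\<le>Suc m. limit_variance p (f p)) / 2)))"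
      by simp
  qed
qed

end

section \<open>Linearity and the normalised field\<close>

lemma bounded_on_sum:
  assumes "finite J" "\<And>j. j \<in> J \<Longrightarrow> bounded_on S (C j) (f j)"
  shows "bounded_on S (\<Sum>j\<in>J. C j) (\<lambda>x. \<Sum>j\<in>J. f j x)"
  using assms
proof (induction J rule: finite_induct)
  case empty
  show ?case using bounded_on_const[of S 0] by simp
next
  case (insert i J)
  then show ?case using bounded_on_add[of S "C i" "f i"] by simp
qed

lemma integral_combination:
  assumes "\<mu> \<in> space (prob_algebra S)" "\<And>j. j \<in> J \<Longrightarrow> bounded_on S (C j) (f j)"
  shows "(\<integral>x. (\<Sum>j\<in>J. a j * f j x) \<partial>\<mu>) = (\<Sum>j\<in>J. a j * (\<integral>x. f j x \<partial>\<mu>))"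
  using bounded_on_measure(2)[OF assms(1) assms(2)] by (subst Bochner_Integration.integral_sum) auto

context dominated_feynman_kac
begin

lemma step_back_combination:
  assumes F: "\<And>j. j \<in> J \<Longrightarrow> bounded_on (PiM {..Suc p} E) (C j) (F j)" and v: "v \<in> space (PiM {..p} E)"
  shows "step_back p (\<lambda>w. \<Sum>j\<in>J. a j * F j w) v = (\<Sum>j\<in>J. a j * step_back p (F j) v)"
proof -
  have vp: "v p \<in> space (E p)" using coordinate_in_space[OF v] by simp
  have b: "bounded_on (E (Suc p)) (C j) (\<lambda>y. F j (v(Suc p := y)))" if "j \<in> J" for j
  proof (rule bounded_on_compose[OF F[OF that]])
    show "(\<lambda>y. v(Suc p := y)) \<in> E (Suc p) \<rightarrow>\<^sub>M PiM {..Suc p} E"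
      using v by (intro measurable_fun_upd[where J="{..p}"]) auto
  qed
  have "(\<integral>y. (\<Sum>j\<in>J. a j * F j (v(Suc p := y))) \<partial>M (Suc p) (v p)) = (\<Sum>j\<in>J. a j * (\<integral>y. F j (v(Suc p := y)) \<partial>M (Suc p) (v p)))"
    by (rule integral_combination[OF prob_algebra_kernelD(1)[OF M_kernel vp] b])
  then show ?thesis by (simp add: step_back_def sum_distrib_left mult.left_commute)
qed

lemma step_back_cong:
  assumes "\<And>w. w \<in> space (PiM {..Suc p} E) \<Longrightarrow> F w = F' w" and v: "v \<in> space (PiM {..p} E)"
  shows "step_back p F v = step_back p F' v"
proof -
  have vp: "v p \<in> space (E p)" using coordinate_in_space[OF v] by simp
  have "(\<integral>y. F (v(Suc p := y)) \<partial>M (Suc p) (v p)) = (\<integral>y. F' (v(Suc p := y)) \<partial>M (Suc p) (v p))"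
  proof (intro Bochner_Integration.integral_cong refl assms(1))
    fix y assume "y \<in> space (M (Suc p) (v p))"
    then have "(v, y) \<in> space (PiM {..p} E \<Otimes>\<^sub>M E (Suc p))"
      using v prob_algebra_kernelD(4)[OF M_kernel vp] by (simp add: space_pair_measure)
    from measurable_space[OF fun_upd_Suc_measurable this]
    show "v(Suc p := y) \<in> space (PiM {..Suc p} E)" by simp
  qed
  then show ?thesis by (simp add: step_back_def)
qed

lemma forward_integral_combination:
  assumes J: "finite J" and F: "\<And>j. j \<in> J \<Longrightarrow> bounded_on (PiM {..n} E) (C j) (F j)" and "p \<le> n"
  shows "v \<in> space (PiM {..p} E) \<Longrightarrow>
    forward_integral p n (\<lambda>w. \<Sum>j\<in>J. a j * F j w) v = (\<Sum>j\<in>J. a j * forward_integral p n (F j) v)"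
  using assms(3)
proof (induction arbitrary: v rule: inc_induct)
  case base
  then show ?case by (simp add: forward_integral_refl)
next
  case (step m)
  have Fa: "bounded_on (PiM {..n} E) (\<Sum>j\<in>J. \<bar>a j\<bar> * C j) (\<lambda>w. \<Sum>j\<in>J. a j * F j w)"
    by (intro bounded_on_sum J bounded_on_cmult F)
  have "forward_integral m n (\<lambda>w. \<Sum>j\<in>J. a j * F j w) v
    = step_back m (\<lambda>w. \<Sum>j\<in>J. a j * forward_integral (Suc m) n (F j) w) v"
    unfolding forward_integral_Suc[OF step(2) step.prems Fa]
    by (rule step_back_cong[OF step.IH step.prems])
  also have "\<dots> = (\<Sum>j\<in>J. a j * forward_integral m n (F j) v)"
    using step(2) by (subst step_back_combination[OF forward_integral_bounded[OF _ F] step.prems])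
      (auto simp: forward_integral_Suc[OF step(2) step.prems F])
  finally show ?case .
qed

lemma weighted_D_combination:
  assumes J: "finite J" and F: "\<And>j. j \<in> J \<Longrightarrow> bounded_on (PiM {..n} E) (C j) (F j)" and pn: "p \<le> n"
    and \<mu>: "\<And>q. q < p \<Longrightarrow> \<mu> q \<in> space (prob_algebra (E q))" and x: "x \<in> space (E p)"
  shows "weighted_D \<mu> p n (\<lambda>w. \<Sum>j\<in>J. a j * F j w) x = (\<Sum>j\<in>J. a j * weighted_D \<mu> p n (F j) x)"
proof -
  note bk = prob_algebra_kernelD(1)[OF backward_kernel_fixed[OF \<mu>] x]
  have "bounded_on (PiM {..<p} E) (C j) (\<lambda>w. forward_integral p n (F j) (w(p := x)))" if "j \<in> J" for j
  proof (rule bounded_on_compose[OF forward_integral_bounded[OF pn F[OF that]]])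
    show "(\<lambda>w. w(p := x)) \<in> PiM {..<p} E \<rightarrow>\<^sub>M PiM {..p} E"
      using x by (intro measurable_fun_upd[where J="{..<p}"]) auto
  qed
  note int = integral_combination[OF bk this]
  have "flow_D \<mu> p n (\<lambda>w. \<Sum>j\<in>J. a j * F j w) x = bwd \<mu> p (\<lambda>v. \<Sum>j\<in>J. a j * forward_integral p n (F j) v) x"
    unfolding flow_D_def
    by (rule bwd_cong_space[OF \<mu> x]) (simp_all add: forward_integral_combination[OF J F pn])
  also have "\<dots> = (\<Sum>j\<in>J. a j * flow_D \<mu> p n (F j) x)"
    unfolding bwd_def flow_D_def by (rule int) simp
  finally show ?thesis by (simp add: weighted_D_def sum_distrib_left mult.left_commute)
qed

lemma FK_Gamma_combination:
  assumes "\<And>j. j \<in> J \<Longrightarrow> bounded_on (PiM {..n} E) (C j) (F j)"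
  shows "FK_Gamma n (\<lambda>w. \<Sum>j\<in>J. a j * F j w) = (\<Sum>j\<in>J. a j * FK_Gamma n (F j))"
proof -
  have "bounded_on P (C j * 1) (\<lambda>\<omega>. F j (history X n \<omega>) * (\<Prod>p<n. G p (X p \<omega>)))" if "j \<in> J" for j
    by (rule bounded_on_mult[OF bounded_on_compose[OF assms[OF that] history_measurable] prod_G_P_bounded])
  from integral_combination[OF prob_in_prob_algebra this]
  show ?thesis unfolding FK_Gamma_def by (simp add: sum_distrib_right mult.assoc)
qed

section \<open>Total masses and the centred test function\<close>

lemma Q_semigroup_kernel: "Q_semigroup k p \<in> E p \<rightarrow>\<^sub>M subprob_algebra (E (p + k))"
proof (induction k arbitrary: p)
  case 0
  have "Q_semigroup 0 p = return (E p)" by (simp add: fun_eq_iff)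
  then show ?case by simp
next
  case (Suc k)
  have "(\<lambda>x. Q_semigroup (Suc k) p x) \<in> E p \<rightarrow>\<^sub>M subprob_algebra (E (Suc p + k))"
    unfolding Q_semigroup.simps by (rule measurable_bind2[OF Q_kernel Suc.IH])
  then show ?case by simp
qed

definition total_mass :: "nat \<Rightarrow> nat \<Rightarrow> 'a \<Rightarrow> real" where
  "total_mass k p x = (\<integral>y. 1 \<partial>Q_semigroup k p x)"

lemma total_mass_0: "x \<in> space (E p) \<Longrightarrow> total_mass 0 p x = 1"
  by (simp add: total_mass_def measure_return)

lemma total_mass_bounded: "bounded_on (E p) 1 (total_mass k p)"
proof (rule bounded_onI)
  show "total_mass k p \<in> borel_measurable (E p)"
    unfolding total_mass_def[abs_def]
    by (rule measurable_compose[OF Q_semigroup_kernel integral_measurable_subprob_algebra]) simp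
  fix x assume "x \<in> space (E p)"
  then show "\<bar>total_mass k p x\<bar> \<le> 1"
    using subprob_space.subprob_measure_le_1[OF subprob_space_kernel[OF Q_semigroup_kernel]]
    by (simp add: total_mass_def)
qed

lemma total_mass_Suc:
  assumes x: "x \<in> space (E p)"
  shows "total_mass (Suc k) p x = G p x * (\<integral>y. total_mass k (Suc p) y \<partial>M (Suc p) x)"
proof -
  have "total_mass (Suc k) p x = (\<integral>y. total_mass k (Suc p) y \<partial>Q (Suc p) x)"
    unfolding total_mass_def Q_semigroup.simps
    by (rule integral_bind_bounded_subprob[OF measurable_space[OF Q_kernel x] Q_semigroup_kernel bounded_on_const])
  then show ?thesis using integral_Q[OF x bounded_onD(1)[OF total_mass_bounded]] by simp
qed

lemma total_mass_pos: "x \<in> space (E p) \<Longrightarrow> 0 < total_mass k p x"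
proof (induction k arbitrary: p x)
  case 0
  then show ?case by (simp add: total_mass_0)
next
  case (Suc k)
  note Mx = prob_algebra_kernelD[OF M_kernel Suc.prems]
  have "0 < (\<integral>y. total_mass k (Suc p) y \<partial>M (Suc p) x)"
    by (rule integral_pos[OF Mx(2) bounded_on_measure(2)[OF Mx(1) total_mass_bounded]]) (simp add: Mx Suc.IH)
  then show ?case using G_pos[OF Suc.prems] by (simp add: total_mass_Suc[OF Suc.prems])
qed

lemma forward_integral_1:
  assumes "p \<le> n"
  shows "v \<in> space (PiM {..p} E) \<Longrightarrow> forward_integral p n (\<lambda>_. 1) v = total_mass (n - p) p (v p)"
  using assms
proof (induction arbitrary: v rule: inc_induct)
  case base
  then show ?case using coordinate_in_space[OF base, of n] by (simp add: forward_integral_refl total_mass_0)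
next
  case (step m)
  have vm: "v m \<in> space (E m)" using coordinate_in_space[OF step.prems] by simp
  have k: "n - m = Suc (n - Suc m)" using step(2) by simp
  have "forward_integral m n (\<lambda>_. 1) v = step_back m (\<lambda>w. total_mass (n - Suc m) (Suc m) (w (Suc m))) v"
    unfolding forward_integral_Suc[OF step(2) step.prems bounded_on_const]
    by (rule step_back_cong[OF step.IH step.prems])
  then show ?case unfolding k total_mass_Suc[OF vm] by (simp add: step_back_def)
qed

text \<open>Backward kernels are probabilities and the forward integral of 1 depends on x_p alone,
  so D(1) is the semigroup mass for every flow.\<close>

lemma flow_D_1:
  assumes "p \<le> n" "\<And>q. q < p \<Longrightarrow> \<mu> q \<in> space (prob_algebra (E q))" "x \<in> space (E p)"
  shows "flow_D \<mu> p n (\<lambda>_. 1) x = total_mass (n - p) p x"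
proof -
  have "flow_D \<mu> p n (\<lambda>_. 1) x = bwd \<mu> p (\<lambda>v. total_mass (n - p) p (v p)) x"
    unfolding flow_D_def by (rule bwd_cong_space[OF assms(2,3)]) (simp_all add: forward_integral_1[OF assms(1)])
  then show ?thesis using bwd_last[OF assms(2,3)] by simp
qed

text \<open>The semigroup identity \<gamma>_n = \<gamma>_p Q_{p,n} tested on 1. It converts the
  normalisation of \<open>G_norm\<close> into the ratio \<gamma>_p(1) / \<gamma>_n(1).\<close>

lemma FK_gamma_total_mass:
  assumes "p \<le> n"
  shows "FK_gamma p (\<lambda>_. 1) * (\<integral>x. total_mass (n - p) p x \<partial>eta p) = FK_gamma n (\<lambda>_. 1)"
proof -
  have "FK_gamma n (\<lambda>_. 1) = FK_Gamma p (forward_integral p n (\<lambda>_. 1))"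
    unfolding FK_gamma_eq by (rule FK_Gamma_forward[OF assms bounded_on_const])
  also have "\<dots> = FK_gamma p (total_mass (n - p) p)"
    unfolding FK_gamma_eq by (rule FK_Gamma_cong) (rule forward_integral_1[OF assms])
  finally show ?thesis
    using FK_gamma_1_pos[of p] by (simp add: integral_eta[OF bounded_onD(1)[OF total_mass_bounded]])
qed

text \<open>The test function for which the unnormalised field reproduces W^Q to first order:
  centring makes its limit integral vanish, and the division by \<gamma>_n(1) matches the
  normalisation of the particle measure.\<close>

definition centred :: "nat \<Rightarrow> ((nat \<Rightarrow> 'a) \<Rightarrow> real) \<Rightarrow> (nat \<Rightarrow> 'a) \<Rightarrow> real" where
  "centred n F w = (F w - FK_Q n F) / FK_gamma n (\<lambda>_. 1)"

lemma centred_bounded: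
  assumes "bounded_on (PiM {..n} E) C F"
  shows "\<exists>C'. bounded_on (PiM {..n} E) C' (centred n F)"
  using bounded_on_cmult[OF bounded_on_diff[OF assms bounded_on_const[of _ "FK_Q n F"]], of "1 / FK_gamma n (\<lambda>_. 1)"]
  by (auto simp: centred_def[abs_def])

text \<open>The factor Q_{p,n}(1)(x) is the numerator of \<open>G_norm\<close> and the denominator
  of \<open>P_norm\<close> and cancels; positivity of the semigroup mass allows this. The remaining
  constant 1 / \<eta>_p Q_{p,n}(1) equals \<gamma>_p(1) / \<gamma>_n(1).\<close>

lemma G_norm_P_norm:
  assumes pn: "p \<le> n" and F: "bounded_on (PiM {..n} E) C F" and x: "x \<in> space (E p)"
  shows "G_norm p n x * P_norm p n (\<lambda>w. F w - FK_Q n F) x = weighted_D eta p n (centred n F) x"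
proof -
  let ?F = "\<lambda>w. F w - FK_Q n F"
  let ?q = "total_mass (n - p) p"
  let ?\<gamma> = "\<lambda>n. FK_gamma n (\<lambda>_. 1)"
  note F' = bounded_on_diff[OF F bounded_on_const[of _ "FK_Q n F"]]
  have q: "0 < ?q x" by (rule total_mass_pos[OF x])
  have D1: "D p n (\<lambda>_. 1) x = ?q x" unfolding D_eq_flow_D by (rule flow_D_1[OF pn eta_in_prob_algebra x])
  have "centred n F = (\<lambda>w. \<Sum>j\<in>{()}. 1 / ?\<gamma> n * ?F w)" by (simp add: centred_def fun_eq_iff)
  then have "weighted_D eta p n (centred n F) x = 1 / ?\<gamma> n * weighted_D eta p n ?F x"
    using weighted_D_combination[of "{()}" n "\<lambda>_. C + \<bar>FK_Q n F\<bar>" "\<lambda>_. ?F" p eta x "\<lambda>_. 1 / ?\<gamma> n"] F' pn eta_in_prob_algebra x by simp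
  also have "\<dots> = ?\<gamma> p * D p n ?F x / ?\<gamma> n"
    by (simp add: weighted_D_def mass_eta D_eq_flow_D)
  also have "\<dots> = D p n ?F x / (\<integral>x. ?q x \<partial>eta p)"
    using FK_gamma_total_mass[OF pn, symmetric] FK_gamma_1_pos[of p] by simp
  also have "\<dots> = G_norm p n x * P_norm p n ?F x"
    unfolding G_norm_def P_norm_def D1 total_mass_def[symmetric] using q by simp
  finally show ?thesis by simp
qed

end

section \<open>Limit of the unnormalised field\<close>

context dominated_particle_model
begin

text \<open>Since z -> exp (i z) is 1-Lipschitz, replacing the random test functions costs at most
  the sum of the first moments of the remainders, and these are bounded by the roots of second
  moments tending to 0.\<close>

lemma W_Gamma_N_char_tendsto:
  assumes F: "bounded_on (PiM {..n} E) C F"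
  shows "(\<lambda>N. \<integral>\<omega>. iexp (W_Gamma_N n N F \<omega>) \<partial>R N)
    \<longlonglongrightarrow> complex_of_real (exp (- ((\<Sum>p\<le>n. limit_variance p (weighted_D eta p n F)) / 2)))"
proof (rule complex_tendsto_sandwich)
  have wb: "bounded_on (E p) C (weighted_D eta p n F)" if "p \<le> n" for p
    by (rule weighted_D_bounded[OF eta_in_prob_algebra that F])
  show "(\<lambda>N. \<integral>\<omega>. iexp (\<Sum>p\<le>n. VN N p (weighted_D eta p n F) \<omega>) \<partial>R N)
    \<longlonglongrightarrow> complex_of_real (exp (- ((\<Sum>p\<le>n. limit_variance p (weighted_D eta p n F)) / 2)))"
    by (rule VN_sum_char_tendsto[OF wb])
  let ?\<delta> = "\<lambda>N p \<omega>. VN N p (\<lambda>x. weighted_D (eta_flow N \<omega>) p n F x - weighted_D eta p n F x) \<omega>"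
  have \<delta>b: "bounded_on (R N) (sqrt N * ((C + C) + (C + C))) (?\<delta> N p)" if N: "1 \<le> N" and p: "p \<le> n" for N p
    using VN_bounded[OF N bounded_on_diff[OF weighted_D_eta_N_bounded[OF N p F] bounded_on_compose[OF wb[OF p] measurable_snd]]] by simp
  have "(\<lambda>N. \<Sum>p\<le>n. sqrt (\<integral>\<omega>. (?\<delta> N p \<omega>)\<^sup>2 \<partial>R N)) \<longlonglongrightarrow> (\<Sum>p\<le>n. sqrt 0)"
    by (intro tendsto_sum tendsto_real_sqrt remainder_tendsto_0[OF F]) simp
  then show "(\<lambda>N. \<Sum>p\<le>n. sqrt (\<integral>\<omega>. (?\<delta> N p \<omega>)\<^sup>2 \<partial>R N)) \<longlonglongrightarrow> 0" by simp
  fix N :: nat assume N: "1 \<le> N"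
  interpret RN: prob_space "R N" by (rule R_prob_space[OF N])
  obtain C' where W: "bounded_on (R N) C' (W_Gamma_N n N F)" using W_Gamma_N_bounded[OF N F] ..
  let ?S = "\<lambda>\<omega>. \<Sum>p\<le>n. VN N p (weighted_D eta p n F) \<omega>"
  have Sm: "?S \<in> borel_measurable (R N)"
    by (rule borel_measurable_sum) (rule VN_measurable[OF N wb], simp)
  have i1: "integrable (R N) (\<lambda>\<omega>. iexp (W_Gamma_N n N F \<omega>))"
    by (rule RN.integrable_const_bound[where B=1]) (use borel_measurable_iexp[OF bounded_onD(1)[OF W]] in auto)
  have i2: "integrable (R N) (\<lambda>\<omega>. iexp (?S \<omega>))"
    by (rule RN.integrable_const_bound[where B=1]) (use borel_measurable_iexp[OF Sm] in \<open>auto simp del: of_real_sum\<close>)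
  have \<delta>i: "integrable (R N) (\<lambda>\<omega>. \<bar>?\<delta> N p \<omega>\<bar>)" if "p \<le> n" for p
    using R_integrable[OF N \<delta>b[OF N that]] by simp
  have "(\<integral>\<omega>. iexp (W_Gamma_N n N F \<omega>) \<partial>R N) - (\<integral>\<omega>. iexp (?S \<omega>) \<partial>R N) = (\<integral>\<omega>. iexp (W_Gamma_N n N F \<omega>) - iexp (?S \<omega>) \<partial>R N)"
    by (rule Bochner_Integration.integral_diff[OF i1 i2, symmetric])
  then have "cmod ((\<integral>\<omega>. iexp (W_Gamma_N n N F \<omega>) \<partial>R N) - (\<integral>\<omega>. iexp (?S \<omega>) \<partial>R N)) \<le> (\<integral>\<omega>. cmod (iexp (W_Gamma_N n N F \<omega>) - iexp (?S \<omega>)) \<partial>R N)"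
    by (simp only: integral_norm_bound)
  also have "\<dots> \<le> (\<integral>\<omega>. (\<Sum>p\<le>n. \<bar>?\<delta> N p \<omega>\<bar>) \<partial>R N)"
  proof (rule integral_mono)
    show "integrable (R N) (\<lambda>\<omega>. cmod (iexp (W_Gamma_N n N F \<omega>) - iexp (?S \<omega>)))"
      by (rule integrable_norm[OF Bochner_Integration.integrable_diff[OF i1 i2]])
    show "integrable (R N) (\<lambda>\<omega>. \<Sum>p\<le>n. \<bar>?\<delta> N p \<omega>\<bar>)"
      by (rule Bochner_Integration.integrable_sum) (rule \<delta>i, simp)
    fix \<omega> assume w: "\<omega> \<in> space (R N)"
    have "W_Gamma_N n N F \<omega> - ?S \<omega> = (\<Sum>p\<le>n. ?\<delta> N p \<omega>)"
      unfolding W_Gamma_N_eq[OF N w F] sum_subtractf[symmetric]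
      by (rule sum.cong[OF refl], rule VN_diff[OF N w, symmetric])
        (use wb weighted_D_bounded[OF eta_N_in_prob_algebra[OF N w] _ F] in auto)
    then have "\<bar>W_Gamma_N n N F \<omega> - ?S \<omega>\<bar> \<le> (\<Sum>p\<le>n. \<bar>?\<delta> N p \<omega>\<bar>)"
      by (simp only: sum_abs)
    then show "cmod (iexp (W_Gamma_N n N F \<omega>) - iexp (?S \<omega>)) \<le> (\<Sum>p\<le>n. \<bar>?\<delta> N p \<omega>\<bar>)"
      using cmod_iexp_diff[of "W_Gamma_N n N F \<omega>" "?S \<omega>"] by linarith
  qed
  also have "\<dots> = (\<Sum>p\<le>n. \<integral>\<omega>. \<bar>?\<delta> N p \<omega>\<bar> \<partial>R N)"
    by (rule Bochner_Integration.integral_sum) (rule \<delta>i, simp)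
  also have "\<dots> \<le> (\<Sum>p\<le>n. sqrt (\<integral>\<omega>. (?\<delta> N p \<omega>)\<^sup>2 \<partial>R N))"
  proof (rule sum_mono)
    fix p assume "p \<in> {..n}"
    then have p: "p \<le> n" by simp
    show "(\<integral>\<omega>. \<bar>?\<delta> N p \<omega>\<bar> \<partial>R N) \<le> sqrt (\<integral>\<omega>. (?\<delta> N p \<omega>)\<^sup>2 \<partial>R N)"
      by (rule expectation_abs_le_sqrt[OF R_prob_space[OF N] bounded_onD(1)[OF \<delta>b[OF N p]] bounded_onD(2)[OF \<delta>b[OF N p]]])
  qed
  finally show "cmod ((\<integral>\<omega>. iexp (W_Gamma_N n N F \<omega>) \<partial>R N) - (\<integral>\<omega>. iexp (?S \<omega>) \<partial>R N)) \<le> (\<Sum>p\<le>n. sqrt (\<integral>\<omega>. (?\<delta> N p \<omega>)\<^sup>2 \<partial>R N))" .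
qed

end

text \<open>On \<open>{m \<ge> \<gamma> / 2}\<close> the two arguments are close; the complement is controlled by \<open>m - \<gamma>\<close> itself.\<close>

lemma iexp_ratio_bound:
  fixes w q m \<gamma> u s :: real
  assumes w: "w = m / \<gamma> * q" and u: "u = s * (m - \<gamma>)" and pos: "0 < m" "0 < \<gamma>" "0 < s"
  shows "cmod (iexp q - iexp w) \<le> (w\<^sup>2 / \<gamma> + 3 * u\<^sup>2 / \<gamma> + 2 / \<gamma>) / s"
proof (cases "\<gamma> / 2 \<le> m")
  case True
  have "q - w = w * (- (u / s)) / m"
    using pos by (simp add: w u field_simps)
  then have "\<bar>q - w\<bar> = \<bar>w\<bar> * \<bar>u\<bar> / s / m"
    using pos by (simp add: abs_mult abs_divide)
  also have "\<dots> \<le> ((w\<^sup>2 + u\<^sup>2) / 2) / s / (\<gamma> / 2)"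
  proof (intro frac_le divide_right_mono)
    show "\<bar>w\<bar> * \<bar>u\<bar> \<le> (w\<^sup>2 + u\<^sup>2) / 2"
      using zero_le_power2[of "\<bar>w\<bar> - \<bar>u\<bar>"] by (simp add: power2_eq_square algebra_simps)
  qed (use True pos in auto)
  also have "\<dots> = (w\<^sup>2 / \<gamma> + u\<^sup>2 / \<gamma>) / s" using pos by (simp add: field_simps)
  also have "\<dots> \<le> (w\<^sup>2 / \<gamma> + 3 * u\<^sup>2 / \<gamma> + 2 / \<gamma>) / s"
    using pos by (intro divide_right_mono) (auto intro!: add_increasing2 divide_right_mono)
  finally show ?thesis using cmod_iexp_diff[of q w] by linarith
next
  case False
  have "cmod (iexp q - iexp w) \<le> cmod (iexp q) + cmod (iexp w)" by (rule norm_triangle_ineq4)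
  then have "cmod (iexp q - iexp w) \<le> 2" by simp
  \<comment> \<open>Here |m - \<gamma>| > \<gamma> / 2, which produces the factor 4; next, 4 |u| <=
    2 u^2 + 2. The remaining terms of the bound are slack shared with the other case.\<close>
  also have "2 \<le> 4 * \<bar>m - \<gamma>\<bar> / \<gamma>" using False pos by (simp add: field_simps)
  also have "\<dots> = 4 * \<bar>u\<bar> / \<gamma> / s" using pos by (simp add: u abs_mult)
  also have "\<dots> \<le> (2 * u\<^sup>2 + 2) / \<gamma> / s"
    using pos zero_le_power2[of "\<bar>u\<bar> - 1"] by (intro divide_right_mono) (simp_all add: power2_eq_square algebra_simps)
  also have "\<dots> \<le> (w\<^sup>2 / \<gamma> + 3 * u\<^sup>2 / \<gamma> + 2 / \<gamma>) / s"
  proof (rule divide_right_mono)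
    have "(2 * u\<^sup>2 + 2) / \<gamma> = 0 + 2 * u\<^sup>2 / \<gamma> + 2 / \<gamma>" by (simp add: add_divide_distrib)
    also have "\<dots> \<le> w\<^sup>2 / \<gamma> + 3 * u\<^sup>2 / \<gamma> + 2 / \<gamma>"
      using pos by (intro add_mono divide_right_mono) auto
    finally show "(2 * u\<^sup>2 + 2) / \<gamma> \<le> w\<^sup>2 / \<gamma> + 3 * u\<^sup>2 / \<gamma> + 2 / \<gamma>" .
  qed (use pos in auto)
  finally show ?thesis .
qed

section \<open>Limit of the normalised field\<close>

context dominated_particle_model
begin

lemma Q_N_integral_bounded:
  assumes N: "1 \<le> N" and F: "bounded_on (PiM {..n} E) C F"
  shows "bounded_on (R N) C (\<lambda>\<omega>. \<integral>v. F v \<partial>Q_N N n \<omega>)"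
proof -
  have "bounded_on (R N \<Otimes>\<^sub>M PiM {..n} E) C (\<lambda>z. F (snd z))"
    by (rule bounded_on_compose[OF F measurable_snd])
  from bwd_bounded_param[of n "eta_flow N" "R N", OF eta_N_kernel[OF N] this]
  have "bounded_on (R N \<Otimes>\<^sub>M E n) C (\<lambda>z. bwd (eta_flow N (fst z)) n F (snd z))"
    by (simp add: case_prod_unfold)
  from bounded_on_kernel_integral[OF eta_N_kernel[OF N] this]
  have "bounded_on (R N) C (\<lambda>\<omega>. \<integral>x. bwd (eta_flow N \<omega>) n F x \<partial>eta_N N n \<omega>)" by simp
  then show ?thesis
    by (rule bounded_on_cong[THEN iffD1, rotated]) (simp add: integral_Q_N(1)[OF N _ F])
qed

lemma W_Q_N_bounded:
  assumes N: "1 \<le> N" and F: "bounded_on (PiM {..n} E) C F"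
  shows "\<exists>C'. bounded_on (R N) C' (W_Q_N n N F)"
  using bounded_on_cmult[OF bounded_on_diff[OF Q_N_integral_bounded[OF N F] bounded_on_const[of _ "FK_Q n F"]], of "sqrt N"]
  unfolding W_Q_N_def[abs_def] by blast

lemma FK_Gamma_1: "FK_Gamma n (\<lambda>_. 1) = FK_gamma n (\<lambda>_. 1)"
  by (simp add: FK_gamma_eq)

lemma FK_Gamma_centred:
  assumes F: "bounded_on (PiM {..n} E) C F"
  shows "FK_Gamma n (centred n F) = 0"
proof -
  \<comment> \<open>The two-element index set encodes the combination of F and the constant 1, so
    that the general linearity lemma covers the subtraction of the mean.\<close>
  let ?a = "\<lambda>b. if b then 1 / FK_gamma n (\<lambda>_. 1) else - FK_Q n F / FK_gamma n (\<lambda>_. 1)"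
  have "centred n F = (\<lambda>w. \<Sum>b\<in>{True, False}. ?a b * (if b then F else (\<lambda>_. 1)) w)"
    by (simp add: centred_def fun_eq_iff diff_divide_distrib)
  moreover have "bounded_on (PiM {..n} E) (if b then C else \<bar>1\<bar>) (if b then F else (\<lambda>_. 1))" for b
    using F bounded_on_const[of _ 1] by (cases b) simp_all
  ultimately have "FK_Gamma n (centred n F) = (\<Sum>b\<in>{True, False}. ?a b * FK_Gamma n (if b then F else (\<lambda>_. 1)))"
    using FK_Gamma_combination[of "{True, False}" n "\<lambda>b. if b then C else \<bar>1\<bar>" "\<lambda>b. if b then F else (\<lambda>_. 1)" ?a] by simp
  then show ?thesis using FK_gamma_1_pos[of n] by (simp add: FK_Q_def FK_Gamma_1)
qed

text \<open>An exact identity, since \<Gamma>_n vanishes on the centred function: the two fields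
  differ only by the factor \<gamma>^N_n(1) / \<gamma>_n(1), which tends to 1.\<close>

lemma W_Gamma_N_centred:
  assumes N: "1 \<le> N" and w: "\<omega> \<in> space (R N)" and F: "bounded_on (PiM {..n} E) C F"
  shows "W_Gamma_N n N (centred n F) \<omega> = mass (eta_flow N \<omega>) n / FK_gamma n (\<lambda>_. 1) * W_Q_N n N F \<omega>"
proof -
  obtain C' where c: "bounded_on (PiM {..n} E) C' (centred n F)" using centred_bounded[OF F] ..
  have "(\<integral>v. centred n F v \<partial>Q_N N n \<omega>) = ((\<integral>v. F v \<partial>Q_N N n \<omega>) - FK_Q n F) / FK_gamma n (\<lambda>_. 1)"
    unfolding centred_def using bounded_on_measure(2)[OF integral_Q_N(2)[OF N w F] F] in_space_prob_algebraD(1)[OF integral_Q_N(2)[OF N w F]]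
    by (simp add: prob_space.prob_space prob_space.finite_measure finite_measure.integrable_const)
  moreover have "(\<integral>v. centred n F v \<partial>Gamma_N N n \<omega>) = mass (eta_flow N \<omega>) n * (\<integral>v. centred n F v \<partial>Q_N N n \<omega>)"
    using integral_Gamma_N[OF N w c] integral_Q_N(1)[OF N w c] by (simp add: flow_Gamma_def)
  ultimately show ?thesis
    by (simp add: W_Gamma_N_def W_Q_N_def FK_Gamma_centred[OF F])
qed

lemma W_Gamma_N_1:
  assumes N: "1 \<le> N" and w: "\<omega> \<in> space (R N)"
  shows "W_Gamma_N n N (\<lambda>_. 1) \<omega> = sqrt N * (mass (eta_flow N \<omega>) n - FK_gamma n (\<lambda>_. 1))"
  using integral_Gamma_N[OF N w bounded_on_const[of _ 1]] flow_Gamma_last[OF flow_eta_N[OF N w], of n "\<lambda>_. 1"]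
    in_space_prob_algebraD(1)[OF eta_N_in_prob_algebra[OF N w, of n]]
  by (simp add: W_Gamma_N_def FK_Gamma_1 prob_space.prob_space)

text \<open>A quantitative Slutsky argument: \<open>iexp_ratio_bound\<close>, with s = sqrt N,
  bounds the difference of the exponentials by second moments of W^\<Gamma> divided by sqrt N, and
  these are bounded uniformly in N.\<close>

lemma W_Q_N_char_tendsto:
  assumes F: "bounded_on (PiM {..n} E) C F"
  shows "(\<lambda>N. \<integral>\<omega>. iexp (W_Q_N n N F \<omega>) \<partial>R N)
    \<longlonglongrightarrow> complex_of_real (exp (- ((\<Sum>p\<le>n. limit_variance p (weighted_D eta p n (centred n F))) / 2)))"
proof -
  obtain C' where c: "bounded_on (PiM {..n} E) C' (centred n F)" using centred_bounded[OF F] ..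
  let ?\<gamma> = "FK_gamma n (\<lambda>_. 1)"
  \<comment> \<open>The bounds of \<open>W_Gamma_N_square\<close> for the centred function and for
    the constant 1, whose field measures the fluctuation of the total mass.\<close>
  let ?A = "real (Suc n) * C'" and ?B = "real (Suc n) * \<bar>1\<bar>"
  show ?thesis
  proof (rule complex_tendsto_sandwich[OF _ inverse_sqrt_tendsto_0 W_Gamma_N_char_tendsto[OF c]])
    fix N :: nat assume N: "1 \<le> N"
    interpret RN: prob_space "R N" by (rule R_prob_space[OF N])
    let ?w = "W_Gamma_N n N (centred n F)" and ?u = "W_Gamma_N n N (\<lambda>_. 1)" and ?q = "W_Q_N n N F"
    obtain Cw where wb: "bounded_on (R N) Cw ?w" using W_Gamma_N_bounded[OF N c] ..
    obtain Cu where ub: "bounded_on (R N) Cu ?u" using W_Gamma_N_bounded[OF N bounded_on_const[of _ 1]] ..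
    obtain Cq where qb: "bounded_on (R N) Cq ?q" using W_Q_N_bounded[OF N F] ..
    have i1: "integrable (R N) (\<lambda>\<omega>. iexp (?q \<omega>))"
      by (rule RN.integrable_const_bound[where B=1]) (use borel_measurable_iexp[OF bounded_onD(1)[OF qb]] in auto)
    have i2: "integrable (R N) (\<lambda>\<omega>. iexp (?w \<omega>))"
      by (rule RN.integrable_const_bound[where B=1]) (use borel_measurable_iexp[OF bounded_onD(1)[OF wb]] in auto)
    have wi: "integrable (R N) (\<lambda>\<omega>. (?w \<omega>)\<^sup>2)" by (rule R_integrable[OF N bounded_on_power2[OF wb]])
    have ui: "integrable (R N) (\<lambda>\<omega>. (?u \<omega>)\<^sup>2)" by (rule R_integrable[OF N bounded_on_power2[OF ub]])
    have "(\<integral>\<omega>. iexp (?q \<omega>) \<partial>R N) - (\<integral>\<omega>. iexp (?w \<omega>) \<partial>R N) = (\<integral>\<omega>. iexp (?q \<omega>) - iexp (?w \<omega>) \<partial>R N)"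
      by (rule Bochner_Integration.integral_diff[OF i1 i2, symmetric])
    then have "cmod ((\<integral>\<omega>. iexp (?q \<omega>) \<partial>R N) - (\<integral>\<omega>. iexp (?w \<omega>) \<partial>R N)) \<le> (\<integral>\<omega>. cmod (iexp (?q \<omega>) - iexp (?w \<omega>)) \<partial>R N)"
      by (simp only: integral_norm_bound)
    also have "\<dots> \<le> (\<integral>\<omega>. ((?w \<omega>)\<^sup>2 / ?\<gamma> + 3 * (?u \<omega>)\<^sup>2 / ?\<gamma> + 2 / ?\<gamma>) / sqrt N \<partial>R N)"
    proof (rule integral_mono)
      show "integrable (R N) (\<lambda>\<omega>. cmod (iexp (?q \<omega>) - iexp (?w \<omega>)))"
        by (rule integrable_norm[OF Bochner_Integration.integrable_diff[OF i1 i2]])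
      show "integrable (R N) (\<lambda>\<omega>. ((?w \<omega>)\<^sup>2 / ?\<gamma> + 3 * (?u \<omega>)\<^sup>2 / ?\<gamma> + 2 / ?\<gamma>) / sqrt N)"
        using wi ui by simp
      show "cmod (iexp (?q \<omega>) - iexp (?w \<omega>)) \<le> ((?w \<omega>)\<^sup>2 / ?\<gamma> + 3 * (?u \<omega>)\<^sup>2 / ?\<gamma> + 2 / ?\<gamma>) / sqrt N"
        if w: "\<omega> \<in> space (R N)" for \<omega>
        by (rule iexp_ratio_bound[OF W_Gamma_N_centred[OF N w F] W_Gamma_N_1[OF N w]])
          (use mass_bounds[of n "eta_flow N \<omega>"] eta_N_in_prob_algebra[OF N w] FK_gamma_1_pos[of n] N in auto)
    qed
    also have "\<dots> = ((\<integral>\<omega>. (?w \<omega>)\<^sup>2 \<partial>R N) / ?\<gamma> + 3 * (\<integral>\<omega>. (?u \<omega>)\<^sup>2 \<partial>R N) / ?\<gamma> + 2 / ?\<gamma>) / sqrt N"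
      using wi ui by (simp add: RN.prob_space)
    also have "\<dots> \<le> (?A\<^sup>2 / ?\<gamma> + 3 * ?B\<^sup>2 / ?\<gamma> + 2 / ?\<gamma>) / sqrt N"
      using W_Gamma_N_square[OF N c] W_Gamma_N_square[OF N bounded_on_const[of _ 1], of n] FK_gamma_1_pos[of n]
      by (intro divide_right_mono add_mono mult_left_mono) auto
    finally show "cmod ((\<integral>\<omega>. iexp (?q \<omega>) \<partial>R N) - (\<integral>\<omega>. iexp (?w \<omega>) \<partial>R N)) \<le> (?A\<^sup>2 / ?\<gamma> + 3 * ?B\<^sup>2 / ?\<gamma> + 2 / ?\<gamma>) / sqrt N" .
  qed
qed

lemma W_Gamma_N_combination:
  assumes N: "1 \<le> N" and w: "\<omega> \<in> space (R N)" and J: "finite J"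
    and F: "\<And>j. j \<in> J \<Longrightarrow> bounded_on (PiM {..n} E) (C j) (F j)"
  shows "W_Gamma_N n N (\<lambda>v. \<Sum>j\<in>J. a j * F j v) \<omega> = (\<Sum>j\<in>J. a j * W_Gamma_N n N (F j) \<omega>)"
proof -
  have Fa: "bounded_on (PiM {..n} E) (\<Sum>j\<in>J. \<bar>a j\<bar> * C j) (\<lambda>w. \<Sum>j\<in>J. a j * F j w)"
    by (intro bounded_on_sum J bounded_on_cmult F)
  note q = integral_Q_N(2)[OF N w bounded_on_const[of _ 0], of n]
  have G: "(\<integral>v. f v \<partial>Gamma_N N n \<omega>) = mass (eta_flow N \<omega>) n * (\<integral>v. f v \<partial>Q_N N n \<omega>)" if "bounded_on (PiM {..n} E) C' f" for C' f
    using integral_Gamma_N[OF N w that] integral_Q_N(1)[OF N w that] by (simp add: flow_Gamma_def)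
  have "(\<integral>v. (\<Sum>j\<in>J. a j * F j v) \<partial>Gamma_N N n \<omega>) = (\<Sum>j\<in>J. a j * (\<integral>v. F j v \<partial>Gamma_N N n \<omega>))"
  proof -
    have "(\<integral>v. (\<Sum>j\<in>J. a j * F j v) \<partial>Q_N N n \<omega>) = (\<Sum>j\<in>J. a j * (\<integral>v. F j v \<partial>Q_N N n \<omega>))"
      by (rule integral_combination[OF q F])
    then show ?thesis by (simp add: G[OF Fa] G[OF F] sum_distrib_left mult.left_commute)
  qed
  moreover have "FK_Gamma n (\<lambda>w. \<Sum>j\<in>J. a j * F j w) = (\<Sum>j\<in>J. a j * FK_Gamma n (F j))"
    by (rule FK_Gamma_combination[OF F])
  ultimately show ?thesis
    by (simp add: W_Gamma_N_def sum_distrib_left right_diff_distrib sum_subtractf mult.left_commute)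
qed

lemma FK_Q_combination:
  assumes "\<And>j. j \<in> J \<Longrightarrow> bounded_on (PiM {..n} E) (C j) (F j)"
  shows "FK_Q n (\<lambda>v. \<Sum>j\<in>J. a j * F j v) = (\<Sum>j\<in>J. a j * FK_Q n (F j))"
proof -
  have "FK_Gamma n (\<lambda>w. \<Sum>j\<in>J. a j * F j w) = (\<Sum>j\<in>J. a j * FK_Gamma n (F j))"
    by (rule FK_Gamma_combination[OF assms])
  then show ?thesis by (simp add: FK_Q_def sum_divide_distrib)
qed

lemma centred_combination:
  assumes "\<And>j. j \<in> J \<Longrightarrow> bounded_on (PiM {..n} E) (C j) (F j)"
  shows "centred n (\<lambda>v. \<Sum>j\<in>J. a j * F j v) = (\<lambda>v. \<Sum>j\<in>J. a j * centred n (F j) v)"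
proof -
  have "FK_Q n (\<lambda>v. \<Sum>j\<in>J. a j * F j v) = (\<Sum>j\<in>J. a j * FK_Q n (F j))"
    by (rule FK_Q_combination[OF assms])
  then show ?thesis
    by (simp add: centred_def fun_eq_iff sum_divide_distrib sum_subtractf[symmetric] right_diff_distrib diff_divide_distrib)
qed

lemma W_Q_N_combination:
  assumes N: "1 \<le> N" and w: "\<omega> \<in> space (R N)"
    and F: "\<And>j. j \<in> J \<Longrightarrow> bounded_on (PiM {..n} E) (C j) (F j)"
  shows "W_Q_N n N (\<lambda>v. \<Sum>j\<in>J. a j * F j v) \<omega> = (\<Sum>j\<in>J. a j * W_Q_N n N (F j) \<omega>)"
proof -
  note q = integral_Q_N(2)[OF N w bounded_on_const[of _ 0], of n]
  have "(\<integral>v. (\<Sum>j\<in>J. a j * F j v) \<partial>Q_N N n \<omega>) = (\<Sum>j\<in>J. a j * (\<integral>v. F j v \<partial>Q_N N n \<omega>))"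
    by (rule integral_combination[OF q F])
  moreover have "FK_Q n (\<lambda>v. \<Sum>j\<in>J. a j * F j v) = (\<Sum>j\<in>J. a j * FK_Q n (F j))"
    by (rule FK_Q_combination[OF F])
  ultimately show ?thesis
    by (simp add: W_Q_N_def sum_distrib_left right_diff_distrib sum_subtractf mult.left_commute)
qed

end

section \<open>The limiting Gaussian fields\<close>

text \<open>As a scaled standard normal law it inherits the standard characteristic function by a
  change of variables.\<close>

lemma centered_gaussian_law_pos:
  assumes "0 < v"
  shows "centered_gaussian_law v = distr std_normal_distribution borel (\<lambda>x. sqrt v * x)"
proof -
  interpret sn: real_distribution std_normal_distribution by (rule real_dist_normal_dist)
  have "distributed std_normal_distribution lborel (\<lambda>x. x) (normal_density 0 1)"
    unfolding distributed_def by (auto simp: distr_id2)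
  from sn.normal_density_affine[OF this, of "sqrt v" 0] assms
  have "distributed std_normal_distribution lborel (\<lambda>x. sqrt v * x) (normal_density 0 (sqrt v))" by simp
  then have "distr std_normal_distribution lborel (\<lambda>x. sqrt v * x) = density lborel (normal_density 0 (sqrt v))"
    by (rule distributed_distr_eq_density)
  moreover have "distr std_normal_distribution borel (\<lambda>x. sqrt v * x) = distr std_normal_distribution lborel (\<lambda>x. sqrt v * x)"
    by (rule distr_cong) simp_all
  ultimately show ?thesis using assms by (simp add: centered_gaussian_law_def)
qed

lemma real_distribution_centered_gaussian_law:
  assumes "0 \<le> v"
  shows "real_distribution (centered_gaussian_law v)"
proof (cases "v = 0")
  case True
  then show ?thesis
    by (auto simp: centered_gaussian_law_def real_distribution_def real_distribution_axioms_def prob_space_return)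
next
  case False
  interpret sn: real_distribution std_normal_distribution by (rule real_dist_normal_dist)
  show ?thesis
    using False assms sn.prob_space_distr[of "\<lambda>x. sqrt v * x" borel]
    by (simp add: centered_gaussian_law_pos real_distribution_def real_distribution_axioms_def)
qed

lemma char_centered_gaussian_law:
  assumes "0 \<le> v"
  shows "char (centered_gaussian_law v) t = complex_of_real (exp (- (t\<^sup>2 * v / 2)))"
proof (cases "v = 0")
  case True
  then show ?thesis by (simp add: centered_gaussian_law_def char_def integral_return)
next
  case False
  then have "char (centered_gaussian_law v) t = (\<integral>x. iexp (t * (sqrt v * x)) \<partial>std_normal_distribution)"
    using assms by (simp add: centered_gaussian_law_pos char_def integral_distr)
  also have "\<dots> = char std_normal_distribution (t * sqrt v)" by (simp add: char_def mult.assoc)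
  also have "\<dots> = complex_of_real (exp (- (t\<^sup>2 * v / 2)))"
    using assms by (simp add: char_std_normal_distribution power_mult_distrib)
  finally show ?thesis .
qed

lemma second_moment_centered_gaussian_law:
  assumes "0 \<le> v"
  shows "(\<integral>x. x\<^sup>2 \<partial>centered_gaussian_law v) = v"
proof (cases "v = 0")
  case True
  then show ?thesis by (simp add: centered_gaussian_law_def integral_return)
next
  case False
  then have "(\<integral>x. x\<^sup>2 \<partial>centered_gaussian_law v) = (\<integral>x. normal_density 0 (sqrt v) x * x\<^sup>2 \<partial>lborel)"
    by (simp add: centered_gaussian_law_def integral_real_density)
  also have "\<dots> = v"
    using integral_normal_moment_even[of "sqrt v" 0 1] False assms by simp
  finally show ?thesis .
qed

text \<open>For fixed coefficients, the hypothesis as a function of \<open>t\<close> is the full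
  characteristic function of one linear combination; Levy uniqueness identifies its law.\<close>

lemma centered_gaussian_fieldI:
  fixes Z :: "'i \<Rightarrow> 'u \<Rightarrow> real"
  assumes U: "prob_space U" and Z: "\<And>f. f \<in> T \<Longrightarrow> Z f \<in> borel_measurable U"
    and char: "\<And>I a. finite I \<Longrightarrow> I \<subseteq> T \<Longrightarrow> \<exists>v\<ge>0. \<forall>t. (\<integral>\<omega>. iexp (\<Sum>f\<in>I. (t * a f) * Z f \<omega>) \<partial>U) = complex_of_real (exp (- (t\<^sup>2 * v / 2)))"
  shows "centered_gaussian_field U T Z"
  unfolding centered_gaussian_field_def
proof (intro conjI ballI allI impI)
  show "Z f \<in> borel_measurable U" if "f \<in> T" for f by (rule Z[OF that])
  fix I and a :: "'i \<Rightarrow> real" assume I: "finite I \<and> I \<subseteq> T"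
  then obtain v where v: "0 \<le> v" "\<And>t. (\<integral>\<omega>. iexp (\<Sum>f\<in>I. (t * a f) * Z f \<omega>) \<partial>U) = complex_of_real (exp (- (t\<^sup>2 * v / 2)))"
    using char[of I a] by blast
  let ?L = "distr U borel (\<lambda>\<omega>. \<Sum>f\<in>I. a f * Z f \<omega>)"
  have m: "(\<lambda>\<omega>. \<Sum>f\<in>I. a f * Z f \<omega>) \<in> borel_measurable U"
    using I Z by (intro borel_measurable_sum borel_measurable_times) auto
  have "?L = centered_gaussian_law v"
  proof (rule Levy_uniqueness[OF _ real_distribution_centered_gaussian_law[OF v(1)]])
    show "real_distribution ?L"
      using prob_space.prob_space_distr[OF U m] by (simp add: real_distribution_def real_distribution_axioms_def)
    show "char ?L = char (centered_gaussian_law v)"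
    proof
      fix t
      have "char ?L t = (\<integral>\<omega>. iexp (t * (\<Sum>f\<in>I. a f * Z f \<omega>)) \<partial>U)"
        unfolding char_def by (rule integral_distr[OF m]) (rule borel_measurable_iexp, simp)
      also have "\<dots> = (\<integral>\<omega>. iexp (\<Sum>f\<in>I. (t * a f) * Z f \<omega>) \<partial>U)"
        by (simp only: sum_distrib_left mult.assoc)
      finally show "char ?L t = char (centered_gaussian_law v) t"
        by (simp only: v(2) char_centered_gaussian_law[OF v(1)])
    qed
  qed
  then show "\<exists>v\<ge>0. ?L = centered_gaussian_law v" using v(1) by blast
qed

text \<open>The multivariate limit is applied to the sequence shifted by one, because the particle
  spaces are only known to be probability spaces from N = 1 on.\<close>

lemma converges_fddI:
  fixes Y :: "nat \<Rightarrow> 'i \<Rightarrow> 'v \<Rightarrow> real"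
  assumes R: "\<And>N. 1 \<le> N \<Longrightarrow> prob_space (R N)" and Y: "\<And>N f. 1 \<le> N \<Longrightarrow> f \<in> T \<Longrightarrow> Y N f \<in> borel_measurable (R N)"
    and U: "prob_space U" and Z: "\<And>f. f \<in> T \<Longrightarrow> Z f \<in> borel_measurable U"
    and char: "\<And>k F t. F \<in> {..<k::nat} \<rightarrow> T \<Longrightarrow>
      (\<lambda>N. \<integral>\<omega>. iexp (\<Sum>i<k. t i * Y N (F i) \<omega>) \<partial>R N) \<longlonglongrightarrow> (\<integral>\<omega>. iexp (\<Sum>i<k. t i * Z (F i) \<omega>) \<partial>U)"
  shows "converges_fdd T R Y U Z"
  unfolding converges_fdd_def
proof (intro conjI allI ballI impI)
  show "\<forall>\<^sub>F N in sequentially. \<forall>f\<in>T. Y N f \<in> borel_measurable (R N)"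
    using Y by (intro eventually_sequentiallyI[of 1]) auto
  show "Z f \<in> borel_measurable U" if "f \<in> T" for f by (rule Z[OF that])
  fix k :: nat and F and \<phi> :: "(nat \<Rightarrow> real) \<Rightarrow> real"
  assume F: "F \<in> {..<k} \<rightarrow> T"
    and \<phi>: "continuous_map (product_topology (\<lambda>_. euclideanreal) {..<k}) euclideanreal \<phi> \<and> bounded (\<phi> ` ({..<k} \<rightarrow>\<^sub>E UNIV))"
  have FT: "F i \<in> T" if "i < k" for i using F that by blast
  have "(\<lambda>N. \<integral>\<omega>. \<phi> (\<lambda>i\<in>{..<k}. Y (Suc N) (F i) \<omega>) \<partial>R (Suc N)) \<longlonglongrightarrow> (\<integral>\<omega>. \<phi> (\<lambda>i\<in>{..<k}. Z (F i) \<omega>) \<partial>U)"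
  proof (rule cramer_wold[where R="\<lambda>N. R (Suc N)" and Y="\<lambda>N i. Y (Suc N) (F i)" and Z="\<lambda>i. Z (F i)", OF _ _ U _ _ conjunct1[OF \<phi>] conjunct2[OF \<phi>]])
    show "(\<lambda>N. \<integral>\<omega>. iexp (\<Sum>i<k. t i * Y (Suc N) (F i) \<omega>) \<partial>R (Suc N)) \<longlonglongrightarrow> (\<integral>\<omega>. iexp (\<Sum>i<k. t i * Z (F i) \<omega>) \<partial>U)" for t
      using LIMSEQ_Suc[OF char[OF F, of t]] .
  qed (use R Y Z FT in simp_all)
  then show "(\<lambda>N. \<integral>\<omega>. \<phi> (\<lambda>i\<in>{..<k}. Y N (F i) \<omega>) \<partial>R N) \<longlonglongrightarrow> (\<integral>\<omega>. \<phi> (\<lambda>i\<in>{..<k}. Z (F i) \<omega>) \<partial>U)"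
    by (rule LIMSEQ_imp_Suc)
qed

lemma var_of_cong: "(\<And>x. x \<in> space M \<Longrightarrow> f x = g x) \<Longrightarrow> var_of M f = var_of M g"
  unfolding var_of_def by (simp cong: Bochner_Integration.integral_cong)

lemma var_of_scale: "var_of M (\<lambda>x. c * f x) = c\<^sup>2 * var_of M f"
  unfolding var_of_def by (simp add: right_diff_distrib[symmetric] power_mult_distrib)

lemma bmfI: "bounded_on S C f \<Longrightarrow> f \<in> bmf S"
  unfolding in_bmf by (rule exI)

lemma bmfE:
  assumes "f \<in> bmf S"
  obtains C where "bounded_on S C f"
  using assms unfolding in_bmf by (rule exE)

lemma bmf_sum:
  assumes "finite J" "\<And>j. j \<in> J \<Longrightarrow> f j \<in> bmf S"
  shows "(\<lambda>x. \<Sum>j\<in>J. a j * f j x) \<in> bmf S"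
proof -
  obtain C where "\<And>j. j \<in> J \<Longrightarrow> bounded_on S (C j) (f j)" using assms(2) unfolding in_bmf by metis
  then have "bounded_on S (\<Sum>j\<in>J. \<bar>a j\<bar> * C j) (\<lambda>x. \<Sum>j\<in>J. a j * f j x)"
    by (intro bounded_on_sum assms(1) bounded_on_cmult)
  then show ?thesis by (rule bmfI)
qed

lemma tendsto_cong_ge_1:
  assumes "\<And>N. 1 \<le> N \<Longrightarrow> a N = b N" "b \<longlonglongrightarrow> (l :: 'b :: topological_space)"
  shows "a \<longlonglongrightarrow> l"
  using assms(2) by (rule Lim_transform_eventually) (use assms(1) in \<open>auto intro!: eventually_sequentiallyI[of 1]\<close>)

lemma bmf_bounds:
  assumes "\<And>j. j \<in> J \<Longrightarrow> F j \<in> bmf S"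
  shows "\<exists>C. \<forall>j\<in>J. bounded_on S (C j) (F j)"
  using assms unfolding in_bmf by (intro bchoice) blast

section \<open>Laws of the limiting fields and convergence\<close>

locale dominated_limit_fields =
  limit_fields P E eta0 M G lam H X eps R xi U V + dominated_particle_model P E eta0 M G lam H X eps R xi hp
  for P :: "'w measure"
    and E :: "nat \<Rightarrow> 'a measure"
    and eta0 M G lam H X eps
    and R :: "nat \<Rightarrow> 'v measure"
    and xi
    and U :: "'u measure"
    and V and hp
begin

lemma limit_variance_cong:
  assumes "\<And>x. x \<in> space (E p) \<Longrightarrow> f x = g x"
  shows "limit_variance p f = limit_variance p g"
proof (cases p)
  case 0
  then show ?thesis using assms in_space_prob_algebraD(3)[OF eta0]
    by (auto simp: limit_variance_def intro: var_of_cong)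
next
  case (Suc m)
  have "step_variance m (eta m) f = step_variance m (eta m) g"
    unfolding step_variance_def
  proof (intro Bochner_Integration.integral_cong refl var_of_cong)
    fix x y assume "x \<in> space (eta m)" "y \<in> space (K (Suc m) (eta m) x)"
    then show "f y = g y"
      using assms Suc in_space_prob_algebraD(3)[OF eta_in_prob_algebra[of m]]
        in_space_prob_algebraD(3)[OF K_in_prob_algebra[OF eta_in_prob_algebra]] by auto
  qed
  then show ?thesis by (simp add: limit_variance_def Suc)
qed

lemma limit_variance_scale: "limit_variance p (\<lambda>x. c * f x) = c\<^sup>2 * limit_variance p f"
  by (auto simp: limit_variance_def step_variance_def var_of_scale split: nat.split)

lemma V_measurable: "f \<in> bmf (E p) \<Longrightarrow> V p f \<in> borel_measurable U"
  using V_gaussian[of p] by (simp add: centered_gaussian_field_def)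

text \<open>Gaussianity supplies some variance v; the second moment of the law equals v and is also
  prescribed by the model, which fixes it.\<close>

lemma V_law:
  assumes f: "f \<in> bmf (E p)"
  shows "distr U borel (V p f) = centered_gaussian_law (limit_variance p f)"
proof -
  have "finite {f} \<and> {f} \<subseteq> bmf (E p)" using f by simp
  from V_gaussian[of p, unfolded centered_gaussian_field_def, THEN conjunct2, THEN spec, THEN spec, THEN mp, OF this, of "\<lambda>_. 1"]
  obtain v where v: "0 \<le> v" "distr U borel (\<lambda>\<omega>. \<Sum>g\<in>{f}. 1 * V p g \<omega>) = centered_gaussian_law v"
    by (elim exE conjE)
  then have v2: "distr U borel (V p f) = centered_gaussian_law v" by simp
  have "(\<integral>\<omega>. (V p f \<omega>)\<^sup>2 \<partial>U) = (\<integral>x. x\<^sup>2 \<partial>distr U borel (V p f))"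
    using V_measurable[OF f] by (simp add: integral_distr)
  also have "\<dots> = v" unfolding v2 by (rule second_moment_centered_gaussian_law[OF v(1)])
  finally have "v = limit_variance p f"
    using V_0_variance[of f] V_Suc_variance[of f "p - 1"] f
    by (cases p) (auto simp: limit_variance_def step_variance_def var_of_def)
  then show ?thesis using v2 by simp
qed

text \<open>Independence is assumed for whole fields as random elements of product spaces;
  evaluating the p-th one at the coordinate \<open>g p\<close> gives independent real variables,
  whose characteristic functions multiply.\<close>

lemma V_sum_char:
  assumes g: "\<And>p. p \<le> n \<Longrightarrow> g p \<in> bmf (E p)"
  shows "(\<integral>\<omega>. iexp (\<Sum>p\<le>n. V p (g p) \<omega>) \<partial>U) = complex_of_real (exp (- ((\<Sum>p\<le>n. limit_variance p (g p)) / 2)))"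
proof -
  interpret U: prob_space U by (rule U_prob_space)
  have "U.indep_vars (\<lambda>p. PiM (bmf (E p)) (\<lambda>_. borel)) (\<lambda>p \<omega>. \<lambda>f\<in>bmf (E p). V p f \<omega>) {..n}"
    by (rule U.indep_vars_subset[OF V_indep]) simp
  then have "U.indep_vars (\<lambda>_. borel) (\<lambda>p \<omega>. (\<lambda>f\<in>bmf (E p). V p f \<omega>) (g p)) {..n}"
    by (rule U.indep_vars_compose2) (use g in \<open>auto intro!: measurable_component_singleton\<close>)
  then have "U.indep_vars (\<lambda>_. borel) (\<lambda>p \<omega>. V p (g p) \<omega>) {..n}"
    by (rule U.indep_vars_cong[THEN iffD1, rotated -1]) (use g in auto)
  from U.char_distr_sum[OF this, of 1]
  have "char (distr U borel (\<lambda>\<omega>. \<Sum>p\<le>n. V p (g p) \<omega>)) 1 = (\<Prod>p\<le>n. char (distr U borel (V p (g p))) 1)" .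
  also have "\<dots> = (\<Prod>p\<le>n. complex_of_real (exp (- (limit_variance p (g p) / 2))))"
    by (intro prod.cong refl) (simp add: V_law[OF g] char_centered_gaussian_law[OF limit_variance_nonneg])
  also have "\<dots> = complex_of_real (exp (- ((\<Sum>p\<le>n. limit_variance p (g p)) / 2)))"
    unfolding of_real_prod[symmetric] exp_sum[symmetric, OF finite_atMost] by (simp add: sum_negf sum_divide_distrib)
  finally have 1: "char (distr U borel (\<lambda>\<omega>. \<Sum>p\<le>n. V p (g p) \<omega>)) 1 = complex_of_real (exp (- ((\<Sum>p\<le>n. limit_variance p (g p)) / 2)))" .
  have "(\<lambda>\<omega>. \<Sum>p\<le>n. V p (g p) \<omega>) \<in> borel_measurable U"
    using V_measurable[OF g] by (intro borel_measurable_sum) auto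
  then have "char (distr U borel (\<lambda>\<omega>. \<Sum>p\<le>n. V p (g p) \<omega>)) 1 = (\<integral>\<omega>. iexp (1 * (\<Sum>p\<le>n. V p (g p) \<omega>)) \<partial>U)"
    unfolding char_def by (rule integral_distr) (rule borel_measurable_iexp, simp)
  then show ?thesis unfolding 1 by simp
qed

text \<open>Linearity holds outside a null set depending on the functions and coefficients, so it is
  extended to finite sums by induction, collecting finitely many null sets.\<close>

lemma V_combination:
  assumes "finite J" "\<And>j. j \<in> J \<Longrightarrow> f j \<in> bmf (E p)"
  shows "AE \<omega> in U. V p (\<lambda>x. \<Sum>j\<in>J. a j * f j x) \<omega> = (\<Sum>j\<in>J. a j * V p (f j) \<omega>)"
  using assms
proof (induction J rule: finite_induct)
  case empty
  have "(\<lambda>_. 0) \<in> bmf (E p)" by (rule bmfI, rule bounded_on_const)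
  from V_linear[OF this this, of 0 0] show ?case by simp
next
  case (insert i J)
  have "(\<lambda>x. \<Sum>j\<in>J. a j * f j x) \<in> bmf (E p)"
    by (rule bmf_sum[OF insert.hyps(1) insert.prems]) simp
  from V_linear[OF insert.prems[OF insertI1] this, of "a i" 1]
  have "AE \<omega> in U. V p (\<lambda>x. a i * f i x + (\<Sum>j\<in>J. a j * f j x)) \<omega> = a i * V p (f i) \<omega> + V p (\<lambda>x. \<Sum>j\<in>J. a j * f j x) \<omega>" by simp
  moreover have "AE \<omega> in U. V p (\<lambda>x. \<Sum>j\<in>J. a j * f j x) \<omega> = (\<Sum>j\<in>J. a j * V p (f j) \<omega>)"
    by (rule insert.IH[OF insert.prems]) simp
  ultimately show ?case
  proof eventually_elim
    case (elim \<omega>)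
    then show ?case using insert.hyps by simp
  qed
qed

text \<open>For each time p the finite combination is first moved inside V_p by linearity, leaving
  one function per time; only then does independence over p apply.\<close>

lemma V_double_sum_char:
  assumes J: "finite J" and g: "\<And>p j. p \<le> n \<Longrightarrow> j \<in> J \<Longrightarrow> g p j \<in> bmf (E p)"
  shows "(\<integral>\<omega>. iexp (\<Sum>j\<in>J. a j * (\<Sum>p\<le>n. b p * V p (g p j) \<omega>)) \<partial>U)
    = complex_of_real (exp (- ((\<Sum>p\<le>n. limit_variance p (\<lambda>x. \<Sum>j\<in>J. (a j * b p) * g p j x)) / 2)))"
proof -
  let ?h = "\<lambda>p x. \<Sum>j\<in>J. (a j * b p) * g p j x"
  have h: "?h p \<in> bmf (E p)" if "p \<le> n" for p by (rule bmf_sum[OF J g[OF that]])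
  have "AE \<omega> in U. \<forall>p\<in>{..n}. V p (?h p) \<omega> = (\<Sum>j\<in>J. (a j * b p) * V p (g p j) \<omega>)"
    by (rule AE_finite_allI) (simp, rule V_combination[OF J g], simp_all)
  then have ae: "AE \<omega> in U. (\<Sum>j\<in>J. a j * (\<Sum>p\<le>n. b p * V p (g p j) \<omega>)) = (\<Sum>p\<le>n. V p (?h p) \<omega>)"
  proof eventually_elim
    case (elim \<omega>)
    have "(\<Sum>j\<in>J. a j * (\<Sum>p\<le>n. b p * V p (g p j) \<omega>)) = (\<Sum>p\<le>n. \<Sum>j\<in>J. (a j * b p) * V p (g p j) \<omega>)"
      unfolding sum_distrib_left mult.assoc by (rule sum.swap)
    then show ?case using elim by simp
  qed
  have "(\<integral>\<omega>. iexp (\<Sum>j\<in>J. a j * (\<Sum>p\<le>n. b p * V p (g p j) \<omega>)) \<partial>U) = (\<integral>\<omega>. iexp (\<Sum>p\<le>n. V p (?h p) \<omega>) \<partial>U)"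
  proof (rule integral_cong_AE)
    show "(\<lambda>\<omega>. iexp (\<Sum>j\<in>J. a j * (\<Sum>p\<le>n. b p * V p (g p j) \<omega>))) \<in> borel_measurable U"
      using V_measurable[OF g] by (intro borel_measurable_iexp borel_measurable_sum borel_measurable_times) auto
    show "(\<lambda>\<omega>. iexp (\<Sum>p\<le>n. V p (?h p) \<omega>)) \<in> borel_measurable U"
      using V_measurable[OF h] by (intro borel_measurable_iexp borel_measurable_sum) auto
    show "AE \<omega> in U. iexp (\<Sum>j\<in>J. a j * (\<Sum>p\<le>n. b p * V p (g p j) \<omega>)) = iexp (\<Sum>p\<le>n. V p (?h p) \<omega>)"
      using ae by eventually_elim simp
  qed
  also have "\<dots> = complex_of_real (exp (- ((\<Sum>p\<le>n. limit_variance p (?h p)) / 2)))"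
    by (rule V_sum_char[OF h])
  finally show ?thesis .
qed

lemma D_bmf:
  assumes "p \<le> n" "F \<in> bmf (PiM {..n} E)"
  shows "D p n F \<in> bmf (E p)"
proof -
  obtain C where "bounded_on (PiM {..n} E) C F" by (rule bmfE[OF assms(2)])
  from D_bounded[OF assms(1) this] show ?thesis by (rule bmfI)
qed

lemma G_norm_P_norm_bmf:
  assumes "p \<le> n" "F \<in> bmf (PiM {..n} E)"
  shows "(\<lambda>x. G_norm p n x * P_norm p n (\<lambda>w. F w - FK_Q n F) x) \<in> bmf (E p)"
proof -
  obtain C where F: "bounded_on (PiM {..n} E) C F" by (rule bmfE[OF assms(2)])
  obtain C' where c: "bounded_on (PiM {..n} E) C' (centred n F)" using centred_bounded[OF F] ..
  have "bounded_on (E p) C' (weighted_D eta p n (centred n F))"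
    by (rule weighted_D_bounded[OF eta_in_prob_algebra assms(1) c])
  then have "bounded_on (E p) C' (\<lambda>x. G_norm p n x * P_norm p n (\<lambda>w. F w - FK_Q n F) x)"
    by (rule bounded_on_cong[THEN iffD1, rotated]) (simp add: G_norm_P_norm[OF assms(1) F])
  then show ?thesis by (rule bmfI)
qed

text \<open>The common expression in which the particle limits and the laws of the limiting fields
  are compared; for W^Q it is evaluated at the centred function.\<close>

definition field_variance :: "nat \<Rightarrow> ((nat \<Rightarrow> 'a) \<Rightarrow> real) \<Rightarrow> real" where
  "field_variance n F = (\<Sum>p\<le>n. limit_variance p (weighted_D eta p n F))"

lemma field_variance_nonneg: "0 \<le> field_variance n F"
  unfolding field_variance_def by (intro sum_nonneg limit_variance_nonneg)

lemma field_variance_scale: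
  assumes "bounded_on (PiM {..n} E) C F"
  shows "field_variance n (\<lambda>w. c * F w) = c\<^sup>2 * field_variance n F"
proof -
  have "limit_variance p (weighted_D eta p n (\<lambda>w. c * F w)) = c\<^sup>2 * limit_variance p (weighted_D eta p n F)" if "p \<le> n" for p
    unfolding limit_variance_scale[symmetric]
  proof (rule limit_variance_cong)
    fix x assume x: "x \<in> space (E p)"
    show "weighted_D eta p n (\<lambda>w. c * F w) x = c * weighted_D eta p n F x"
      using weighted_D_combination[of "{()}" n "\<lambda>_. C" "\<lambda>_. F" p eta x "\<lambda>_. c"] assms that eta_in_prob_algebra x by simp
  qed
  then show ?thesis by (simp add: field_variance_def sum_distrib_left)
qed

lemma W_Gamma_char:
  assumes J: "finite J" and F: "\<And>j. j \<in> J \<Longrightarrow> F j \<in> bmf (PiM {..n} E)"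
  shows "(\<integral>\<omega>. iexp (\<Sum>j\<in>J. a j * W_Gamma V n (F j) \<omega>) \<partial>U)
    = complex_of_real (exp (- (field_variance n (\<lambda>w. \<Sum>j\<in>J. a j * F j w) / 2)))"
proof -
  have "\<exists>C. \<forall>j\<in>J. bounded_on (PiM {..n} E) (C j) (F j)" by (rule bmf_bounds[OF F])
  then obtain C where C: "\<And>j. j \<in> J \<Longrightarrow> bounded_on (PiM {..n} E) (C j) (F j)" by blast
  have "limit_variance p (\<lambda>x. \<Sum>j\<in>J. (a j * FK_gamma p (\<lambda>_. 1)) * D p n (F j) x) = limit_variance p (weighted_D eta p n (\<lambda>w. \<Sum>j\<in>J. a j * F j w))"
    if "p \<le> n" for p
  proof (rule limit_variance_cong)
    fix x assume x: "x \<in> space (E p)"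
    have "weighted_D eta p n (\<lambda>w. \<Sum>j\<in>J. a j * F j w) x = (\<Sum>j\<in>J. a j * weighted_D eta p n (F j) x)"
      by (rule weighted_D_combination[OF J C that eta_in_prob_algebra x])
    then show "(\<Sum>j\<in>J. (a j * FK_gamma p (\<lambda>_. 1)) * D p n (F j) x) = weighted_D eta p n (\<lambda>w. \<Sum>j\<in>J. a j * F j w) x"
      by (simp add: weighted_D_def D_eq_flow_D mass_eta mult.assoc)
  qed
  then show ?thesis
    unfolding W_Gamma_def field_variance_def by (subst V_double_sum_char[OF J D_bmf[OF _ F]]) simp_all
qed

text \<open>Rewriting G P as the weighted backward function of \<open>centred n F\<close> makes the
  dependence on F visibly linear, so the combination over \<open>J\<close> can be formed inside
  it.\<close>

lemma W_Q_char:
  assumes J: "finite J" and F: "\<And>j. j \<in> J \<Longrightarrow> F j \<in> bmf (PiM {..n} E)"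
  shows "(\<integral>\<omega>. iexp (\<Sum>j\<in>J. a j * W_Q V n (F j) \<omega>) \<partial>U)
    = complex_of_real (exp (- (field_variance n (centred n (\<lambda>w. \<Sum>j\<in>J. a j * F j w)) / 2)))"
proof -
  have "\<exists>C. \<forall>j\<in>J. bounded_on (PiM {..n} E) (C j) (F j)" by (rule bmf_bounds[OF F])
  then obtain C where C: "\<And>j. j \<in> J \<Longrightarrow> bounded_on (PiM {..n} E) (C j) (F j)" by blast
  obtain C' where C': "\<And>j. j \<in> J \<Longrightarrow> bounded_on (PiM {..n} E) (C' j) (centred n (F j))"
    using centred_bounded[OF C] by metis
  let ?g = "\<lambda>p j x. G_norm p n x * P_norm p n (\<lambda>w. F j w - FK_Q n (F j)) x"
  have cc: "centred n (\<lambda>w. \<Sum>j\<in>J. a j * F j w) = (\<lambda>w. \<Sum>j\<in>J. a j * centred n (F j) w)"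
    by (rule centred_combination[OF C])
  have lv: "limit_variance p (\<lambda>x. \<Sum>j\<in>J. (a j * 1) * ?g p j x) = limit_variance p (weighted_D eta p n (centred n (\<lambda>w. \<Sum>j\<in>J. a j * F j w)))"
    if "p \<le> n" for p
  proof (rule limit_variance_cong)
    fix x assume x: "x \<in> space (E p)"
    have "weighted_D eta p n (\<lambda>w. \<Sum>j\<in>J. a j * centred n (F j) w) x = (\<Sum>j\<in>J. a j * weighted_D eta p n (centred n (F j)) x)"
      by (rule weighted_D_combination[OF J C' that eta_in_prob_algebra x])
    then show "(\<Sum>j\<in>J. (a j * 1) * ?g p j x) = weighted_D eta p n (centred n (\<lambda>w. \<Sum>j\<in>J. a j * F j w)) x"
      unfolding cc by (simp add: G_norm_P_norm[OF that C x])
  qed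
  have "(\<integral>\<omega>. iexp (\<Sum>j\<in>J. a j * W_Q V n (F j) \<omega>) \<partial>U) = (\<integral>\<omega>. iexp (\<Sum>j\<in>J. a j * (\<Sum>p\<le>n. 1 * V p (?g p j) \<omega>)) \<partial>U)"
    by (simp add: W_Q_def)
  also have "\<dots> = complex_of_real (exp (- ((\<Sum>p\<le>n. limit_variance p (\<lambda>x. \<Sum>j\<in>J. (a j * 1) * ?g p j x)) / 2)))"
    by (rule V_double_sum_char[OF J G_norm_P_norm_bmf[OF _ F]])
  also have "(\<Sum>p\<le>n. limit_variance p (\<lambda>x. \<Sum>j\<in>J. (a j * 1) * ?g p j x)) = field_variance n (centred n (\<lambda>w. \<Sum>j\<in>J. a j * F j w))"
    unfolding field_variance_def by (rule sum.cong[OF refl], rule lv) simp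
  finally show ?thesis .
qed

lemma W_Gamma_measurable: "F \<in> bmf (PiM {..n} E) \<Longrightarrow> W_Gamma V n F \<in> borel_measurable U"
  unfolding W_Gamma_def[abs_def]
  by (intro borel_measurable_sum borel_measurable_times borel_measurable_const V_measurable D_bmf) auto

lemma W_Q_measurable: "F \<in> bmf (PiM {..n} E) \<Longrightarrow> W_Q V n F \<in> borel_measurable U"
  unfolding W_Q_def[abs_def]
  by (intro borel_measurable_sum V_measurable G_norm_P_norm_bmf) auto

text \<open>Scaling the coefficients by t multiplies the variance by t^2, so each linear combination
  has a Gaussian characteristic function.\<close>

lemma centered_gaussian_field_W_Gamma: "centered_gaussian_field U (bmf (PiM {..n} E)) (W_Gamma V n)"
proof (rule centered_gaussian_fieldI[OF U_prob_space W_Gamma_measurable])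
  fix I and a :: "_ \<Rightarrow> real" assume I: "finite I" "I \<subseteq> bmf (PiM {..n} E)"
  let ?F = "\<lambda>w. \<Sum>f\<in>I. a f * f w"
  have "?F \<in> bmf (PiM {..n} E)" by (rule bmf_sum[OF I(1)]) (use I(2) in blast)
  then obtain C where F: "bounded_on (PiM {..n} E) C ?F" by (rule bmfE)
  have "(\<integral>\<omega>. iexp (\<Sum>f\<in>I. (t * a f) * W_Gamma V n f \<omega>) \<partial>U) = complex_of_real (exp (- (t\<^sup>2 * field_variance n ?F / 2)))" for t
  proof -
    have "(\<integral>\<omega>. iexp (\<Sum>f\<in>I. (t * a f) * W_Gamma V n f \<omega>) \<partial>U) = complex_of_real (exp (- (field_variance n (\<lambda>w. \<Sum>f\<in>I. (t * a f) * f w) / 2)))"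
      by (rule W_Gamma_char[OF I(1), of "\<lambda>f. f"]) (use I in auto)
    also have "(\<lambda>w. \<Sum>f\<in>I. (t * a f) * f w) = (\<lambda>w. t * ?F w)"
      by (simp add: fun_eq_iff sum_distrib_left mult.assoc)
    finally show ?thesis unfolding field_variance_scale[OF F] .
  qed
  then show "\<exists>v\<ge>0. \<forall>t. (\<integral>\<omega>. iexp (\<Sum>f\<in>I. (t * a f) * W_Gamma V n f \<omega>) \<partial>U) = complex_of_real (exp (- (t\<^sup>2 * v / 2)))"
    using field_variance_nonneg[of n ?F] by blast
qed

lemma centered_gaussian_field_W_Q: "centered_gaussian_field U (bmf (PiM {..n} E)) (W_Q V n)"
proof (rule centered_gaussian_fieldI[OF U_prob_space W_Q_measurable])
  fix I and a :: "_ \<Rightarrow> real" assume I: "finite I" "I \<subseteq> bmf (PiM {..n} E)"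
  let ?F = "\<lambda>w. \<Sum>f\<in>I. a f * f w"
  have "?F \<in> bmf (PiM {..n} E)" by (rule bmf_sum[OF I(1)]) (use I(2) in blast)
  then obtain C where F: "bounded_on (PiM {..n} E) C ?F" by (rule bmfE)
  obtain C' where c: "bounded_on (PiM {..n} E) C' (centred n ?F)" using centred_bounded[OF F] ..
  have "(\<integral>\<omega>. iexp (\<Sum>f\<in>I. (t * a f) * W_Q V n f \<omega>) \<partial>U) = complex_of_real (exp (- (t\<^sup>2 * field_variance n (centred n ?F) / 2)))" for t
  proof -
    have "(\<integral>\<omega>. iexp (\<Sum>f\<in>I. (t * a f) * W_Q V n f \<omega>) \<partial>U) = complex_of_real (exp (- (field_variance n (centred n (\<lambda>w. \<Sum>f\<in>I. (t * a f) * f w)) / 2)))"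
      by (rule W_Q_char[OF I(1), of "\<lambda>f. f"]) (use I in auto)
    also have "(\<lambda>w. \<Sum>f\<in>I. (t * a f) * f w) = (\<lambda>w. \<Sum>j\<in>{()}. t * ?F w)"
      by (simp add: fun_eq_iff sum_distrib_left mult.assoc)
    also have "centred n (\<lambda>w. \<Sum>j\<in>{()}. t * ?F w) = (\<lambda>w. \<Sum>j\<in>{()}. t * centred n ?F w)"
      by (rule centred_combination[of "{()}" n "\<lambda>_. C" "\<lambda>_. ?F" "\<lambda>_. t"]) (rule F)
    also have "\<dots> = (\<lambda>w. t * centred n ?F w)" by simp
    finally show ?thesis unfolding field_variance_scale[OF c] .
  qed
  then show "\<exists>v\<ge>0. \<forall>t. (\<integral>\<omega>. iexp (\<Sum>f\<in>I. (t * a f) * W_Q V n f \<omega>) \<partial>U) = complex_of_real (exp (- (t\<^sup>2 * v / 2)))"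
    using field_variance_nonneg[of n "centred n ?F"] by blast
qed

text \<open>The particle field is linear in its index, so a joint characteristic function is the
  scalar one at the combined test function; the limit field has the same value there.\<close>

lemma converges_fdd_W_Gamma:
  "converges_fdd (bmf (PiM {..n} E)) R (W_Gamma_N n) U (W_Gamma V n)"
proof (rule converges_fddI[OF R_prob_space _ U_prob_space W_Gamma_measurable])
  show "W_Gamma_N n N f \<in> borel_measurable (R N)" if Nf: "1 \<le> N" "f \<in> bmf (PiM {..n} E)" for N f
  proof -
    obtain C where "bounded_on (PiM {..n} E) C f" by (rule bmfE[OF Nf(2)])
    then obtain C' where "bounded_on (R N) C' (W_Gamma_N n N f)" using W_Gamma_N_bounded[OF Nf(1)] by blast
    then show ?thesis by (rule bounded_onD(1))
  qed
  fix k :: nat and F and t :: "nat \<Rightarrow> real" assume F: "F \<in> {..<k} \<rightarrow> bmf (PiM {..n} E)"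
  then have Fi: "F i \<in> bmf (PiM {..n} E)" if "i \<in> {..<k}" for i using that by blast
  have "\<exists>C. \<forall>i\<in>{..<k}. bounded_on (PiM {..n} E) (C i) (F i)" by (rule bmf_bounds[OF Fi])
  then obtain C where C: "\<And>i. i \<in> {..<k} \<Longrightarrow> bounded_on (PiM {..n} E) (C i) (F i)" by blast
  obtain C' where Fs: "bounded_on (PiM {..n} E) C' (\<lambda>w. \<Sum>i<k. t i * F i w)"
    by (rule bmfE[OF bmf_sum[OF finite_lessThan Fi]])
  have char_U: "(\<integral>\<omega>. iexp (\<Sum>i<k. t i * W_Gamma V n (F i) \<omega>) \<partial>U) = complex_of_real (exp (- (field_variance n (\<lambda>w. \<Sum>i<k. t i * F i w) / 2)))"
    by (rule W_Gamma_char[OF finite_lessThan Fi])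
  show "(\<lambda>N. \<integral>\<omega>. iexp (\<Sum>i<k. t i * W_Gamma_N n N (F i) \<omega>) \<partial>R N) \<longlonglongrightarrow> (\<integral>\<omega>. iexp (\<Sum>i<k. t i * W_Gamma V n (F i) \<omega>) \<partial>U)"
    unfolding char_U field_variance_def
  proof (rule tendsto_cong_ge_1[OF _ W_Gamma_N_char_tendsto[OF Fs]])
    show "(\<integral>\<omega>. iexp (\<Sum>i<k. t i * W_Gamma_N n N (F i) \<omega>) \<partial>R N) = (\<integral>\<omega>. iexp (W_Gamma_N n N (\<lambda>w. \<Sum>i<k. t i * F i w) \<omega>) \<partial>R N)"
      if "1 \<le> N" for N
      by (rule Bochner_Integration.integral_cong[OF refl]) (simp only: W_Gamma_N_combination[OF that _ finite_lessThan C])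
  qed
qed

lemma converges_fdd_W_Q:
  "converges_fdd (bmf (PiM {..n} E)) R (W_Q_N n) U (W_Q V n)"
proof (rule converges_fddI[OF R_prob_space _ U_prob_space W_Q_measurable])
  show "W_Q_N n N f \<in> borel_measurable (R N)" if Nf: "1 \<le> N" "f \<in> bmf (PiM {..n} E)" for N f
  proof -
    obtain C where "bounded_on (PiM {..n} E) C f" by (rule bmfE[OF Nf(2)])
    then obtain C' where "bounded_on (R N) C' (W_Q_N n N f)" using W_Q_N_bounded[OF Nf(1)] by blast
    then show ?thesis by (rule bounded_onD(1))
  qed
  fix k :: nat and F and t :: "nat \<Rightarrow> real" assume F: "F \<in> {..<k} \<rightarrow> bmf (PiM {..n} E)"
  then have Fi: "F i \<in> bmf (PiM {..n} E)" if "i \<in> {..<k}" for i using that by blast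
  have "\<exists>C. \<forall>i\<in>{..<k}. bounded_on (PiM {..n} E) (C i) (F i)" by (rule bmf_bounds[OF Fi])
  then obtain C where C: "\<And>i. i \<in> {..<k} \<Longrightarrow> bounded_on (PiM {..n} E) (C i) (F i)" by blast
  obtain C' where Fs: "bounded_on (PiM {..n} E) C' (\<lambda>w. \<Sum>i<k. t i * F i w)"
    by (rule bmfE[OF bmf_sum[OF finite_lessThan Fi]])
  have char_U: "(\<integral>\<omega>. iexp (\<Sum>i<k. t i * W_Q V n (F i) \<omega>) \<partial>U) = complex_of_real (exp (- (field_variance n (centred n (\<lambda>w. \<Sum>i<k. t i * F i w)) / 2)))"
    by (rule W_Q_char[OF finite_lessThan Fi])
  show "(\<lambda>N. \<integral>\<omega>. iexp (\<Sum>i<k. t i * W_Q_N n N (F i) \<omega>) \<partial>R N) \<longlonglongrightarrow> (\<integral>\<omega>. iexp (\<Sum>i<k. t i * W_Q V n (F i) \<omega>) \<partial>U)"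
    unfolding char_U field_variance_def
  proof (rule tendsto_cong_ge_1[OF _ W_Q_N_char_tendsto[OF Fs]])
    show "(\<integral>\<omega>. iexp (\<Sum>i<k. t i * W_Q_N n N (F i) \<omega>) \<partial>R N) = (\<integral>\<omega>. iexp (W_Q_N n N (\<lambda>w. \<Sum>i<k. t i * F i w) \<omega>) \<partial>R N)"
      if "1 \<le> N" for N
      by (rule Bochner_Integration.integral_cong[OF refl]) (simp only: W_Q_N_combination[OF that _ C])
  qed
qed

end

theorem theorem3p1:
  fixes P :: "'w measure"
    and E :: "nat \<Rightarrow> 'a measure"
    and eta0 :: "'a measure"
    and M :: "nat \<Rightarrow> 'a \<Rightarrow> 'a measure"
    and G :: "nat \<Rightarrow> 'a \<Rightarrow> real"
    and lam :: "nat \<Rightarrow> 'a measure"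
    and H :: "nat \<Rightarrow> 'a \<Rightarrow> 'a \<Rightarrow> real"
    and X :: "nat \<Rightarrow> 'w \<Rightarrow> 'a"
    and eps :: "nat \<Rightarrow> real"
    and R :: "nat \<Rightarrow> 'v measure"
    and xi :: "nat \<Rightarrow> nat \<Rightarrow> 'v \<Rightarrow> nat \<Rightarrow> 'a"
    and U :: "'u measure"
    and V :: "nat \<Rightarrow> ('a \<Rightarrow> real) \<Rightarrow> 'u \<Rightarrow> real"
    and n :: nat
  assumes model: "limit_fields P E eta0 M G lam H X eps R xi U V"
    and regularity: "\<And>m. 1 \<le> m \<Longrightarrow> \<exists>h_minus h_plus :: 'a \<Rightarrow> real.
      h_minus \<in> borel_measurable (E m) \<and> h_plus \<in> borel_measurable (E m) \<and>
      (\<forall>y\<in>space (E m). 0 < h_minus y \<and> 0 < h_plus y) \<and>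
      (\<forall>x\<in>space (E (m - 1)). \<forall>y\<in>space (E m). h_minus y \<le> H m x y \<and> H m x y \<le> h_plus y) \<and>
      integrable (feynman_kac.eta P E G X m) (\<lambda>y. (h_plus y / h_minus y) ^ 4) \<and>
      integrable (lam m) h_plus"
  shows "centered_gaussian_field U (bmf (PiM {..n} E)) (feynman_kac.W_Gamma P E M G H X V n) \<and>
    centered_gaussian_field U (bmf (PiM {..n} E)) (feynman_kac.W_Q P E M G H X V n) \<and>
    converges_fdd (bmf (PiM {..n} E))
      R (particle_model.W_Gamma_N P E G H X xi n)
      U (feynman_kac.W_Gamma P E M G H X V n) \<and>
    converges_fdd (bmf (PiM {..n} E))
      R (particle_model.W_Q_N P E G H X xi n)
      U (feynman_kac.W_Q P E M G H X V n)"
proof -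
  interpret lf: limit_fields P E eta0 M G lam H X eps R xi U V by (rule model)
  \<comment> \<open>The implication under the quantifier supplies a witness at m = 0 too, so that a
    single sequence of envelopes can be chosen.\<close>
  have "\<forall>m. \<exists>h. 1 \<le> m \<longrightarrow> h \<in> borel_measurable (E m) \<and>
      (\<forall>x\<in>space (E (m - 1)). \<forall>y\<in>space (E m). H m x y \<le> h y) \<and> integrable (lam m) h"
    using regularity by meson
  then obtain hp where hp: "\<And>m. 1 \<le> m \<Longrightarrow> hp m \<in> borel_measurable (E m) \<and>
      (\<forall>x\<in>space (E (m - 1)). \<forall>y\<in>space (E m). H m x y \<le> hp m y) \<and> integrable (lam m) (hp m)"
    by metis
  interpret dominated_limit_fields P E eta0 M G lam H X eps R xi U V hp
  proof
    show "hp (Suc m) \<in> borel_measurable (E (Suc m))" "integrable (lam (Suc m)) (hp (Suc m))" for m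
      using hp[of "Suc m"] by auto
    show "H (Suc m) x y \<le> hp (Suc m) y" if "x \<in> space (E m)" "y \<in> space (E (Suc m))" for m x y
      using hp[of "Suc m"] that by simp
  qed
  show ?thesis
    using centered_gaussian_field_W_Gamma centered_gaussian_field_W_Q converges_fdd_W_Gamma converges_fdd_W_Q
    by blast
qed

end
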